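(* Suppose $1\leq p\leq\infty$ and $\varphi\in\mathcal W^*_{\mathrm{gc}}(\mathbb C^n)$, with associated $\rho$, $\rho$-regularization $\widetilde\varphi$ and entire function $F$. Let $\psi=\widetilde\varphi-\operatorname{Re}F$. For $\omega\in L_{0,1}$ set $$T_\varphi(\omega):=e^FA_\psi(e^{-F}\omega).$$ (A) There is a constant $C>0$ such that for every $\omega\in L_{0,1}$ with $\rho\omega\in L_\varphi^p$, $$\|T_\varphi(\omega)\|_{L_\varphi^p}\leq C\|\rho\,\omega\|_{L_\varphi^p}.$$ (B) Let $\kappa\in\mathbb R$. For every $g\in\Gamma$ and every $f\in\mathcal C^2(\mathbb C^n)$ satisfying $\rho^\kappa\bar\partial f\in L^p$, we have $$\bar\partial T_\varphi(g\bar\partial f)=g\bar\partial f.$$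
   Context: $n\ge 1$; $dV$ is Lebesgue measure on $\mathbb C^n$; $B(z,r)=\{w:|w-z|<r\}$. Weights. $\mathcal S$ is the class of positive Borel functions $\rho$ on $\mathbb C^n$ for which there is $c_0\ge1$ with $c_0^{-1}\rho(w)\le\rho(z)\le c_0\rho(w)$ whenever $z\in B(w,\rho(w))$; $\omega_\rho(z)=\rho(z)^{-2}i\partial\bar\partial|z|^2$. A $\rho$-regularization of a plurisubharmonic $\varphi$ is a strictly plurisubharmonic $\widetilde\varphi\in\mathcal C^2(\mathbb C^n)$ with $\|\varphi-\widetilde\varphi\|_{L^\infty}<\infty$ and $m\omega_\rho\le i\partial\bar\partial\widetilde\varphi\le M\omega_\rho$ for some $0<m\le M<\infty$. A nonnegative Borel measure $\mu$ is doubling if $\mu(B(z,2r))\le C\mu(B(z,r))$ for all $z,r$ and some $C$. $\mathcal W^*(\mathbb C^n)$ is the class of plurisubharmonic $\varphi$ admitting, for some $\rho\in\mathcal S$, a $\rho$-regularization $\widetilde\varphi$ with $(i\partial\bar\partial\widetilde\varphi)^n$ doubling. $\mathcal W^*_{\mathrm{gc}}(\mathbb C^n)$ is the class of $\varphi\in\mathcal W^*(\mathbb C^n)$ for which there are $\rho\in\mathcal S$, a $\rho$-regularization $\widetilde\varphi$ with doubling Monge--Ampère measure, an entire function $F$ and constants $0<m\le M<\infty$ with $$m\rho(z)^{-2}I_{2n}\le D^2_{\mathbb R}(\widetilde\varphi-\operatorname{Re}F)(z)\le M\rho(z)^{-2}I_{2n},\quad z\in\mathbb C^n,$$ where $D^2_{\mathbb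 R}$ is the real Hessian under $\mathbb C^n\cong\mathbb R^{2n}$. Such $\rho,\widetilde\varphi,F$ are fixed for each $\varphi$. Spaces. $\|f\|_{L_\varphi^p}=(\int|f|^pe^{-p\varphi}dV)^{1/p}$ for $p<\infty$, $\|f\|_{L_\varphi^\infty}=\operatorname{ess\,sup}|f|e^{-\varphi}$; $L^p=L^p(dV)$. $F_\varphi^2$ is the space of entire functions in $L_\varphi^2$, $K_z^\varphi$ its reproducing kernel at $z$ for the inner product $\int f\overline ge^{-2\varphi}dV$, and $\Gamma$ is the linear span of $\{K_z^\varphi:z\in\mathbb C^n\}$. $L_{0,1}$ is the set of $(0,1)$-forms $\omega=\sum_j\omega_jd\overline z_j$ with measurable coefficients; $|\omega|=\sum_j|\omega_j|$, and norms of forms are norms of $|\omega|$. The operator $A_\psi$ (normalized Berndtsson--Andersson operator) is $$A_\psi(\omega)(z)=c_n\int_{\mathbb C^n}e^{\langle2\partial\psi(\xi),z-\xi\rangle}\sum_{j=0}^{n-1}\omega(\xi)\wedge\frac{\partial|\xi-z|^2\wedge(2\bar\partial\partial\psi(\xi))^j\wedge(\bar\partial\partial|\xi-z|^2)^{n-1-j}}{j!\,|\xi-z|^{2n-2j}},$$ where differentials are in $\xi$, $\langle\partial\psi(\xi),z-\xi\rangle=\sum_j\frac{\partial\psi}{\partial\xi_j}(\xi)(z_j-\xi_j)$, and $c_n\ne0$ is the normalization constant, depending only on $n$, of the Berndtsson--Andersson representation formula; it is fixed by the requirement that, for $\psi\equiv0$, $A_0(\bar\partial u)=u$ for all $u\in\mathcal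 C_c^\infty(\mathbb C^n)$. The equation in (B) is in the sense of distributions. *)

theory Defs
  imports "HOL-Analysis.Analysis" "HOL-Combinatorics.Permutations"
    "HOL-Probability.Essential_Supremum"
begin

text \<open>
  Complex \<open>n\<close>-space is \<^typ>\<open>complex^'n\<close> with \<open>n = CARD('n) \<ge> 1\<close>; its norm is the Euclidean norm
  and \<^term>\<open>lebesgue\<close> is Lebesgue measure under the identification with real \<open>2n\<close>-space.
\<close>

section \<open>Smoothness and Wirtinger derivatives\<close>

primrec Ck :: "nat \<Rightarrow> ('a::euclidean_space \<Rightarrow> 'b::real_normed_vector) \<Rightarrow> bool" where
  "Ck 0 f \<longleftrightarrow> continuous_on UNIV f"
| "Ck (Suc k) f \<longleftrightarrow> (\<forall>x. f differentiable (at x)) \<and>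
     (\<forall>v. Ck k (\<lambda>x. frechet_derivative f (at x) v))"

definition test_fun :: "('a::euclidean_space \<Rightarrow> 'b::real_normed_vector) \<Rightarrow> bool" where
  "test_fun u \<longleftrightarrow> (\<forall>k. Ck k u) \<and> compact (closure {x. u x \<noteq> 0})"

definition entire :: "(complex^'n \<Rightarrow> complex) \<Rightarrow> bool" where
  "entire f \<longleftrightarrow> (\<forall>z. \<exists>f'. (f has_derivative f') (at z) \<and> (\<forall>c v. f' (c *s v) = c * f' v))"

definition pd_z :: "'n \<Rightarrow> (complex^'n \<Rightarrow> complex) \<Rightarrow> complex^'n \<Rightarrow> complex" where
  "pd_z j f z = (frechet_derivative f (at z) (axis j 1)
     - \<i> * frechet_derivative f (at z) (axis j \<i>)) / 2"

definition pd_zbar :: "'n \<Rightarrow> (complex^'n \<Rightarrow> complex) \<Rightarrow> complex^'n \<Rightarrow> complex" where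
  "pd_zbar j f z = (frechet_derivative f (at z) (axis j 1)
     + \<i> * frechet_derivative f (at z) (axis j \<i>)) / 2"

definition hessian :: "(complex^'n \<Rightarrow> real) \<Rightarrow> complex^'n \<Rightarrow> complex^'n \<Rightarrow> complex^'n \<Rightarrow> real" where
  "hessian u z v w = frechet_derivative (\<lambda>x. frechet_derivative u (at x) w) (at z) v"


section \<open>Differential forms at a point\<close>

text \<open>
  A complex-valued real-multilinear alternating \<open>k\<close>-form is represented as a function of a
  sequence of tangent vectors, of which it uses only the entries with index below \<open>k\<close>; the degree
  is passed explicitly to the wedge product.
\<close>

type_synonym 'n cform = "(nat \<Rightarrow> complex^'n) \<Rightarrow> complex"

definition wedge :: "nat \<Rightarrow> nat \<Rightarrow> 'n::finite cform \<Rightarrow> 'n cform \<Rightarrow> 'n cform" where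
  "wedge k l \<alpha> \<beta> v = (\<Sum>\<sigma> | \<sigma> permutes {..<k + l}.
     of_int (sign \<sigma>) * \<alpha> (\<lambda>i. v (\<sigma> i)) * \<beta> (\<lambda>i. v (\<sigma> (k + i)))) / (fact k * fact l)"

primrec wpow2 :: "'n::finite cform \<Rightarrow> nat \<Rightarrow> 'n cform" \<comment> \<open>wedge powers of a 2-form\<close> where
  "wpow2 \<alpha> 0 = (\<lambda>v. 1)"
| "wpow2 \<alpha> (Suc j) = wedge 2 (2 * j) \<alpha> (wpow2 \<alpha> j)"

definition fscale :: "complex \<Rightarrow> 'n::finite cform \<Rightarrow> 'n cform" where
  "fscale c \<alpha> v = c * \<alpha> v"

definition dz :: "'n::finite \<Rightarrow> 'n cform" where
  "dz j v = v 0 $ j"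

definition dzbar :: "'n::finite \<Rightarrow> 'n cform" where
  "dzbar j v = cnj (v 0 $ j)"

text \<open>
  The coefficient \<open>h\<close> of a top-degree form \<open>h dV\<close>, obtained by evaluating at the basis
  \<open>e\<^sub>1, i e\<^sub>1, \<dots>, e\<^sub>n, i e\<^sub>n\<close>. Since the vectors come in pairs, the value does not depend on the
  enumeration of the index type.
\<close>
definition top_coeff :: "'n::finite cform \<Rightarrow> complex" where
  "top_coeff \<alpha> = \<alpha> (\<lambda>i. axis (from_nat_into UNIV (i div 2)) (if even i then 1 else \<i>))"

definition form01 :: "complex^'n::finite \<Rightarrow> 'n cform" where
  "form01 a v = (\<Sum>j\<in>UNIV. a $ j * dzbar j v)"

definition del_form :: "(complex^'n::finite \<Rightarrow> complex) \<Rightarrow> complex^'n \<Rightarrow> 'n cform" where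
  "del_form u z v = (\<Sum>j\<in>UNIV. pd_z j u z * dz j v)"

definition dbar_del_form :: "(complex^'n::finite \<Rightarrow> complex) \<Rightarrow> complex^'n \<Rightarrow> 'n cform" where
  "dbar_del_form u z v =
     (\<Sum>k\<in>UNIV. \<Sum>j\<in>UNIV. pd_zbar k (pd_z j u) z * wedge 1 1 (dzbar k) (dz j) v)"

definition i_del_dbar_form :: "(complex^'n::finite \<Rightarrow> complex) \<Rightarrow> complex^'n \<Rightarrow> 'n cform" where
  "i_del_dbar_form u z v =
     \<i> * (\<Sum>j\<in>UNIV. \<Sum>k\<in>UNIV. pd_z j (pd_zbar k u) z * wedge 1 1 (dz j) (dzbar k) v)"

text \<open>The coefficient vector of d-bar \<open>u\<close>; a (0,1)-form is identified with its coefficient vector field.\<close>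
definition dbar :: "(complex^'n \<Rightarrow> complex) \<Rightarrow> complex^'n \<Rightarrow> complex^'n" where
  "dbar u z = (\<chi> j. pd_zbar j u z)"

text \<open>
  The order on real (1,1)-forms. For \<open>\<theta> = i \<Sum> a\<^sub>j\<^sub>k dz\<^sub>j \<and> dzbar\<^sub>k\<close> one has
  \<open>\<theta>(v, iv) = 2 \<Sum> a\<^sub>j\<^sub>k v\<^sub>j cnj v\<^sub>k\<close>, so this is the Loewner order of the Hermitian coefficient matrices.
\<close>
definition form11_val :: "'n::finite cform \<Rightarrow> complex^'n \<Rightarrow> real" where
  "form11_val \<theta> v = Re (\<theta> (\<lambda>i. if i = 0 then v else \<i> *s v))"

definition form11_le :: "'n::finite cform \<Rightarrow> 'n cform \<Rightarrow> bool" where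
  "form11_le \<theta> \<eta> \<longleftrightarrow> (\<forall>v. form11_val \<theta> v \<le> form11_val \<eta> v)"

definition form01_abs :: "complex^'n \<Rightarrow> real" where
  "form01_abs a = (\<Sum>j\<in>UNIV. cmod (a $ j))"


section \<open>Weights\<close>

text \<open>The integral of a function whose positive part has finite integral.\<close>
definition ereal_integral :: "'a measure \<Rightarrow> ('a \<Rightarrow> ereal) \<Rightarrow> ereal" where
  "ereal_integral M f =
     enn2ereal (\<integral>\<^sup>+x. e2ennreal (f x) \<partial>M) - enn2ereal (\<integral>\<^sup>+x. e2ennreal (- f x) \<partial>M)"

definition psh :: "(complex^'n \<Rightarrow> ereal) \<Rightarrow> bool" where
  "psh \<phi> \<longleftrightarrow> (\<forall>z. \<phi> z < \<infinity>) \<and> (\<forall>a. open {z. \<phi> z < a}) \<and>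
     (\<forall>a b. \<phi> a \<le> ereal (1 / (2 * pi)) *
        ereal_integral (restrict_space lborel {0..2 * pi}) (\<lambda>\<theta>. \<phi> (a + cis \<theta> *s b)))"

definition strictly_psh_C2 :: "(complex^'n::finite \<Rightarrow> real) \<Rightarrow> bool" where
  "strictly_psh_C2 u \<longleftrightarrow> Ck 2 u \<and>
     (\<forall>z v. v \<noteq> 0 \<longrightarrow> 0 < form11_val (i_del_dbar_form (\<lambda>x. of_real (u x)) z) v)"

definition class_S :: "(complex^'n \<Rightarrow> real) set" where
  "class_S = {\<rho>. \<rho> \<in> borel_measurable borel \<and> (\<forall>z. 0 < \<rho> z) \<and>
     (\<exists>c0\<ge>1. \<forall>w. \<forall>z\<in>ball w (\<rho> w). \<rho> w / c0 \<le> \<rho> z \<and> \<rho> z \<le> c0 * \<rho> w)}"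

definition omega :: "(complex^'n::finite \<Rightarrow> real) \<Rightarrow> complex^'n \<Rightarrow> 'n cform" where
  "omega \<rho> z = fscale (of_real (\<rho> z powi (-2))) (i_del_dbar_form (\<lambda>x. of_real ((norm x)\<^sup>2)) z)"

definition regularization ::
  "(complex^'n::finite \<Rightarrow> real) \<Rightarrow> (complex^'n \<Rightarrow> ereal) \<Rightarrow> (complex^'n \<Rightarrow> real) \<Rightarrow> bool" where
  "regularization \<rho> \<phi> \<phi>t \<longleftrightarrow> strictly_psh_C2 \<phi>t \<and>
     (\<exists>B::real. AE z in lebesgue. \<bar>\<phi> z - ereal (\<phi>t z)\<bar> \<le> ereal B) \<and>
     (\<exists>m M::real. 0 < m \<and> m \<le> M \<and>
        (\<forall>z. form11_le (fscale (of_real m) (omega \<rho> z)) (i_del_dbar_form (\<lambda>x. of_real (\<phi>t x)) z) \<and>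
             form11_le (i_del_dbar_form (\<lambda>x. of_real (\<phi>t x)) z) (fscale (of_real M) (omega \<rho> z))))"

definition doubling :: "(complex^'n) measure \<Rightarrow> bool" where
  "doubling \<mu> \<longleftrightarrow> sets \<mu> = sets borel \<and>
     (\<exists>C::real. \<forall>z r. 0 < r \<longrightarrow> emeasure \<mu> (ball z (2 * r)) \<le> ennreal C * emeasure \<mu> (ball z r))"

definition monge_ampere :: "(complex^'n::finite \<Rightarrow> real) \<Rightarrow> (complex^'n) measure" where
  "monge_ampere u = density lborel (\<lambda>z. ennreal (Re (top_coeff
     (wpow2 (i_del_dbar_form (\<lambda>x. of_real (u x)) z) CARD('n)))))"

definition W_star :: "(complex^'n::finite \<Rightarrow> ereal) set" where
  "W_star = {\<phi>. psh \<phi> \<and>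
     (\<exists>\<rho>\<in>class_S. \<exists>\<phi>t. regularization \<rho> \<phi> \<phi>t \<and> doubling (monge_ampere \<phi>t))}"

definition gc_data :: "(complex^'n::finite \<Rightarrow> ereal) \<Rightarrow> (complex^'n \<Rightarrow> real) \<Rightarrow>
    (complex^'n \<Rightarrow> real) \<Rightarrow> (complex^'n \<Rightarrow> complex) \<Rightarrow> bool" where
  "gc_data \<phi> \<rho> \<phi>t F \<longleftrightarrow> \<rho> \<in> class_S \<and> regularization \<rho> \<phi> \<phi>t \<and> doubling (monge_ampere \<phi>t) \<and>
     entire F \<and>
     (\<exists>m M::real. 0 < m \<and> m \<le> M \<and> (\<forall>z v.
        m * \<rho> z powi (-2) * (v \<bullet> v) \<le> hessian (\<lambda>x. \<phi>t x - Re (F x)) z v v \<and>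
        hessian (\<lambda>x. \<phi>t x - Re (F x)) z v v \<le> M * \<rho> z powi (-2) * (v \<bullet> v)))"

definition W_star_gc :: "(complex^'n::finite \<Rightarrow> ereal) set" where
  "W_star_gc = {\<phi>\<in>W_star. \<exists>\<rho> \<phi>t F. gc_data \<phi> \<rho> \<phi>t F}"


section \<open>Weighted spaces\<close>

definition eexp :: "ereal \<Rightarrow> ennreal" where
  "eexp x = (if x = \<infinity> then \<infinity> else if x = -\<infinity> then 0 else ennreal (exp (real_of_ereal x)))"

definition ennreal_powr :: "ennreal \<Rightarrow> real \<Rightarrow> ennreal" where
  "ennreal_powr x a = (if x = \<infinity> then \<infinity> else ennreal (enn2real x powr a))" \<comment> \<open>for \<open>a > 0\<close>\<close>

text \<open>The argument \<open>h\<close> is the modulus of a function or of a (0,1)-form.\<close>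
definition Lnorm :: "ennreal \<Rightarrow> (complex^'n \<Rightarrow> ereal) \<Rightarrow> (complex^'n \<Rightarrow> real) \<Rightarrow> ennreal" where
  "Lnorm p \<phi> h =
     (if p = \<infinity> then esssup lebesgue (\<lambda>z. ennreal (h z) * eexp (- \<phi> z))
      else ennreal_powr (\<integral>\<^sup>+z. ennreal (h z powr enn2real p) *
             eexp (- (ereal (enn2real p) * \<phi> z)) \<partial>lebesgue) (1 / enn2real p))"

definition Lfun :: "ennreal \<Rightarrow> (complex^'n \<Rightarrow> ereal) \<Rightarrow> (complex^'n \<Rightarrow> complex) set" where
  "Lfun p \<phi> = {f\<in>borel_measurable lebesgue. Lnorm p \<phi> (\<lambda>z. cmod (f z)) < \<infinity>}"

definition L01 :: "(complex^'n \<Rightarrow> complex^'n) set" where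
  "L01 = {\<omega>. \<forall>j. (\<lambda>z. \<omega> z $ j) \<in> borel_measurable lebesgue}"

definition Lform :: "ennreal \<Rightarrow> (complex^'n \<Rightarrow> ereal) \<Rightarrow> (complex^'n \<Rightarrow> complex^'n) set" where
  "Lform p \<phi> = {\<omega>\<in>L01. Lnorm p \<phi> (\<lambda>z. form01_abs (\<omega> z)) < \<infinity>}"

definition Fock2 :: "(complex^'n \<Rightarrow> ereal) \<Rightarrow> (complex^'n \<Rightarrow> complex) set" where
  "Fock2 \<phi> = {f. entire f \<and> f \<in> Lfun 2 \<phi>}"

definition Fock_inner :: "(complex^'n \<Rightarrow> ereal) \<Rightarrow> (complex^'n \<Rightarrow> complex) \<Rightarrow>
    (complex^'n \<Rightarrow> complex) \<Rightarrow> complex" where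
  "Fock_inner \<phi> f g =
     (LINT w|lebesgue. f w * cnj (g w) * of_real (enn2real (eexp (- (2 * \<phi> w)))))"

definition repr_kernel_at :: "(complex^'n \<Rightarrow> ereal) \<Rightarrow> complex^'n \<Rightarrow> (complex^'n \<Rightarrow> complex) \<Rightarrow> bool" where
  "repr_kernel_at \<phi> z K \<longleftrightarrow> K \<in> Fock2 \<phi> \<and> (\<forall>f\<in>Fock2 \<phi>. f z = Fock_inner \<phi> f K)"

definition Gamma_span :: "(complex^'n \<Rightarrow> ereal) \<Rightarrow> (complex^'n \<Rightarrow> complex) set" where
  "Gamma_span \<phi> = {g. \<exists>S a. finite S \<and> S \<subseteq> {K. \<exists>z. repr_kernel_at \<phi> z K} \<and>
     g = (\<lambda>w. \<Sum>K\<in>S. a K * K w)}"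


section \<open>The Berndtsson--Andersson operator\<close>

definition dist2 :: "complex^'n \<Rightarrow> complex^'n \<Rightarrow> complex" where
  "dist2 z \<xi> = of_real ((norm (\<xi> - z))\<^sup>2)"

definition BA_form :: "(complex^'n::finite \<Rightarrow> real) \<Rightarrow> (complex^'n \<Rightarrow> complex^'n) \<Rightarrow>
    complex^'n \<Rightarrow> complex^'n \<Rightarrow> 'n cform" where
  "BA_form \<psi> \<omega> z \<xi> v = (let \<Psi> = (\<lambda>x. complex_of_real (\<psi> x)); n = CARD('n) in
     exp (\<Sum>j\<in>UNIV. 2 * pd_z j \<Psi> \<xi> * (z $ j - \<xi> $ j)) *
     (\<Sum>j<n. wedge 1 (2 * n - 1) (form01 (\<omega> \<xi>))
               (wedge 1 (2 * n - 2) (del_form (dist2 z) \<xi>)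
                 (wedge (2 * j) (2 * (n - 1 - j))
                    (wpow2 (fscale 2 (dbar_del_form \<Psi> \<xi>)) j)
                    (wpow2 (dbar_del_form (dist2 z) \<xi>) (n - 1 - j)))) v
             / (fact j * of_real (norm (\<xi> - z) ^ (2 * n - 2 * j)))))"

definition BA_integrand :: "(complex^'n::finite \<Rightarrow> real) \<Rightarrow> (complex^'n \<Rightarrow> complex^'n) \<Rightarrow>
    complex^'n \<Rightarrow> complex^'n \<Rightarrow> complex" where
  "BA_integrand \<psi> \<omega> z \<xi> = top_coeff (BA_form \<psi> \<omega> z \<xi>)"

definition BA_const :: "'n::finite itself \<Rightarrow> complex" where
  "BA_const _ = (THE c. c \<noteq> 0 \<and> (\<forall>u::complex^'n \<Rightarrow> complex. test_fun u \<longrightarrow>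
     (\<forall>z. c * (LINT \<xi>|lebesgue. BA_integrand (\<lambda>_. 0) (dbar u) z \<xi>) = u z)))"

definition BA_op :: "(complex^'n::finite \<Rightarrow> real) \<Rightarrow> (complex^'n \<Rightarrow> complex^'n) \<Rightarrow>
    complex^'n \<Rightarrow> complex" where
  "BA_op \<psi> \<omega> z = BA_const TYPE('n) * (LINT \<xi>|lebesgue. BA_integrand \<psi> \<omega> z \<xi>)"

text \<open>
  \<^term>\<open>BA_op\<close> is a Bochner integral, hence \<open>0\<close> wherever the integrand is not integrable; the
  following predicate says that this convention matters only on a null set of points.
\<close>
definition BA_defined :: "(complex^'n::finite \<Rightarrow> real) \<Rightarrow> (complex^'n \<Rightarrow> complex^'n) \<Rightarrow> bool" where
  "BA_defined \<psi> \<omega> \<longleftrightarrow> (AE z in lebesgue. integrable lebesgue (BA_integrand \<psi> \<omega> z))"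

definition psi_of :: "(complex^'n \<Rightarrow> real) \<Rightarrow> (complex^'n \<Rightarrow> complex) \<Rightarrow> complex^'n \<Rightarrow> real" where
  "psi_of \<phi>t F z = \<phi>t z - Re (F z)"

definition T_defined :: "(complex^'n::finite \<Rightarrow> real) \<Rightarrow> (complex^'n \<Rightarrow> complex) \<Rightarrow>
    (complex^'n \<Rightarrow> complex^'n) \<Rightarrow> bool" where
  "T_defined \<phi>t F \<omega> \<longleftrightarrow> BA_defined (psi_of \<phi>t F) (\<lambda>\<xi>. exp (- F \<xi>) *s \<omega> \<xi>)"

definition T_op :: "(complex^'n::finite \<Rightarrow> real) \<Rightarrow> (complex^'n \<Rightarrow> complex) \<Rightarrow>
    (complex^'n \<Rightarrow> complex^'n) \<Rightarrow> complex^'n \<Rightarrow> complex" where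
  "T_op \<phi>t F \<omega> z = exp (F z) * BA_op (psi_of \<phi>t F) (\<lambda>\<xi>. exp (- F \<xi>) *s \<omega> \<xi>) z"

definition loc_integrable :: "(complex^'n \<Rightarrow> complex) \<Rightarrow> bool" where
  "loc_integrable u \<longleftrightarrow> (\<forall>K. compact K \<longrightarrow> set_integrable lebesgue K u)"

text \<open>The equation d-bar \<open>u = \<omega>\<close> in the sense of distributions.\<close>
definition dbar_distr :: "(complex^'n \<Rightarrow> complex) \<Rightarrow> (complex^'n \<Rightarrow> complex^'n) \<Rightarrow> bool" where
  "dbar_distr u \<omega> \<longleftrightarrow> loc_integrable u \<and> (\<forall>j. loc_integrable (\<lambda>z. \<omega> z $ j)) \<and>
     (\<forall>h. test_fun h \<longrightarrow> (\<forall>j.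
        - (LINT z|lebesgue. u z * pd_zbar j h z) = (LINT z|lebesgue. \<omega> z $ j * h z)))"

end

theory Submission
 imports Defs "HOL-Complex_Analysis.Cauchy_Integral_Formula"
begin

text \<open>
 With \<open>q = 2 \<partial>\<psi>\<close> and \<open>W\<close> the matrix of the antiholomorphic derivatives of \<open>q\<close>, the integrand of the operator is a constant times
 \<open>exp \<langle>q, z - \<xi>\<rangle>\<close> times the integral over \<open>t > 0\<close> of \<open>exp (- t |\<xi> - z|^2)\<close> times the sum over \<open>j\<close> of the conjugate of \<open>(\<xi> - z)\<^sub>j\<close> times the
 determinant of \<open>W + t I\<close> with row \<open>j\<close> replaced by \<open>\<omega>\<close>. Integrating the Piola identity for these determinants over \<open>t\<close> gives the
 Berndtsson--Andersson formula for compactly supported functions; the case \<open>q = 0\<close> identifies the constant.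

 For (A), convexity of \<open>\<psi>\<close> at scale \<open>\<rho>\<close> makes the kernel decay exponentially in \<open>|z - \<xi>| / \<rho> \<xi>\<close>, the doubling condition allows to exchange
 \<open>\<rho> \<xi>\<close> and \<open>\<rho> z\<close> up to a power, and the Schur test applies.

 For (B), nothing is known about the growth of \<open>u = exp (- F) g f\<close>, so a cutoff of \<open>u\<close> must not contribute: outside a large ball \<open>q\<close> is
 perturbed by a multiple of the conjugate of \<open>\<xi>\<close>, which makes the kernel as small as desired where the cutoff lives, at no loss elsewhere.
 For the perturbed \<open>q\<close> the formula shows that the operator applied to the derivative of \<open>u\<close> differs from a multiple of \<open>u\<close> by a holomorphic
 function. The kernels \<open>g\<close> grow at most like \<open>exp \<phi>t\<close> times a power of \<open>1 / \<rho>\<close>, by the Bochner--Martinelli formula on a ball of radius \<open>\<rho>\<close>.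
\<close>

text \<open>The Piola identity differentiates the rows of a determinant once more, whereas \<psi> is
  only C^2 and so \<open>q\<close> only C^1; it is proved for C^2 rows and carried over to C^1 rows
  by averaging along coordinate segments. The perturbation in (B) rests on one count. Multiplying
  the conjugate of \<xi> by minus the logarithm of a damping factor E puts E^n in front of the
  exponential, for |\<xi>| large and at least 2 |z|, while the entries of the matrix grow like 1 / E
  but enter in degree at most n - 1. One factor E remains, however deep the damping. Its depth can
  thus be chosen after the radius, against a cutoff whose derivative involves the uncontrolled
  \<open>u\<close>. The representation formula admits the perturbed \<open>q\<close> because it
  holds for every C^1 \<open>q\<close>, not only for gradients. Doubling also makes \<rho>, 1 /
  \<rho> and every real power of \<rho> polynomially bounded, so that the exponential decay absorbs
  the exponent \<kappa>, the growth of \<open>g\<close> and all values of p at once. The normalizing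
  constant is a definite description, unique only if some test function is nonzero; in (B) that
  function is the one the equation is tested with.\<close>

abbreviation (input) "Ck1 \<equiv> Ck (Suc 0)"
abbreviation (input) "Ck2 \<equiv> Ck (Suc (Suc 0))"
abbreviation (input) "cor \<equiv> complex_of_real"
abbreviation (input) "cont \<equiv> continuous_on UNIV"
abbreviation (input) "bm \<equiv> borel_measurable"
abbreviation (input) "FD \<equiv> frechet_derivative"
abbreviation (input) "integ \<equiv> integrable lborel"

section \<open>Calculus of C^k functions and integration by parts\<close>

lemma Ck1I:
 assumes "!!x. (f has_derivative f' x) (at x)" "!!v. cont (%x. f' x v)"
 shows "Ck1 f"
proof -
 have "FD f (at x) = f' x" for x
  using frechet_derivative_at[OF assms(1)] by simp
 thus ?thesis using assms by (auto simp: differentiable_def)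
qed

lemma Ck_Suc_has_derivative:
 assumes "Ck (Suc k) f"
 shows "(f has_derivative FD f (at x)) (at x)"
 using assms by (simp add: frechet_derivative_works)

lemma Ck_Suc_deriv: "Ck (Suc k) f ==> Ck k (%x. FD f (at x) v)"
 by simp

lemma Ck_SucI:
 assumes "!!x. (f has_derivative f' x) (at x)" "!!v. Ck k (%x. f' x v)"
 shows "Ck (Suc k) f"
proof -
 have "FD f (at x) = f' x" for x
  using frechet_derivative_at[OF assms(1)] by simp
 thus ?thesis using assms by (auto simp: differentiable_def)
qed

lemma Ck_continuous: "Ck k f ==> cont f"
proof (cases k)
 case (Suc j)
 assume "Ck k f"
 hence "!!x. (f has_derivative FD f (at x)) (at x)"
  using Suc Ck_Suc_has_derivative by blast
 thus ?thesis by (meson continuous_at_imp_continuous_on has_derivative_continuous)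
qed simp

lemma Ck_Suc_imp: "Ck (Suc k) f ==> Ck k f"
proof (induction k arbitrary: f)
 case 0
 thus ?case using Ck_continuous by (metis Ck.simps(1))
next
 case (Suc k)
 show ?case
  by (rule Ck_SucI[OF Ck_Suc_has_derivative[OF Suc.prems]]) (rule Suc.IH[OF Ck_Suc_deriv[OF Suc.prems]])
qed

lemma Ck_const: "Ck k (%x. c)"
 by (induction k arbitrary: c) (auto intro!: Ck_SucI[where f'="%_ _. 0"] continuous_intros simp del: Ck.simps(2))

lemma Ck_bounded_linear:
 assumes "bounded_linear L" "Ck k f"
 shows "Ck k (%x. L (f x))"
 using assms(2)
proof (induction k arbitrary: f)
 case 0
 thus ?case using bounded_linear.continuous_on[OF assms(1)] by auto
next
 case (Suc k)
 show ?case
  by (rule Ck_SucI[OF bounded_linear.has_derivative[OF assms(1) Ck_Suc_has_derivative[OF Suc.prems]]])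
   (rule Suc.IH[OF Ck_Suc_deriv[OF Suc.prems]])
qed

lemma Ck_add:
 assumes "Ck k f" "Ck k g"
 shows "Ck k (%x. f x + g x)"
 using assms
proof (induction k arbitrary: f g)
 case 0
 thus ?case by (auto intro: continuous_intros)
next
 case (Suc k)
 show ?case
  by (rule Ck_SucI[OF has_derivative_add[OF Ck_Suc_has_derivative[OF Suc.prems(1)] Ck_Suc_has_derivative[OF Suc.prems(2)]]])
   (rule Suc.IH[OF Ck_Suc_deriv[OF Suc.prems(1)] Ck_Suc_deriv[OF Suc.prems(2)]])
qed

lemma Ck_diff:
 assumes "Ck k f" "Ck k g"
 shows "Ck k (%x. f x - g x)"
 using Ck_add[OF assms(1) Ck_bounded_linear[OF bounded_linear_minus[OF bounded_linear_ident] assms(2)]] by simp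

lemma Ck_linear: "bounded_linear f ==> Ck k f"
proof (cases k)
 case 0
 assume "bounded_linear f"
 thus ?thesis using 0 by (simp add: linear_continuous_on)
next
 case (Suc j)
 assume "bounded_linear f"
 thus ?thesis
  unfolding Suc by (intro Ck_SucI[where f'="%_. f"] bounded_linear_imp_has_derivative Ck_const)
qed

lemma Ck_mult:
 fixes f g :: "'a::euclidean_space => 'b::real_normed_algebra"
 assumes "Ck k f" "Ck k g"
 shows "Ck k (%x. f x * g x)"
 using assms
proof (induction k arbitrary: f g)
 case 0
 thus ?case by (auto intro: continuous_intros)
next
 case (Suc k)
 show ?case
  by (rule Ck_SucI[OF has_derivative_mult[OF Ck_Suc_has_derivative[OF Suc.prems(1)] Ck_Suc_has_derivative[OF Suc.prems(2)]]])
   (intro Ck_add Suc.IH Ck_Suc_imp[OF Suc.prems(1)] Ck_Suc_imp[OF Suc.prems(2)] Ck_Suc_deriv[OF Suc.prems(1)] Ck_Suc_deriv[OF Suc.prems(2)])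
qed

lemma Ck_sum: "(!!i. i \<in> A ==> Ck k (f i)) ==> Ck k (%x. \<Sum>i\<in>A. f i x)"
 by (induction A rule: infinite_finite_induct) (auto intro: Ck_add Ck_const)

lemma Ck_prod:
 fixes f :: "'i => 'a::euclidean_space => 'b::real_normed_field"
 shows "(!!i. i \<in> A ==> Ck k (f i)) ==> Ck k (%x. \<Prod>i\<in>A. f i x)"
 by (induction A rule: infinite_finite_induct) (auto intro: Ck_mult Ck_const)

lemma Ck1_chain:
 fixes h :: "'b::real_normed_field => 'b"
 assumes h: "!!y. (h has_field_derivative h' y) (at y)" "cont h'" and f: "Ck1 f"
 shows "Ck1 (%x. h (f x))"
proof (rule Ck1I)
 show "((%x. h (f x)) has_derivative (%v. h' (f x) * FD f (at x) v)) (at x)" for x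
  using has_derivative_compose[OF Ck_Suc_has_derivative[OF f] h(1)[unfolded has_field_derivative_def]] by simp
 show "cont (%x. h' (f x) * FD f (at x) v)" for v
  using f Ck_continuous[OF f] continuous_on_compose2[OF h(2) Ck_continuous[OF f]] by (auto intro!: continuous_intros)
qed

lemma Ck1_exp:
 fixes f :: "'a::euclidean_space => complex"
 shows "Ck1 f ==> Ck1 (%x. exp (f x))"
 by (rule Ck1_chain[where h'=exp]) (auto intro: continuous_intros DERIV_exp)

lemma linear_component_cvec: "bounded_linear (%x::complex^'n. x $ j)"
 by (rule bounded_linear_vec_nth)

lemma linear_cnj_component: "bounded_linear (%x::complex^'n. cnj (x $ j))"
 by (intro bounded_linear_compose[OF bounded_linear_cnj bounded_linear_vec_nth])

lemmas Ck_nth = Ck_linear[OF linear_component_cvec]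
lemmas Ck_cnj_nth = Ck_linear[OF linear_cnj_component]

lemma norm_sq_cvec: "cor ((norm (x::complex^'n))^2) = (\<Sum>j\<in>UNIV. x $ j * cnj (x $ j))"
proof -
 have "(norm x)^2 = (\<Sum>j\<in>UNIV. (cmod (x $ j))^2)"
  by (simp add: norm_vec_def L2_set_def sum_nonneg)
 thus ?thesis by (simp only: of_real_sum complex_norm_square)
qed

lemma Ck_norm_sq: "Ck k (%x::complex^'n. (norm (x - a))^2)"
proof -
 have "(%x::complex^'n. (norm (x - a))^2) = (%x. \<Sum>j\<in>UNIV. Re ((x $ j - a $ j) * (cnj (x $ j) - cnj (a $ j))))"
 proof
  fix x :: "complex^'n"
  show "(norm (x - a))^2 = (\<Sum>j\<in>UNIV. Re ((x $ j - a $ j) * (cnj (x $ j) - cnj (a $ j))))"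
   using arg_cong[OF norm_sq_cvec[of "x - a"], of Re] by simp
 qed
 thus ?thesis
  by (simp only:) (intro Ck_sum Ck_bounded_linear[OF bounded_linear_Re] Ck_mult Ck_diff Ck_nth Ck_cnj_nth Ck_const)
qed

lemma Ck_of_real: "Ck k f ==> Ck k (%x. cor (f x))"
 by (rule Ck_bounded_linear[OF bounded_linear_of_real])

subsection \<open>Compactly supported functions\<close>

text \<open>Support inside a ball, stated by a radius: equivalent to compact support here, and
  inherited by derivatives and products without taking closures.\<close>

definition csupp :: "('a::real_normed_vector => 'b::zero) => bool" where
 "csupp f \<longleftrightarrow> (\<exists>R. \<forall>x. f x ~= 0 \<longrightarrow> norm x <= R)"

lemma csuppI: "(!!x. R < norm x ==> f x = 0) ==> csupp f"
 unfolding csupp_def by (meson not_le)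

lemma csupp_mono: "csupp f ==> (!!x. f x = 0 ==> g x = 0) ==> csupp g"
 unfolding csupp_def by metis

lemma csuppE:
 assumes "csupp f"
 obtains R where "R > 0" "!!x. R < norm x ==> f x = 0"
proof -
 obtain R where "\<forall>x. f x ~= 0 \<longrightarrow> norm x <= R" using assms by (auto simp: csupp_def)
 thus thesis by (intro that[of "max R 1"]) (auto simp: not_le)
qed

lemma csupp_integrable:
 fixes f :: "'a::euclidean_space => 'b::{banach,second_countable_topology}"
 assumes "cont f" "csupp f"
 shows "integ f"
proof -
 obtain R where R: "!!x. R < norm x ==> f x = 0" using csuppE[OF assms(2)] by metis
 have "integ (%x. indicator (cball 0 R) x *\<^sub>R f x)"
  by (rule borel_integrable_compact) (auto intro: continuous_on_subset[OF assms(1)])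
 also have "(%x. indicator (cball 0 R) x *\<^sub>R f x) = f"
  using R by (auto simp: indicator_def fun_eq_iff not_le)
 finally show ?thesis .
qed

lemma csupp_bounded:
 fixes f :: "'a::euclidean_space => 'b::real_normed_vector"
 assumes "cont f" "csupp f"
 obtains B where "B > 0" "!!x. norm (f x) <= B"
proof -
 obtain R where R: "!!x. R < norm x ==> f x = 0" using csuppE[OF assms(2)] by metis
 have "bounded (f ` cball 0 R)"
  by (intro compact_imp_bounded compact_continuous_image continuous_on_subset[OF assms(1)]) auto
 then obtain B where B: "B > 0" "!!x. x \<in> cball 0 R ==> norm (f x) <= B"
  by (auto simp: bounded_pos)
 have "norm (f x) <= B" for x
  using B R[of x] by (cases "norm x <= R") (auto simp: not_le)
 thus thesis using that B by blast
qed

lemma csupp_deriv: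
 fixes f :: "'a::real_normed_vector => 'b::real_normed_vector"
 assumes "csupp f"
 shows "csupp (%x. FD f (at x) v)"
proof -
 obtain R where R: "!!x. R < norm x ==> f x = 0" using csuppE[OF assms] by metis
 show ?thesis
 proof (rule csuppI[where R=R])
  fix x :: 'a assume x: "R < norm x"
  have op: "open {y. R < norm (y :: 'a)}" by (intro open_Collect_less continuous_intros)
  have "(f has_derivative (%_. 0)) (at x)"
   by (rule has_derivative_transform_within_open[OF has_derivative_const[of 0] op]) (use R x in auto)
  thus "FD f (at x) v = 0"
   using frechet_derivative_at by metis
 qed
qed

lemma integral_translate:
 fixes f :: "'a::euclidean_space => 'b::{banach,second_countable_topology}"
 assumes "f \<in> bm borel"
 shows "(LINT x|lborel. f (x + a)) = (LINT x|lborel. f x)"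
 using integral_distr[of "(+) a" lborel borel f] assms by (simp add: lborel_distr_plus add.commute)

lemma has_vector_derivative_quotient:
 assumes "(f has_vector_derivative D) (at t)"
 shows "((%s. (f s - f t) /\<^sub>R (s - t)) \<longlongrightarrow> D) (at t)"
proof -
 have "((%s. norm ((f s - f t) - (s - t) *\<^sub>R D) / norm (s - t)) \<longlongrightarrow> 0) (at t)"
  using assms by (simp add: has_vector_derivative_def has_derivative_iff_norm)
 hence "((%s. norm ((f s - f t) /\<^sub>R (s - t) - D)) \<longlongrightarrow> 0) (at t)"
 proof (rule Lim_transform_eventually)
  have "norm ((f s - f t) - (s - t) *\<^sub>R D) / norm (s - t) = norm ((f s - f t) /\<^sub>R (s - t) - D)" if "s ~= t" for s
  proof -
   have "(f s - f t) /\<^sub>R (s - t) - D = ((f s - f t) - (s - t) *\<^sub>R D) /\<^sub>R (s - t)"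
    using that by (simp add: scaleR_diff_right)
   thus ?thesis by (simp add: divide_inverse mult.commute)
  qed
  thus "\<forall>\<^sub>F s in at t. norm ((f s - f t) - (s - t) *\<^sub>R D) / norm (s - t) = norm ((f s - f t) /\<^sub>R (s - t) - D)"
   by (auto simp: eventually_at_filter)
 qed
 thus ?thesis using Lim_null[of "%s. (f s - f t) /\<^sub>R (s - t)" D "at t"] tendsto_norm_zero_iff by blast
qed

lemma has_vector_derivative_line:
 assumes "Ck (Suc k) f"
 shows "((%t. f (x + t *\<^sub>R v)) has_vector_derivative FD f (at (x + t *\<^sub>R v)) v) (at t within S)"
proof -
 have "((%t. x + t *\<^sub>R v) has_vector_derivative v) (at t within S)"
  by (auto intro!: derivative_eq_intros)
 hence "((f \<circ> (%t. x + t *\<^sub>R v)) has_vector_derivative FD f (at (x + t *\<^sub>R v)) v) (at t within S)"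
  by (rule vector_derivative_diff_chain_within)
   (rule has_derivative_at_withinI[OF Ck_Suc_has_derivative[OF assms]])
 thus ?thesis by (simp add: o_def)
qed

text \<open>Translation invariance makes the integrals of all difference quotients vanish.\<close>
lemma integral_deriv_zero:
 fixes f :: "'a::euclidean_space => 'b::{banach,second_countable_topology}"
 assumes f: "Ck1 f" and s: "csupp f"
 shows "(LINT x|lborel. FD f (at x) v) = 0"
proof -
 let ?D = "%x. FD f (at x) v"
 define h where "h n = 1 / real (Suc n)" for n
 have h: "0 < h n" "h n <= 1" for n by (auto simp: h_def)
 define g where "g n x = (f (x + h n *\<^sub>R v) - f x) /\<^sub>R h n" for n x
 have cf: "cont f" by (rule Ck_continuous[OF f])
 have cD: "cont ?D" using f by simp
 have mf[measurable]: "f \<in> bm borel" by (rule borel_measurable_continuous_onI[OF cf])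
 obtain R where R: "R > 0" "!!x. R < norm x ==> f x = 0" by (rule csuppE[OF s], rule that)
 obtain B where B: "B > 0" "!!x. norm (?D x) <= B" by (rule csupp_bounded[OF cD csupp_deriv[OF s]], rule that)
 have g0: "(LINT x|lborel. g n x) = 0" for n
 proof -
  have i: "integ (%x. f (x + a))" for a
   by (rule csupp_integrable)
    (auto intro!: continuous_on_compose2[OF cf] continuous_intros csuppI[where R="R + norm a"] R(2)
     less_le_trans[OF _ norm_diff_ineq])
  have i0: "integ f" by (rule csupp_integrable[OF cf s])
  have "(LINT x|lborel. g n x) = ((LINT x|lborel. f (x + h n *\<^sub>R v)) - (LINT x|lborel. f x)) /\<^sub>R h n"
   unfolding g_def using i i0 by simp
  thus ?thesis by (simp add: integral_translate)
 qed
 note dv = has_vector_derivative_line[OF f, of _ v]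
 \<comment> \<open>Domination of the quotients: inside the larger ball by the mean value inequality
   along the segment, outside it because both points of the quotient lie beyond the support, the
   step \<open>h n\<close> being at most 1.\<close>
 have bd: "norm (g n x) <= B * indicator (cball 0 (R + norm v)) x" for n x
 proof (cases "norm x <= R + norm v")
  case True
  have "norm (f (x + h n *\<^sub>R v) - f (x + 0 *\<^sub>R v)) <= B * norm (h n - 0)"
  proof (rule differentiable_bound[of "{0..h n}" "%t. f (x + t *\<^sub>R v)" "%t s. s *\<^sub>R ?D (x + t *\<^sub>R v)"])
   show "onorm (%s. s *\<^sub>R ?D (x + t *\<^sub>R v)) <= B" for t
   proof (rule onorm_le)
    fix s :: real
    show "norm (s *\<^sub>R ?D (x + t *\<^sub>R v)) <= B * norm s"
     using mult_left_mono[OF B(2)[of "x + t *\<^sub>R v"], of "\<bar>s\<bar>"] by (simp add: mult.commute)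
   qed
  qed (use h[of n] dv[of x] in \<open>auto simp: has_vector_derivative_def\<close>)
  hence "norm (g n x) <= B"
   using h[of n] by (simp add: g_def inverse_eq_divide pos_divide_le_eq mult.commute del: scaleR_right_diff_distrib scaleR_diff_right)
  thus ?thesis using True by simp
 next
  case False
  have "R < norm x" using False norm_ge_zero[of v] by linarith
  moreover have "norm (h n *\<^sub>R v) <= norm v" using h[of n] by (simp add: mult_left_le_one_le)
  hence "R < norm (x + h n *\<^sub>R v)" using False norm_diff_ineq[of x "h n *\<^sub>R v"] by linarith
  ultimately have "g n x = 0" using R(2) by (simp add: g_def)
  thus ?thesis using B(1) by (simp add: indicator_def)
 qed
 have "(%n. LINT x|lborel. g n x) \<longlonglongrightarrow> (LINT x|lborel. ?D x)"
 proof (rule integral_dominated_convergence[where w="%x. B * indicator (cball 0 (R + norm v)) x"])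
  show "?D \<in> bm lborel" using borel_measurable_continuous_onI[OF cD] by simp
  show "g n \<in> bm lborel" for n unfolding g_def by measurable
  show "integ (%x. B * indicator (cball 0 (R + norm v)) x)"
   by (intro integrable_mult_right integrable_real_indicator) (auto simp: emeasure_bounded_finite[unfolded infinity_ennreal_def])
  show "AE x in lborel. norm (g n x) <= B * indicator (cball 0 (R + norm v)) x" for n using bd by simp
  have "(%n. g n x) \<longlonglongrightarrow> ?D x" for x
  proof -
   have "((%t. (f (x + t *\<^sub>R v) - f (x + 0 *\<^sub>R v)) /\<^sub>R (t - 0)) \<longlongrightarrow> ?D (x + 0 *\<^sub>R v)) (at 0)"
    by (rule has_vector_derivative_quotient) (rule dv)
   moreover have "filterlim h (at 0) sequentially"
    unfolding h_def by (intro filterlim_atI LIMSEQ_Suc lim_1_over_n) auto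
   ultimately have "((%n. (f (x + h n *\<^sub>R v) - f (x + 0 *\<^sub>R v)) /\<^sub>R (h n - 0)) \<longlongrightarrow> ?D (x + 0 *\<^sub>R v)) sequentially"
    by (rule filterlim_compose)
   thus ?thesis by (simp add: g_def)
  qed
  thus "AE x in lborel. (%n. g n x) \<longlonglongrightarrow> ?D x" by simp
 qed
 thus ?thesis using g0 by (simp add: LIMSEQ_const_iff)
qed

subsection \<open>Symmetry of second derivatives\<close>

lemma has_real_derivative_line:
 fixes f :: "'a::euclidean_space => real"
 assumes "Ck (Suc k) f"
 shows "((%t. f (x + t *\<^sub>R v)) has_real_derivative FD f (at (x + t *\<^sub>R v)) v) (at t within S)"
 using has_vector_derivative_line[OF assms] by (simp add: has_real_derivative_iff_has_vector_derivative)

text \<open>The mean value theorem applied once in direction \<open>v\<close> and once in direction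
  \<open>w\<close>. The left-hand side is symmetric in \<open>v\<close> and \<open>w\<close>, which
  is what forces the mixed derivatives to agree.\<close>

lemma second_difference_mvt:
 fixes f :: "'a::euclidean_space => real"
 assumes f: "Ck2 f" and h: "h > 0"
 shows "\<exists>s t. 0 < s \<and> s < h \<and> 0 < t \<and> t < h \<and>
  f (x + h *\<^sub>R v + h *\<^sub>R w) - f (x + h *\<^sub>R v) - f (x + h *\<^sub>R w) + f x =
  h * h * FD (%y. FD f (at y) v) (at (x + s *\<^sub>R v + t *\<^sub>R w)) w"
proof -
 let ?D = "%y. FD f (at y) v"
 have D: "Ck1 ?D" using f by (rule Ck_Suc_deriv)
 have "\<exists>s>0. s < h \<and> (f (x + h *\<^sub>R w + h *\<^sub>R v) - f (x + h *\<^sub>R v)) - (f (x + h *\<^sub>R w + 0 *\<^sub>R v) - f (x + 0 *\<^sub>R v))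
   = (h - 0) * (?D (x + h *\<^sub>R w + s *\<^sub>R v) - ?D (x + s *\<^sub>R v))"
  by (rule MVT2[OF h]) (intro DERIV_diff has_real_derivative_line[OF f])
 then obtain s where s: "s > 0" "s < h" and e1: "f (x + h *\<^sub>R w + h *\<^sub>R v) - f (x + h *\<^sub>R v) - f (x + h *\<^sub>R w) + f x
   = h * (?D (x + h *\<^sub>R w + s *\<^sub>R v) - ?D (x + s *\<^sub>R v))" by (auto simp: algebra_simps)
 have "\<exists>t>0. t < h \<and> ?D ((x + s *\<^sub>R v) + h *\<^sub>R w) - ?D ((x + s *\<^sub>R v) + 0 *\<^sub>R w)
   = (h - 0) * FD ?D (at ((x + s *\<^sub>R v) + t *\<^sub>R w)) w"
  by (rule MVT2[OF h]) (rule has_real_derivative_line[OF D])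
 then obtain t where t: "t > 0" "t < h" and e2: "?D (x + s *\<^sub>R v + h *\<^sub>R w) - ?D (x + s *\<^sub>R v)
   = h * FD ?D (at (x + s *\<^sub>R v + t *\<^sub>R w)) w" by auto
 have "x + h *\<^sub>R w + s *\<^sub>R v = x + s *\<^sub>R v + h *\<^sub>R w" "x + h *\<^sub>R w + h *\<^sub>R v = x + h *\<^sub>R v + h *\<^sub>R w"
  by (simp_all add: ac_simps)
 thus ?thesis using s t e1 e2 by (rule_tac exI[of _ s], rule_tac exI[of _ t]) auto
qed

text \<open>Schwarz's theorem: the symmetric second difference equals a value of either mixed
  derivative at a point near \<open>x\<close>, and the points tend to \<open>x\<close> as the step
  tends to 0.\<close>

lemma frechet_derivative_commute_real:
 fixes f :: "'a::euclidean_space => real"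
 assumes f: "Ck2 f"
 shows "FD (%y. FD f (at y) v) (at x) w =
  FD (%y. FD f (at y) w) (at x) v" (is "?P x = ?Q x")
proof -
 have c: "cont ?P" "cont ?Q"
  using f by simp_all
 define h where "h n = 1 / real (Suc n)" for n
 have h: "h n > 0" for n by (simp add: h_def)
 have h0: "h \<longlonglongrightarrow> 0" unfolding h_def by (intro LIMSEQ_Suc lim_1_over_n)
 have "\<exists>s t s' t'. 0 < s \<and> s < h n \<and> 0 < t \<and> t < h n \<and> 0 < s' \<and> s' < h n \<and> 0 < t' \<and> t' < h n \<and>
   ?P (x + s *\<^sub>R v + t *\<^sub>R w) = ?Q (x + s' *\<^sub>R w + t' *\<^sub>R v)" for n
 proof -
  have "x + h n *\<^sub>R w + h n *\<^sub>R v = x + h n *\<^sub>R v + h n *\<^sub>R w" by (simp add: ac_simps)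
  thus ?thesis
   using second_difference_mvt[OF f h[of n], of x v w] second_difference_mvt[OF f h[of n], of x w v] h[of n]
   by (smt (verit) mult_left_cancel mult_pos_pos)
 qed
 then obtain s t s' t' where st: "!!n. 0 < s n \<and> s n < h n \<and> 0 < t n \<and> t n < h n \<and> 0 < s' n \<and> s' n < h n \<and> 0 < t' n \<and> t' n < h n"
   and e: "!!n. ?P (x + s n *\<^sub>R v + t n *\<^sub>R w) = ?Q (x + s' n *\<^sub>R w + t' n *\<^sub>R v)" by metis
 have l: "s \<longlonglongrightarrow> 0" "t \<longlonglongrightarrow> 0" "s' \<longlonglongrightarrow> 0" "t' \<longlonglongrightarrow> 0"
  by (rule tendsto_sandwich[OF _ _ tendsto_const h0]; use st in \<open>auto intro!: always_eventually less_imp_le\<close>)+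
 have "(%n. x + s n *\<^sub>R v + t n *\<^sub>R w) \<longlonglongrightarrow> x + 0 *\<^sub>R v + 0 *\<^sub>R w"
  "(%n. x + s' n *\<^sub>R w + t' n *\<^sub>R v) \<longlonglongrightarrow> x + 0 *\<^sub>R w + 0 *\<^sub>R v"
  using l by (intro tendsto_intros; simp)+
 hence "(%n. ?P (x + s n *\<^sub>R v + t n *\<^sub>R w)) \<longlonglongrightarrow> ?P x" "(%n. ?Q (x + s' n *\<^sub>R w + t' n *\<^sub>R v)) \<longlonglongrightarrow> ?Q x"
  by (auto intro: continuous_on_tendsto_compose[OF c(1)] continuous_on_tendsto_compose[OF c(2)])
 thus ?thesis using e LIMSEQ_unique by simp
qed

lemma frechet_derivative_bounded_linear:
 assumes "bounded_linear L" "f differentiable (at x)"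
 shows "FD (%x. L (f x)) (at x) v = L (FD f (at x) v)"
 using frechet_derivative_at[OF bounded_linear.has_derivative[OF assms(1)], of f] assms(2)
 by (metis frechet_derivative_works)

lemma frechet_derivative_commute:
 fixes f :: "'a::euclidean_space => complex"
 assumes f: "Ck2 f"
 shows "FD (%y. FD f (at y) v) (at x) w =
  FD (%y. FD f (at y) w) (at x) v"
proof -
 have d1: "f differentiable (at x)" for x using f by simp
 have d2: "(%y. FD f (at y) v) differentiable (at x)" for x v using f by simp
 have *: "L (FD (%y. FD f (at y) v) (at x) w) =
  FD (%y. FD (%x. L (f x)) (at y) v) (at x) w"
  if "bounded_linear L" for L :: "complex => real" and v w
  by (simp add: frechet_derivative_bounded_linear[OF that] d1 d2)
 show ?thesis
  by (rule complex_eqI; subst (1 2) *)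
   (simp_all only: bounded_linear_Re bounded_linear_Im
    frechet_derivative_commute_real[OF Ck_bounded_linear[OF bounded_linear_Re f], of v]
    frechet_derivative_commute_real[OF Ck_bounded_linear[OF bounded_linear_Im f], of v])
qed

subsection \<open>Wirtinger calculus\<close>

lemma pd_zbar_eq: "(f has_derivative f') (at z) ==> pd_zbar k f z = (f' (axis k 1) + \<i> * f' (axis k \<i>)) / 2"
 unfolding pd_zbar_def using frechet_derivative_at by metis

lemma pd_z_eq: "(f has_derivative f') (at z) ==> pd_z k f z = (f' (axis k 1) - \<i> * f' (axis k \<i>)) / 2"
 unfolding pd_z_def using frechet_derivative_at by metis

lemma Ck_pd_zbar: "Ck (Suc k) f ==> Ck k (pd_zbar j f)"
 and Ck_pd_z: "Ck (Suc k) f ==> Ck k (pd_z j f)"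
 unfolding pd_zbar_def[abs_def] pd_z_def[abs_def]
 by (simp_all only: divide_inverse) (intro Ck_mult Ck_add Ck_diff Ck_const Ck_Suc_deriv | assumption)+

lemma pd_zbar_add:
 "f differentiable (at z) ==> g differentiable (at z) ==> pd_zbar k (%x. f x + g x) z = pd_zbar k f z + pd_zbar k g z"
 by (subst pd_zbar_eq[OF has_derivative_add[OF frechet_derivative_works[THEN iffD1] frechet_derivative_works[THEN iffD1]]])
  (auto simp: pd_zbar_def field_simps)

lemma pd_zbar_mult:
 "f differentiable (at z) ==> g differentiable (at z) ==>
  pd_zbar k (%x. f x * g x) z = f z * pd_zbar k g z + pd_zbar k f z * g z"
 by (subst pd_zbar_eq[OF has_derivative_mult[OF frechet_derivative_works[THEN iffD1] frechet_derivative_works[THEN iffD1]]])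
  (auto simp: pd_zbar_def field_simps)

lemma pd_zbar_const [simp]: "pd_zbar k (%x. c) z = 0"
 by (subst pd_zbar_eq[OF has_derivative_const]) simp

lemma pd_zbar_chain:
 assumes "(h has_field_derivative h') (at (f z))" "f differentiable (at z)"
 shows "pd_zbar k (%x. h (f x)) z = h' * pd_zbar k f z"
 using has_derivative_compose[OF assms(2)[unfolded frechet_derivative_works] assms(1)[unfolded has_field_derivative_def]]
 by (subst pd_zbar_eq) (auto simp: pd_zbar_def field_simps)

lemma pd_zbar_sum:
 assumes "!!i. i \<in> A ==> f i differentiable (at z)"
 shows "pd_zbar k (%x. \<Sum>i\<in>A. f i x) z = (\<Sum>i\<in>A. pd_zbar k (f i) z)"
 using assms
 by (induction A rule: infinite_finite_induct) (auto simp: pd_zbar_add)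

lemma pd_zbar_prod:
 assumes "finite A" "!!i. i \<in> A ==> f i differentiable (at z)"
 shows "pd_zbar k (%x. \<Prod>i\<in>A. f i x) z = (\<Sum>l\<in>A. pd_zbar k (f l) z * (\<Prod>i\<in>A - {l}. f i z))"
 using assms
proof (induction A rule: finite_induct)
 case (insert a A)
 have d: "(%x. \<Prod>i\<in>A. f i x) differentiable (at z)"
  using insert.prems has_derivative_prod[of A f "%i. FD (f i) (at z)" z UNIV]
  by (auto simp: differentiable_def frechet_derivative_works[symmetric])
 have "(\<Prod>i\<in>insert a A - {l}. f i z) = f a z * (\<Prod>i\<in>A - {l}. f i z)" if "l \<in> A" for l
  using insert.hyps that by (subst insert_Diff_if) auto
 moreover have "insert a A - {a} = A" using insert.hyps by auto
 ultimately show ?case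
  using insert.hyps insert.prems d
  by (simp add: pd_zbar_mult insert.IH sum_distrib_left mult.assoc mult.left_commute add.commute)
qed simp

lemma pd_zbar_nth [simp]: "pd_zbar k (%x. x $ j) z = 0"
 by (subst pd_zbar_eq[OF bounded_linear_imp_has_derivative[OF linear_component_cvec]]) (simp add: axis_def)

lemma pd_zbar_cnj_nth [simp]: "pd_zbar k (%x. cnj (x $ j)) z = (if j = k then 1 else 0)"
 by (subst pd_zbar_eq[OF bounded_linear_imp_has_derivative[OF linear_cnj_component]]) (simp add: axis_def)

lemma Ck_differentiable: "Ck (Suc k) f ==> f differentiable (at x)"
 by simp

lemma pd_zbar_commute:
 assumes f: "Ck2 f"
 shows "pd_zbar a (pd_zbar b f) z = pd_zbar b (pd_zbar a f) z"
proof -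
 let ?D = "%v w. FD (%x. FD f (at x) v) (at z) w"
 have hd: "((pd_zbar b f) has_derivative (%w. (?D (axis b 1) w + \<i> * ?D (axis b \<i>) w) / 2)) (at z)" for b
  unfolding pd_zbar_def[abs_def] using f
  by (auto intro!: derivative_eq_intros frechet_derivative_works[THEN iffD1] simp: )
 show ?thesis
  unfolding pd_zbar_eq[OF hd]
  by (simp add: frechet_derivative_commute[OF f, of "axis b 1" z "axis a 1"]
   frechet_derivative_commute[OF f, of "axis b 1" z "axis a \<i>"]
   frechet_derivative_commute[OF f, of "axis b \<i>" z "axis a 1"]
   frechet_derivative_commute[OF f, of "axis b \<i>" z "axis a \<i>"] algebra_simps add_divide_distrib diff_divide_distrib)
qed

lemma csupp_pd_zbar:
 assumes "csupp f" shows "csupp (pd_zbar k f)"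
proof -
 obtain R where R: "!!x. norm x > R ==> FD f (at x) (axis k 1) = 0"
  using csuppE[OF csupp_deriv[OF assms]] by metis
 obtain R' where R': "!!x. norm x > R' ==> FD f (at x) (axis k \<i>) = 0"
  using csuppE[OF csupp_deriv[OF assms]] by metis
 show ?thesis
  by (rule csuppI[of "max R R'"]) (simp add: pd_zbar_def R R')
qed

lemma integral_pd_zbar_zero:
 assumes f: "Ck1 f" and s: "csupp f"
 shows "(LINT x|lborel. pd_zbar k f x) = 0"
proof -
 have i: "integ (%x. FD f (at x) v)" for v
  using f by (intro csupp_integrable csupp_deriv[OF s]) simp
 show ?thesis
  unfolding pd_zbar_def using i integral_deriv_zero[OF f s] by simp
qed

lemma integral_by_parts_zbar:
 assumes f: "Ck1 f" and g: "Ck1 g" and s: "csupp f"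
 shows "(LINT x|lborel. pd_zbar k f x * g x) = - (LINT x|lborel. f x * pd_zbar k g x)"
proof -
 have "(LINT x|lborel. pd_zbar k (%x. f x * g x) x) = 0"
  by (intro integral_pd_zbar_zero Ck_mult f g csupp_mono[OF s]) simp
 also have "pd_zbar k (%x. f x * g x) = (%x. pd_zbar k f x * g x + f x * pd_zbar k g x)"
  using f g by (auto simp: fun_eq_iff pd_zbar_mult)
 also have "(LINT x|lborel. pd_zbar k f x * g x + f x * pd_zbar k g x) =
   (LINT x|lborel. pd_zbar k f x * g x) + (LINT x|lborel. f x * pd_zbar k g x)"
  by (intro Bochner_Integration.integral_add csupp_integrable csupp_mono[OF csupp_pd_zbar[OF s]] csupp_mono[OF s]
     continuous_intros Ck_continuous[OF f] Ck_continuous[OF g]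
     Ck_continuous[OF Ck_pd_zbar[OF f]] Ck_continuous[OF Ck_pd_zbar[OF g]]) auto
 finally show ?thesis by (simp add: eq_neg_iff_add_eq_0)
qed

section \<open>The integral of a d-bar Jacobian with one compactly supported entry\<close>

subsection \<open>Mollification by averaging along coordinate directions\<close>

lemma continuous_on_comp_UNIV:
 "cont f ==> continuous_on S g ==> continuous_on S (%x. f (g x))"
 by (rule continuous_on_compose2) auto

text \<open>The mean of \<open>f\<close> over the segment from \<open>x\<close> to
  \<open>x + h v\<close>. It serves as a mollifier: in direction \<open>v\<close> its derivative is
  a difference quotient of \<open>f\<close>, so one order of smoothness is gained there.\<close>

definition avg :: "real => 'a::euclidean_space => ('a => complex) => 'a => complex" where
 "avg h v f x = integral (cbox 0 1) (%t. f (x + (t * h) *\<^sub>R v))"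

lemma avg_continuous:
 assumes "cont f"
 shows "cont (avg h v f)"
 unfolding avg_def[abs_def]
 by (rule integral_continuous_on_param)
  (simp only: case_prod_unfold, intro continuous_on_comp_UNIV[OF assms] continuous_intros)

lemma avg_integrable:
 fixes f :: "'a::euclidean_space => complex"
 assumes "cont f"
 shows "(%t::real. f (x + (t * h) *\<^sub>R v)) integrable_on cbox 0 1"
 by (rule integrable_continuous) (intro continuous_on_comp_UNIV[OF assms] continuous_intros)

text \<open>Differentiation under the integral sign. The Leibniz rule takes the derivative as a
  bounded operator depending continuously on both variables, hence the passage through
  \<open>Blinfun\<close>, with continuity checked on basis vectors.\<close>

lemma avg_has_derivative:
 assumes f: "Ck1 f"
 shows "(avg h v f has_derivative (%w. avg h v (%y. FD f (at y) w) x)) (at x)"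
proof -
 let ?f = "%x t. f (x + (t * h) *\<^sub>R v)"
 have bl: "bounded_linear (FD f (at y))" for y
  using has_derivative_bounded_linear[OF Ck_Suc_has_derivative[OF f]] .
 define fx where "fx x t = Blinfun (FD f (at (x + (t * h) *\<^sub>R v)))" for x :: 'a and t :: real
 have fx: "blinfun_apply (fx x t) = FD f (at (x + (t * h) *\<^sub>R v))" for x t
  unfolding fx_def by (rule bounded_linear_Blinfun_apply[OF bl])
 have cfx: "continuous_on (UNIV \<times> cbox 0 1) (%(x, t). fx x t)"
 proof (rule continuous_on_blinfun_componentwise)
  fix i :: 'a assume "i \<in> Basis"
  have "cont (%y. FD f (at y) i)" using f by simp
  thus "continuous_on (UNIV \<times> cbox 0 1) (%x. blinfun_apply (case x of (x, t) => fx x t) i)"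
   by (simp only: case_prod_unfold fx) (rule continuous_on_comp_UNIV, assumption, intro continuous_intros)
 qed
 have "((%x. integral (cbox 0 1) (?f x)) has_derivative integral (cbox 0 1) (fx x)) (at x within UNIV)"
 proof (rule leibniz_rule[OF _ _ cfx])
  fix x :: 'a and t :: real
  have "((%x. f (x + (t * h) *\<^sub>R v)) has_derivative (%w. FD f (at (x + (t * h) *\<^sub>R v)) w)) (at x)"
   by (rule has_derivative_compose[OF _ Ck_Suc_has_derivative[OF f], of _ "%w. w"])
    (auto intro!: derivative_eq_intros)
  thus "((%x. ?f x t) has_derivative blinfun_apply (fx x t)) (at x within UNIV)"
   by (simp add: fx)
  show "?f x integrable_on cbox 0 1" by (rule avg_integrable[OF Ck_continuous[OF f]])
 qed auto
 moreover have "blinfun_apply (integral (cbox 0 1) (fx x)) = (%w. avg h v (%y. FD f (at y) w) x)"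
 proof (rule ext)
  fix w
  have "fx x integrable_on cbox 0 1"
  proof (rule integrable_continuous)
   have "continuous_on (cbox 0 1) (%t::real. (x, t))" by (intro continuous_intros)
   from continuous_on_compose2[OF cfx this] show "continuous_on (cbox 0 1) (fx x)" by auto
  qed
  thus "blinfun_apply (integral (cbox 0 1) (fx x)) w = avg h v (%y. FD f (at y) w) x"
   by (simp add: blinfun_apply_integral avg_def fx)
 qed
 ultimately show ?thesis by (simp only: avg_def[symmetric])
qed

lemma avg_frechet:
 assumes f: "Ck1 f"
 shows "FD (avg h v f) (at x) w = avg h v (%y. FD f (at y) w) x"
 using frechet_derivative_at[OF avg_has_derivative[OF f]] by metis

lemma avg_Ck:
 assumes f: "Ck1 f"
 shows "Ck1 (avg h v f)"
 by (rule Ck1I[OF avg_has_derivative[OF f]]) (use f in \<open>auto intro: avg_continuous\<close>)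

text \<open>The fundamental theorem of calculus along the segment; this is where the extra
  derivative comes from.\<close>

lemma avg_frechet_self:
 assumes f: "Ck1 f" and h: "h ~= 0"
 shows "FD (avg h v f) (at x) v = (f (x + h *\<^sub>R v) - f x) / of_real h"
proof -
 have "((%t. f (x + (t * h) *\<^sub>R v) / of_real h) has_vector_derivative FD f (at (x + (t * h) *\<^sub>R v)) v) (at t within {0..1})" for t
 proof -
  have "((%t. x + (t * h) *\<^sub>R v) has_vector_derivative h *\<^sub>R v) (at t within {0..1})"
   by (auto intro!: derivative_eq_intros simp: has_vector_derivative_def)
  hence "((f \<circ> (%t. x + (t * h) *\<^sub>R v)) has_vector_derivative FD f (at (x + (t * h) *\<^sub>R v)) (h *\<^sub>R v)) (at t within {0..1})"
   by (rule vector_derivative_diff_chain_within)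
    (rule has_derivative_at_withinI[OF Ck_Suc_has_derivative[OF f]])
  hence "((%t. f (x + (t * h) *\<^sub>R v)) has_vector_derivative h *\<^sub>R FD f (at (x + (t * h) *\<^sub>R v)) v) (at t within {0..1})"
   using linear_scale[OF has_derivative_linear[OF Ck_Suc_has_derivative[OF f]]] by (simp add: o_def)
  from has_vector_derivative_divide[OF this, of "of_real h"] show ?thesis
   using h by (simp add: scaleR_conv_of_real)
 qed
 hence "((%t. FD f (at (x + (t * h) *\<^sub>R v)) v) has_integral
   (f (x + (1 * h) *\<^sub>R v) / of_real h - f (x + (0 * h) *\<^sub>R v) / of_real h)) {0..1}"
  by (intro fundamental_theorem_of_calculus) auto
 thus ?thesis
  unfolding avg_frechet[OF f] avg_def by (simp add: integral_unique diff_divide_distrib)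
qed

lemma Ck_translate:
 assumes "Ck k f" shows "Ck k (%x. f (x + a))"
 using assms
proof (induction k arbitrary: f)
 case 0
 thus ?case by (auto intro!: continuous_on_comp_UNIV[where f=f] continuous_on_add continuous_on_id continuous_on_const)
next
 case (Suc k)
 show ?case
 proof (rule Ck_SucI)
  show "((%x. f (x + a)) has_derivative (%w. FD f (at (x + a)) w)) (at x)" for x
   by (rule has_derivative_compose[OF _ Ck_Suc_has_derivative[OF Suc.prems], of _ "%w. w"])
    (auto intro!: derivative_eq_intros)
  show "Ck k (%x. FD f (at (x + a)) v)" for v
   by (rule Suc.IH[OF Ck_Suc_deriv[OF Suc.prems]])
 qed
qed

definition avgs :: "'a::euclidean_space list => real => ('a => complex) => 'a => complex" where
 "avgs bs h f = foldr (avg h) bs f"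

lemma avgs_simps: "avgs [] h f = f" "avgs (b # bs) h f = avg h b (avgs bs h f)"
 by (simp_all add: avgs_def)

lemma avgs_Ck1:
 assumes f: "Ck1 f"
 shows "Ck1 (avgs bs h f) \<and>
  (\<forall>w. (%x. FD (avgs bs h f) (at x) w) = avgs bs h (%x. FD f (at x) w))"
proof (induction bs)
 case Nil
 thus ?case using f by (simp add: avgs_simps del: Ck.simps)
next
 case (Cons b bs)
 thus ?case by (auto simp: avgs_simps avg_frechet intro: avg_Ck simp del: Ck.simps)
qed

text \<open>If \<open>b\<close> is averaged further inside, the outermost averaging preserves what
  was gained; if \<open>b\<close> is the outermost direction, the derivative is a difference
  quotient of a C^1 function.\<close>

lemma avgs_deriv_Ck1:
 assumes f: "Ck1 f" and h: "h ~= 0" and b: "b \<in> set bs"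
 shows "Ck1 (%x. FD (avgs bs h f) (at x) b)"
 using b
proof (induction bs)
 case (Cons c bs)
 have g: "Ck1 (avgs bs h f)" using avgs_Ck1[OF f] by blast
 show ?case
 proof (cases "b \<in> set bs")
  case True
  thus ?thesis using avg_Ck[OF Cons.IH] by (simp add: avgs_simps avg_frechet[OF g] del: Ck.simps)
 next
  case False
  hence "c = b" using Cons.prems by simp
  thus ?thesis
   by (simp add: avgs_simps avg_frechet_self[OF g h] divide_inverse del: Ck.simps)
    (intro Ck_mult Ck_diff Ck_translate[OF g] Ck_const g)
 qed
qed simp

lemma avgs_Ck2:
 fixes f :: "'a::euclidean_space => complex"
 assumes f: "Ck1 f" and h: "h ~= 0" and bs: "set bs = (Basis :: 'a set)"
 shows "Ck2 (avgs bs h f)"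
proof (rule Ck_SucI)
 have g: "Ck1 (avgs bs h f)" using avgs_Ck1[OF f] by blast
 show "(avgs bs h f has_derivative FD (avgs bs h f) (at x)) (at x)" for x
  by (rule Ck_Suc_has_derivative[OF g])
 fix v :: 'a
 have "FD (avgs bs h f) (at x) v = (\<Sum>b\<in>Basis. (v \<bullet> b) *\<^sub>R FD (avgs bs h f) (at x) b)" for x
 proof -
  have l: "linear (FD (avgs bs h f) (at x))"
   using has_derivative_linear[OF Ck_Suc_has_derivative[OF g]] .
  have "FD (avgs bs h f) (at x) (\<Sum>b\<in>Basis. (v \<bullet> b) *\<^sub>R b) = (\<Sum>b\<in>Basis. (v \<bullet> b) *\<^sub>R FD (avgs bs h f) (at x) b)"
   using l by (simp add: linear_sum linear_scale)
  thus ?thesis by (simp add: euclidean_representation)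
 qed
 thus "Ck1 (%x. FD (avgs bs h f) (at x) v)"
  by (simp only:) (intro Ck_sum Ck_bounded_linear[OF bounded_linear_scaleR_right] avgs_deriv_Ck1[OF f h]; simp add: bs)
qed

lemma avgs_continuous: "cont f ==> cont (avgs bs h f)"
 by (induction bs) (auto simp: avgs_simps intro: avg_continuous)

text \<open>A closed disc about \<open>c\<close> is convex, so averages of values in it stay in it,
  and each averaging moves the argument by at most \<open>\<bar>h\<bar>\<close>. With
  \<open>c = f x\<close> this yields convergence, with \<open>c = 0\<close> uniform bounds.\<close>

lemma avgs_close:
 fixes f :: "'a::euclidean_space => complex"
 assumes f: "cont f" and bs: "!!b. b \<in> set bs ==> norm b = 1" and e: "0 <= e"
  and *: "!!y. dist y x <= d + real (length bs) * \<bar>h\<bar> ==> norm (f y - c) <= e"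
  and y: "dist y x <= d"
 shows "norm (avgs bs h f y - c) <= e"
 using bs * y
proof (induction bs arbitrary: d y)
 case Nil
 thus ?case by (simp add: avgs_simps)
next
 case (Cons b bs)
 let ?g = "avgs bs h f"
 have cg: "cont ?g" by (rule avgs_continuous[OF f])
 have g: "norm (?g (y + (t * h) *\<^sub>R b) - c) <= e" if t: "t \<in> cbox 0 1" for t :: real
 proof (rule Cons.IH[where d="d + \<bar>h\<bar>"])
  have "dist (y + (t * h) *\<^sub>R b) x <= norm (y - x) + norm ((t * h) *\<^sub>R b)"
   by (metis add_diff_eq dist_norm norm_triangle_ineq diff_add_eq)
  also have "norm ((t * h) *\<^sub>R b) <= 1 * \<bar>h\<bar>"
   using t Cons.prems(1)[of b] by (auto simp: abs_mult mult_left_le_one_le)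
  finally show "dist (y + (t * h) *\<^sub>R b) x <= d + \<bar>h\<bar>" using Cons.prems(3) by (simp add: dist_norm)
  show "norm (f z - c) <= e" if "dist z x <= d + \<bar>h\<bar> + real (length bs) * \<bar>h\<bar>" for z
   using that by (intro Cons.prems(2)) (simp add: algebra_simps)
 qed (use Cons.prems(1) in auto)
 have "((%t. ?g (y + (t * h) *\<^sub>R b) - c) has_integral (avg h b ?g y - c)) (cbox 0 1)"
 proof -
  have "((%t::real. ?g (y + (t * h) *\<^sub>R b)) has_integral avg h b ?g y) (cbox 0 1)"
   unfolding avg_def by (intro integrable_integral avg_integrable cg)
  from has_integral_diff[OF this has_integral_const[of c 0 1]] show ?thesis by simp
 qed
 from has_integral_bound[OF e this g] show ?case by (simp add: avgs_simps)
qed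

lemma avgs_tendsto:
 fixes f :: "'a::euclidean_space => complex"
 assumes f: "cont f" and bs: "!!b. b \<in> set bs ==> norm b = 1" and h: "h \<longlonglongrightarrow> 0"
 shows "(%n. avgs bs (h n) f x) \<longlonglongrightarrow> f x"
proof (rule LIMSEQ_I)
 fix r :: real assume r: "0 < r"
 have "isCont f x" using f continuous_on_eq_continuous_at by blast
 then obtain d where d: "d > 0" "!!y. dist y x < d ==> dist (f y) (f x) < r / 2"
  using r unfolding continuous_at_eps_delta by (metis half_gt_zero)
 have "(%n. real (length bs) * \<bar>h n\<bar>) \<longlonglongrightarrow> real (length bs) * \<bar>0\<bar>"
  by (intro tendsto_intros h)
 hence "eventually (%n. real (length bs) * \<bar>h n\<bar> < d) sequentially"
  using d(1) by (intro order_tendstoD(2)) simp_all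
 then obtain N where N: "!!n. n \<ge> N ==> real (length bs) * \<bar>h n\<bar> < d"
  by (auto simp: eventually_sequentially)
 show "\<exists>N. \<forall>n\<ge>N. norm (avgs bs (h n) f x - f x) < r"
 proof (intro exI[of _ N] allI impI)
  fix n assume n: "n \<ge> N"
  have "norm (avgs bs (h n) f x - f x) <= r / 2"
  proof (rule avgs_close[OF f bs, where d=0 and x=x])
   fix y assume "dist y x <= 0 + real (length bs) * \<bar>h n\<bar>"
   hence "dist (f y) (f x) < r / 2" using N[OF n] by (intro d(2)) simp
   thus "norm (f y - f x) <= r / 2" by (simp add: dist_norm)
  qed (use r in auto)
  thus "norm (avgs bs (h n) f x - f x) < r" using r by simp
 qed
qed

lemma avgs_bounded:
 fixes f :: "'a::euclidean_space => complex"
 assumes f: "cont f" and bs: "!!b. b \<in> set bs ==> norm b = 1"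
  and B: "0 <= B" "!!y. norm y <= R + real (length bs) ==> norm (f y) <= B" and h: "\<bar>h\<bar> <= 1" and x: "norm x <= R"
 shows "norm (avgs bs h f x) <= B"
proof -
 have "norm (avgs bs h f x - 0) <= B"
 proof (rule avgs_close[OF f bs B(1), where d=R and x=0])
  fix y :: 'a assume "dist y 0 <= R + real (length bs) * \<bar>h\<bar>"
  also have "... <= R + real (length bs)" using h by (simp add: mult_left_le)
  finally show "norm (f y - 0) <= B" using B(2) by simp
 qed (use x in auto)
 thus ?thesis by simp
qed

subsection \<open>The Piola identity in integrated form\<close>

lemma dbar_det_expand:
 "det (\<chi> i. dbar (v i) x) = (\<Sum>p | p permutes (UNIV::'n::finite set). of_int (sign p) * (\<Prod>i\<in>UNIV. pd_zbar (p i) (v i) x))"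
 by (simp add: det_def dbar_def)

text \<open>Integration by parts moves the derivative off row \<open>j\<close> onto the product of
  the other rows; what arises are second derivatives, which cancel in pairs in the alternating
  sum.\<close>

lemma integral_det_dbar_C2:
 fixes v :: "'n::finite => complex^'n => complex"
 assumes v: "!!i. i ~= j ==> Ck2 (v i)" and vj: "Ck1 (v j)" and s: "csupp (v j)"
 shows "(LINT x|lborel. det (\<chi> i. dbar (v i) x)) = 0"
proof -
 define X where "X p x = (\<Prod>i\<in>UNIV - {j}. pd_zbar (p i) (v i) x)" for p :: "'n => 'n" and x
 have v1: "Ck1 (pd_zbar k (v i))" if "i ~= j" for i k using Ck_pd_zbar[OF v[OF that]] .
 have X: "Ck1 (X p)" for p unfolding X_def[abs_def] by (intro Ck_prod v1) auto
 let ?Y = "%p l x. pd_zbar (p j) (pd_zbar (p l) (v l)) x * (\<Prod>i\<in>UNIV - {j} - {l}. pd_zbar (p i) (v i) x)"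
 have dX: "pd_zbar (p j) (X p) x = (\<Sum>l\<in>UNIV - {j}. ?Y p l x)" for p x
  unfolding X_def[abs_def] using v1 by (intro pd_zbar_prod) auto
 have prod: "(\<Prod>i\<in>UNIV. pd_zbar (p i) (v i) x) = pd_zbar (p j) (v j) x * X p x" for p x
  unfolding X_def by (subst prod.remove[of UNIV j]) auto
 have int: "integ (%x. pd_zbar (p j) (v j) x * X p x)" for p
  by (intro csupp_integrable csupp_mono[OF csupp_pd_zbar[OF s]] continuous_intros Ck_continuous[OF X] Ck_continuous[OF Ck_pd_zbar[OF vj]]) auto
 have "cont (pd_zbar k (X p))" for k p using Ck_continuous[OF Ck_pd_zbar[OF X]] .
 hence int2: "integ (%x. v j x * pd_zbar (p j) (X p) x)" for p
  by (intro csupp_integrable csupp_mono[OF s] continuous_intros Ck_continuous[OF vj]) auto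
 \<comment> \<open>Exchanging the values of \<open>p\<close> at \<open>j\<close> and
   \<open>l\<close> reverses the sign and, the second derivatives being symmetric, preserves the
   product; the sum is its own negative.\<close>
 have anti: "(\<Sum>p | p permutes (UNIV::'n set). of_int (sign p) * ?Y p l x) = 0" if l: "l ~= j" for l x
 proof -
  let ?t = "Transposition.transpose j l"
  have t: "?t permutes UNIV" by (rule permutes_swap_id) auto
  have "(\<Sum>p | p permutes (UNIV::'n set). of_int (sign p) * ?Y p l x) =
    (\<Sum>p | p permutes (UNIV::'n set). of_int (sign (p \<circ> ?t)) * ?Y (p \<circ> ?t) l x)"
   by (rule sum_permutations_compose_right[OF t])
  also have "... = (\<Sum>p | p permutes (UNIV::'n set). - (of_int (sign p) * ?Y p l x))"
  proof (rule sum.cong[OF refl])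
   fix p :: "'n => 'n" assume "p \<in> {p. p permutes UNIV}"
   hence p: "p permutes UNIV" by simp
   have sg: "sign (p \<circ> ?t) = - sign p"
    using p t l by (subst sign_compose) (auto simp: permutation_permutes sign_swap_id)
   have "pd_zbar (p l) (pd_zbar (p j) (v l)) x = pd_zbar (p j) (pd_zbar (p l) (v l)) x"
    by (rule pd_zbar_commute[OF v[OF l]])
   moreover have "(\<Prod>i\<in>UNIV - {j} - {l}. pd_zbar ((p \<circ> ?t) i) (v i) x) = (\<Prod>i\<in>UNIV - {j} - {l}. pd_zbar (p i) (v i) x)"
    by (rule prod.cong) (auto simp: Transposition.transpose_def)
   ultimately show "of_int (sign (p \<circ> ?t)) * ?Y (p \<circ> ?t) l x = - (of_int (sign p) * ?Y p l x)"
    by (simp add: sg)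
  qed
  also have "... = - (\<Sum>p | p permutes (UNIV::'n set). of_int (sign p) * ?Y p l x)"
   by (simp add: sum_negf)
  finally show ?thesis by (auto simp: complex_eq_iff)
 qed
 have "(LINT x|lborel. det (\<chi> i. dbar (v i) x)) =
   (\<Sum>p | p permutes (UNIV::'n set). of_int (sign p) * (LINT x|lborel. pd_zbar (p j) (v j) x * X p x))"
  unfolding dbar_det_expand prod using int by (subst Bochner_Integration.integral_sum) auto
 also have "... = (\<Sum>p | p permutes (UNIV::'n set). of_int (sign p) * - (LINT x|lborel. v j x * pd_zbar (p j) (X p) x))"
  by (simp only: integral_by_parts_zbar[OF vj X s])
 also have "... = - (LINT x|lborel. (\<Sum>p | p permutes (UNIV::'n set). of_int (sign p) * (v j x * pd_zbar (p j) (X p) x)))"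
  using int2 by (subst Bochner_Integration.integral_sum) (auto simp: sum_negf)
 also have "(%x. \<Sum>p | p permutes (UNIV::'n set). of_int (sign p) * (v j x * pd_zbar (p j) (X p) x)) = (%x. 0)"
 proof
  fix x
  have "(\<Sum>p | p permutes (UNIV::'n set). of_int (sign p) * (v j x * pd_zbar (p j) (X p) x)) =
   v j x * (\<Sum>p | p permutes (UNIV::'n set). \<Sum>l\<in>UNIV - {j}. of_int (sign p) * ?Y p l x)"
   unfolding dX by (simp add: sum_distrib_left mult_ac)
  also have "(\<Sum>p | p permutes (UNIV::'n set). \<Sum>l\<in>UNIV - {j}. of_int (sign p) * ?Y p l x) =
    (\<Sum>l\<in>UNIV - {j}. \<Sum>p | p permutes (UNIV::'n set). of_int (sign p) * ?Y p l x)"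
   by (rule sum.swap)
  also have "... = 0" using anti by (intro sum.neutral) auto
  finally show "(\<Sum>p | p permutes (UNIV::'n set). of_int (sign p) * (v j x * pd_zbar (p j) (X p) x)) = 0" by simp
 qed
 finally show ?thesis by simp
qed

lemma integral_det_dbar:
 fixes v :: "'n::finite => complex^'n => complex"
 assumes v: "!!i. Ck1 (v i)" and s: "csupp (v j)"
 shows "(LINT x|lborel. det (\<chi> i. dbar (v i) x)) = 0"
proof -
 obtain bs where bs: "set bs = (Basis :: (complex^'n) set)" using finite_list[OF finite_Basis] by blast
 have nb: "norm b = 1" if "b \<in> set bs" for b using that bs by simp
 define h where "h m = 1 / real (Suc m)" for m
 have h: "h m ~= 0" "\<bar>h m\<bar> <= 1" for m by (auto simp: h_def)
 have h0: "h \<longlonglongrightarrow> 0" unfolding h_def by (intro LIMSEQ_Suc lim_1_over_n)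
 \<comment> \<open>Row \<open>j\<close> is kept unaveraged, since C^1 suffices for it; its support
   then confines all approximating determinants to one ball.\<close>
 define w where "w m i = (if i = j then v j else avgs bs (h m) (v i))" for m i
 have w1: "Ck1 (w m i)" for m i using v avgs_Ck1[OF v] by (simp add: w_def del: Ck.simps)
 have z: "(LINT x|lborel. det (\<chi> i. dbar (w m i) x)) = 0" for m
  by (rule integral_det_dbar_C2[where j=j])
   (auto simp: w_def s v avgs_Ck2[OF v h(1) bs] simp del: Ck.simps)
 have cD: "cont (%x. FD (v i) (at x) u)" for i u using v by simp
 have pw: "pd_zbar k (w m i) x = (if i = j then pd_zbar k (v j) x else
   (avgs bs (h m) (%x. FD (v i) (at x) (axis k 1)) x +
    \<i> * avgs bs (h m) (%x. FD (v i) (at x) (axis k \<i>)) x) / 2)" for k m i x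
  using avgs_Ck1[OF v[of i], of bs "h m"] by (simp add: w_def pd_zbar_def fun_eq_iff)
 have lim: "(%m. pd_zbar k (w m i) x) \<longlonglongrightarrow> pd_zbar k (v i) x" for k i x
 proof (cases "i = j")
  case True thus ?thesis by (simp add: pw)
 next
  case False
  show ?thesis
   by (simp only: pw False if_False, simp only: pd_zbar_def) (intro tendsto_intros avgs_tendsto[OF cD nb h0]; simp)
 qed
 obtain R where R: "R > 0" "!!x. R < norm x ==> v j x = 0" by (rule csuppE[OF s], rule that)
 have Rp: "pd_zbar k (v j) x = 0" if "R < norm x" for k x
 proof -
  have op: "open {y. R < norm (y :: complex^'n)}" by (intro open_Collect_less continuous_intros)
  have "(v j has_derivative (%_. 0)) (at x)"
   by (rule has_derivative_transform_within_open[OF has_derivative_const[of 0] op]) (use R that in auto)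
  thus ?thesis by (simp add: pd_zbar_eq)
 qed
 \<comment> \<open>An iterated average at a point of norm at most \<open>R\<close> uses values at
   most \<open>length bs\<close> further out, as \<open>h m\<close> is at most 1.\<close>
 let ?R = "R + real (length bs)"
 have "\<exists>B>0. \<forall>y. norm y <= ?R \<longrightarrow> norm (FD (v i) (at y) (axis k c)) <= B" for i k c
 proof -
  have "bounded ((%x. FD (v i) (at x) (axis k c)) ` cball 0 ?R)"
   by (intro compact_imp_bounded compact_continuous_image continuous_on_subset[OF cD]) auto
  thus ?thesis by (auto simp: bounded_pos)
 qed
 then obtain Bf where Bf: "!!i k c. Bf i k c > 0" "!!i k c y. norm y <= ?R ==> norm (FD (v i) (at y) (axis k c)) <= Bf i k c"
  by metis
 define B where "B = (\<Sum>i\<in>UNIV. \<Sum>k\<in>UNIV. Bf i k 1 + Bf i k \<i>)"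
 have B: "Bf i k 1 <= B" "Bf i k \<i> <= B" for i k
 proof -
  have nn: "0 <= Bf i k 1 + Bf i k \<i>" for i k by (intro add_nonneg_nonneg less_imp_le Bf(1))
  have "Bf i k 1 + Bf i k \<i> <= (\<Sum>k\<in>UNIV. Bf i k 1 + Bf i k \<i>)"
   by (intro member_le_sum nn) auto
  also have "... <= B" unfolding B_def
   by (intro member_le_sum sum_nonneg nn) auto
  finally show "Bf i k 1 <= B" "Bf i k \<i> <= B" using Bf(1)[of i k 1] Bf(1)[of i k \<i>] by linarith+
 qed
 have B0: "B \<ge> 0" using B(1) Bf(1) by (meson less_imp_le order_trans)
 have half: "norm ((a + \<i> * b) / 2) <= B" if "norm a <= B" "norm b <= B" for a b
  using norm_triangle_ineq[of a "\<i> * b"] that by (simp add: norm_divide norm_mult)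
 have bnd: "norm (pd_zbar k (w m i) x) <= B" if x: "norm x <= R" for k m i x
 proof (cases "i = j")
  case True
  have "norm x <= ?R" using x by simp
  thus ?thesis using True Bf(2)[of x i k] B[of i k]
   by (simp add: pw) (unfold pd_zbar_def, rule half, (meson order_trans)+)
 next
  case False
  have a: "norm (avgs bs (h m) (%x. FD (v i) (at x) (axis k c)) x) <= B" if "Bf i k c <= B" for c
   by (rule avgs_bounded[OF cD nb B0 _ h(2) x]) (use order_trans[OF Bf(2) that] in auto)
  show ?thesis
   by (simp only: pw False if_False) (intro half a B)
 qed
 have "(%m. LINT x|lborel. det (\<chi> i. dbar (w m i) x)) \<longlonglongrightarrow> (LINT x|lborel. det (\<chi> i. dbar (v i) x))"
 proof (rule integral_dominated_convergence[where w="%x. (\<Sum>p | p permutes (UNIV::'n set). B ^ CARD('n)) * indicator (cball 0 R) x"])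
  have c: "cont (%x. det (\<chi> i. dbar (u i) x))" if "!!i. Ck1 (u i)" for u :: "'n => complex^'n => complex"
   unfolding dbar_det_expand by (intro continuous_intros Ck_continuous[OF Ck_pd_zbar[OF that]])
  show "(%x. det (\<chi> i. dbar (v i) x)) \<in> bm lborel"
   using borel_measurable_continuous_onI[OF c[OF v]] by simp
  show "(%x. det (\<chi> i. dbar (w m i) x)) \<in> bm lborel" for m
   using borel_measurable_continuous_onI[OF c[OF w1]] by simp
  show "integ (%x::complex^'n. (\<Sum>p | p permutes (UNIV::'n set). B ^ CARD('n)) * indicator (cball 0 R) x)"
   by (intro integrable_mult_right integrable_real_indicator) (auto simp: emeasure_bounded_finite[unfolded infinity_ennreal_def])
  show "AE x in lborel. (%m. det (\<chi> i. dbar (w m i) x)) \<longlonglongrightarrow> det (\<chi> i. dbar (v i) x)"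
   unfolding dbar_det_expand by (intro AE_I2 tendsto_intros lim)
  show "AE x in lborel. norm (det (\<chi> i. dbar (w m i) x)) <= (\<Sum>p | p permutes (UNIV::'n set). B ^ CARD('n)) * indicator (cball 0 R) x" for m
  proof (rule AE_I2)
   fix x :: "complex^'n"
   show "norm (det (\<chi> i. dbar (w m i) x)) <= (\<Sum>p | p permutes (UNIV::'n set). B ^ CARD('n)) * indicator (cball 0 R) x"
   proof (cases "norm x <= R")
    case True
    have "norm (det (\<chi> i. dbar (w m i) x)) <= (\<Sum>p | p permutes (UNIV::'n set). B ^ CARD('n))"
     unfolding dbar_det_expand
    proof (rule sum_norm_le)
     fix p :: "'n => 'n"
     have "norm (\<Prod>i\<in>UNIV. pd_zbar (p i) (w m i) x) <= (\<Prod>i\<in>(UNIV::'n set). B)"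
      unfolding prod_norm[symmetric] by (intro prod_mono) (use bnd[OF True] in auto)
     thus "norm (of_int (sign p) * (\<Prod>i\<in>UNIV. pd_zbar (p i) (w m i) x)) <= B ^ CARD('n)"
      by (simp add: norm_mult sign_def)
    qed
    thus ?thesis using True by simp
   next
    case False
    hence "pd_zbar k (w m j) x = 0" for k using Rp[of x k] by (simp add: pw)
    hence "(\<Prod>i\<in>UNIV. pd_zbar (p i) (w m i) x) = 0" for p
     by (intro prod_zero) auto
    hence "det (\<chi> i. dbar (w m i) x) = 0"
     unfolding dbar_det_expand by (simp only: mult_zero_right sum.neutral_const)
    thus ?thesis using False by simp
   qed
  qed
 qed
 thus ?thesis using z by (simp add: LIMSEQ_const_iff)
qed

declare Ck.simps [simp del]

section \<open>The Berndtsson--Andersson formula for a general phase, in terms of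
  determinants\<close>

subsection \<open>Determinants with a replaced row\<close>

definition rowrep :: "complex^'n^'n => 'n => complex^'n => complex^'n^'n::finite" where
 "rowrep A j a = (\<chi> i. if i = j then a else A $ i)"

definition shiftI :: "complex^'n^'n => complex => complex^'n^'n::finite" where
 "shiftI A t = (\<chi> i k. A $ i $ k + (if i = k then t else 0))"

lemma det_rowrep_add: "det (rowrep A j (a + b)) = det (rowrep A j a) + det (rowrep A j b)"
 unfolding rowrep_def using det_row_add[of j "%_. a" "%_. b" "%i. A $ i"] by simp

lemma det_rowrep_scale: "det (rowrep A j (c *s a)) = c * det (rowrep A j a)"
 unfolding rowrep_def using det_row_mul[of j c "%_. a" "%i. A $ i"] by simp

lemma det_rowrep_sum: "det (rowrep A j (\<Sum>i\<in>S. f i)) = (\<Sum>i\<in>S. det (rowrep A j (f i)))"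
proof (induction S rule: infinite_finite_induct)
 case (insert x S)
 thus ?case by (simp add: det_rowrep_add)
qed (use det_rowrep_scale[of _ _ 0 0] in \<open>simp_all\<close>)

lemma det_rowrep_row: "det (rowrep A j (A $ l)) = (if l = j then det A else 0)"
proof (cases "l = j")
 case True
 hence "rowrep A j (A $ l) = A" by (simp add: rowrep_def vec_eq_iff)
 thus ?thesis using True by simp
next
 case False
 hence "row l (rowrep A j (A $ l)) = row j (rowrep A j (A $ l))"
  by (simp add: rowrep_def row_def vec_eq_iff)
 thus ?thesis using False det_identical_rows[of l j] by simp
qed

lemma det_rowrep_expand:
 "det (rowrep A j a) = (\<Sum>p | p permutes UNIV. of_int (sign p) * (a $ p j * (\<Prod>i\<in>UNIV - {j}. A $ i $ p i)))"
proof -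
 have "(\<Prod>i\<in>UNIV. rowrep A j a $ i $ p i) = a $ p j * (\<Prod>i\<in>UNIV - {j}. A $ i $ p i)" for p
  by (subst prod.remove[of UNIV j]) (auto simp: rowrep_def intro!: prod.cong)
 thus ?thesis by (simp add: det_def)
qed

text \<open>Jacobi's formula along \<open>A + t I\<close>: the principal cofactors appear as
  determinants with a row replaced by a unit vector, the form in which the Piola identity produces
  them.\<close>

lemma det_shiftI_deriv:
 "((%t. det (shiftI A t)) has_field_derivative (\<Sum>j\<in>UNIV. det (rowrep (shiftI A t) j (axis j 1)))) (at t)"
proof -
 have "((%t. \<Sum>p | p permutes UNIV. of_int (sign p) * (\<Prod>i\<in>UNIV. shiftI A t $ i $ p i)) has_field_derivative
   (\<Sum>p | p permutes UNIV. of_int (sign p) * (\<Sum>j\<in>UNIV. (if j = p j then 1 else 0) * (\<Prod>i\<in>UNIV - {j}. shiftI A t $ i $ p i)))) (at t)"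
  by (intro DERIV_sum DERIV_cmult has_field_derivative_prod)
   (auto simp: shiftI_def intro!: derivative_eq_intros)
 also have "(\<Sum>p | p permutes UNIV. of_int (sign p) * (\<Sum>j\<in>UNIV. (if j = p j then 1 else 0) * (\<Prod>i\<in>UNIV - {j}. shiftI A t $ i $ p i)))
   = (\<Sum>j\<in>UNIV. det (rowrep (shiftI A t) j (axis j 1)))"
  by (simp only: det_rowrep_expand sum_distrib_left, subst sum.swap, intro sum.cong refl) (auto simp: axis_def)
 finally show ?thesis by (simp add: det_def)
qed

lemma continuous_on_det:
 assumes "!!i j. continuous_on S (%x. A x $ i $ j)"
 shows "continuous_on S (%x. det (A x :: complex^'n^'n))"
 unfolding det_def by (intro continuous_intros assms)

lemma det_shiftI_scale:
 assumes "t ~= 0"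
 shows "det (shiftI A t) = t ^ CARD('n) * det (shiftI (\<chi> i k. A $ i $ k / t) 1 :: complex^'n^'n)"
proof -
 let ?B = "shiftI (\<chi> i k. A $ i $ k / t) 1"
 have "shiftI A t = (\<chi> i. t *s ?B $ i)"
  using assms by (auto simp: shiftI_def vec_eq_iff vector_scalar_mult_def algebra_simps)
 hence "det (shiftI A t) = (\<Prod>i\<in>(UNIV::'n set). t) * det (\<chi> i. ?B $ i)"
  by (simp only: det_rows_mul)
 thus ?thesis by simp
qed

lemma norm_det_bound:
 fixes A :: "complex^'n^'n"
 assumes "!!i j. norm (A $ i $ j) <= b"
 shows "norm (det A) <= fact CARD('n) * b ^ CARD('n)"
proof -
 have "norm (det A) <= (\<Sum>p | p permutes (UNIV::'n set). b ^ CARD('n))"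
  unfolding det_def
 proof (rule sum_norm_le)
  fix p :: "'n => 'n"
  have "norm (\<Prod>i\<in>UNIV. A $ i $ p i) <= (\<Prod>i\<in>(UNIV::'n set). b)"
   unfolding prod_norm[symmetric] by (intro prod_mono) (use assms in auto)
  thus "norm (of_int (sign p) * (\<Prod>i\<in>UNIV. A $ i $ p i)) <= b ^ CARD('n)"
   by (simp add: norm_mult sign_def)
 qed
 thus ?thesis by (simp add: card_permutations)
qed

text \<open>The coefficient of \<open>t ^ (n - 1 - m)\<close> in the polynomial \<open>\<Sum>j. s j * det (rowrep (A + t I) j a)\<close>.\<close>
definition adj_coeff :: "complex^'n^'n => complex^'n => complex^'n => nat => complex" where
 "adj_coeff A s a m = (\<Sum>j\<in>UNIV. \<Sum>p | p permutes UNIV. \<Sum>S | S \<subseteq> UNIV - {j} \<and> card S = m.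
   of_int (sign p) * (s $ j * a $ p j * ((\<Prod>i\<in>S. A $ i $ p i) * (\<Prod>i\<in>UNIV - {j} - S. if i = p i then 1 else 0))))"

text \<open>When the product over the rows other than \<open>j\<close> is multiplied out,
  \<open>S\<close> collects the rows contributing an entry of \<open>A\<close>; each of the
  remaining n - 1 - |S| rows contributes a diagonal \<open>t\<close>.\<close>

lemma adj_poly:
 fixes A :: "complex^'n^'n"
 shows "(\<Sum>j\<in>UNIV. s $ j * det (rowrep (shiftI A t) j a)) = (\<Sum>m<CARD('n). t ^ (CARD('n) - 1 - m) * adj_coeff A s a m)"
proof -
 let ?n = "CARD('n)"
 let ?d = "%p j S. (\<Prod>i\<in>S. A $ i $ p i) * (\<Prod>i\<in>UNIV - {j} - S. if i = p i then 1 else 0)"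
 have exp: "(\<Prod>i\<in>UNIV - {j}. shiftI A t $ i $ p i) =
   (\<Sum>m<?n. t ^ (?n - 1 - m) * (\<Sum>S | S \<subseteq> UNIV - {j} \<and> card S = m. ?d p j S))" for j and p :: "'n => 'n"
 proof -
  have c: "card S < ?n" "(\<Prod>i\<in>UNIV - {j} - S. if i = p i then t else 0) = t ^ (?n - 1 - card S) * (\<Prod>i\<in>UNIV - {j} - S. if i = p i then 1 else 0)"
   if S: "S \<subseteq> UNIV - {j}" for S :: "'n set"
  proof -
   have "card S <= card (UNIV - {j})" by (rule card_mono[OF _ S]) simp
   thus "card S < ?n" by (simp add: le_less_trans card_gt_0_iff Suc_le_eq less_Suc_eq_le[symmetric])
   have "(\<Prod>i\<in>UNIV - {j} - S. if i = p i then t else 0) = (\<Prod>i\<in>UNIV - {j} - S. t * (if i = p i then 1 else 0))"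
    by (rule prod.cong) auto
   also have "... = t ^ card (UNIV - {j} - S) * (\<Prod>i\<in>UNIV - {j} - S. if i = p i then 1 else 0)"
    by (simp only: prod.distrib prod_constant)
   also have "card (UNIV - {j} - S) = ?n - 1 - card S"
    using S by (subst card_Diff_subset) (auto simp: finite_subset[OF subset_UNIV])
   finally show "(\<Prod>i\<in>UNIV - {j} - S. if i = p i then t else 0) = t ^ (?n - 1 - card S) * (\<Prod>i\<in>UNIV - {j} - S. if i = p i then 1 else 0)" .
  qed
  have "(\<Prod>i\<in>UNIV - {j}. shiftI A t $ i $ p i) = (\<Sum>S\<in>Pow (UNIV - {j}). (\<Prod>i\<in>S. A $ i $ p i) * (\<Prod>i\<in>UNIV - {j} - S. if i = p i then t else 0))"
   by (simp add: shiftI_def prod_add)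
  also have "... = (\<Sum>S\<in>Pow (UNIV - {j}). t ^ (?n - 1 - card S) * ?d p j S)"
   by (rule sum.cong[OF refl]) (simp add: c mult_ac)
  also have "... = (\<Sum>m\<in>{..<?n}. \<Sum>S | S \<in> Pow (UNIV - {j}) \<and> card S = m. t ^ (?n - 1 - card S) * ?d p j S)"
   by (rule sum.group[symmetric]) (use c in auto)
  also have "... = (\<Sum>m<?n. t ^ (?n - 1 - m) * (\<Sum>S | S \<subseteq> UNIV - {j} \<and> card S = m. ?d p j S))"
   by (simp add: sum_distrib_left)
  finally show ?thesis .
 qed
 have "(\<Sum>j\<in>UNIV. s $ j * det (rowrep (shiftI A t) j a)) =
   (\<Sum>j\<in>UNIV. \<Sum>p | p permutes UNIV. \<Sum>m<?n. t ^ (?n - 1 - m) * (\<Sum>S | S \<subseteq> UNIV - {j} \<and> card S = m.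
     of_int (sign p) * (s $ j * a $ p j * ?d p j S)))"
  unfolding det_rowrep_expand exp by (simp add: sum_distrib_left mult_ac)
 also have "... = (\<Sum>m<?n. \<Sum>j\<in>UNIV. \<Sum>p | p permutes UNIV. t ^ (?n - 1 - m) * (\<Sum>S | S \<subseteq> UNIV - {j} \<and> card S = m.
     of_int (sign p) * (s $ j * a $ p j * ?d p j S)))"
  by (subst sum.swap[of _ _ "{..<?n}"], rule sum.cong[OF refl], subst sum.swap[of _ _ "{..<?n}"]) simp
 also have "... = (\<Sum>m<?n. t ^ (?n - 1 - m) * adj_coeff A s a m)"
  by (simp add: adj_coeff_def sum_distrib_left)
 finally show ?thesis .
qed

text \<open>A count of the summands of \<open>adj_coeff\<close>: n rows \<open>j\<close>, n!
  permutations, at most 2^n sets \<open>S\<close>.\<close>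

definition adj_bound :: "'n::finite itself => real" where
 "adj_bound _ = real CARD('n) * fact CARD('n) * 2 ^ CARD('n)"

lemma adj_bound_nonneg: "0 <= adj_bound TYPE('n::finite)"
 by (simp add: adj_bound_def)

lemma norm_adj_coeff:
 fixes A :: "complex^'n^'n"
 assumes A: "!!i k. norm (A $ i $ k) <= w" and s: "!!j. norm (s $ j) <= r" and a: "!!k. norm (a $ k) <= b"
 shows "norm (adj_coeff A s a m) <= adj_bound TYPE('n) * (r * b * w ^ m)"
proof -
 have nn: "0 <= r" "0 <= b" "0 <= w"
  using s[of undefined] a[of undefined] A[of undefined undefined] norm_ge_zero order_trans by blast+
 have t: "norm (of_int (sign p) * (s $ j * a $ p j * ((\<Prod>i\<in>S. A $ i $ p i) * (\<Prod>i\<in>UNIV - {j} - S. if i = p i then 1 else 0)))) <= r * b * w ^ m"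
  if "card S = m" for j S and p :: "'n => 'n"
 proof -
  have "norm (\<Prod>i\<in>S. A $ i $ p i) <= (\<Prod>i\<in>S. w)"
   unfolding prod_norm[symmetric] by (intro prod_mono) (use A in auto)
  moreover have "norm (\<Prod>i\<in>UNIV - {j} - S. if i = p i then 1 else (0::complex)) <= (\<Prod>i\<in>UNIV - {j} - S. 1)"
   unfolding prod_norm[symmetric] by (intro prod_mono) auto
  ultimately have "norm ((\<Prod>i\<in>S. A $ i $ p i) * (\<Prod>i\<in>UNIV - {j} - S. if i = p i then 1 else 0)) <= w ^ m * 1"
   unfolding norm_mult using that nn by (intro mult_mono) auto
  moreover have "norm (s $ j * a $ p j) <= r * b"
   unfolding norm_mult by (intro mult_mono s a nn) auto
  ultimately have "norm (s $ j * a $ p j * ((\<Prod>i\<in>S. A $ i $ p i) * (\<Prod>i\<in>UNIV - {j} - S. if i = p i then 1 else 0))) <= (r * b) * (w ^ m * 1)"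
   unfolding norm_mult[of "s $ j * a $ p j"] using nn by (intro mult_mono) auto
  thus ?thesis by (simp add: norm_mult sign_def)
 qed
 have "norm (adj_coeff A s a m) <= (\<Sum>j\<in>(UNIV::'n set). \<Sum>p | p permutes (UNIV::'n set). \<Sum>S | S \<subseteq> UNIV - {j} \<and> card S = m. r * b * w ^ m)"
  unfolding adj_coeff_def by (intro sum_norm_le) (rule t, simp)
 also have "... <= (\<Sum>j\<in>(UNIV::'n set). \<Sum>p | p permutes (UNIV::'n set). 2 ^ CARD('n) * (r * b * w ^ m))"
 proof (intro sum_mono)
  fix j :: 'n
  have "card {S. S \<subseteq> UNIV - {j} \<and> card S = m} <= card (Pow (UNIV::'n set))"
   by (intro card_mono) auto
  also have "... = 2 ^ CARD('n)" by (simp add: card_Pow)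
  finally have "real (card {S. S \<subseteq> UNIV - {j} \<and> card S = m}) <= 2 ^ CARD('n)"
   by (metis of_nat_le_iff of_nat_numeral of_nat_power)
  thus "(\<Sum>S | S \<subseteq> UNIV - {j} \<and> card S = m. r * b * w ^ m) <= 2 ^ CARD('n) * (r * b * w ^ m)"
   using nn by (simp add: mult_right_mono)
 qed
 also have "... = adj_bound TYPE('n) * (r * b * w ^ m)"
  by (simp add: adj_bound_def card_permutations)
 finally show ?thesis .
qed

subsection \<open>The kernel\<close>

definition phase :: "('n => complex^'n => complex) => complex^'n => complex^'n => complex" where
 "phase q z x = (\<Sum>l\<in>UNIV. q l x * (z $ l - x $ l))"

definition dbar_mat :: "('n => complex^'n => complex) => complex^'n => complex^'n^'n" where
 "dbar_mat q x = (\<chi> l. dbar (q l) x)"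

text \<open>The coefficients of the form \<partial>|x - z|^2 in \<open>x\<close>.\<close>

definition svec :: "complex^'n => complex^'n => complex^'n" where
 "svec z x = (\<chi> j. cnj (x $ j) - cnj (z $ j))"

lemma norm_svec_nth: "norm (svec z x $ j) <= norm (x - z)"
proof -
 have "norm (svec z x $ j) = norm ((x - z) $ j)" by (simp add: svec_def flip: complex_cnj_diff)
 also have "... <= norm (x - z)" by (rule Finite_Cartesian_Product.norm_nth_le)
 finally show ?thesis .
qed

lemma svec_sq: "(\<Sum>j\<in>UNIV. svec z x $ j * (z $ j - x $ j)) = - of_real ((norm (x - z))^2)"
proof -
 have "- cor ((norm (x - z))^2) = (\<Sum>j\<in>UNIV. - ((x - z) $ j * cnj ((x - z) $ j)))"
  by (simp only: norm_sq_cvec sum_negf)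
 also have "... = (\<Sum>j\<in>UNIV. svec z x $ j * (z $ j - x $ j))"
  by (rule sum.cong) (auto simp: svec_def algebra_simps)
 finally show ?thesis by simp
qed

lemma Ck_phase: "(!!l. Ck1 (q l)) ==> Ck1 (phase q z)"
 unfolding phase_def[abs_def] by (intro Ck_sum Ck_mult Ck_diff Ck_const Ck_nth)

lemma Ck_svec: "Ck k (%x. svec z x $ j)"
 unfolding svec_def by (simp) (intro Ck_diff Ck_const Ck_cnj_nth)

lemma pd_zbar_diff:
 "f differentiable (at z) ==> g differentiable (at z) ==> pd_zbar k (%x. f x - g x) z = pd_zbar k f z - pd_zbar k g z"
 by (subst pd_zbar_eq[OF has_derivative_diff[OF frechet_derivative_works[THEN iffD1] frechet_derivative_works[THEN iffD1]]])
  (auto simp: pd_zbar_def field_simps)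

lemma differentiable_nth: "(%x::complex^'n. x $ j) differentiable (at x)"
 using Ck_differentiable[OF Ck_nth] .

lemma differentiable_cnj_nth: "(%x::complex^'n. cnj (x $ j)) differentiable (at x)"
 using Ck_differentiable[OF Ck_cnj_nth] .

lemma dbar_phase:
 assumes q: "!!l. Ck1 (q l)"
 shows "dbar (phase q z) x = (\<Sum>l\<in>UNIV. (z $ l - x $ l) *s dbar_mat q x $ l)"
proof -
 have "pd_zbar k (phase q z) x = (\<Sum>l\<in>UNIV. pd_zbar k (q l) x * (z $ l - x $ l))" for k
 proof -
  have d: "(%x. z $ l - x $ l) differentiable (at x)" for l
   by (intro differentiable_diff differentiable_const differentiable_nth)
  have "pd_zbar k (%x. z $ l - x $ l) x = 0" for l
   by (subst pd_zbar_diff) (auto intro: differentiable_nth)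
  thus ?thesis unfolding phase_def[abs_def]
   by (subst pd_zbar_sum)
    (auto intro!: differentiable_mult Ck_differentiable[OF q] d simp: pd_zbar_mult[OF Ck_differentiable[OF q] d])
 qed
 thus ?thesis by (simp add: dbar_def dbar_mat_def vec_eq_iff algebra_simps)
qed

lemma dbar_svec: "dbar (%x. svec z x $ j) x = axis j 1"
proof -
 have "pd_zbar k (%x. cnj (x $ j) - cnj (z $ j)) x = (if j = k then 1 else 0)" for k
  by (subst pd_zbar_diff) (auto intro: differentiable_cnj_nth)
 thus ?thesis by (auto simp: dbar_def svec_def vec_eq_iff axis_def)
qed

lemma dbar_mult:
 assumes "f differentiable (at x)" "g differentiable (at x)"
 shows "dbar (%x. f x * g x) x = f x *s dbar g x + g x *s dbar f x"
 using assms by (simp add: dbar_def vec_eq_iff pd_zbar_mult mult.commute)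

lemma dbar_exp:
 assumes "f differentiable (at x)"
 shows "dbar (%x. exp (f x)) x = exp (f x) *s dbar f x"
 using pd_zbar_chain[OF DERIV_exp assms] by (simp add: dbar_def vec_eq_iff)

lemma continuous_dbar_nth: "Ck1 f ==> cont (%x. dbar f x $ k)"
 using Ck_continuous[OF Ck_pd_zbar] by (simp add: dbar_def)

lemma continuous_dbar_mat: "(!!l. Ck1 (q l)) ==> cont (%x. dbar_mat q x $ i $ k)"
 by (simp add: dbar_mat_def) (rule continuous_dbar_nth)

lemma dbar_eq_0_outside:
 assumes "!!x. R < norm x ==> u x = 0" "R < norm x"
 shows "dbar u x = 0"
proof -
 have op: "open {y. R < norm (y :: complex^'n)}" by (intro open_Collect_less continuous_intros)
 have "(u has_derivative (%_. 0)) (at x)"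
  by (rule has_derivative_transform_within_open[OF has_derivative_const[of 0] op]) (use assms in auto)
 thus ?thesis by (simp add: pd_zbar_eq dbar_def vec_eq_iff)
qed

text \<open>Apply the Piola identity with the functions \<open>w\<close> and \<open>u s\<^sub>j exp (phase w z)\<close> in row \<open>j\<close>, and sum over \<open>j\<close>.\<close>
lemma divergence_identity:
 fixes w :: "'n::finite => complex^'n => complex"
 assumes w: "!!l. Ck1 (w l)" and u: "Ck1 u" and s: "csupp u"
 shows "(LINT x|lborel. exp (phase w z x) * (\<Sum>j\<in>UNIV. svec z x $ j * det (rowrep (dbar_mat w x) j (dbar u x))) +
   u x * (exp (phase w z x) * ((\<Sum>j\<in>UNIV. det (rowrep (dbar_mat w x) j (axis j 1))) - of_real ((norm (x - z))^2) * det (dbar_mat w x)))) = 0"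
proof -
 let ?e = "%x. exp (phase w z x)"
 define phi where "phi j x = u x * (?e x * svec z x $ j)" for j x
 have phi1: "Ck1 (phi j)" for j
  unfolding phi_def[abs_def] by (intro Ck_mult u Ck1_exp Ck_phase w Ck_svec)
 have phis: "csupp (phi j)" for j by (rule csupp_mono[OF s]) (simp add: phi_def)
 define D where "D j x = det (\<chi> i. dbar (if i = j then phi j else w i) x)" for j x
 have cD: "cont (D j)" for j
  unfolding D_def[abs_def] using continuous_dbar_nth[OF w] continuous_dbar_nth[OF phi1]
  by (intro continuous_on_det) auto
 have D_eq: "D j x = det (rowrep (dbar_mat w x) j (dbar (phi j) x))" for j x
  unfolding D_def rowrep_def dbar_mat_def by (rule arg_cong[where f=det]) (simp add: vec_eq_iff)
 have sD: "csupp (D j)" for j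
 proof -
  obtain R where R: "!!x. R < norm x ==> phi j x = 0" using csuppE[OF phis[of j]] by metis
  have "dbar (phi j) x = 0" if "R < norm x" for x using R that by (rule dbar_eq_0_outside)
  thus ?thesis using det_rowrep_scale[of _ _ 0 0] by (intro csuppI[of R]) (simp add: D_eq)
 qed
 have D0: "(LINT x|lborel. D j x) = 0" for j
  unfolding D_def by (rule integral_det_dbar[where j=j]) (use w phi1 phis in auto)
 have dphi: "dbar (phi j) x = (?e x * svec z x $ j) *s dbar u x + (u x * ?e x) *s axis j 1 +
   (\<Sum>l\<in>UNIV. (u x * ?e x * svec z x $ j * (z $ l - x $ l)) *s dbar_mat w x $ l)" for j x
 proof -
  have du: "u differentiable (at x)" "phase w z differentiable (at x)" "(%x. svec z x $ j) differentiable (at x)"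
   "(%x. ?e x) differentiable (at x)"
   by (rule Ck_differentiable[OF u] Ck_differentiable[OF Ck_phase[OF w]] Ck_differentiable[OF Ck_svec]
    Ck_differentiable[OF Ck1_exp[OF Ck_phase[OF w]]])+
  have "dbar (phi j) x = u x *s (?e x *s axis j 1 + svec z x $ j *s (?e x *s (\<Sum>l\<in>UNIV. (z $ l - x $ l) *s dbar_mat w x $ l)))
    + (?e x * svec z x $ j) *s dbar u x"
   unfolding phi_def[abs_def]
   by (simp only: dbar_mult[OF du(1) differentiable_mult[OF du(4,3)]] dbar_mult[OF du(4,3)] dbar_exp[OF du(2)] dbar_phase[OF w] dbar_svec)
  thus ?thesis
   by (simp add: vec_eq_iff sum_distrib_left algebra_simps)
 qed
 have Dj: "D j x = ?e x * (svec z x $ j * det (rowrep (dbar_mat w x) j (dbar u x))) +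
   u x * (?e x * (det (rowrep (dbar_mat w x) j (axis j 1)) + svec z x $ j * (z $ j - x $ j) * det (dbar_mat w x)))" for j x
 proof -
  \<comment> \<open>The derivative of the phase contributes multiples of the rows of
    \<open>dbar_mat w x\<close>; put in place of row \<open>j\<close>, only row \<open>j\<close>
    itself gives a nonzero determinant, the others producing two equal rows.\<close>
  have "(\<Sum>l\<in>UNIV. u x * ?e x * svec z x $ j * (z $ l - x $ l) * (if l = j then det (dbar_mat w x) else 0)) =
   u x * ?e x * svec z x $ j * (z $ j - x $ j) * det (dbar_mat w x)"
   by (subst sum.remove[of _ j]) auto
  hence "D j x = ?e x * svec z x $ j * det (rowrep (dbar_mat w x) j (dbar u x)) +
    u x * ?e x * det (rowrep (dbar_mat w x) j (axis j 1)) + u x * ?e x * svec z x $ j * (z $ j - x $ j) * det (dbar_mat w x)"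
   by (simp only: D_eq dphi det_rowrep_add det_rowrep_scale det_rowrep_sum det_rowrep_row)
  thus ?thesis by (simp add: algebra_simps)
 qed
 have "0 = (\<Sum>j\<in>UNIV. LINT x|lborel. D j x)" using D0 by simp
 also have "... = (LINT x|lborel. (\<Sum>j\<in>UNIV. D j x))"
  by (rule Bochner_Integration.integral_sum[symmetric]) (rule csupp_integrable[OF cD sD])
 also have "(%x. \<Sum>j\<in>UNIV. D j x) = (%x. ?e x * (\<Sum>j\<in>UNIV. svec z x $ j * det (rowrep (dbar_mat w x) j (dbar u x))) +
   u x * (?e x * ((\<Sum>j\<in>UNIV. det (rowrep (dbar_mat w x) j (axis j 1))) - of_real ((norm (x - z))^2) * det (dbar_mat w x))))"
 proof
  fix x
  have "(\<Sum>j\<in>UNIV. svec z x $ j * (z $ j - x $ j) * det (dbar_mat w x)) = - of_real ((norm (x - z))^2) * det (dbar_mat w x)"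
   by (simp only: sum_distrib_right[symmetric] svec_sq)
  thus "(\<Sum>j\<in>UNIV. D j x) = ?e x * (\<Sum>j\<in>UNIV. svec z x $ j * det (rowrep (dbar_mat w x) j (dbar u x))) +
   u x * (?e x * ((\<Sum>j\<in>UNIV. det (rowrep (dbar_mat w x) j (axis j 1))) - of_real ((norm (x - z))^2) * det (dbar_mat w x)))"
   by (simp add: Dj sum.distrib sum_distrib_left[symmetric])
 qed
 finally show ?thesis by simp
qed

subsection \<open>Dyadic estimates for radial integrals\<close>

abbreviation ubv :: "'a::euclidean_space itself => real" where
 "ubv _ \<equiv> unit_ball_vol (real DIM('a))"

lemma ball_measurable [measurable]: "ball (a::'a::euclidean_space) r \<in> sets borel"
 by (rule borel_open) simp

lemma ennreal_le_suminf: "f k <= (\<Sum>k. f k)" for f :: "nat => ennreal"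
 using sum_le_suminf[of f "{k}"] by simp

lemma suminf_half_ennreal: "c \<ge> 0 ==> (\<Sum>k. ennreal (c * (1 / 2) ^ k)) = ennreal (2 * c)"
 by (subst suminf_ennreal2) (auto simp: suminf_mult suminf_geometric summable_geometric intro!: summable_mult)

text \<open>A substitute for polar coordinates: height times volume of the k-th ball is at most of
  order 2^(-k), so the integrals over the balls sum to a geometric series.\<close>

lemma nn_integral_balls_le:
 fixes a :: "'a::euclidean_space" and h :: "'a => ennreal"
 assumes "!!x. h x <= (\<Sum>k. ennreal (c k) * indicator (ball a (r k)) x)"
  and c: "!!k. 0 <= c k" and r: "!!k. 0 <= r k" and e: "!!k. c k * r k ^ DIM('a) <= e * (1 / 2) ^ k" and e0: "0 <= e"
 shows "(\<integral>\<^sup>+x. h x \<partial>lborel) <= ennreal (2 * (ubv TYPE('a) * e))"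
proof -
 have "(\<integral>\<^sup>+x. h x \<partial>lborel) <= (\<integral>\<^sup>+x. (\<Sum>k. ennreal (c k) * indicator (ball a (r k)) x) \<partial>lborel)"
  by (intro nn_integral_mono assms)
 also have "... = (\<Sum>k. ennreal (c k) * emeasure lborel (ball a (r k)))"
  by (subst nn_integral_suminf) (measurable, auto simp: nn_integral_cmult_indicator)
 also have "... <= (\<Sum>k. ennreal ((ubv TYPE('a) * e) * (1 / 2) ^ k))"
 proof (intro suminf_le summableI)
  fix k
  have "ennreal (c k) * emeasure lborel (ball a (r k)) = ennreal (ubv TYPE('a) * (c k * r k ^ DIM('a)))"
   using c[of k] r[of k] by (simp add: emeasure_ball ennreal_mult'[symmetric] mult_ac)
  also have "... <= ennreal (ubv TYPE('a) * (e * (1 / 2) ^ k))"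
   by (intro ennreal_leI mult_left_mono e) auto
  finally show "ennreal (c k) * emeasure lborel (ball a (r k)) <= ennreal (ubv TYPE('a) * e * (1 / 2) ^ k)"
   by (simp add: mult.assoc)
 qed
 also have "... = ennreal (2 * (ubv TYPE('a) * e))"
  using e0 by (intro suminf_half_ennreal) simp
 finally show ?thesis .
qed

lemma exists_dyadic_small:
 fixes d s :: real
 assumes "0 < d" "d < s"
 obtains k where "s / 2 ^ Suc k <= d" "d < s / 2 ^ k"
proof -
 obtain m where "(1 / 2 :: real) ^ m < d / s"
  using real_arch_pow_inv[of "d / s" "1 / 2"] assms by auto
 hence ex: "\<exists>m. s / 2 ^ m <= d"
  using assms by (intro exI[of _ m]) (simp add: field_simps power_one_over)
 define m where "m = (LEAST m. s / 2 ^ m <= d)"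
 have m: "s / 2 ^ m <= d" unfolding m_def by (rule LeastI_ex[OF ex])
 have "m ~= 0" using m assms by (intro notI) simp
 then obtain k where k: "m = Suc k" using not0_implies_Suc by blast
 have "\<not> s / 2 ^ k <= d" using not_less_Least[of k "%m. s / 2 ^ m <= d"] k m_def by auto
 thus thesis using that[of k] m k by simp
qed

lemma exists_dyadic_large:
 fixes d s :: real
 assumes "0 < s" "s <= d"
 obtains k where "2 ^ k * s <= d" "d < 2 ^ Suc k * s"
proof -
 obtain m where "d / s < 2 ^ m" using real_arch_pow[of 2 "d / s"] by auto
 hence ex: "\<exists>m. d < 2 ^ m * s" using assms by (intro exI[of _ m]) (simp add: field_simps)
 define m where "m = (LEAST m. d < 2 ^ m * s)"
 have m: "d < 2 ^ m * s" unfolding m_def by (rule LeastI_ex[OF ex])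
 have "m ~= 0" using m assms by (intro notI) simp
 then obtain k where k: "m = Suc k" using not0_implies_Suc by blast
 have "\<not> d < 2 ^ k * s" using not_less_Least[of k "%m. d < 2 ^ m * s"] k m_def by auto
 thus thesis using that[of k] m k by simp
qed

lemma nn_integral_near:
 fixes a :: "'a::euclidean_space"
 assumes s: "0 < s" and D: "2 <= DIM('a)"
 shows "(\<integral>\<^sup>+x. indicator (ball a s) x * ennreal ((s / dist x a) ^ (DIM('a) - 1)) \<partial>lborel)
  <= ennreal (2 * (ubv TYPE('a) * (2 ^ DIM('a) * s ^ DIM('a))))"
proof (rule nn_integral_balls_le[where c="%k. (2 ^ Suc k) ^ (DIM('a) - 1)" and r="%k. s / 2 ^ k"])
 fix x :: 'a
 let ?D = "DIM('a)"
 show "indicator (ball a s) x * ennreal ((s / dist x a) ^ (?D - 1))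
   <= (\<Sum>k. ennreal ((2 ^ Suc k) ^ (?D - 1)) * indicator (ball a (s / 2 ^ k)) x)"
 proof (cases "x \<in> ball a s \<and> x ~= a")
  case True
  hence "0 < dist x a" "dist x a < s" by (auto simp: dist_commute)
  then obtain k where k: "s / 2 ^ Suc k <= dist x a" "dist x a < s / 2 ^ k" by (rule exists_dyadic_small)
  have "(s / dist x a) ^ (?D - 1) <= (2 ^ Suc k) ^ (?D - 1)"
   using k(1) s True by (intro power_mono) (auto simp: field_simps)
  hence "indicator (ball a s) x * ennreal ((s / dist x a) ^ (?D - 1)) <= ennreal ((2 ^ Suc k) ^ (?D - 1)) * indicator (ball a (s / 2 ^ k)) x"
   using True k(2) by (simp add: dist_commute ennreal_leI del: power_Suc)
  also have "... <= (\<Sum>k. ennreal ((2 ^ Suc k) ^ (?D - 1)) * indicator (ball a (s / 2 ^ k)) x)"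
   by (rule ennreal_le_suminf)
  finally show ?thesis .
 next
  case False
  \<comment> \<open>At the centre the quotient is 0 by division by zero, and the exponent is
    positive because the dimension is at least 2.\<close>
  thus ?thesis using D by (auto simp: indicator_def zero_power)
 qed
next
 fix k
 obtain D where D': "DIM('a) = Suc D" using D by (cases "DIM('a)") auto
 show "(2 ^ Suc k) ^ (DIM('a) - 1) * (s / 2 ^ k) ^ DIM('a) <= 2 ^ DIM('a) * s ^ DIM('a) * (1 / 2) ^ k"
  using s unfolding D' by (simp add: field_simps power_mult_distrib power_divide)
qed (use s in auto)

lemma nn_integral_far:
 fixes a :: "'a::euclidean_space"
 assumes s: "0 < s"
 shows "(\<integral>\<^sup>+x. indicator (- ball a s) x * ennreal ((s / dist x a) ^ (DIM('a) + 1)) \<partial>lborel)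
  <= ennreal (2 * (ubv TYPE('a) * (2 ^ DIM('a) * s ^ DIM('a))))"
proof (rule nn_integral_balls_le[where c="%k. (1 / 2 ^ k) ^ (DIM('a) + 1)" and r="%k. 2 ^ Suc k * s"])
 fix x :: 'a
 let ?D = "DIM('a)"
 show "indicator (- ball a s) x * ennreal ((s / dist x a) ^ (?D + 1))
   <= (\<Sum>k. ennreal ((1 / 2 ^ k) ^ (?D + 1)) * indicator (ball a (2 ^ Suc k * s)) x)"
 proof (cases "x \<in> ball a s")
  case False
  hence "s <= dist x a" by (auto simp: dist_commute)
  with s obtain k where k: "2 ^ k * s <= dist x a" "dist x a < 2 ^ Suc k * s" by (rule exists_dyadic_large)
  have d0: "0 < dist x a" using \<open>s <= dist x a\<close> s by linarith
  have "(s / dist x a) ^ (?D + 1) <= (1 / 2 ^ k) ^ (?D + 1)"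
   using k(1) s d0 by (intro power_mono) (auto simp: field_simps)
  hence "indicator (- ball a s) x * ennreal ((s / dist x a) ^ (?D + 1)) <= ennreal ((1 / 2 ^ k) ^ (?D + 1)) * indicator (ball a (2 ^ Suc k * s)) x"
   using False k(2) by (simp add: dist_commute ennreal_leI del: power_Suc)
  also have "... <= (\<Sum>k. ennreal ((1 / 2 ^ k) ^ (?D + 1)) * indicator (ball a (2 ^ Suc k * s)) x)"
   by (rule ennreal_le_suminf)
  finally show ?thesis .
 qed simp
next
 fix k
 show "(1 / 2 ^ k) ^ (DIM('a) + 1) * (2 ^ Suc k * s) ^ DIM('a) <= 2 ^ DIM('a) * s ^ DIM('a) * (1 / 2) ^ k"
  using s by (simp add: field_simps power_mult_distrib power_divide)
qed (use s in auto)

text \<open>A radial majorant on \<open>d\<close>-dimensional space, integrable at the origin and at infinity.\<close>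
definition radmaj :: "nat => real => real" where
 "radmaj d x = (if x < 1 then (1 / x) ^ (d - 1) else (1 / x) ^ (d + 1))"

lemma radmaj_nonneg: "0 <= x ==> 0 <= radmaj d x"
 by (simp add: radmaj_def)

lemma radmaj_measurable [measurable]: "radmaj d \<in> bm borel"
 unfolding radmaj_def[abs_def] by measurable

lemma nn_integral_radmaj:
 fixes a :: "'a::euclidean_space"
 assumes s: "0 < s" and D: "2 <= DIM('a)"
 shows "(\<integral>\<^sup>+x. ennreal (radmaj DIM('a) (dist x a / s)) \<partial>lborel) <= ennreal (4 * (ubv TYPE('a) * (2 ^ DIM('a) * s ^ DIM('a))))"
proof -
 have "ennreal (radmaj DIM('a) (dist x a / s)) = indicator (ball a s) x * ennreal ((s / dist x a) ^ (DIM('a) - 1)) +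
   indicator (- ball a s) x * ennreal ((s / dist x a) ^ (DIM('a) + 1))" for x
  using s by (auto simp: radmaj_def indicator_def dist_commute)
 hence "(\<integral>\<^sup>+x. ennreal (radmaj DIM('a) (dist x a / s)) \<partial>lborel) =
  (\<integral>\<^sup>+x. indicator (ball a s) x * ennreal ((s / dist x a) ^ (DIM('a) - 1)) \<partial>lborel) +
   (\<integral>\<^sup>+x. indicator (- ball a s) x * ennreal ((s / dist x a) ^ (DIM('a) + 1)) \<partial>lborel)"
  by (simp only:) (rule nn_integral_add; measurable)
 also have "... <= ennreal (2 * (ubv TYPE('a) * (2 ^ DIM('a) * s ^ DIM('a)))) + ennreal (2 * (ubv TYPE('a) * (2 ^ DIM('a) * s ^ DIM('a))))"
  by (intro add_mono nn_integral_near nn_integral_far s D)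
 also have "... = ennreal (4 * (ubv TYPE('a) * (2 ^ DIM('a) * s ^ DIM('a))))"
  using s by (subst ennreal_plus[symmetric]) auto
 finally show ?thesis .
qed

lemma integrable_radmaj:
 fixes a :: "'a::euclidean_space"
 assumes s: "0 < s" and D: "2 <= DIM('a)"
 shows "integ (%x. radmaj DIM('a) (dist x a / s))"
proof (rule integrableI_nonneg)
 show "(\<integral>\<^sup>+x. ennreal (radmaj DIM('a) (dist x a / s)) \<partial>lborel) < \<infinity>"
  using nn_integral_radmaj[OF s D, of a] by (simp add: le_less_trans ennreal_less_top)
qed (use s in \<open>auto intro!: radmaj_nonneg\<close>)

lemma integrable_near:
 fixes a :: "'a::euclidean_space"
 assumes s: "0 < s" and D: "2 <= DIM('a)"
 shows "integ (%x. indicator (ball a s) x * (1 / dist x a) ^ (DIM('a) - 1))"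
proof (rule Bochner_Integration.integrable_bound[OF integrable_mult_right[OF integrable_radmaj[OF s D, of a], of "(1 / s) ^ (DIM('a) - 1)"]])
 show "AE x in lborel. norm (indicator (ball a s) x * (1 / dist x a) ^ (DIM('a) - 1)) <= norm ((1 / s) ^ (DIM('a) - 1) * radmaj DIM('a) (dist x a / s))"
  using s by (intro AE_I2) (auto simp: indicator_def radmaj_def dist_commute power_divide)
qed measurable

lemma DIM_cvec: "DIM(complex^'n) = 2 * CARD('n)"
 by simp

lemma DIM_cvec_ge: "2 <= DIM(complex^'n::finite)"
 by (simp add: Suc_le_eq)

text \<open>Comparison with \<open>radmaj\<close>, by the decay of the exponential against
  powers.\<close>

lemma integrable_gauss: "integ (%x::complex^'n. exp (- (norm x)\<^sup>2))"
proof -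
 let ?D = "DIM(complex^'n)"
 have lim: "((%y::real. y ^ (?D + 1) / exp y) \<longlongrightarrow> 0) at_top" by (rule tendsto_power_div_exp_0)
 hence "eventually (%y::real. y ^ (?D + 1) / exp y < 1) at_top" by (rule order_tendstoD) simp
 then obtain Y :: real where Y: "!!y. y \<ge> Y ==> y ^ (?D + 1) / exp y < 1" unfolding eventually_at_top_linorder by blast
 define C where "C = max 1 (max Y 1 ^ (?D + 1))"
 have b: "exp (- y\<^sup>2) <= C * radmaj ?D y" if y: "0 < y" for y :: real
 proof (cases "y < 1")
  case True
  have "1 <= (1 / y) ^ (?D - 1)" using True y by (intro one_le_power) simp
  hence "1 * 1 <= C * radmaj ?D y" using True by (intro mult_mono) (auto simp: C_def radmaj_def)
  moreover have "exp (- y\<^sup>2) <= 1" by simp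
  ultimately show ?thesis by linarith
 next
  case False
  hence y1: "1 <= y" by simp
  have "y ^ (?D + 1) <= C * exp (y^2)"
  proof (cases "y \<ge> Y")
   case True
   have "y ^ (?D + 1) <= exp y" using Y[OF True] by (simp add: less_imp_le)
   also have "... <= exp (y^2)" using y1 by (simp add: power2_eq_square)
   also have "... <= C * exp (y^2)" by (simp add: C_def)
   finally show ?thesis .
  next
   case False
   have "y ^ (?D + 1) <= max Y 1 ^ (?D + 1)" using False y by (intro power_mono) auto
   also have "... <= C * 1" by (simp add: C_def)
   also have "... <= C * exp (y^2)" by (intro mult_left_mono) (auto simp: C_def)
   finally show ?thesis .
  qed
  hence "exp (- y\<^sup>2) * y ^ (?D + 1) <= C"
   by (simp add: exp_minus field_simps)
  thus ?thesis using False y by (simp add: radmaj_def power_divide field_simps)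
 qed
 have i1: "integ (%x::complex^'n. radmaj ?D (dist x 0 / 1))"
  by (rule integrable_radmaj[OF _ DIM_cvec_ge]) simp
 \<comment> \<open>The origin gets a term of its own: there \<open>radmaj\<close> is 0 by division
   by zero, while the Gaussian is 1.\<close>
 have int: "integ (%x::complex^'n. C * radmaj ?D (dist x 0 / 1) + indicator {0} x :: real)"
  by (intro Bochner_Integration.integrable_add integrable_mult_right i1 integrable_real_indicator) auto
 show ?thesis
 proof (rule Bochner_Integration.integrable_bound[OF int])
  show "AE x in lborel. norm (exp (- (norm (x::complex^'n))\<^sup>2)) <= norm (C * radmaj ?D (dist x 0 / 1) + indicator {0} x :: real)"
  proof (intro AE_I2)
   fix x :: "complex^'n"
   have "0 <= C * radmaj ?D (norm x)" by (intro mult_nonneg_nonneg radmaj_nonneg) (auto simp: C_def)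
   thus "norm (exp (- (norm x)\<^sup>2)) <= norm (C * radmaj ?D (dist x 0 / 1) + indicator {0} x :: real)"
    using b[of "norm x"] by (cases "x = 0") (auto simp: indicator_def)
  qed
 qed (auto intro!: borel_measurable_continuous_onI continuous_intros)
qed

text \<open>Equal to \<pi>^n; it is the mass of the point evaluation that the parameter t leaves at
  \<open>z\<close> when it tends to infinity.\<close>

definition gauss_const :: "'n::finite itself => real" where
 "gauss_const _ = (LINT x|lborel. exp (- (norm (x::complex^'n))\<^sup>2))"

lemma gauss_const_pos: "0 < gauss_const TYPE('n::finite)"
proof -
 have "0 <= gauss_const TYPE('n)" unfolding gauss_const_def by (rule integral_nonneg_AE) simp
 moreover have "gauss_const TYPE('n) ~= 0"
 proof
  assume "gauss_const TYPE('n) = 0"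
  hence "AE x in lborel. exp (- (norm (x::complex^'n))\<^sup>2) = 0"
   unfolding gauss_const_def using integral_nonneg_eq_0_iff_AE[OF integrable_gauss] by auto
  hence "AE x in (lborel::(complex^'n) measure). False" by simp
  hence "emeasure lborel (UNIV :: (complex^'n) set) = 0" using AE_iff_measurable[of UNIV "lborel::(complex^'n) measure" "%_. False"] by auto
  thus False by (simp add: emeasure_lborel_UNIV)
 qed
 ultimately show ?thesis by simp
qed

subsection \<open>Truncated Gamma integrals\<close>

text \<open>The derivative of the exponential telescopes against the derivative of the partial sum
  of the exponential series, leaving only the top term.\<close>

lemma power_exp_antideriv:
 fixes a :: real
 shows "((%t. exp (- (t * a)) * (\<Sum>j\<le>k. (t * a) ^ j / fact j)) has_real_derivative
  (- a * (exp (- (t * a)) * ((t * a) ^ k / fact k)))) (at t within S)"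
proof (induction k)
 case 0
 show ?case by (auto intro!: derivative_eq_intros)
next
 case (Suc k)
 have "((%t. (t * a) ^ Suc k) has_real_derivative (real (Suc k) * (t * a) ^ k * a)) (at t within S)"
  by (auto intro!: derivative_eq_intros simp del: power_Suc)
 from DERIV_cdivide[OF this, of "fact (Suc k)"]
 have "((%t. (t * a) ^ Suc k / fact (Suc k)) has_real_derivative (a * ((t * a) ^ k / fact k))) (at t within S)"
  by (rule DERIV_cong) (simp add: fact_Suc del: of_nat_Suc power_Suc)
 moreover have "((%t. exp (- (t * a))) has_real_derivative (- a * exp (- (t * a)))) (at t within S)"
  by (auto intro!: derivative_eq_intros)
 ultimately have "((%t. exp (- (t * a)) * ((t * a) ^ Suc k / fact (Suc k))) has_real_derivative
   (- a * exp (- (t * a)) * ((t * a) ^ Suc k / fact (Suc k)) + a * ((t * a) ^ k / fact k) * exp (- (t * a)))) (at t within S)"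
  by (rule DERIV_mult[rotated])
 from DERIV_add[OF Suc this]
 show ?case by (simp add: distrib_left algebra_simps del: power_Suc fact_Suc)
qed

lemma truncated_gamma:
 fixes a T :: real
 assumes a: "0 < a" and T: "0 <= T"
 shows "(LINT t|lborel. indicator {0..T} t *\<^sub>R (t ^ k * exp (- (t * a)))) =
  fact k / a ^ Suc k * (1 - exp (- (T * a)) * (\<Sum>j\<le>k. (T * a) ^ j / fact j))"
proof -
 let ?E = "%t. - (fact k / a ^ Suc k) * (exp (- (t * a)) * (\<Sum>j\<le>k. (t * a) ^ j / fact j))"
 have "(LINT t|lborel. indicator {0..T} t *\<^sub>R (t ^ k * exp (- (t * a)))) = ?E T - ?E 0"
 proof (rule integral_FTC_atLeastAtMost[OF T])
  fix t
  have "(?E has_real_derivative (- (fact k / a ^ Suc k) * (- a * (exp (- (t * a)) * ((t * a) ^ k / fact k))))) (at t within {0..T})"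
   by (intro DERIV_cmult power_exp_antideriv)
  also have "(- (fact k / a ^ Suc k) * (- a * (exp (- (t * a)) * ((t * a) ^ k / fact k)))) = t ^ k * exp (- (t * a))"
   using a by (simp add: power_mult_distrib field_simps)
  finally show "(?E has_vector_derivative t ^ k * exp (- (t * a))) (at t within {0..T})"
   by (simp add: has_real_derivative_iff_has_vector_derivative)
 qed (intro continuous_intros)
 also have "(\<Sum>j\<le>k. (0 * a) ^ j / fact j) = 1"
  by (subst sum.remove[of _ 0]) (auto simp: zero_power intro!: sum.neutral)
 finally show ?thesis by (simp add: algebra_simps)
qed

lemma truncated_gamma_tendsto:
 fixes a :: real
 assumes a: "0 < a" and T: "filterlim T at_top sequentially" "!!m. 0 <= T m"
 shows "(%m. LINT t|lborel. indicator {0..T m} t *\<^sub>R (t ^ k * exp (- (t * a)))) \<longlonglongrightarrow> fact k / a ^ Suc k"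
proof -
 have Ta: "filterlim (%m. T m * a) at_top sequentially"
  using filterlim_tendsto_pos_mult_at_top[OF tendsto_const a T(1)] by (simp add: mult.commute)
 have "(%m. (T m * a) ^ j / exp (T m * a)) \<longlonglongrightarrow> 0" for j
  by (rule filterlim_compose[OF tendsto_power_div_exp_0 Ta])
 hence "(%m. \<Sum>j\<le>k. (T m * a) ^ j / exp (T m * a) / fact j) \<longlonglongrightarrow> (\<Sum>j\<le>k. 0 / fact j)"
  by (intro tendsto_intros) auto
 hence "(%m. exp (- (T m * a)) * (\<Sum>j\<le>k. (T m * a) ^ j / fact j)) \<longlonglongrightarrow> 0"
  by (simp add: sum_distrib_left exp_minus field_simps)
 from tendsto_mult[OF tendsto_const tendsto_diff[OF tendsto_const this], of "fact k / a ^ Suc k" 1]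
 show ?thesis by (simp only: truncated_gamma[OF a T(2)]) simp
qed

lemma truncated_gamma_bound:
 fixes a T :: real
 assumes a: "0 < a" and T: "0 <= T"
 shows "0 <= (LINT t|lborel. indicator {0..T} t *\<^sub>R (t ^ k * exp (- (t * a))))"
  "(LINT t|lborel. indicator {0..T} t *\<^sub>R (t ^ k * exp (- (t * a)))) <= fact k / a ^ Suc k"
proof -
 show "0 <= (LINT t|lborel. indicator {0..T} t *\<^sub>R (t ^ k * exp (- (t * a))))"
  by (rule integral_nonneg_AE) (auto simp: indicator_def)
 have "0 <= exp (- (T * a)) * (\<Sum>j\<le>k. (T * a) ^ j / fact j)"
  using a T by (intro mult_nonneg_nonneg sum_nonneg divide_nonneg_nonneg) auto
 hence "fact k / a ^ Suc k * (1 - exp (- (T * a)) * (\<Sum>j\<le>k. (T * a) ^ j / fact j)) <= fact k / a ^ Suc k * 1"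
  using a by (intro mult_left_mono) auto
 thus "(LINT t|lborel. indicator {0..T} t *\<^sub>R (t ^ k * exp (- (t * a)))) <= fact k / a ^ Suc k"
  by (simp only: mult_1_right truncated_gamma[OF a T])
qed

subsection \<open>The representation formula\<close>

text \<open>The integral over t > 0 of exp (- t |x - z|^2) times the polynomial of
  \<open>adj_poly\<close>, term by term: t^(n - 1 - m) integrates to (n - 1 - m)! / |x - z|^(2 (n -
  m)).\<close>

definition BAker :: "complex^'n^'n => complex^'n => complex^'n => complex^'n => complex" where
 "BAker A z x a = (\<Sum>m<CARD('n). adj_coeff A (svec z x) a m *
   of_real (fact (CARD('n) - 1 - m) / norm (x - z) ^ (2 * (CARD('n) - m))))"

lemma norm_BAker:
 fixes A :: "complex^'n^'n"
 assumes A: "!!i k. norm (A $ i $ k) <= w" and a: "!!k. norm (a $ k) <= b"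
 shows "norm (BAker A z x a) <= adj_bound TYPE('n) * fact CARD('n) * (b * (\<Sum>m<CARD('n). w ^ m * (norm (x - z) / norm (x - z) ^ (2 * (CARD('n) - m)))))"
proof -
 have nn: "0 <= b" "0 <= w"
  using a[of undefined] A[of undefined undefined] norm_ge_zero order_trans by blast+
 have "norm (BAker A z x a) <= (\<Sum>m<CARD('n). (adj_bound TYPE('n) * (norm (x - z) * b * w ^ m)) * (fact CARD('n) / norm (x - z) ^ (2 * (CARD('n) - m))))"
  unfolding BAker_def
 proof (rule sum_norm_le)
  fix m assume "m \<in> {..<CARD('n)}"
  have "norm (adj_coeff A (svec z x) a m) <= adj_bound TYPE('n) * (norm (x - z) * b * w ^ m)"
   by (rule norm_adj_coeff[OF A norm_svec_nth a])
  moreover have "norm (cor (fact (CARD('n) - 1 - m) / norm (x - z) ^ (2 * (CARD('n) - m)))) <= fact CARD('n) / norm (x - z) ^ (2 * (CARD('n) - m))"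
   by (simp add: norm_divide norm_power divide_right_mono fact_mono)
  ultimately show "norm (adj_coeff A (svec z x) a m * of_real (fact (CARD('n) - 1 - m) / norm (x - z) ^ (2 * (CARD('n) - m))))
    <= (adj_bound TYPE('n) * (norm (x - z) * b * w ^ m)) * (fact CARD('n) / norm (x - z) ^ (2 * (CARD('n) - m)))"
   unfolding norm_mult using nn adj_bound_nonneg[where 'n='n] by (intro mult_mono) auto
 qed
 also have "... = adj_bound TYPE('n) * fact CARD('n) * (b * (\<Sum>m<CARD('n). w ^ m * (norm (x - z) / norm (x - z) ^ (2 * (CARD('n) - m)))))"
  by (simp add: sum_distrib_left mult_ac)
 finally show ?thesis .
qed

text \<open>On a bounded region all summands of the kernel are controlled by the strongest
  singularity, of order 2 n - 1, which is integrable in real dimension 2 n.\<close>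

lemma radial_power_le:
 assumes "m < n" "0 <= r" "r <= (R::real)"
 shows "r / r ^ (2 * (n - m)) <= R ^ (2 * m) * (1 / r) ^ (2 * n - 1)"
proof (cases "r = 0")
 case False
 hence r: "r > 0" using assms by simp
 obtain k where k: "n = Suc (m + k)" using assms(1) less_imp_Suc_add by blast
 have "r / r ^ (2 * (n - m)) = r ^ (2 * m) * (1 / r) ^ (2 * n - 1)"
  using r by (simp add: k field_simps power_add power_mult)
 also have "... <= R ^ (2 * m) * (1 / r) ^ (2 * n - 1)"
  using assms r by (intro mult_right_mono power_mono) auto
 finally show ?thesis .
qed (use assms in auto)

text \<open>Why the parameter t is introduced by adding t times the conjugate of x - z to
  \<open>q\<close>: the exponential acquires a Gaussian centred at \<open>z\<close>, and the matrix
  of derivatives is shifted by t I.\<close>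

lemma phase_shift:
 "phase (%l x. q l x + of_real t * svec z x $ l) z x = phase q z x - of_real (t * (norm (x - z))^2)"
proof -
 have "phase (%l x. q l x + of_real t * svec z x $ l) z x = phase q z x + of_real t * (\<Sum>l\<in>UNIV. svec z x $ l * (z $ l - x $ l))"
  by (simp add: phase_def sum.distrib sum_distrib_left distrib_right mult.assoc)
 thus ?thesis by (simp add: svec_sq)
qed

lemma dbar_mat_shift:
 assumes "!!l. Ck1 (q l)"
 shows "dbar_mat (%l x. q l x + of_real t * svec z x $ l) x = shiftI (dbar_mat q x) (of_real t)"
proof -
 have "pd_zbar k (%x. q l x + of_real t * svec z x $ l) x = pd_zbar k (q l) x + of_real t * dbar (%x. svec z x $ l) x $ k" for k l
  by (subst pd_zbar_add[OF Ck_differentiable[OF assms] differentiable_mult[OF differentiable_const Ck_differentiable[OF Ck_svec]]])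
   (subst pd_zbar_mult[OF differentiable_const Ck_differentiable[OF Ck_svec]], simp add: dbar_def)
 thus ?thesis
  by (auto simp: dbar_mat_def shiftI_def vec_eq_iff dbar_svec) (simp_all add: dbar_def axis_def)
qed

lemma exp_diff_of_real: "exp (p - cor a) = exp p * of_real (exp (- a))"
 by (metis diff_conv_add_uminus exp_add exp_of_real of_real_minus)

lemma measurable_lborel_continuous: "cont f ==> f \<in> bm lborel"
 by (simp add: borel_measurable_continuous_onI)

lemma det_rowrep_zero: "det (rowrep A j 0) = 0"
 using det_rowrep_scale[of A j 0 0] by simp

lemma fubini_csupp:
 fixes f :: "'a::euclidean_space => real => complex"
 assumes c: "cont (%p. f (fst p) (snd p))" and R: "!!x t. R < norm x ==> f x t = 0"
 shows "(LINT t|lborel. indicator {a..b} t *\<^sub>R (LINT x|lborel. f x t)) = (LINT x|lborel. (LINT t|lborel. indicator {a..b} t *\<^sub>R f x t))"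
proof -
 have "integ (%p. indicator (cball 0 R \<times> {a..b}) p *\<^sub>R f (fst p) (snd p))"
  by (intro borel_integrable_compact continuous_on_subset[OF c]) (auto intro: compact_Times)
 also have "(%p. indicator (cball 0 R \<times> {a..b}) p *\<^sub>R f (fst p) (snd p)) = (%(x, t). indicator {a..b} t *\<^sub>R f x t)"
  using R by (force simp: indicator_def not_le)
 finally have "integrable (lborel \<Otimes>\<^sub>M lborel) (%(x, t). indicator {a..b} t *\<^sub>R f x t)"
  by (simp add: lborel_prod)
 from lborel_pair.Fubini_integral[OF this] show ?thesis by simp
qed

lemma integral_scale:
 fixes f :: "'a::euclidean_space => 'b::{banach,second_countable_topology}"
 assumes [measurable]: "f \<in> bm borel" and c: "c > 0"
 shows "(LINT x|lborel. f x) = c ^ DIM('a) *\<^sub>R (LINT x|lborel. f (z + c *\<^sub>R x))"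
proof -
 have "(LINT x|lborel. f x) = (LINT x|density (distr lborel borel (%x. z + c *\<^sub>R x)) (%_. ennreal (\<bar>c\<bar> ^ DIM('a))). f x)"
  using lborel_affine[of c z] c by simp
 also have "... = (LINT x|distr lborel borel (%x. z + c *\<^sub>R x). \<bar>c\<bar> ^ DIM('a) *\<^sub>R f x)"
  by (rule integral_density) auto
 also have "... = (LINT x|lborel. \<bar>c\<bar> ^ DIM('a) *\<^sub>R f (z + c *\<^sub>R x))"
  by (rule integral_distr) auto
 finally show ?thesis using c by simp
qed

lemma svec_eq: "svec z x $ j = cnj (x $ j) - cnj (z $ j)"
 by (simp add: svec_def)

context
 fixes q :: "'n::finite => complex^'n => complex" and u :: "complex^'n => complex"
 assumes q: "!!l. Ck1 (q l)" and u: "Ck1 u" and s: "csupp u"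
begin

text \<open>For fixed t the divergence identity equates the integral of the kernel part with minus
  the integral of \<open>u\<close> times the t-derivative of exponential times determinant. Fubini
  and the fundamental theorem of calculus on [0, T] finish.\<close>

lemma BA_homotopy:
 assumes T: "0 <= T"
 shows "(LINT x|lborel. (LINT t|lborel. indicator {0..T} t *\<^sub>R (exp (phase q z x - of_real (t * (norm (x - z))^2)) *
   (\<Sum>j\<in>UNIV. svec z x $ j * det (rowrep (shiftI (dbar_mat q x) (of_real t)) j (dbar u x)))))) =
  - (LINT x|lborel. u x * (exp (phase q z x - of_real (T * (norm (x - z))^2)) * det (shiftI (dbar_mat q x) (of_real T)) -
    exp (phase q z x) * det (dbar_mat q x)))"
proof -
 define N where "N x t = exp (phase q z x - of_real (t * (norm (x - z))^2)) *
   (\<Sum>j\<in>UNIV. svec z x $ j * det (rowrep (shiftI (dbar_mat q x) (of_real t)) j (dbar u x)))" for x t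
 define H where "H x t = exp (phase q z x - of_real (t * (norm (x - z))^2)) * det (shiftI (dbar_mat q x) (of_real t))" for x t
 define Hd where "Hd x t = exp (phase q z x - of_real (t * (norm (x - z))^2)) *
   ((\<Sum>j\<in>UNIV. det (rowrep (shiftI (dbar_mat q x) (of_real t)) j (axis j 1))) - of_real ((norm (x - z))^2) * det (shiftI (dbar_mat q x) (of_real t)))" for x t
 obtain R where R: "!!x. R < norm x ==> u x = 0" using csuppE[OF s] by metis
 have cp: "cont (phase q z)" by (rule Ck_continuous[OF Ck_phase[OF q]])
 have cA: "cont (%p::(complex^'n) \<times> real. shiftI (dbar_mat q (fst p)) (of_real (snd p)) $ i $ k)" for i k
 proof -
  have "cont (%p::(complex^'n) \<times> real. dbar_mat q (fst p) $ i $ k)"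
   by (rule continuous_on_comp_UNIV[OF continuous_dbar_mat[of q, OF q] continuous_on_fst[OF continuous_on_id]])
  thus ?thesis
   by (cases "i = k") (simp_all add: shiftI_def continuous_on_add continuous_on_snd continuous_on_id)
 qed
 have ce: "cont (%p. exp (phase q z (fst p) - of_real (snd p * (norm (fst p - z))^2)))"
  by (intro continuous_intros continuous_on_comp_UNIV[OF cp])
 have cdet: "cont (%p::(complex^'n) \<times> real. det (shiftI (dbar_mat q (fst p)) (of_real (snd p))))"
  by (intro continuous_on_det cA)
 have crow: "cont (%p::(complex^'n) \<times> real. det (rowrep (shiftI (dbar_mat q (fst p)) (of_real (snd p))) j (a (fst p))))"
  if "!!k. cont (%x. a x $ k)" for j and a :: "complex^'n => complex^'n"
 proof (rule continuous_on_det)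
  fix i k
  show "cont (%p::(complex^'n) \<times> real. rowrep (shiftI (dbar_mat q (fst p)) (of_real (snd p))) j (a (fst p)) $ i $ k)"
   using cA[of i k] continuous_on_comp_UNIV[OF that[of k] continuous_on_fst[OF continuous_on_id]]
   by (cases "i = j") (simp_all add: rowrep_def)
 qed
 have csv: "cont (%p::(complex^'n) \<times> real. svec z (fst p) $ j)" for j
  unfolding svec_eq by (intro continuous_intros)
 have cN: "cont (%p. N (fst p) (snd p))"
  unfolding N_def by (intro continuous_intros ce csv crow continuous_dbar_nth[OF u])
 have cHd: "cont (%p. Hd (fst p) (snd p))"
  unfolding Hd_def by (intro continuous_intros ce cdet crow)
 have cu: "cont (%p::(complex^'n) \<times> real. u (fst p))"
  by (intro continuous_on_comp_UNIV[OF Ck_continuous[OF u]] continuous_intros)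
 have sec: "cont (%x. f x t)" if "cont (%p. f (fst p) (snd p))" for f :: "complex^'n => real => complex" and t
  using continuous_on_comp_UNIV[OF that, of UNIV "%x. (x, t)"] by (simp add: continuous_on_Pair)
 have sec2: "continuous_on S (%t. f x t)" if "cont (%p. f (fst p) (snd p))" for f :: "complex^'n => real => complex" and x S
  using continuous_on_comp_UNIV[OF that, of S "%t. (x, t)"] by (simp add: continuous_on_Pair)
 have N0: "N x t = 0" if "R < norm x" for x t
  using dbar_eq_0_outside[where u=u, OF R that] by (simp add: N_def det_rowrep_zero)
 have step: "(LINT x|lborel. N x t) = - (LINT x|lborel. u x * Hd x t)" for t
 proof -
  have w: "Ck1 (%x. q l x + of_real t * svec z x $ l)" for l
   by (intro Ck_add q Ck_mult Ck_const Ck_svec)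
  have "(LINT x|lborel. N x t + u x * Hd x t) = 0"
   using divergence_identity[where z=z and w="%l x. q l x + of_real t * svec z x $ l", OF w u s] by (simp only: phase_shift dbar_mat_shift[OF q] N_def Hd_def)
  moreover have "integ (%x. N x t)"
   by (intro csupp_integrable sec[OF cN] csuppI[OF N0])
  moreover have "integ (%x. u x * Hd x t)"
   by (intro csupp_integrable continuous_intros Ck_continuous[OF u] sec[OF cHd] csupp_mono[OF s]) simp
  ultimately show ?thesis by (simp add: eq_neg_iff_add_eq_0)
 qed
 have ftc: "(LINT t|lborel. indicator {0..T} t *\<^sub>R (u x * Hd x t)) = u x * (H x T - H x 0)" for x
 proof -
  have "(LINT t|lborel. indicator {0..T} t *\<^sub>R (u x * Hd x t)) = u x * H x T - u x * H x 0"
  proof (rule integral_FTC_atLeastAtMost[OF T])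
   fix t
   \<comment> \<open>Differentiating the exponential and, by Jacobi's formula, the determinant gives
     exactly the bracket multiplying \<open>u\<close> in the divergence identity.\<close>
   have "((%\<tau>. exp (phase q z x - \<tau> * of_real ((norm (x - z))^2)) * det (shiftI (dbar_mat q x) \<tau>)) has_field_derivative
     exp (phase q z x - of_real t * of_real ((norm (x - z))^2)) *
     ((\<Sum>j\<in>UNIV. det (rowrep (shiftI (dbar_mat q x) (of_real t)) j (axis j 1))) - of_real ((norm (x - z))^2) * det (shiftI (dbar_mat q x) (of_real t)))) (at (of_real t))"
    by (rule derivative_eq_intros det_shiftI_deriv refl)+ (simp add: algebra_simps)
   from has_vector_derivative_real_field[OF this]
   have "(H x has_vector_derivative Hd x t) (at t within {0..T})"
    unfolding H_def[abs_def] Hd_def by simp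
   thus "((%t. u x * H x t) has_vector_derivative u x * Hd x t) (at t within {0..T})"
    by (rule has_vector_derivative_mult_right)
  qed (intro continuous_intros sec2[OF cHd])
  thus ?thesis by (simp add: right_diff_distrib)
 qed
 have "(LINT x|lborel. (LINT t|lborel. indicator {0..T} t *\<^sub>R N x t)) = (LINT t|lborel. indicator {0..T} t *\<^sub>R (LINT x|lborel. N x t))"
  by (rule fubini_csupp[symmetric, OF cN N0])
 also have "... = - (LINT t|lborel. indicator {0..T} t *\<^sub>R (LINT x|lborel. u x * Hd x t))"
  by (simp add: step)
 also have "(LINT t|lborel. indicator {0..T} t *\<^sub>R (LINT x|lborel. u x * Hd x t)) = (LINT x|lborel. (LINT t|lborel. indicator {0..T} t *\<^sub>R (u x * Hd x t)))"
  by (rule fubini_csupp[where R=R]) (intro continuous_intros cu cHd, simp add: R)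
 also have "... = (LINT x|lborel. u x * (H x T - H x 0))" by (simp only: ftc)
 finally have "(LINT x|lborel. (LINT t|lborel. indicator {0..T} t *\<^sub>R N x t)) = - (LINT x|lborel. u x * (H x T - H x 0))" .
 moreover have "shiftI (dbar_mat q x) 0 = dbar_mat q x" for x by (simp add: shiftI_def)
 ultimately show ?thesis by (simp add: N_def H_def)
qed

lemma local_bounds:
 obtains R B w b where "R > 0" "!!x. R < norm x ==> u x = 0" "B \<ge> 0" "w \<ge> 0" "b \<ge> 0"
  "!!x. norm x <= R ==> norm (exp (phase q z x)) <= B" "!!x i k. norm x <= R ==> norm (dbar_mat q x $ i $ k) <= w"
  "!!x k. norm (dbar u x $ k) <= b" "!!x. norm (u x) <= b"
proof -
 obtain R where R: "R > 0" "!!x. R < norm x ==> u x = 0" by (rule csuppE[OF s], rule that)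
 have bd: "\<exists>B\<ge>0. \<forall>x. norm x <= R \<longrightarrow> norm (f x) <= B" if "cont f" for f :: "complex^'n => complex"
 proof -
  have "bounded (f ` cball 0 R)"
   by (intro compact_imp_bounded compact_continuous_image continuous_on_subset[OF that]) auto
  thus ?thesis by (auto simp: bounded_pos intro: less_imp_le)
 qed
 have "cont (%x. exp (phase q z x))" by (rule Ck_continuous[OF Ck1_exp[OF Ck_phase[OF q]]])
 then obtain B where B: "B \<ge> 0" "!!x. norm x <= R ==> norm (exp (phase q z x)) <= B" using bd by metis
 have "\<forall>i k. \<exists>w\<ge>0. \<forall>x. norm x <= R \<longrightarrow> norm (dbar_mat q x $ i $ k) <= w"
  by (intro allI bd continuous_dbar_mat q)
 then obtain wf where wf: "!!i k. 0 <= wf i k" "!!i k x. norm x <= R ==> norm (dbar_mat q x $ i $ k) <= wf i k"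
  unfolding choice_iff by blast
 have w: "norm (dbar_mat q x $ i $ k) <= (\<Sum>i\<in>UNIV. \<Sum>k\<in>UNIV. wf i k)" if "norm x <= R" for x i k
 proof -
  have "wf i k <= (\<Sum>k\<in>UNIV. wf i k)" by (intro member_le_sum wf) auto
  also have "... <= (\<Sum>i\<in>UNIV. \<Sum>k\<in>UNIV. wf i k)" by (rule member_le_sum) (auto intro: wf sum_nonneg)
  finally show ?thesis using wf(2)[OF that, of i k] by linarith
 qed
 have "\<forall>k. \<exists>b\<ge>0. \<forall>x. norm x <= R \<longrightarrow> norm (dbar u x $ k) <= b"
  by (intro allI bd continuous_dbar_nth u)
 then obtain bf where bf: "!!k. 0 <= bf k" "!!k x. norm x <= R ==> norm (dbar u x $ k) <= bf k"
  unfolding choice_iff by blast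
 obtain b1 where b1: "b1 \<ge> 0" "!!x. norm x <= R ==> norm (u x) <= b1" using bd[OF Ck_continuous[OF u]] by metis
 let ?b = "(\<Sum>k\<in>UNIV. bf k) + b1"
 have s0: "0 <= (\<Sum>k\<in>UNIV. bf k)" by (intro sum_nonneg bf)
 have b: "norm (dbar u x $ k) <= ?b" for x k
 proof (cases "norm x <= R")
  case True
  have "bf k <= (\<Sum>k\<in>UNIV. bf k)" by (intro member_le_sum bf) auto
  thus ?thesis using bf(2)[OF True, of k] b1(1) by linarith
 next
  case False
  thus ?thesis using dbar_eq_0_outside[where u=u and x=x, OF R(2)] s0 b1(1) by simp
 qed
 have b': "norm (u x) <= ?b" for x
  using b1(2)[of x] R(2)[of x] s0 b1(1) by (cases "norm x <= R") auto
 show thesis by (rule that[OF R B(1) _ _ B(2) w b b']) (auto intro: sum_nonneg wf s0 b1(1) add_nonneg_nonneg)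
qed

text \<open>Substituting x = z + v / k with k^2 = T turns the Gaussian into exp (- |v|^2); the
  Jacobian k^(-2n) cancels the factor T^n taken out of the determinant, what remains of which tends
  to 1. The parameter runs through squares so that the scale is 1 / k.\<close>

lemma BA_boundary_limit:
 "(%m. LINT x|lborel. u x * (exp (phase q z x - of_real ((real (Suc m))^2 * (norm (x - z))^2)) * det (shiftI (dbar_mat q x) (of_real ((real (Suc m))^2)))))
  \<longlonglongrightarrow> of_real (gauss_const TYPE('n)) * u z"
proof -
 obtain R B w b where R: "R > 0" "!!x. R < norm x ==> u x = 0" and nn: "B \<ge> 0" "w \<ge> 0" "b \<ge> 0"
  and B: "!!x. norm x <= R ==> norm (exp (phase q z x)) <= B" and w: "!!x i k. norm x <= R ==> norm (dbar_mat q x $ i $ k) <= w"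
  and b: "!!x. norm (u x) <= b"
  by (rule local_bounds, rule that)
 define E where "E t x = u x * (exp (phase q z x) * det (shiftI (\<chi> i k. dbar_mat q x $ i $ k / of_real t) 1))" for t x
 define c where "c m = 1 / real (Suc m)" for m
 have c: "0 < c m" "c m <= 1" for m by (auto simp: c_def)
 have c0: "c \<longlonglongrightarrow> 0" unfolding c_def[abs_def] by (intro LIMSEQ_Suc lim_1_over_n)
 have cE: "cont (E t)" if "t ~= 0" for t
 proof -
  have "cont (%x. shiftI (\<chi> i k. dbar_mat q x $ i $ k / of_real t) 1 $ i $ k)" for i k
   using continuous_dbar_mat[of q i k, OF q] that
   by (cases "i = k") (simp_all add: shiftI_def continuous_on_add continuous_on_divide continuous_on_const)
  hence "cont (%x. det (shiftI (\<chi> i k. dbar_mat q x $ i $ k / of_real t) 1))"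
   by (rule continuous_on_det)
  thus ?thesis unfolding E_def[abs_def]
   by (intro continuous_on_mult continuous_on_exp Ck_continuous[OF u] Ck_continuous[OF Ck_phase[OF q]])
 qed
 have bE: "norm (E t x) <= b * (B * (fact CARD('n) * (w + 1) ^ CARD('n)))" if "t \<ge> 1" for t x
 proof (cases "norm x <= R")
  case True
  have "norm (shiftI (\<chi> i k. dbar_mat q x $ i $ k / of_real t) 1 $ i $ k) <= w + 1" for i k
  proof -
   have "norm (dbar_mat q x $ i $ k / of_real t) <= w / 1"
    unfolding norm_divide using w[OF True, of i k] that nn by (intro frac_le) auto
   thus ?thesis
    using norm_triangle_ineq[of "dbar_mat q x $ i $ k / of_real t" "if i = k then 1 else 0"] by (auto simp: shiftI_def split: if_splits)
  qed
  from norm_det_bound[OF this] show ?thesis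
   unfolding E_def norm_mult using nn by (intro mult_mono b B[OF True]) auto
 next
  case False
  thus ?thesis using R(2)[of x] nn by (simp add: E_def)
 qed
 have eq: "(LINT x|lborel. u x * (exp (phase q z x - of_real ((real (Suc m))^2 * (norm (x - z))^2)) * det (shiftI (dbar_mat q x) (of_real ((real (Suc m))^2)))))
   = (LINT v|lborel. E ((real (Suc m))^2) (z + c m *\<^sub>R v) * of_real (exp (- (norm v)\<^sup>2)))" for m
 proof -
  let ?t = "(real (Suc m))^2"
  have t0: "cor ?t ~= 0" by (simp del: of_nat_Suc)
  let ?f = "%x. u x * (exp (phase q z x - of_real (?t * (norm (x - z))^2)) * det (shiftI (dbar_mat q x) (of_real ?t)))"
  have f: "?f x = of_real (?t ^ CARD('n)) * (E ?t x * of_real (exp (- (?t * (norm (x - z))^2))))" for x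
   by (subst det_shiftI_scale[OF t0]) (simp only: E_def exp_diff_of_real of_real_power mult_ac)
  have fm: "?f \<in> bm borel" unfolding f
   by (intro borel_measurable_continuous_onI continuous_intros cE) (simp del: of_nat_Suc)
  have "(LINT x|lborel. ?f x) = c m ^ DIM(complex^'n) *\<^sub>R (LINT v|lborel. ?f (z + c m *\<^sub>R v))"
   by (rule integral_scale[OF fm c(1)])
  also have "(%v. ?f (z + c m *\<^sub>R v)) = (%v. of_real (?t ^ CARD('n)) * (E ?t (z + c m *\<^sub>R v) * of_real (exp (- (norm v)\<^sup>2))))"
  proof
   fix v :: "complex^'n"
   have "?t * (norm (z + c m *\<^sub>R v - z))^2 = (norm v)^2"
    by (simp add: c_def power_mult_distrib power_divide del: of_nat_Suc)
   thus "?f (z + c m *\<^sub>R v) = of_real (?t ^ CARD('n)) * (E ?t (z + c m *\<^sub>R v) * of_real (exp (- (norm v)\<^sup>2)))"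
    unfolding f by (simp only:)
  qed
  also have "c m ^ DIM(complex^'n) *\<^sub>R (LINT v|lborel. of_real (?t ^ CARD('n)) * (E ?t (z + c m *\<^sub>R v) * of_real (exp (- (norm v)\<^sup>2)))) =
    (LINT v|lborel. E ?t (z + c m *\<^sub>R v) * of_real (exp (- (norm v)\<^sup>2)))"
  proof -
   have "c m ^ DIM(complex^'n) * ?t ^ CARD('n) = 1"
    by (simp add: c_def power_divide power_mult[symmetric] mult.commute del: of_nat_Suc)
   hence "c m ^ DIM(complex^'n) *\<^sub>R (of_real (?t ^ CARD('n)) * J) = J" for J :: complex
    by (simp only: scaleR_conv_of_real mult.assoc[symmetric] of_real_mult[symmetric] of_real_1 mult_1_left)
   thus ?thesis unfolding integral_mult_right_zero .
  qed
  finally show ?thesis .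
 qed
 have "(%m. LINT v|lborel. E ((real (Suc m))^2) (z + c m *\<^sub>R v) * of_real (exp (- (norm v)\<^sup>2))) \<longlonglongrightarrow> (LINT v|lborel. u z * of_real (exp (- (norm (v::complex^'n))\<^sup>2)))"
 proof (rule integral_dominated_convergence[where w="%v. (b * (B * (fact CARD('n) * (w + 1) ^ CARD('n)))) * exp (- (norm v)\<^sup>2)"])
  show "(%v::complex^'n. u z * of_real (exp (- (norm v)\<^sup>2))) \<in> bm lborel"
   by (intro measurable_lborel_continuous continuous_intros)
  show "(%v. E ((real (Suc m))^2) (z + c m *\<^sub>R v) * of_real (exp (- (norm v)\<^sup>2))) \<in> bm lborel" for m
   by (intro measurable_lborel_continuous continuous_intros continuous_on_comp_UNIV[OF cE]) (simp del: of_nat_Suc)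
  show "integ (%v::complex^'n. (b * (B * (fact CARD('n) * (w + 1) ^ CARD('n)))) * exp (- (norm v)\<^sup>2))"
   by (intro integrable_mult_right integrable_gauss)
  show "AE v in lborel. norm (E ((real (Suc m))^2) (z + c m *\<^sub>R v) * of_real (exp (- (norm v)\<^sup>2))) <= (b * (B * (fact CARD('n) * (w + 1) ^ CARD('n)))) * exp (- (norm v)\<^sup>2)" for m
   unfolding norm_mult by (intro AE_I2 mult_mono bE) (auto simp: nn)
  have "(%m. E ((real (Suc m))^2) (z + c m *\<^sub>R v)) \<longlonglongrightarrow> u z" for v
  proof -
   define x where "x m = z + c m *\<^sub>R v" for m
   have "(%m. z + c m *\<^sub>R v) \<longlonglongrightarrow> z + 0 *\<^sub>R v" by (intro tendsto_intros c0)
   hence x: "x \<longlonglongrightarrow> z" by (simp add: x_def[abs_def])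
   have ct: "(%m. f (x m)) \<longlonglongrightarrow> f z" if "cont f" for f :: "complex^'n => complex"
    using continuous_on_tendsto_compose[OF that x] by simp
   have sh: "shiftI (\<chi> i k. dbar_mat q (x m) $ i $ k / of_real ((real (Suc m))^2)) 1 $ i $ k =
     dbar_mat q (x m) $ i $ k * of_real ((c m)^2) + (if i = k then 1 else 0)" for m i k
    by (simp add: shiftI_def c_def power_divide del: of_nat_Suc)
   have "(%m. dbar_mat q (x m) $ i $ k * of_real ((c m)^2) + (if i = k then 1 else 0)) \<longlonglongrightarrow>
     dbar_mat q z $ i $ k * of_real (0^2) + (if i = k then 1 else 0)" for i k
    by (intro tendsto_intros c0 ct[OF continuous_dbar_mat[OF q]])
   hence "(%m. det (shiftI (\<chi> i k. dbar_mat q (x m) $ i $ k / of_real ((real (Suc m))^2)) 1)) \<longlonglongrightarrow> det (\<chi> i k. if i = k then 1 else 0 :: complex^'n^'n)"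
    unfolding det_def sh by (intro tendsto_intros) simp
   also have "det (\<chi> i k. if i = k then 1 else 0 :: complex^'n^'n) = 1"
    using det_I by (simp add: mat_def)
   finally have d: "(%m. det (shiftI (\<chi> i k. dbar_mat q (x m) $ i $ k / of_real ((real (Suc m))^2)) 1)) \<longlonglongrightarrow> 1" .
   have "(%m. E ((real (Suc m))^2) (x m)) \<longlonglongrightarrow> u z * (exp (phase q z z) * 1)"
    unfolding E_def by (intro tendsto_intros d ct Ck_continuous[OF u] Ck_continuous[OF Ck_phase[OF q]])
   thus ?thesis by (simp add: x_def phase_def)
  qed
  thus "AE v in lborel. (%m. E ((real (Suc m))^2) (z + c m *\<^sub>R v) * of_real (exp (- (norm v)\<^sup>2))) \<longlonglongrightarrow> u z * of_real (exp (- (norm v)\<^sup>2))"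
   by (intro AE_I2 tendsto_intros)
 qed
 thus ?thesis
  unfolding eq gauss_const_def by (simp add: mult.commute del: of_nat_Suc)
qed

text \<open>The homotopy formula as T tends to infinity: the truncated kernels converge off the
  diagonal, and the end point of the homotopy becomes a multiple of \<open>u z\<close>.\<close>

theorem BA_representation:
 shows "integ (%x. exp (phase q z x) * BAker (dbar_mat q x) z x (dbar u x))"
  and "(LINT x|lborel. exp (phase q z x) * BAker (dbar_mat q x) z x (dbar u x)) =
   (LINT x|lborel. u x * (exp (phase q z x) * det (dbar_mat q x))) - of_real (gauss_const TYPE('n)) * u z"
proof -
 let ?n = "CARD('n)"
 let ?c = "%m x. adj_coeff (dbar_mat q x) (svec z x) (dbar u x) m"
 obtain R B w b where R: "R > 0" "!!x. R < norm x ==> u x = 0" and nn: "B \<ge> 0" "w \<ge> 0" "b \<ge> 0"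
  and B: "!!x. norm x <= R ==> norm (exp (phase q z x)) <= B" and w: "!!x i k. norm x <= R ==> norm (dbar_mat q x $ i $ k) <= w"
  and b: "!!x k. norm (dbar u x $ k) <= b"
  by (rule local_bounds, rule that)
 define T where "T m = (real (Suc m))^2" for m
 have T: "0 <= T m" for m by (simp add: T_def)
 have Tinf: "filterlim T at_top sequentially"
  unfolding T_def[abs_def] by (intro filterlim_pow_at_top filterlim_compose[OF filterlim_real_sequentially] filterlim_Suc) simp
 define G where "G m x = (LINT t|lborel. indicator {0..T m} t *\<^sub>R (exp (phase q z x - of_real (t * (norm (x - z))^2)) *
   (\<Sum>j\<in>UNIV. svec z x $ j * det (rowrep (shiftI (dbar_mat q x) (of_real t)) j (dbar u x)))))" for m x
 define I where "I k m a = (LINT t|lborel. indicator {0..T m} t *\<^sub>R (t ^ k * exp (- (t * a))))" for k m and a :: real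
 have G: "G m x = exp (phase q z x) * (\<Sum>l<?n. ?c l x * of_real (I (?n - 1 - l) m ((norm (x - z))^2)))" for m x
 proof -
  have int: "integ (%t. indicator {0..T m} t *\<^sub>R (t ^ k * exp (- (t * a))))" for k and a :: real
   by (rule borel_integrable_compact) (auto intro!: continuous_intros)
  have "G m x = (LINT t|lborel. (\<Sum>l<?n. (exp (phase q z x) * ?c l x) * of_real (indicator {0..T m} t *\<^sub>R (t ^ (?n - 1 - l) * exp (- (t * (norm (x - z))^2))))))"
   unfolding G_def
  proof (rule Bochner_Integration.integral_cong[OF refl])
   fix t :: real
   have "exp (phase q z x - of_real (t * (norm (x - z))^2)) = exp (phase q z x) * of_real (exp (- (t * (norm (x - z))^2)))"
    by (rule exp_diff_of_real)
   thus "indicator {0..T m} t *\<^sub>R (exp (phase q z x - of_real (t * (norm (x - z))^2)) *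
     (\<Sum>j\<in>UNIV. svec z x $ j * det (rowrep (shiftI (dbar_mat q x) (of_real t)) j (dbar u x)))) =
    (\<Sum>l<?n. (exp (phase q z x) * ?c l x) * of_real (indicator {0..T m} t *\<^sub>R (t ^ (?n - 1 - l) * exp (- (t * (norm (x - z))^2)))))"
    unfolding adj_poly by (simp add: sum_distrib_left scaleR_conv_of_real mult_ac)
  qed
  also have "... = (\<Sum>l<?n. (exp (phase q z x) * ?c l x) * of_real (I (?n - 1 - l) m ((norm (x - z))^2)))"
   unfolding I_def using int by (subst Bochner_Integration.integral_sum) (auto simp del: of_real_mult)
  finally show ?thesis by (simp add: sum_distrib_left mult.assoc)
 qed
 have Gint: "(LINT x|lborel. G m x) = - (LINT x|lborel. u x * (exp (phase q z x - of_real (T m * (norm (x - z))^2)) * det (shiftI (dbar_mat q x) (of_real (T m))) -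
    exp (phase q z x) * det (dbar_mat q x)))" for m
  unfolding G_def by (rule BA_homotopy[OF T])
 let ?K = "%x. exp (phase q z x) * BAker (dbar_mat q x) z x (dbar u x)"
 have pw: "2 * (?n - l) = 2 * Suc (?n - 1 - l)" if "l < ?n" for l using that by simp
 have lim: "(%m. G m x) \<longlonglongrightarrow> ?K x" if "x ~= z" for x
 proof -
  have a: "0 < (norm (x - z))^2" using that by simp
  have "(%m. I k m ((norm (x - z))^2)) \<longlonglongrightarrow> fact k / ((norm (x - z))^2) ^ Suc k" for k
   unfolding I_def by (rule truncated_gamma_tendsto[OF a Tinf T])
  hence "(%m. G m x) \<longlonglongrightarrow> exp (phase q z x) * (\<Sum>l<?n. ?c l x * of_real (fact (?n - 1 - l) / ((norm (x - z))^2) ^ Suc (?n - 1 - l)))"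
   unfolding G by (intro tendsto_intros)
  also have "(\<Sum>l<?n. ?c l x * of_real (fact (?n - 1 - l) / ((norm (x - z))^2) ^ Suc (?n - 1 - l))) = BAker (dbar_mat q x) z x (dbar u x)"
   unfolding BAker_def by (intro sum.cong refl) (simp only: lessThan_iff pw power_mult)
  finally show ?thesis .
 qed
 define R1 where "R1 = R + norm z + 1"
 define C where "C = B * (adj_bound TYPE('n) * fact ?n * (b * (\<Sum>l<?n. w ^ l * R1 ^ (2 * l))))"
 define dom where "dom x = C * (indicator (ball z R1) x * (1 / dist x z) ^ (DIM(complex^'n) - 1))" for x
 have dom_int: "integ dom"
  unfolding dom_def using R by (intro integrable_mult_right integrable_near DIM_cvec_ge) (simp add: R1_def add_pos_nonneg)
 have C0: "0 <= C" using nn adj_bound_nonneg[where 'n='n] by (auto simp: C_def R1_def intro!: mult_nonneg_nonneg sum_nonneg)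
 have bnd: "norm (exp (phase q z x)) * (adj_bound TYPE('n) * fact ?n * (b * (\<Sum>l<?n. w ^ l * (norm (x - z) / norm (x - z) ^ (2 * (?n - l)))))) <= dom x"
  if x: "norm x <= R" for x
 proof -
  have r: "norm (x - z) < R1" using x norm_triangle_ineq4[of x z] by (simp add: R1_def)
  have "(\<Sum>l<?n. w ^ l * (norm (x - z) / norm (x - z) ^ (2 * (?n - l)))) <= (\<Sum>l<?n. w ^ l * (R1 ^ (2 * l) * (1 / norm (x - z)) ^ (2 * ?n - 1)))"
   using r nn by (intro sum_mono mult_left_mono radial_power_le) auto
  also have "... = (\<Sum>l<?n. w ^ l * R1 ^ (2 * l)) * (1 / norm (x - z)) ^ (2 * ?n - 1)"
   by (simp add: sum_distrib_right mult.assoc)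
  finally have "norm (exp (phase q z x)) * (adj_bound TYPE('n) * fact ?n * (b * (\<Sum>l<?n. w ^ l * (norm (x - z) / norm (x - z) ^ (2 * (?n - l)))))) <=
   B * (adj_bound TYPE('n) * fact ?n * (b * ((\<Sum>l<?n. w ^ l * R1 ^ (2 * l)) * (1 / norm (x - z)) ^ (2 * ?n - 1))))"
   using nn adj_bound_nonneg[where 'n='n] by (intro mult_mono B x mult_left_mono) (auto intro!: mult_nonneg_nonneg sum_nonneg)
  also have "... = dom x" using r by (simp add: dom_def C_def dist_norm norm_minus_commute mult_ac)
  finally show ?thesis .
 qed
 have dom0: "0 <= dom x" for x using C0 by (simp add: dom_def)
 \<comment> \<open>The bound does not depend on \<open>m\<close>, since a truncated Gamma integral
   lies between 0 and the complete one.\<close>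
 have Gb: "norm (G m x) <= dom x" if "x ~= z" for m x
 proof (cases "norm x <= R")
  case True
  have a: "0 < (norm (x - z))^2" using that by simp
  have "norm (\<Sum>l<?n. ?c l x * of_real (I (?n - 1 - l) m ((norm (x - z))^2))) <=
    (\<Sum>l<?n. (adj_bound TYPE('n) * (norm (x - z) * b * w ^ l)) * (fact ?n / norm (x - z) ^ (2 * (?n - l))))"
  proof (rule sum_norm_le)
   fix l assume l: "l \<in> {..<?n}"
   have "\<bar>I (?n - 1 - l) m ((norm (x - z))^2)\<bar> <= fact (?n - 1 - l) / ((norm (x - z))^2) ^ Suc (?n - 1 - l)"
    using truncated_gamma_bound[OF a T, of m "?n - 1 - l"] unfolding I_def by simp
   also have "... = fact (?n - 1 - l) / norm (x - z) ^ (2 * (?n - l))"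
    using l pw[of l] by (simp only: lessThan_iff power_mult)
   also have "... <= fact ?n / norm (x - z) ^ (2 * (?n - l))"
    by (intro divide_right_mono fact_mono) auto
   finally have "\<bar>I (?n - 1 - l) m ((norm (x - z))^2)\<bar> <= fact ?n / norm (x - z) ^ (2 * (?n - l))" .
   moreover have "norm (?c l x) <= adj_bound TYPE('n) * (norm (x - z) * b * w ^ l)"
    by (rule norm_adj_coeff[OF w[OF True] norm_svec_nth b])
   ultimately show "norm (?c l x * of_real (I (?n - 1 - l) m ((norm (x - z))^2))) <= (adj_bound TYPE('n) * (norm (x - z) * b * w ^ l)) * (fact ?n / norm (x - z) ^ (2 * (?n - l)))"
    unfolding norm_mult using nn adj_bound_nonneg[where 'n='n] by (intro mult_mono) auto
  qed
  also have "... = adj_bound TYPE('n) * fact ?n * (b * (\<Sum>l<?n. w ^ l * (norm (x - z) / norm (x - z) ^ (2 * (?n - l)))))"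
   by (simp add: sum_distrib_left mult_ac)
  finally have "norm (G m x) <= norm (exp (phase q z x)) * (adj_bound TYPE('n) * fact ?n * (b * (\<Sum>l<?n. w ^ l * (norm (x - z) / norm (x - z) ^ (2 * (?n - l))))))"
   unfolding G norm_mult[of "exp _"] by (intro mult_left_mono) auto
  thus ?thesis using bnd[OF True] by linarith
 next
  case False
  have "dbar u x = 0" using dbar_eq_0_outside[where u=u and x=x, OF R(2)] False by simp
  hence "G m x = 0" by (simp add: G adj_coeff_def)
  thus ?thesis using dom0 by simp
 qed
 have ae: "AE x in lborel. x ~= z" by (rule AE_lborel_singleton)
 have meas_c: "cont (%x. ?c l x)" for l
  unfolding adj_coeff_def svec_eq
  by (intro continuous_intros continuous_dbar_mat[OF q] continuous_dbar_nth[OF u])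
 have cp: "cont (phase q z)" by (rule Ck_continuous[OF Ck_phase[OF q]])
 have [measurable]: "(%x. ?c l x) \<in> bm borel" "(%x. exp (phase q z x)) \<in> bm borel" for l
  by (intro borel_measurable_continuous_onI meas_c continuous_intros cp)+
 have Km: "?K \<in> bm lborel"
  unfolding BAker_def by measurable
 have Im: "(%x. I k m ((norm (x - z))^2)) \<in> bm borel" for k m
 by (simp add: I_def[abs_def])
 have Gm: "G m \<in> bm lborel" for m
  unfolding G[abs_def] using Im by measurable
 show int: "integ ?K"
 proof (rule Bochner_Integration.integrable_bound[OF dom_int Km])
  show "AE x in lborel. norm (?K x) <= norm (dom x)"
  proof (rule AE_mp[OF ae], intro AE_I2 impI)
   fix x assume "x ~= z"
   from LIMSEQ_le_const2[OF tendsto_norm[OF lim[OF this]], of "dom x"] Gb[OF this]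
   have "norm (?K x) <= dom x" by blast
   thus "norm (?K x) <= norm (dom x)" by simp
  qed
 qed
 have l1: "(%m. LINT x|lborel. G m x) \<longlonglongrightarrow> (LINT x|lborel. ?K x)"
  by (rule integral_dominated_convergence[OF Km Gm dom_int])
   (use ae lim Gb in \<open>auto elim!: eventually_mono\<close>)
 let ?U = "%m x. u x * (exp (phase q z x - of_real (T m * (norm (x - z))^2)) * det (shiftI (dbar_mat q x) (of_real (T m))))"
 let ?P = "%x. u x * (exp (phase q z x) * det (dbar_mat q x))"
 have cD: "cont (%x. det (dbar_mat q x))" by (intro continuous_on_det continuous_dbar_mat[OF q])
 have cDs: "cont (%x. det (shiftI (dbar_mat q x) t))" for t
 proof (rule continuous_on_det)
  show "cont (%x. shiftI (dbar_mat q x) t $ i $ k)" for i k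
   using continuous_dbar_mat[of q i k, OF q] by (cases "i = k") (simp_all add: shiftI_def continuous_on_add)
 qed
 have iU: "integ (?U m)" for m
  by (intro csupp_integrable csupp_mono[OF s] continuous_intros Ck_continuous[OF u] cp cDs) simp
 have iP: "integ ?P"
  by (intro csupp_integrable csupp_mono[OF s] continuous_intros Ck_continuous[OF u] cp cD) simp
 have "(LINT x|lborel. G m x) = (LINT x|lborel. ?P x) - (LINT x|lborel. ?U m x)" for m
  unfolding Gint using iU iP by (simp add: right_diff_distrib)
 moreover have "(%m. (LINT x|lborel. ?P x) - (LINT x|lborel. ?U m x)) \<longlonglongrightarrow> (LINT x|lborel. ?P x) - of_real (gauss_const TYPE('n)) * u z"
  unfolding T_def by (intro tendsto_intros BA_boundary_limit)
 ultimately show "(LINT x|lborel. ?K x) = (LINT x|lborel. ?P x) - of_real (gauss_const TYPE('n)) * u z"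
  using l1 LIMSEQ_unique by simp
qed

end

section \<open>Identification of the operator given by differential forms with the determinant
  kernel\<close>

subsection \<open>Exterior algebra\<close>

text \<open>The wedge product of the covectors \<open>l 0\<close>, ..., \<open>l (m - 1)\<close>,
  written as the determinant of the numbers \<open>l i (v k)\<close>.\<close>

definition Alt :: "nat => (nat => complex^'n => complex) => 'n::finite cform" where
 "Alt m l v = (\<Sum>\<sigma> | \<sigma> permutes {..<m}. of_int (sign \<sigma>) * (\<Prod>i<m. l i (v (\<sigma> i))))"

lemma Alt_cong: "(!!i. i < m ==> l i = l' i) ==> Alt m l v = Alt m l' v"
 unfolding Alt_def by (intro sum.cong refl arg_cong2[of _ _ _ _ "(*)"] prod.cong) auto

text \<open>Acts as \<pi> on the first \<open>k\<close> indices and as \<tau>, shifted by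
  \<open>k\<close>, on the following \<open>l\<close>.\<close>

definition block_perm :: "nat => nat => (nat => nat) => (nat => nat) => nat => nat" where
 "block_perm k l \<pi> \<tau> = \<pi> \<circ> map_permutation {..<l} ((+) k) \<tau>"

lemma block_perm:
 assumes p: "\<pi> permutes {..<k}" and t: "\<tau> permutes {..<l}"
 shows "block_perm k l \<pi> \<tau> permutes {..<k + l}" "sign (block_perm k l \<pi> \<tau>) = sign \<pi> * sign \<tau>"
  "i < k ==> block_perm k l \<pi> \<tau> i = \<pi> i" "i < l ==> block_perm k l \<pi> \<tau> (k + i) = k + \<tau> i"
proof -
 let ?t = "map_permutation {..<l} ((+) k) \<tau>"
 have im: "(+) k ` {..<l} = {k..<k + l}"
  by (simp add: lessThan_atLeast0 add.commute)
 have inj: "inj_on ((+) k) {..<l}" by simp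
 have tp: "?t permutes {k..<k + l}"
  by (rule map_permutation_permutes[OF _ t]) (simp add: bij_betw_def inj im)
 have t1: "?t permutes {..<k + l}" by (rule permutes_subset[OF tp]) auto
 have p1: "\<pi> permutes {..<k + l}" by (rule permutes_subset[OF p]) auto
 show "block_perm k l \<pi> \<tau> permutes {..<k + l}"
  unfolding block_perm_def by (rule permutes_compose[OF t1 p1])
 have "permutation \<pi>" "permutation ?t" using p1 t1 by (auto simp: permutation_permutes)
 thus "sign (block_perm k l \<pi> \<tau>) = sign \<pi> * sign \<tau>"
  unfolding block_perm_def using sign_map_permutation[OF inj t] by (simp add: sign_compose)
 show "block_perm k l \<pi> \<tau> i = \<pi> i" if "i < k"
  using that permutes_not_in[OF tp, of i] by (simp add: block_perm_def)
 show "block_perm k l \<pi> \<tau> (k + i) = k + \<tau> i" if i: "i < l"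
 proof -
  have "inv_into {..<l} ((+) k) (k + i) = i" using i by simp
  hence "?t (k + i) = k + \<tau> i"
   using i im by (auto simp: map_permutation_def restrict_id_def)
  moreover have "\<pi> (k + \<tau> i) = k + \<tau> i" using permutes_not_in[OF p] by auto
  ultimately show ?thesis by (simp add: block_perm_def)
 qed
qed

lemma prod_lessThan_add: "(\<Prod>i<k + l. f i) = (\<Prod>i<k. f i) * (\<Prod>i<l. f (k + i))" for f :: "nat => complex"
 by (induction l) (simp_all add: mult.assoc)

text \<open>For each pair (\<pi>, \<tau>) from the two inner expansions, reindexing \<sigma> by the
  block permutation gives the same sum; the k! l! equal copies cancel the denominator in
  \<open>wedge\<close>.\<close>

lemma wedge_Alt:
 "wedge k l (Alt k a) (Alt l b) v = Alt (k + l) (%i. if i < k then a i else b (i - k)) v"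
proof -
 let ?R = "Alt (k + l) (%i. if i < k then a i else b (i - k)) v"
 let ?c = "%i. if i < k then a i else b (i - k)"
 have inner: "(\<Sum>\<sigma> | \<sigma> permutes {..<k + l}. of_int (sign \<sigma>) *
   (of_int (sign \<pi>) * (\<Prod>i<k. a i (v (\<sigma> (\<pi> i))))) * (of_int (sign \<tau>) * (\<Prod>i<l. b i (v (\<sigma> (k + \<tau> i)))))) = ?R"
  if p: "\<pi> permutes {..<k}" and t: "\<tau> permutes {..<l}" for \<pi> \<tau>
 proof -
  let ?\<theta> = "block_perm k l \<pi> \<tau>"
  note bp = block_perm[OF p t]
  have "?R = (\<Sum>\<sigma> | \<sigma> permutes {..<k + l}. of_int (sign (\<sigma> \<circ> ?\<theta>)) * (\<Prod>i<k + l. ?c i (v ((\<sigma> \<circ> ?\<theta>) i))))"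
   unfolding Alt_def by (rule sum_permutations_compose_right[OF bp(1)])
  also have "... = (\<Sum>\<sigma> | \<sigma> permutes {..<k + l}. of_int (sign \<sigma>) *
   (of_int (sign \<pi>) * (\<Prod>i<k. a i (v (\<sigma> (\<pi> i))))) * (of_int (sign \<tau>) * (\<Prod>i<l. b i (v (\<sigma> (k + \<tau> i))))))"
  proof (rule sum.cong[OF refl])
   fix \<sigma> assume "\<sigma> \<in> {\<sigma>. \<sigma> permutes {..<k + l}}"
   hence "sign (\<sigma> \<circ> ?\<theta>) = sign \<sigma> * (sign \<pi> * sign \<tau>)"
    using bp(1,2) by (subst sign_compose) (auto simp: permutation_permutes)
   moreover have "(\<Prod>i<k + l. ?c i (v ((\<sigma> \<circ> ?\<theta>) i))) = (\<Prod>i<k. a i (v (\<sigma> (\<pi> i)))) * (\<Prod>i<l. b i (v (\<sigma> (k + \<tau> i))))"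
    unfolding prod_lessThan_add using bp(3,4) by (intro arg_cong2[of _ _ _ _ "(*)"] prod.cong) auto
   ultimately show "of_int (sign (\<sigma> \<circ> ?\<theta>)) * (\<Prod>i<k + l. ?c i (v ((\<sigma> \<circ> ?\<theta>) i))) = of_int (sign \<sigma>) *
    (of_int (sign \<pi>) * (\<Prod>i<k. a i (v (\<sigma> (\<pi> i))))) * (of_int (sign \<tau>) * (\<Prod>i<l. b i (v (\<sigma> (k + \<tau> i)))))"
    by simp
  qed
  finally show ?thesis by simp
 qed
 have "(\<Sum>\<sigma> | \<sigma> permutes {..<k + l}. of_int (sign \<sigma>) * Alt k a (%i. v (\<sigma> i)) * Alt l b (%i. v (\<sigma> (k + i)))) =
   (\<Sum>\<sigma> | \<sigma> permutes {..<k + l}. \<Sum>\<pi> | \<pi> permutes {..<k}. \<Sum>\<tau> | \<tau> permutes {..<l}. of_int (sign \<sigma>) *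
   (of_int (sign \<pi>) * (\<Prod>i<k. a i (v (\<sigma> (\<pi> i))))) * (of_int (sign \<tau>) * (\<Prod>i<l. b i (v (\<sigma> (k + \<tau> i))))))"
  unfolding Alt_def by (simp only: sum_distrib_left[symmetric] sum_distrib_right[symmetric])
 also have "... = (\<Sum>\<pi> | \<pi> permutes {..<k}. \<Sum>\<tau> | \<tau> permutes {..<l}. \<Sum>\<sigma> | \<sigma> permutes {..<k + l}. of_int (sign \<sigma>) *
   (of_int (sign \<pi>) * (\<Prod>i<k. a i (v (\<sigma> (\<pi> i))))) * (of_int (sign \<tau>) * (\<Prod>i<l. b i (v (\<sigma> (k + \<tau> i))))))"
  by (subst sum.swap, rule sum.cong[OF refl], rule sum.swap)
 also have "... = (\<Sum>\<pi> | \<pi> permutes {..<k}. \<Sum>\<tau> | \<tau> permutes {..<l}. ?R)"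
  by (intro sum.cong refl inner) auto
 also have "... = fact k * (fact l * ?R)"
  by (simp add: card_permutations)
 finally show ?thesis by (simp add: wedge_def)
qed

lemma wedge_sum:
 assumes "finite X" "finite Y"
 shows "wedge k l (%v. \<Sum>x\<in>X. c x * A x v) (%v. \<Sum>y\<in>Y. d y * B y v) v =
  (\<Sum>x\<in>X. \<Sum>y\<in>Y. c x * d y * wedge k l (A x) (B y) v)"
proof -
 have "(\<Sum>\<sigma> | \<sigma> permutes {..<k + l}. of_int (sign \<sigma>) * (\<Sum>x\<in>X. c x * A x (%i. v (\<sigma> i))) * (\<Sum>y\<in>Y. d y * B y (%i. v (\<sigma> (k + i))))) =
   (\<Sum>\<sigma> | \<sigma> permutes {..<k + l}. \<Sum>x\<in>X. \<Sum>y\<in>Y. c x * d y * (of_int (sign \<sigma>) * A x (%i. v (\<sigma> i)) * B y (%i. v (\<sigma> (k + i)))))"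
  by (simp add: sum_product sum_distrib_left mult_ac)
 also have "... = (\<Sum>x\<in>X. \<Sum>y\<in>Y. \<Sum>\<sigma> | \<sigma> permutes {..<k + l}. c x * d y * (of_int (sign \<sigma>) * A x (%i. v (\<sigma> i)) * B y (%i. v (\<sigma> (k + i)))))"
  by (subst sum.swap, rule sum.cong[OF refl], rule sum.swap)
 finally show ?thesis
  by (simp add: wedge_def sum_divide_distrib sum_distrib_left)
qed

lemma sum_Times: "sum f (A \<times> B) = (\<Sum>x\<in>A. \<Sum>y\<in>B. f (x, y))"
 by (simp add: sum.cartesian_product case_prod_unfold)

text \<open>The i-th pair (k, j) occupies the slots 2 i and 2 i + 1 with \<open>dzbar k\<close> and
  \<open>dz j\<close>. Factors thus have even degree and concatenate without signs.\<close>

definition zlist :: "('n \<times> 'n) list => nat => complex^'n => complex" where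
 "zlist xs i = (if even i then (%u. cnj (u $ fst (xs ! (i div 2)))) else (%u. u $ snd (xs ! (i div 2))))"

text \<open>The wedge product of the (1,1)-forms \<open>\<Sum>j k. C (k, j) dzbar\<^sub>k \<and> dz\<^sub>j\<close> over the list.\<close>
definition form11s :: "('n \<times> 'n => complex) list => 'n::finite cform" where
 "form11s Cs v = (\<Sum>xs | length xs = length Cs. (\<Prod>i<length Cs. (Cs ! i) (xs ! i)) * Alt (2 * length Cs) (zlist xs) v)"

lemma finite_lists_length: "finite {xs :: 'a::finite list. length xs = k}"
 using finite_lists_length_eq[of "UNIV :: 'a set" k] by simp

lemma zlist_append: "zlist (xs @ ys) i = (if i < 2 * length xs then zlist xs i else zlist ys (i - 2 * length xs))"
proof -
 have "(i - 2 * length xs) div 2 = i div 2 - length xs" by simp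
 moreover have "even (i - 2 * length xs) = even i" if "\<not> i < 2 * length xs" using that by simp
 ultimately show ?thesis by (auto simp: zlist_def nth_append)
qed

lemma sum_lists_append:
 fixes f :: "'a::finite list => complex"
 shows "(\<Sum>zs | length zs = k + l. f zs) = (\<Sum>xs | length xs = k. \<Sum>ys | length ys = l. f (xs @ ys))"
proof -
 have "(\<Sum>xs | length xs = k. \<Sum>ys | length ys = l. f (xs @ ys)) = (\<Sum>(xs, ys)\<in>{xs. length xs = k} \<times> {ys. length ys = l}. f (xs @ ys))"
  by (simp add: sum.cartesian_product)
 also have "... = (\<Sum>zs | length zs = k + l. f zs)"
  by (rule sum.reindex_bij_witness[where i="%zs. (take k zs, drop k zs)" and j="%(xs, ys). xs @ ys"]) auto
 finally show ?thesis by simp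
qed

lemma wedge_form11s:
 "wedge (2 * length Cs) (2 * length Ds) (form11s Cs) (form11s Ds) v = form11s (Cs @ Ds) v"
proof -
 let ?k = "length Cs" and ?l = "length Ds"
 have "wedge (2 * ?k) (2 * ?l) (form11s Cs) (form11s Ds) v =
  (\<Sum>xs | length xs = ?k. \<Sum>ys | length ys = ?l. (\<Prod>i<?k. (Cs ! i) (xs ! i)) * (\<Prod>i<?l. (Ds ! i) (ys ! i)) *
    wedge (2 * ?k) (2 * ?l) (Alt (2 * ?k) (zlist xs)) (Alt (2 * ?l) (zlist ys)) v)"
  unfolding form11s_def[abs_def] by (intro wedge_sum finite_lists_length)
 also have "... = (\<Sum>xs | length xs = ?k. \<Sum>ys | length ys = ?l. (\<Prod>i<?k + ?l. ((Cs @ Ds) ! i) ((xs @ ys) ! i)) *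
    Alt (2 * (?k + ?l)) (zlist (xs @ ys)) v)"
 proof (intro sum.cong refl)
  fix xs ys :: "('a \<times> 'a) list" assume "xs \<in> {xs. length xs = ?k}" "ys \<in> {ys. length ys = ?l}"
  hence l: "length xs = ?k" "length ys = ?l" by auto
  have "(\<Prod>i<?k + ?l. ((Cs @ Ds) ! i) ((xs @ ys) ! i)) = (\<Prod>i<?k. (Cs ! i) (xs ! i)) * (\<Prod>i<?l. (Ds ! i) (ys ! i))"
   unfolding prod_lessThan_add using l by (intro arg_cong2[of _ _ _ _ "(*)"] prod.cong) (auto simp: nth_append)
  moreover have "wedge (2 * ?k) (2 * ?l) (Alt (2 * ?k) (zlist xs)) (Alt (2 * ?l) (zlist ys)) v = Alt (2 * (?k + ?l)) (zlist (xs @ ys)) v"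
   unfolding wedge_Alt distrib_left by (rule Alt_cong) (simp add: zlist_append l)
  ultimately show "(\<Prod>i<?k. (Cs ! i) (xs ! i)) * (\<Prod>i<?l. (Ds ! i) (ys ! i)) *
    wedge (2 * ?k) (2 * ?l) (Alt (2 * ?k) (zlist xs)) (Alt (2 * ?l) (zlist ys)) v =
    (\<Prod>i<?k + ?l. ((Cs @ Ds) ! i) ((xs @ ys) ! i)) * Alt (2 * (?k + ?l)) (zlist (xs @ ys)) v" by simp
 qed
 also have "... = form11s (Cs @ Ds) v"
  unfolding form11s_def length_append by (rule sum_lists_append[symmetric])
 finally show ?thesis .
qed

lemma permutes_lessThan_1: "{\<sigma>. \<sigma> permutes {..<Suc 0}} = {id}"
 by (auto simp: lessThan_Suc)

lemma Alt_0: "Alt 0 l v = 1"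
 by (simp add: Alt_def)

lemma Alt_1: "Alt (Suc 0) l v = l 0 (v 0)"
 by (simp add: Alt_def permutes_lessThan_1)

lemma form11s_Nil: "form11s [] v = 1"
 by (simp add: form11s_def Alt_0)

lemma dz_Alt: "dz j = Alt 1 (%_ u. u $ j)" and dzbar_Alt: "dzbar j = Alt 1 (%_ u. cnj (u $ j))"
 by (simp_all add: fun_eq_iff dz_def dzbar_def Alt_1)

lemma wedge_dzbar_dz: "wedge 1 1 (dzbar k) (dz j) v = Alt 2 (zlist [(k, j)]) v"
proof -
 have "wedge 1 1 (dzbar k) (dz j) v = Alt (1 + 1) (%i. if i < 1 then (%u. cnj (u $ k)) else (%u. u $ j)) v"
  unfolding dz_Alt dzbar_Alt by (rule wedge_Alt)
 also have "... = Alt 2 (zlist [(k, j)]) v"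
  unfolding one_add_one by (rule Alt_cong) (auto simp: zlist_def less_2_cases_iff)
 finally show ?thesis .
qed

lemma sum_lists_1: "(\<Sum>xs | length xs = Suc 0. f xs) = (\<Sum>x\<in>UNIV. f [x])" for f :: "'a::finite list => complex"
 by (rule sum.reindex_bij_witness[where i="%x. [x]" and j=hd]) (auto simp: length_Suc_conv)

lemma form11s_single: "form11s [C] v = (\<Sum>k\<in>UNIV. \<Sum>j\<in>UNIV. C (k, j) * wedge 1 1 (dzbar k) (dz j) v)"
proof -
 have "form11s [C] v = (\<Sum>x\<in>UNIV. C x * Alt 2 (zlist [x]) v)"
  by (simp add: form11s_def sum_lists_1)
 also have "... = (\<Sum>k\<in>UNIV. \<Sum>j\<in>UNIV. C (k, j) * Alt 2 (zlist [(k, j)]) v)"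
  by (simp add: sum.cartesian_product case_prod_unfold flip: UNIV_Times_UNIV)
 finally show ?thesis by (simp only: wedge_dzbar_dz)
qed

lemma wpow2_form11s: "wpow2 (form11s [C]) j v = form11s (replicate j C) v"
proof (induction j arbitrary: v)
 case 0
 thus ?case by (simp add: form11s_Nil)
next
 case (Suc j)
 hence "wpow2 (form11s [C]) j = form11s (replicate j C)" by blast
 thus ?case using wedge_form11s[of "[C]" "replicate j C" v] by simp
qed

lemma dbar_del_form11s: "dbar_del_form u z = form11s [%(k, j). pd_zbar k (pd_z j u) z]"
 by (simp add: fun_eq_iff dbar_del_form_def form11s_single)

lemma fscale_form11s: "fscale c (form11s [C]) = form11s [%x. c * C x]"
 by (simp add: fun_eq_iff fscale_def form11s_single sum_distrib_left mult.assoc)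

lemma wedge_11_explicit:
 assumes "!!v. \<alpha> v = f (v 0)" "!!v. \<beta> v = g (v 0)"
 shows "wedge 1 1 \<alpha> \<beta> v = f (v 0) * g (v 1) - f (v 1) * g (v 0)"
proof -
 have s: "{..<2} = insert 1 {0::nat}" by auto
 have "(\<Sum>\<sigma> | \<sigma> permutes {..<2::nat}. of_int (sign \<sigma>) * f (v (\<sigma> 0)) * g (v (\<sigma> 1))) =
   f (v 0) * g (v 1) - f (v 1) * g (v 0)"
  unfolding s by (subst sum_over_permutations_insert) (auto simp: sign_swap_id)
 thus ?thesis by (simp add: wedge_def assms one_add_one[symmetric] del: one_add_one)
qed

text \<open>Reversing \<open>dz j\<close> and \<open>dzbar k\<close> accounts for the minus sign in
  the coefficients.\<close>

lemma i_del_dbar_form11s: "i_del_dbar_form u z = form11s [%(k, j). - \<i> * pd_z j (pd_zbar k u) z]"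
proof
 fix v :: "nat => complex^'a"
 have "wedge 1 1 (dz j) (dzbar k) v = - wedge 1 1 (dzbar k) (dz j) v" for j k
  by (subst (1 2) wedge_11_explicit) (simp_all add: dz_def dzbar_def mult.commute)
 thus "i_del_dbar_form u z v = form11s [%(k, j). - \<i> * pd_z j (pd_zbar k u) z] v"
  by (simp add: i_del_dbar_form_def form11s_single sum_distrib_left sum_negf mult.assoc) (rule sum.swap)
qed

text \<open>A (0,1)-form and a (1,0)-form in front of a product of (1,1)-forms act together as one more (1,1)-form.\<close>
lemma wedge_one_forms:
 "wedge 1 (2 * length Ds + 1) (form01 a) (wedge 1 (2 * length Ds) (%v. \<Sum>j\<in>UNIV. s j * dz j v) (form11s Ds)) v =
  form11s ((%(k, j). a $ k * s j) # Ds) v"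
proof -
 let ?l = "length Ds"
 let ?P = "%ys. \<Prod>i<?l. (Ds ! i) (ys ! i)"
 let ?A1 = "%j ys. Alt (1 + 2 * ?l) (%i. if i < 1 then %u. u $ j else zlist ys (i - 1))"
 let ?Y = "{ys :: ('a \<times> 'a) list. length ys = ?l}"
 have 1: "wedge 1 (2 * ?l) (%v. \<Sum>j\<in>UNIV. s j * dz j v) (form11s Ds) = (%v. \<Sum>x\<in>UNIV \<times> ?Y. (s (fst x) * ?P (snd x)) * ?A1 (fst x) (snd x) v)"
 proof
  fix v
  have "wedge 1 (2 * ?l) (%v. \<Sum>j\<in>UNIV. s j * dz j v) (form11s Ds) v =
    (\<Sum>j\<in>UNIV. \<Sum>ys\<in>?Y. s j * ?P ys * wedge 1 (2 * ?l) (dz j) (Alt (2 * ?l) (zlist ys)) v)"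
   unfolding form11s_def[abs_def] by (intro wedge_sum finite_lists_length) simp
  also have "... = (\<Sum>j\<in>UNIV. \<Sum>ys\<in>?Y. s j * ?P ys * ?A1 j ys v)"
   unfolding dz_Alt wedge_Alt by simp
  finally show "wedge 1 (2 * ?l) (%v. \<Sum>j\<in>UNIV. s j * dz j v) (form11s Ds) v = (\<Sum>x\<in>UNIV \<times> ?Y. (s (fst x) * ?P (snd x)) * ?A1 (fst x) (snd x) v)"
   by (simp add: sum.cartesian_product case_prod_unfold)
 qed
 have 2: "wedge 1 (2 * ?l + 1) (dzbar k) (?A1 j ys) v = Alt (2 * (1 + ?l)) (zlist ((k, j) # ys)) v" if "length ys = ?l" for k j ys
 proof -
  have c: "2 * ?l + 1 = 1 + 2 * ?l" by simp
  have "wedge 1 (1 + 2 * ?l) (dzbar k) (?A1 j ys) v =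
    Alt (1 + (1 + 2 * ?l)) (%i. if i < 1 then %u. cnj (u $ k) else (%i. if i < 1 then %u. u $ j else zlist ys (i - 1)) (i - 1)) v"
   unfolding dzbar_Alt by (rule wedge_Alt)
  also have "1 + (1 + 2 * ?l) = 2 * (1 + ?l)" by simp
  also have "Alt (2 * (1 + ?l)) (%i. if i < 1 then %u. cnj (u $ k) else (%i. if i < 1 then %u. u $ j else zlist ys (i - 1)) (i - 1)) v
    = Alt (2 * (1 + ?l)) (zlist ((k, j) # ys)) v"
  proof (rule Alt_cong)
   fix i
   have e: "zlist ((k, j) # ys) i = (if i < 2 then zlist [(k, j)] i else zlist ys (i - 2))"
    using zlist_append[of "[(k, j)]" ys i] by simp
   consider "i = 0" | "i = 1" | "2 <= i" by linarith
   thus "(if i < 1 then %u. cnj (u $ k) else (%i. if i < 1 then %u. u $ j else zlist ys (i - 1)) (i - 1)) = zlist ((k, j) # ys) i"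
    unfolding e by cases (auto simp: zlist_def numeral_2_eq_2)
  qed
  finally show ?thesis unfolding c .
 qed
 have "wedge 1 (2 * ?l + 1) (form01 a) (%v. \<Sum>x\<in>UNIV \<times> ?Y. (s (fst x) * ?P (snd x)) * ?A1 (fst x) (snd x) v) v =
  (\<Sum>k\<in>UNIV. \<Sum>x\<in>UNIV \<times> ?Y. a $ k * (s (fst x) * ?P (snd x)) * wedge 1 (2 * ?l + 1) (dzbar k) (?A1 (fst x) (snd x)) v)"
  unfolding form01_def[abs_def] by (intro wedge_sum finite_cartesian_product finite_lists_length) simp_all
 also have "... = (\<Sum>k\<in>UNIV. \<Sum>j\<in>UNIV. \<Sum>ys\<in>?Y. a $ k * (s j * ?P ys) * Alt (2 * (1 + ?l)) (zlist ((k, j) # ys)) v)"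
  by (intro sum.cong refl, subst sum_Times, intro sum.cong refl) (simp only: fst_conv snd_conv mem_Collect_eq 2)
 also have "... = (\<Sum>x\<in>UNIV. \<Sum>ys\<in>?Y. a $ fst x * (s (snd x) * ?P ys) * Alt (2 * (1 + ?l)) (zlist (x # ys)) v)"
  by (subst UNIV_Times_UNIV[symmetric], subst sum_Times) simp
 also have "... = (\<Sum>xs | length xs = Suc 0. \<Sum>ys\<in>?Y. (\<Prod>i<Suc ?l. (((%(k, j). a $ k * s j) # Ds) ! i) ((xs @ ys) ! i)) * Alt (2 * (1 + ?l)) (zlist (xs @ ys)) v)"
  unfolding sum_lists_1 by (intro sum.cong refl) (simp add: prod.lessThan_Suc_shift case_prod_unfold mult.assoc del: prod.lessThan_Suc)
 also have "... = form11s ((%(k, j). a $ k * s j) # Ds) v"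
  unfolding form11s_def using sum_lists_append[of "%zs. (\<Prod>i<Suc ?l. (((%(k, j). a $ k * s j) # Ds) ! i) (zs ! i)) * Alt (2 * (1 + ?l)) (zlist zs) v" "Suc 0" ?l]
  by simp
 finally show ?thesis unfolding 1 .
qed

lemma Alt_permute:
 assumes t: "\<theta> permutes {..<m}"
 shows "Alt m (%i. l (\<theta> i)) v = of_int (sign \<theta>) * Alt m l v"
proof -
 have "Alt m (%i. l (\<theta> i)) v = (\<Sum>\<sigma> | \<sigma> permutes {..<m}. of_int (sign (\<sigma> \<circ> \<theta>)) * (\<Prod>i<m. l (\<theta> i) (v ((\<sigma> \<circ> \<theta>) i))))"
  unfolding Alt_def by (rule sum_permutations_compose_right[OF t])
 also have "... = (\<Sum>\<sigma> | \<sigma> permutes {..<m}. of_int (sign \<theta>) * (of_int (sign \<sigma>) * (\<Prod>i<m. l i (v (\<sigma> i)))))"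
 proof (rule sum.cong[OF refl])
  fix \<sigma> assume "\<sigma> \<in> {\<sigma>. \<sigma> permutes {..<m}}"
  hence "sign (\<sigma> \<circ> \<theta>) = sign \<sigma> * sign \<theta>"
   using t by (subst sign_compose) (auto simp: permutation_permutes)
  moreover have "(\<Prod>i<m. l (\<theta> i) (v (\<sigma> (\<theta> i)))) = (\<Prod>i<m. l i (v (\<sigma> i)))"
   using prod.permute[OF t, of "%i. l i (v (\<sigma> i))"] by (simp add: o_def)
  ultimately show "of_int (sign (\<sigma> \<circ> \<theta>)) * (\<Prod>i<m. l (\<theta> i) (v ((\<sigma> \<circ> \<theta>) i))) = of_int (sign \<theta>) * (of_int (sign \<sigma>) * (\<Prod>i<m. l i (v (\<sigma> i))))"
   by simp
 qed
 finally show ?thesis by (simp add: Alt_def sum_distrib_left)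
qed

text \<open>The determinant of a block diagonal matrix with blocks of size two; the induction
  removes the last two indices, on which only the identity and the exchange survive.\<close>

lemma sum_perm_block2:
 fixes c :: "nat => nat => complex"
 assumes "!!i l. i div 2 ~= l div 2 ==> c i l = 0"
 shows "(\<Sum>\<sigma> | \<sigma> permutes {..<2 * m}. of_int (sign \<sigma>) * (\<Prod>i<2 * m. c i (\<sigma> i))) =
  (\<Prod>k<m. c (2 * k) (2 * k) * c (2 * k + 1) (2 * k + 1) - c (2 * k) (2 * k + 1) * c (2 * k + 1) (2 * k))"
proof (induction m)
 case 0
 thus ?case by simp
next
 case (Suc m)
 let ?a = "2 * m + 1" and ?b = "2 * m"
 let ?tr = "Transposition.transpose"
 let ?S = "{..<2 * m}"
 let ?f = "%\<sigma>. of_int (sign \<sigma>) * (\<Prod>i<2 * Suc m. c i (\<sigma> i))"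
 have set: "{..<2 * Suc m} = insert ?a (insert ?b ?S)" "{..<2 * m + 1} = insert ?b ?S" by auto
 have f: "?f \<sigma> = of_int (sign \<sigma>) * ((\<Prod>i<2 * m. c i (\<sigma> i)) * c ?b (\<sigma> ?b) * c ?a (\<sigma> ?a))" for \<sigma>
  by simp
 \<comment> \<open>Permutations are decomposed by the image \<open>b\<close> of the index
   \<open>?a\<close> and then by the image \<open>b'\<close> of \<open>?b\<close>; an image outside
   the last block makes a factor of the product vanish.\<close>
 have z1: "?f (?tr ?a b \<circ> q) = 0" if "b \<in> ?S" "q permutes insert ?b ?S" for b q
 proof -
  have "q ?a = ?a" using that(2) by (intro permutes_not_in) auto
  hence "(?tr ?a b \<circ> q) ?a = b" by simp
  moreover have "c ?a b = 0" using that(1) by (intro assms) auto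
  ultimately show ?thesis by simp
 qed
 have z2: "?f (?tr ?a b \<circ> (?tr ?b b' \<circ> q)) = 0" if "b' \<in> ?S" "b = ?a \<or> b = ?b" "q permutes ?S" for b b' q
 proof -
  have "q ?b = ?b" using that(3) by (intro permutes_not_in) auto
  moreover have "?tr ?a b b' = b'" using that(1,2) by (intro transpose_apply_other) auto
  ultimately have "(?tr ?a b \<circ> (?tr ?b b' \<circ> q)) ?b = b'" by simp
  moreover have "c ?b b' = 0" using that(1) by (intro assms) auto
  ultimately show ?thesis by simp
 qed
 let ?Q = "\<Sum>q | q permutes ?S. of_int (sign q) * (\<Prod>i<2 * m. c i (q i))"
 have inner: "(\<Sum>q | q permutes insert ?b ?S. ?f (?tr ?a b \<circ> q)) = (\<Sum>q | q permutes ?S. ?f (?tr ?a b \<circ> q))" if "b = ?a \<or> b = ?b" for b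
 proof -
  have e: "?tr ?a b \<circ> (?tr ?b ?b \<circ> q) = ?tr ?a b \<circ> q" for q :: "nat => nat" by simp
  have "(\<Sum>q | q permutes insert ?b ?S. ?f (?tr ?a b \<circ> q)) = (\<Sum>b'\<in>insert ?b ?S. \<Sum>q | q permutes ?S. ?f (?tr ?a b \<circ> (?tr ?b b' \<circ> q)))"
   by (rule sum_over_permutations_insert) auto
  also have "... = (\<Sum>q | q permutes ?S. ?f (?tr ?a b \<circ> (?tr ?b ?b \<circ> q))) + (\<Sum>b'\<in>?S. \<Sum>q | q permutes ?S. ?f (?tr ?a b \<circ> (?tr ?b b' \<circ> q)))"
   by (rule sum.insert) auto
  also have "(\<Sum>b'\<in>?S. \<Sum>q | q permutes ?S. ?f (?tr ?a b \<circ> (?tr ?b b' \<circ> q))) = 0"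
   by (intro sum.neutral ballI) (use z2 that in auto)
  finally show ?thesis by (simp only: e add_0_right)
 qed
 have ca: "(\<Sum>q | q permutes ?S. ?f (?tr ?a ?a \<circ> q)) = ?Q * (c ?b ?b * c ?a ?a)"
  unfolding sum_distrib_right
 proof (rule sum.cong[OF refl])
  fix q assume "q \<in> {q. q permutes ?S}"
  hence "q ?a = ?a" "q ?b = ?b" by (auto intro!: permutes_not_in)
  thus "?f (?tr ?a ?a \<circ> q) = of_int (sign q) * (\<Prod>i<2 * m. c i (q i)) * (c ?b ?b * c ?a ?a)"
   by simp
 qed
 have cb: "(\<Sum>q | q permutes ?S. ?f (?tr ?a ?b \<circ> q)) = ?Q * (- (c ?b ?a * c ?a ?b))"
  unfolding sum_distrib_right
 proof (rule sum.cong[OF refl])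
  fix q assume "q \<in> {q. q permutes ?S}"
  hence q: "q permutes ?S" by simp
  hence qa: "q ?a = ?a" "q ?b = ?b" by (auto intro!: permutes_not_in)
  have "permutation q" using q by (auto simp: permutation_permutes)
  hence sg: "sign (?tr ?a ?b \<circ> q) = - sign q"
   by (subst sign_compose) (auto simp: sign_swap_id permutation_swap_id)
  have "(\<Prod>i<2 * m. c i ((?tr ?a ?b \<circ> q) i)) = (\<Prod>i<2 * m. c i (q i))"
  proof (rule prod.cong[OF refl])
   fix i assume "i \<in> {..<2 * m}"
   hence "q i \<in> ?S" using permutes_in_image[OF q] by blast
   hence "?tr ?a ?b (q i) = q i" by (intro transpose_apply_other) auto
   thus "c i ((?tr ?a ?b \<circ> q) i) = c i (q i)" by simp
  qed
  thus "?f (?tr ?a ?b \<circ> q) = of_int (sign q) * (\<Prod>i<2 * m. c i (q i)) * (- (c ?b ?a * c ?a ?b))"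
   unfolding f sg using qa by simp
 qed
 have "(\<Sum>\<sigma> | \<sigma> permutes {..<2 * Suc m}. ?f \<sigma>) = (\<Sum>b\<in>insert ?a (insert ?b ?S). \<Sum>q | q permutes insert ?b ?S. ?f (?tr ?a b \<circ> q))"
  unfolding set(1) by (rule sum_over_permutations_insert) auto
 also have "... = (\<Sum>q | q permutes insert ?b ?S. ?f (?tr ?a ?a \<circ> q)) + ((\<Sum>q | q permutes insert ?b ?S. ?f (?tr ?a ?b \<circ> q)) +
   (\<Sum>b\<in>?S. \<Sum>q | q permutes insert ?b ?S. ?f (?tr ?a b \<circ> q)))"
  by (subst sum.insert; simp del: prod.lessThan_Suc mult_Suc_right)
 also have "(\<Sum>b\<in>?S. \<Sum>q | q permutes insert ?b ?S. ?f (?tr ?a b \<circ> q)) = 0"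
  by (intro sum.neutral ballI) (use z1 in auto)
 finally have "(\<Sum>\<sigma> | \<sigma> permutes {..<2 * Suc m}. ?f \<sigma>) = ?Q * (c ?b ?b * c ?a ?a) + ?Q * (- (c ?b ?a * c ?a ?b))"
  by (simp only: inner[OF disjI1[OF refl]] inner[OF disjI2[OF refl]] ca cb add_0_right)
 thus ?case unfolding Suc by (simp add: algebra_simps)
qed

subsection \<open>Top-degree coefficients\<close>

abbreviation enum :: "nat => 'n::finite" where
 "enum \<equiv> from_nat_into UNIV"

lemma bij_enum: "bij_betw (enum :: nat => 'n::finite) {..<CARD('n)} UNIV"
 using bij_betw_from_nat_into_finite[of "UNIV :: 'n set"] by simp

text \<open>Exchanging two values x and y of an enumeration is the same as exchanging the two
  positions at which they occur, so alternation in the positions gives the sign of a permutation of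
  the values.\<close>

lemma alternating_permute:
 fixes \<Phi> :: "(nat => 'n::finite) => complex"
 assumes cong: "!!a b. (!!i. i < CARD('n) ==> a i = b i) ==> \<Phi> a = \<Phi> b"
  and alt: "!!a i j. i < CARD('n) ==> j < CARD('n) ==> i ~= j ==> \<Phi> (a \<circ> Transposition.transpose i j) = - \<Phi> a"
  and p: "p permutes (UNIV :: 'n set)"
 shows "\<Phi> (p \<circ> enum) = of_int (sign p) * \<Phi> enum"
 using p finite[of UNIV]
proof (induction p rule: permutes_induct)
 case id
 thus ?case by simp
next
 case (swap x y p)
 let ?n = "CARD('n)"
 have bij: "bij_betw (p \<circ> enum) {..<?n} UNIV"
  by (rule bij_betw_trans[OF bij_enum]) (use swap.hyps in \<open>auto intro: permutes_imp_bij\<close>)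
 then obtain i j where ij: "i < ?n" "j < ?n" "p (enum i) = x" "p (enum j) = y"
  unfolding bij_betw_def by (metis (no_types, lifting) UNIV_I comp_apply imageE lessThan_iff)
 have "i ~= j" using ij swap.hyps by auto
 have "\<Phi> (Transposition.transpose x y \<circ> p \<circ> enum) = \<Phi> ((p \<circ> enum) \<circ> Transposition.transpose i j)"
 proof (rule cong)
  fix l assume l: "l < ?n"
  have inj: "p (enum l) = p (enum m) \<longleftrightarrow> l = m" if "m < ?n" for m
   using bij l that unfolding bij_betw_def inj_on_def by auto
  show "(Transposition.transpose x y \<circ> p \<circ> enum) l = ((p \<circ> enum) \<circ> Transposition.transpose i j) l"
   using inj[OF ij(1)] inj[OF ij(2)] ij by auto
 qed
 also have "... = - \<Phi> (p \<circ> enum)" by (rule alt[OF ij(1,2) \<open>i ~= j\<close>])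
 also have "... = - (of_int (sign p) * \<Phi> enum)" by (simp only: swap.IH)
 also have "... = of_int (sign (Transposition.transpose x y \<circ> p)) * \<Phi> enum"
 proof -
  have "permutation p" using swap.hyps by (auto simp: permutation_permutes)
  hence "sign (Transposition.transpose x y \<circ> p) = - sign p"
   using swap.hyps by (simp add: sign_compose permutation_swap_id sign_swap_id)
  thus ?thesis by simp
 qed
 finally show ?case .
qed

definition zfun :: "(nat => 'n) => (nat => 'n) => nat => complex^'n => complex" where
 "zfun a b i = (if even i then (%u. cnj (u $ a (i div 2))) else (%u. u $ b (i div 2)))"

definition basis_seq :: "nat => complex^'n::finite" where
 "basis_seq i = axis (enum (i div 2)) (if even i then 1 else \<i>)"

definition top_val :: "(nat => 'n::finite) => (nat => 'n) => complex" where
 "top_val a b = Alt (2 * CARD('n)) (zfun a b) basis_seq"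

lemma top_val_cong:
 assumes "!!i. i < CARD('n) ==> a i = a' i" "!!i. i < CARD('n) ==> b i = b' i"
 shows "top_val a b = top_val (a' :: nat => 'n::finite) b'"
 unfolding top_val_def by (rule Alt_cong) (use assms in \<open>auto simp: zfun_def\<close>)

lemma sign_transpose_neq: "i ~= j ==> sign (Transposition.transpose i j) = - 1"
 by (simp add: sign_swap_id)

lemma top_val_alt1:
 fixes a b :: "nat => 'n::finite"
 assumes "i < CARD('n)" "j < CARD('n)" "i ~= j"
 shows "top_val (a \<circ> Transposition.transpose i j) b = - top_val a b"
proof -
 have t: "Transposition.transpose (2 * i) (2 * j) permutes {..<2 * CARD('n)}"
  using assms by (intro permutes_swap_id) auto
 have "zfun (a \<circ> Transposition.transpose i j) b = (%l. zfun a b (Transposition.transpose (2 * i) (2 * j) l))"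
 proof
  fix l :: nat
  consider k where "l = 2 * k" | k where "l = 2 * k + 1" by (metis evenE oddE)
  thus "zfun (a \<circ> Transposition.transpose i j) b l = zfun a b (Transposition.transpose (2 * i) (2 * j) l)"
   by cases (simp_all add: zfun_def Transposition.transpose_def Suc_double_not_eq_double)
 qed
 hence "top_val (a \<circ> Transposition.transpose i j) b = Alt (2 * CARD('n)) (%l. zfun a b (Transposition.transpose (2 * i) (2 * j) l)) basis_seq"
  by (simp only: top_val_def)
 also have "... = - top_val a b"
  unfolding Alt_permute[OF t] top_val_def using assms by (simp add: sign_transpose_neq)
 finally show ?thesis .
qed

lemma top_val_alt2:
 fixes a b :: "nat => 'n::finite"
 assumes "i < CARD('n)" "j < CARD('n)" "i ~= j"
 shows "top_val a (b \<circ> Transposition.transpose i j) = - top_val a b"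
proof -
 have t: "Transposition.transpose (2 * i + 1) (2 * j + 1) permutes {..<2 * CARD('n)}"
  using assms by (intro permutes_swap_id) auto
 have "zfun a (b \<circ> Transposition.transpose i j) = (%l. zfun a b (Transposition.transpose (2 * i + 1) (2 * j + 1) l))"
 proof
  fix l :: nat
  consider k where "l = 2 * k" | k where "l = 2 * k + 1" by (metis evenE oddE)
  thus "zfun a (b \<circ> Transposition.transpose i j) l = zfun a b (Transposition.transpose (2 * i + 1) (2 * j + 1) l)"
   by cases (simp_all add: zfun_def Transposition.transpose_def double_not_eq_Suc_double Suc_double_not_eq_double)
 qed
 hence "top_val a (b \<circ> Transposition.transpose i j) = Alt (2 * CARD('n)) (%l. zfun a b (Transposition.transpose (2 * i + 1) (2 * j + 1) l)) basis_seq"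
  by (simp only: top_val_def)
 also have "... = - top_val a b"
  unfolding Alt_permute[OF t] top_val_def using assms by (simp add: sign_transpose_neq)
 finally show ?thesis .
qed

lemma comp_transpose_same: "a i = a j ==> a \<circ> Transposition.transpose i j = a"
 by (auto simp: fun_eq_iff Transposition.transpose_def)

lemma top_val_eq_0:
 fixes a b :: "nat => 'n::finite"
 assumes "\<not> (inj_on a {..<CARD('n)} \<and> inj_on b {..<CARD('n)})"
 shows "top_val a b = 0"
proof -
 have self: "x = - x ==> x = 0" for x :: complex by auto
 consider i j where "i < CARD('n)" "j < CARD('n)" "i ~= j" "a i = a j" | i j where "i < CARD('n)" "j < CARD('n)" "i ~= j" "b i = b j"
  using assms unfolding inj_on_def by auto
 thus ?thesis
 proof cases
  case 1
  from top_val_alt1[OF this(1-3), of a b] 1(4) show ?thesis by (simp add: comp_transpose_same self)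
 next
  case 2
  from top_val_alt2[OF this(1-3), of a b] 2(4) show ?thesis by (simp add: comp_transpose_same self)
 qed
qed

text \<open>The k-th pair of covectors vanishes on all basis vectors but e_k and i e_k, so the
  matrix is block diagonal, each block having determinant 1 * \<i> - (- \<i>) * 1 = 2 \<i>.\<close>

lemma top_val_enum: "top_val enum (enum :: nat => 'n::finite) = (2 * \<i>) ^ CARD('n)"
proof -
 let ?n = "CARD('n)"
 define c where "c i l = (if i < 2 * ?n \<and> l < 2 * ?n then zfun (enum :: nat => 'n) enum i (basis_seq l) else 0)" for i l
 have inj: "(enum i :: 'n) = enum j \<longleftrightarrow> i = j" if "i < ?n" "j < ?n" for i j
  using bij_enum[where 'n='n] that unfolding bij_betw_def inj_on_def by auto
 have c0: "c i l = 0" if "i div 2 ~= l div 2" for i l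
 proof (cases "i < 2 * ?n \<and> l < 2 * ?n")
  case True
  hence "(enum (i div 2) :: 'n) ~= enum (l div 2)" using that by (subst inj) auto
  thus ?thesis by (auto simp: c_def zfun_def basis_seq_def axis_def)
 qed (auto simp: c_def)
 have "top_val enum (enum :: nat => 'n) = (\<Sum>\<sigma> | \<sigma> permutes {..<2 * ?n}. of_int (sign \<sigma>) * (\<Prod>i<2 * ?n. c i (\<sigma> i)))"
  unfolding top_val_def Alt_def
 proof (intro sum.cong refl arg_cong2[of _ _ _ _ "(*)"] prod.cong)
  fix \<sigma> i assume "\<sigma> \<in> {\<sigma>. \<sigma> permutes {..<2 * ?n}}" and i: "i \<in> {..<2 * ?n}"
  hence "\<sigma> i \<in> {..<2 * ?n}" using permutes_in_image[of \<sigma> "{..<2 * ?n}" i] by auto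
  thus "zfun enum (enum :: nat => 'n) i (basis_seq (\<sigma> i)) = c i (\<sigma> i)" using i by (simp add: c_def)
 qed
 also have "... = (\<Prod>k<?n. c (2 * k) (2 * k) * c (2 * k + 1) (2 * k + 1) - c (2 * k) (2 * k + 1) * c (2 * k + 1) (2 * k))"
  by (rule sum_perm_block2[OF c0])
 also have "... = (\<Prod>k<?n. 2 * \<i>)"
  by (rule prod.cong[OF refl]) (auto simp: c_def zfun_def basis_seq_def axis_def)
 finally show ?thesis by simp
qed

lemma top_val_perms:
 assumes p: "p permutes (UNIV :: 'n::finite set)" and q: "q permutes (UNIV :: 'n set)"
 shows "top_val (p \<circ> enum) (q \<circ> enum) = of_int (sign p) * of_int (sign q) * (2 * \<i>) ^ CARD('n)"
proof -
 have "top_val (p \<circ> enum) (q \<circ> enum) = of_int (sign p) * top_val (enum :: nat => 'n) (q \<circ> enum)"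
  by (rule alternating_permute[where \<Phi>="%a. top_val a (q \<circ> enum)"]) (auto intro: top_val_cong top_val_alt1 p)
 also have "top_val (enum :: nat => 'n) (q \<circ> enum) = of_int (sign q) * top_val enum (enum :: nat => 'n)"
  by (rule alternating_permute[where \<Phi>="top_val (enum :: nat => 'n)"]) (auto intro: top_val_cong top_val_alt2 q)
 finally show ?thesis by (simp only: top_val_enum mult.assoc)
qed

lemma permutes_of_inj_list:
 fixes a :: "nat => 'n::finite"
 assumes "inj_on a {..<CARD('n)}"
 obtains p where "p permutes (UNIV :: 'n set)" "!!i. i < CARD('n) ==> p (enum i) = a i"
proof -
 let ?e = "enum :: nat => 'n"
 let ?g = "inv_into {..<CARD('n)} ?e"
 have g: "?g (?e i) = i" if "i < CARD('n)" for i
  using bij_enum[where 'n='n] that by (simp add: bij_betw_def)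
 have "inj (a \<circ> ?g)"
 proof (rule comp_inj_on)
  show "inj ?g" using bij_enum[where 'n='n] by (metis bij_betw_def inj_on_inv_into order_refl)
  have "range ?g \<subseteq> {..<CARD('n)}" using bij_enum[where 'n='n]
   by (metis bij_betw_def image_subsetI inv_into_into)
  thus "inj_on a (range ?g)" using assms inj_on_subset by blast
 qed
 hence "bij (a \<circ> ?g)" by (simp only: bij_def finite_UNIV_inj_surj finite)
 from bij_imp_permutes[OF this] have "(a \<circ> ?g) permutes UNIV" by simp
 thus thesis using that[of "a \<circ> ?g"] g by simp
qed

text \<open>A repeated \<open>dzbar\<close> or \<open>dz\<close> kills the wedge product; the lists
  without repetition in either component correspond to pairs of permutations.\<close>

lemma top_coeff_form11s:
 fixes Cs :: "('n::finite \<times> 'n => complex) list"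
 assumes n: "length Cs = CARD('n)"
 shows "top_coeff (form11s Cs) = (2 * \<i>) ^ CARD('n) * (\<Sum>q | q permutes (UNIV::'n set). \<Sum>p | p permutes (UNIV::'n set).
   of_int (sign p) * of_int (sign q) * (\<Prod>i<CARD('n). (Cs ! i) (p (enum i), q (enum i))))"
proof -
 let ?n = "CARD('n)"
 let ?P = "{p. p permutes (UNIV::'n set)}"
 let ?f = "%xs. (\<Prod>i<?n. (Cs ! i) (xs ! i)) * top_val (%i. fst (xs ! i)) (%i. snd (xs ! i))"
 let ?m = "%(q, p). map (%i. (p (enum i), q (enum i))) [0..<?n]"
 let ?I = "{xs :: ('n \<times> 'n) list. length xs = ?n \<and> inj_on (%i. fst (xs ! i)) {..<?n} \<and> inj_on (%i. snd (xs ! i)) {..<?n}}"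
 have surj: "\<exists>i<?n. enum i = x" for x :: 'n
  using bij_enum[where 'n='n] unfolding bij_betw_def by (metis UNIV_I imageE lessThan_iff)
 have "top_coeff (form11s Cs) = (\<Sum>xs | length xs = ?n. ?f xs)"
  unfolding top_coeff_def form11s_def n top_val_def basis_seq_def[abs_def] zlist_def[abs_def] zfun_def[abs_def] by simp
 also have "... = (\<Sum>xs\<in>?I. ?f xs)"
  by (rule sum.mono_neutral_right[OF finite_lists_length]) (auto intro: top_val_eq_0)
 also have "... = (\<Sum>x\<in>?P \<times> ?P. ?f (?m x))"
 proof (rule sum.reindex_cong[of ?m])
  show "inj_on ?m (?P \<times> ?P)"
  proof (rule inj_onI, clarify)
   fix q p q' p' :: "'n => 'n"
   assume e: "map (%i. (p (enum i), q (enum i))) [0..<?n] = map (%i. (p' (enum i), q' (enum i))) [0..<?n]"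
   have "p x = p' x \<and> q x = q' x" for x
   proof -
    obtain i where i: "i < ?n" "enum i = x" using surj by blast
    thus ?thesis using arg_cong[OF e, of "%l. l ! i"] by simp
   qed
   thus "q = q' \<and> p = p'" by blast
  qed
  have inj_e: "inj_on (%i. p (enum i)) {..<?n}" if "p permutes (UNIV::'n set)" for p
   using comp_inj_on[OF bij_betw_imp_inj_on[OF bij_enum[where 'n='n]] inj_on_subset[OF permutes_inj[OF that] subset_UNIV]] by (simp add: o_def)
  show "?I = ?m ` (?P \<times> ?P)"
  proof (intro equalityI subsetI)
   fix xs assume "xs \<in> ?I"
   hence l: "length xs = ?n" and i1: "inj_on (%i. fst (xs ! i)) {..<?n}" and i2: "inj_on (%i. snd (xs ! i)) {..<?n}" by auto
   obtain p where p: "p permutes (UNIV::'n set)" "!!i. i < ?n ==> p (enum i) = fst (xs ! i)" by (rule permutes_of_inj_list[OF i1], rule that)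
   obtain q where q: "q permutes (UNIV::'n set)" "!!i. i < ?n ==> q (enum i) = snd (xs ! i)" by (rule permutes_of_inj_list[OF i2], rule that)
   have "xs = ?m (q, p)" by (rule nth_equalityI) (auto simp: l p q)
   thus "xs \<in> ?m ` (?P \<times> ?P)" using p(1) q(1) by blast
  next
   fix xs assume "xs \<in> ?m ` (?P \<times> ?P)"
   then obtain p q where pq: "p permutes (UNIV::'n set)" "q permutes (UNIV::'n set)" "xs = ?m (q, p)" by auto
   thus "xs \<in> ?I" using inj_e[OF pq(1)] inj_e[OF pq(2)] by (auto simp: inj_on_def)
  qed
 qed simp
 also have "... = (\<Sum>x\<in>?P \<times> ?P. (2 * \<i>) ^ ?n * (case x of (q, p) => of_int (sign p) * of_int (sign q) * (\<Prod>i<?n. (Cs ! i) (p (enum i), q (enum i)))))"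
 proof (rule sum.cong[OF refl])
  fix x assume "x \<in> ?P \<times> ?P"
  then obtain q p where pq: "q permutes (UNIV::'n set)" "p permutes (UNIV::'n set)" and x: "x = (q, p)" by auto
  have "top_val (%i. fst (?m (q, p) ! i)) (%i. snd (?m (q, p) ! i)) = top_val (p \<circ> enum) (q \<circ> enum)"
   by (rule top_val_cong) auto
  moreover have "(\<Prod>i<?n. (Cs ! i) (?m (q, p) ! i)) = (\<Prod>i<?n. (Cs ! i) (p (enum i), q (enum i)))"
   by (rule prod.cong) auto
  ultimately show "?f (?m x) = (2 * \<i>) ^ ?n * (case x of (q, p) => of_int (sign p) * of_int (sign q) * (\<Prod>i<?n. (Cs ! i) (p (enum i), q (enum i))))"
   by (simp only: x case_prod_conv top_val_perms[OF pq(2,1)] mult_ac)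
 qed
 finally show ?thesis by (simp add: sum_distrib_left[symmetric] sum_Times)
qed

text \<open>The same sum with \<open>p = r \<circ> q\<close>, indexed by \<open>i = q (enum k)\<close>.\<close>
lemma top_coeff_form11s':
 fixes Cs :: "('n::finite \<times> 'n => complex) list"
 assumes n: "length Cs = CARD('n)"
 shows "top_coeff (form11s Cs) = (2 * \<i>) ^ CARD('n) * (\<Sum>q | q permutes (UNIV::'n set). \<Sum>r | r permutes (UNIV::'n set).
   of_int (sign r) * (\<Prod>i<CARD('n). (Cs ! i) (r (q (enum i)), q (enum i))))"
proof -
 have "(\<Sum>p | p permutes (UNIV::'n set). of_int (sign p) * of_int (sign q) * (\<Prod>i<CARD('n). (Cs ! i) (p (enum i), q (enum i)))) =
   (\<Sum>r | r permutes (UNIV::'n set). of_int (sign r) * (\<Prod>i<CARD('n). (Cs ! i) (r (q (enum i)), q (enum i))))"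
  if q: "q permutes UNIV" for q
 proof -
  have "(\<Sum>p | p permutes (UNIV::'n set). of_int (sign p) * of_int (sign q) * (\<Prod>i<CARD('n). (Cs ! i) (p (enum i), q (enum i)))) =
   (\<Sum>r | r permutes (UNIV::'n set). of_int (sign (r \<circ> q)) * of_int (sign q) * (\<Prod>i<CARD('n). (Cs ! i) ((r \<circ> q) (enum i), q (enum i))))"
   by (rule sum_permutations_compose_right[OF q])
  also have "... = (\<Sum>r | r permutes (UNIV::'n set). of_int (sign r) * (\<Prod>i<CARD('n). (Cs ! i) (r (q (enum i)), q (enum i))))"
  proof (rule sum.cong[OF refl])
   fix r :: "'n => 'n" assume "r \<in> {r. r permutes UNIV}"
   hence "sign (r \<circ> q) = sign r * sign q"
    using q by (subst sign_compose) (auto simp: permutation_permutes)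
   hence "of_int (sign (r \<circ> q)) * of_int (sign q) = (of_int (sign r) :: complex)"
    by (simp add: mult.assoc flip: of_int_mult)
   thus "of_int (sign (r \<circ> q)) * of_int (sign q) * (\<Prod>i<CARD('n). (Cs ! i) ((r \<circ> q) (enum i), q (enum i))) =
     of_int (sign r) * (\<Prod>i<CARD('n). (Cs ! i) (r (q (enum i)), q (enum i)))" by simp
  qed
  finally show ?thesis .
 qed
 thus ?thesis by (simp add: top_coeff_form11s[OF n])
qed

text \<open>With equal factors the product no longer depends on \<open>q\<close>, so the sum over
  \<open>q\<close> contributes n!.\<close>

lemma top_coeff_wpow2:
 fixes C :: "'n::finite \<times> 'n => complex"
 shows "top_coeff (wpow2 (form11s [C]) CARD('n)) = (2 * \<i>) ^ CARD('n) * fact CARD('n) * det (\<chi> i k. C (k, i))"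
proof -
 have w: "wpow2 (form11s [C]) CARD('n) = form11s (replicate CARD('n) C)" by (simp add: fun_eq_iff wpow2_form11s)
 have "(\<Prod>i<CARD('n). (replicate CARD('n) C ! i) (r (q (enum i)), q (enum i))) = (\<Prod>i\<in>UNIV. C (r i, i))"
  if q: "q permutes (UNIV::'n set)" for q r
 proof -
  have "bij_betw (%i. q (enum i)) {..<CARD('n)} UNIV"
   using bij_betw_trans[OF bij_enum[where 'n='n] permutes_imp_bij[OF q]] by (simp add: o_def)
  from prod.reindex_bij_betw[OF this, of "%i. C (r i, i)"] show ?thesis by simp
 qed
 hence "top_coeff (wpow2 (form11s [C]) CARD('n)) = (2 * \<i>) ^ CARD('n) * (\<Sum>q | q permutes (UNIV::'n set). \<Sum>r | r permutes (UNIV::'n set).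
   of_int (sign r) * (\<Prod>i\<in>UNIV. C (r i, i)))"
  unfolding w by (subst top_coeff_form11s') auto
 thus ?thesis by (simp add: det_def card_permutations)
qed

subsection \<open>Comparison with the kernel\<close>

lemma exists_perm_map:
 fixes S S' :: "'n::finite set"
 assumes "j \<notin> S" "j' \<notin> S'" "card S = card S'"
 obtains t where "t permutes UNIV" "t j = j'" "t ` S = S'"
proof -
 let ?R = "UNIV - insert j S" and ?R' = "UNIV - insert j' S'"
 have "card ?R = card ?R'" using assms by (simp add: card_Diff_subset)
 then obtain g where g: "bij_betw g ?R ?R'" using finite_same_card_bij by (metis finite)
 obtain f where f: "bij_betw f S S'" using finite_same_card_bij assms(3) by (metis finite)
 define t where "t i = (if i = j then j' else if i \<in> S then f i else g i)" for i
 have im: "t ` S = S'" using f assms(1) by (auto simp: t_def bij_betw_def)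
 have "t ` ?R = g ` ?R" by (rule image_cong) (auto simp: t_def)
 hence "t ` ?R = ?R'" using g by (simp add: bij_betw_def)
 hence "range t = UNIV"
  using im by (metis Diff_partition Un_insert_left image_Un image_insert insert_is_Un subset_UNIV t_def)
 hence "bij t" by (simp add: bij_def finite_UNIV_surj_inj)
 from bij_imp_permutes[OF this] have "t permutes UNIV" by simp
 thus thesis using that im by (simp add: t_def)
qed

text \<open>All fibres of \<open>q \<mapsto> (q x, q ` S\<^sub>0)\<close> have the same size.\<close>
lemma sum_over_fibres:
 fixes x0 :: "'n::finite" and f :: "'n => 'n set => complex"
 assumes x0: "x0 \<notin> S0"
 shows "(\<Sum>q | q permutes UNIV. f (q x0) (q ` S0)) =
  of_real (fact (card S0) * fact (CARD('n) - 1 - card S0)) * (\<Sum>j\<in>UNIV. \<Sum>S | S \<subseteq> UNIV - {j} \<and> card S = card S0. f j S)"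
proof -
 let ?n = "CARD('n)" and ?m = "card S0"
 let ?P = "{q. q permutes (UNIV::'n set)}"
 let ?X = "Sigma (UNIV::'n set) (%j. {S. S \<subseteq> UNIV - {j} \<and> card S = ?m})"
 define N where "N = card {q\<in>?P. q x0 = x0 \<and> q ` S0 = S0}"
 have fin: "finite ?P" by simp
 have fib: "card {q\<in>?P. (q x0, q ` S0) = x} = N" if x: "x \<in> ?X" for x
 proof -
  obtain j S where jS: "x = (j, S)" and jS': "S \<subseteq> UNIV - {j}" "card S0 = card S" using x by auto
  hence jS'': "j \<notin> S" by blast
  obtain t where t: "t permutes UNIV" "t x0 = j" "t ` S0 = S" by (rule exists_perm_map[OF x0 jS'' jS'(2)], rule that)
  have bt: "inj t" using permutes_inj[OF t(1)] .
  \<comment> \<open>Composition with \<open>t\<close> on the left carries the fibre over (x0, S0)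
    onto the fibre over (j, S).\<close>
  have "bij_betw (%q. t \<circ> q) {q\<in>?P. q x0 = x0 \<and> q ` S0 = S0} {q\<in>?P. (q x0, q ` S0) = x}"
  proof (rule bij_betwI[where g="%q. inv t \<circ> q"])
   show "(%q. t \<circ> q) \<in> {q\<in>?P. q x0 = x0 \<and> q ` S0 = S0} \<rightarrow> {q\<in>?P. (q x0, q ` S0) = x}"
   proof (rule Pi_I)
    fix q assume q: "q \<in> {q\<in>?P. q x0 = x0 \<and> q ` S0 = S0}"
    have "(t \<circ> q) ` S0 = S" using q t(3) image_comp[of t q S0] by simp
    moreover have "t \<circ> q permutes UNIV" using q t(1) by (auto intro: permutes_compose)
    ultimately show "t \<circ> q \<in> {q\<in>?P. (q x0, q ` S0) = x}" using q t(2) by (simp only: jS mem_Collect_eq o_apply)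
   qed
   show "(%q. inv t \<circ> q) \<in> {q\<in>?P. (q x0, q ` S0) = x} \<rightarrow> {q\<in>?P. q x0 = x0 \<and> q ` S0 = S0}"
   proof (rule Pi_I)
    fix q assume q: "q \<in> {q\<in>?P. (q x0, q ` S0) = x}"
    have "(inv t \<circ> q) ` S0 = inv t ` (t ` S0)" using q t(3) jS image_comp[of "inv t" q S0] by simp
    also have "... = S0" by (rule image_inv_f_f[OF bt])
    finally have "(inv t \<circ> q) ` S0 = S0" .
    moreover have "inv t \<circ> q permutes UNIV" using q t(1) by (auto intro: permutes_compose permutes_inv)
    moreover have "(inv t \<circ> q) x0 = x0" using q jS t(2) inv_f_f[OF bt, of x0] by auto
    ultimately show "inv t \<circ> q \<in> {q\<in>?P. q x0 = x0 \<and> q ` S0 = S0}" by (simp only: mem_Collect_eq)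
   qed
   show "inv t \<circ> (t \<circ> q) = q" for q using permutes_inv_o(2)[OF t(1)] by (simp add: o_assoc)
   show "t \<circ> (inv t \<circ> q) = q" for q using permutes_inv_o(1)[OF t(1)] by (simp add: o_assoc)
  qed
  from bij_betw_same_card[OF this] show ?thesis by (simp only: N_def)
 qed
 have range: "(q x0, q ` S0) \<in> ?X" if "q \<in> ?P" for q
 proof -
  have "inj q" using that permutes_inj by blast
  thus ?thesis using x0 by (auto simp: inj_image_mem_iff card_image inj_on_subset dest: injD)
 qed
 have finX: "finite ?X" by simp
 have "(\<Sum>q\<in>?P. h (q x0) (q ` S0)) = of_nat N * (\<Sum>(j, S)\<in>?X. h j S)" for h :: "'n => 'n set => complex"
 proof -
  have "(\<Sum>q\<in>?P. h (q x0) (q ` S0)) = (\<Sum>x\<in>?X. \<Sum>q\<in>{q\<in>?P. (q x0, q ` S0) = x}. h (q x0) (q ` S0))"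
   by (rule sum.group[symmetric, OF fin finX]) (use range in auto)
  also have "... = (\<Sum>x\<in>?X. of_nat N * (case x of (j, S) => h j S))"
  proof (rule sum.cong[OF refl])
   fix x assume x: "x \<in> ?X"
   have "(\<Sum>q\<in>{q\<in>?P. (q x0, q ` S0) = x}. h (q x0) (q ` S0)) = (\<Sum>q\<in>{q\<in>?P. (q x0, q ` S0) = x}. (case x of (j, S) => h j S))"
    by (rule sum.cong) auto
   thus "(\<Sum>q\<in>{q\<in>?P. (q x0, q ` S0) = x}. h (q x0) (q ` S0)) = of_nat N * (case x of (j, S) => h j S)"
    by (simp only: sum_constant fib[OF x])
  qed
  finally show ?thesis by (simp add: sum_distrib_left)
 qed
 note main = this
 have m: "?m <= ?n - 1"
 proof -
  have "?m <= card (UNIV - {x0})" using x0 by (intro card_mono) auto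
  thus ?thesis by simp
 qed
 \<comment> \<open>The common size \<open>N\<close> of the fibres follows by applying the fibration
   to the constant function 1, that is, by counting all permutations.\<close>
 have "(of_nat (fact ?n) :: complex) = (\<Sum>q\<in>?P. 1)" by (simp add: card_permutations)
 also have "... = of_nat N * (\<Sum>(j, S)\<in>?X. 1)" by (rule main)
 also have "(\<Sum>(j, S)\<in>?X. 1 :: complex) = of_nat (card ?X)" by simp
 also have "card ?X = ?n * ((?n - 1) choose ?m)"
  using n_subsets[of "UNIV - {_::'n}" ?m] by simp
 finally have "of_nat (fact ?n) = (of_nat (N * (?n * ((?n - 1) choose ?m))) :: complex)" by (simp only: of_nat_mult)
 hence "fact ?n = N * (?n * ((?n - 1) choose ?m))" using of_nat_eq_iff by blast
 moreover have "fact ?n = ?n * (fact ?m * fact (?n - 1 - ?m) * ((?n - 1) choose ?m))"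
  using binomial_fact_lemma[OF m] by (simp add: fact_num_eq_if[of ?n])
 ultimately have "N * (?n * ((?n - 1) choose ?m)) = ?n * (fact ?m * fact (?n - 1 - ?m) * ((?n - 1) choose ?m))"
  by (rule trans[OF sym])
 hence "(?n * ((?n - 1) choose ?m)) * N = (?n * ((?n - 1) choose ?m)) * (fact ?m * fact (?n - 1 - ?m))"
  by (simp only: mult_ac)
 moreover have "?n * ((?n - 1) choose ?m) ~= 0" using m by simp
 ultimately have N: "N = fact ?m * fact (?n - 1 - ?m)"
  using mult_left_cancel by blast
 show ?thesis using main[of f] by (simp add: N sum.Sigma)
qed

lemma prod_split3:
 fixes g :: "nat => complex"
 assumes "m < n"
 shows "(\<Prod>i<n. g i) = g 0 * ((\<Prod>i\<in>{1..m}. g i) * (\<Prod>i\<in>{m<..<n}. g i))"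
proof -
 have s: "{..<n} = insert 0 ({1..m} \<union> {m<..<n})" using assms by auto
 have "(\<Prod>i\<in>{1..m} \<union> {m<..<n}. g i) = (\<Prod>i\<in>{1..m}. g i) * (\<Prod>i\<in>{m<..<n}. g i)"
  by (rule prod.union_disjoint) auto
 thus ?thesis unfolding s by (subst prod.insert) auto
qed

text \<open>Slot 0 carries the form and \<partial>|\<xi> - z|^2, slots 1 to m the matrix, the others
  the identity. A permutation \<open>q\<close> matters only through the image \<open>j\<close> of
  slot 0 and the image \<open>S\<close> of the slots 1 to m, so each pair (j, S) is met m! (n - 1 -
  m)! times.\<close>

lemma BA_term:
 fixes A :: "complex^'n^'n::finite" and a s :: "complex^'n"
 assumes m: "m < CARD('n)"
 shows "top_coeff (form11s ((%(k, j). a $ k * s $ j) # replicate m (%(k, j). A $ j $ k) @ replicate (CARD('n) - 1 - m) (%(k, j). if j = k then 1 else 0))) =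
  (2 * \<i>) ^ CARD('n) * (of_real (fact m * fact (CARD('n) - 1 - m)) * adj_coeff A s a m)"
proof -
 let ?n = "CARD('n)" and ?e = "enum :: nat => 'n"
 let ?Cs = "(%(k, j). a $ k * s $ j) # replicate m (%(k, j). A $ j $ k) @ replicate (?n - 1 - m) (%(k, j). if j = k then 1 else (0::complex))"
 define x0 where "x0 = ?e 0"
 define S0 where "S0 = ?e ` {1..m}"
 have n0: "0 < ?n" by simp
 have inj: "inj_on ?e {..<?n}" using bij_enum[where 'n='n] by (simp add: bij_betw_def)
 have sub: "{1..m} \<subseteq> {..<?n}" using m by auto
 have x0: "x0 \<notin> S0" unfolding x0_def S0_def using inj_on_image_mem_iff[OF inj _ sub, of 0] n0 by simp
 have cS0: "card S0 = m" unfolding S0_def using inj m by (subst card_image) (auto intro: inj_on_subset)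
 define f where "f j S = (\<Sum>p | p permutes (UNIV::'n set). of_int (sign p) * (s $ j * a $ p j * ((\<Prod>i\<in>S. A $ i $ p i) * (\<Prod>i\<in>UNIV - {j} - S. if i = p i then 1 else 0))))" for j S
 have len: "length ?Cs = ?n" using m by simp
 have prod: "(\<Prod>i<?n. (?Cs ! i) (r (q (?e i)), q (?e i))) = s $ q x0 * a $ r (q x0) *
   ((\<Prod>i\<in>q ` S0. A $ i $ r i) * (\<Prod>i\<in>UNIV - {q x0} - q ` S0. if i = r i then 1 else 0))" if q: "q permutes (UNIV::'n set)" for q r
 proof -
  have bq: "bij_betw (%i. q (?e i)) {..<?n} UNIV"
   using bij_betw_trans[OF bij_enum[where 'n='n] permutes_imp_bij[OF q]] by (simp add: o_def)
  hence iq: "inj_on (%i. q (?e i)) {..<?n}" and sq: "(%i. q (?e i)) ` {..<?n} = UNIV" by (auto simp: bij_betw_def)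
  have "(\<Prod>i<?n. (?Cs ! i) (r (q (?e i)), q (?e i))) = (?Cs ! 0) (r (q (?e 0)), q (?e 0)) *
    ((\<Prod>i\<in>{1..m}. (?Cs ! i) (r (q (?e i)), q (?e i))) * (\<Prod>i\<in>{m<..<?n}. (?Cs ! i) (r (q (?e i)), q (?e i))))"
   by (rule prod_split3[OF m])
  also have "(\<Prod>i\<in>{1..m}. (?Cs ! i) (r (q (?e i)), q (?e i))) = (\<Prod>i\<in>{1..m}. A $ q (?e i) $ r (q (?e i)))"
   by (rule prod.cong) (auto simp: nth_append)
  also have "... = (\<Prod>i\<in>q ` S0. A $ i $ r i)"
  proof -
   have "inj_on (%i. q (?e i)) {1..m}" using m by (intro inj_on_subset[OF iq]) auto
   from prod.reindex[OF this, of "%i. A $ i $ r i"] show ?thesis by (simp add: S0_def image_image)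
  qed
  also have "(\<Prod>i\<in>{m<..<?n}. (?Cs ! i) (r (q (?e i)), q (?e i))) = (\<Prod>i\<in>{m<..<?n}. if q (?e i) = r (q (?e i)) then 1 else 0)"
   by (rule prod.cong) (auto simp: nth_append)
  also have "... = (\<Prod>i\<in>UNIV - {q x0} - q ` S0. if i = r i then 1 else 0)"
  proof -
   have i2: "inj_on (%i. q (?e i)) {m<..<?n}" by (intro inj_on_subset[OF iq]) auto
   have "UNIV - {q x0} - q ` S0 = (%i. q (?e i)) ` ({..<?n} - {0} - {1..m})"
   proof -
    have e1: "(%i. q (?e i)) ` ({..<?n} - {0} - {1..m}) = (%i. q (?e i)) ` ({..<?n} - {0}) - (%i. q (?e i)) ` {1..m}"
     by (rule inj_on_image_set_diff[OF iq _ sub]) auto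
    have e2: "(%i. q (?e i)) ` ({..<?n} - {0}) = (%i. q (?e i)) ` {..<?n} - (%i. q (?e i)) ` {0}"
     by (rule inj_on_image_set_diff[OF iq]) (use n0 in auto)
    show ?thesis unfolding e1 e2 sq by (simp add: x0_def S0_def image_image)
   qed
   also have "{..<?n} - {0} - {1..m} = {m<..<?n}" by auto
   finally show ?thesis using prod.reindex[OF i2, of "%i. if i = r i then 1 else (0::complex)"] by simp
  qed
  finally show ?thesis by (simp add: x0_def)
 qed
 have "top_coeff (form11s ?Cs) = (2 * \<i>) ^ ?n * (\<Sum>q | q permutes (UNIV::'n set). f (q x0) (q ` S0))"
  unfolding top_coeff_form11s'[OF len] f_def
  by (intro arg_cong2[of _ _ _ _ "(*)"] refl sum.cong) (simp only: prod mem_Collect_eq)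
 also have "(\<Sum>q | q permutes (UNIV::'n set). f (q x0) (q ` S0)) =
   of_real (fact m * fact (?n - 1 - m)) * (\<Sum>j\<in>UNIV. \<Sum>S | S \<subseteq> UNIV - {j} \<and> card S = m. f j S)"
  using sum_over_fibres[OF x0, of f] by (simp only: cS0)
 also have "(\<Sum>j\<in>UNIV. \<Sum>S | S \<subseteq> UNIV - {j} \<and> card S = m. f j S) = adj_coeff A s a m"
  unfolding f_def adj_coeff_def by (intro sum.cong refl) (rule sum.swap)
 finally show ?thesis .
qed

subsection \<open>The integrand and the normalization constant\<close>

lemma dist2_has_derivative:
 "(dist2 z has_derivative (%v. \<Sum>j\<in>UNIV. (x $ j - z $ j) * cnj (v $ j) + v $ j * svec z x $ j)) (at x)"
proof -
 have "dist2 z = (%x. \<Sum>j\<in>UNIV. (x $ j - z $ j) * (cnj (x $ j) - cnj (z $ j)))"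
 proof
  fix x show "dist2 z x = (\<Sum>j\<in>UNIV. (x $ j - z $ j) * (cnj (x $ j) - cnj (z $ j)))"
   using norm_sq_cvec[of "x - z"] by (simp add: dist2_def)
 qed
 moreover have "((%x. \<Sum>j\<in>UNIV. (x $ j - z $ j) * (cnj (x $ j) - cnj (z $ j))) has_derivative
   (%v. \<Sum>j\<in>UNIV. (x $ j - z $ j) * (cnj (v $ j) - 0) + (v $ j - 0) * (cnj (x $ j) - cnj (z $ j)))) (at x)"
  by (intro has_derivative_sum has_derivative_mult has_derivative_diff has_derivative_const
   bounded_linear_imp_has_derivative linear_component_cvec linear_cnj_component)
 ultimately show ?thesis by (simp add: svec_eq)
qed

lemma pd_z_dist2: "pd_z j (dist2 z) = (%x. svec z x $ j)"
proof
 fix x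
 have "(\<Sum>i\<in>UNIV. (x $ i - z $ i) * cnj (axis j c $ i) + axis j c $ i * svec z x $ i) = (x $ j - z $ j) * cnj c + c * svec z x $ j" for c
  by (subst sum.remove[of _ j]) (auto simp: axis_def intro!: sum.neutral)
 note s = this
 show "pd_z j (dist2 z) x = svec z x $ j"
  unfolding pd_z_eq[OF dist2_has_derivative] s by (simp add: algebra_simps)
qed

lemma pd_zbar_dist2: "pd_zbar k (pd_z j (dist2 z)) x = (if j = k then 1 else 0)"
 using arg_cong[OF dbar_svec[of z j x], of "%v. v $ k"] by (simp add: pd_z_dist2 dbar_def axis_def eq_commute)

definition dpsi :: "(complex^'n => real) => 'n => complex^'n => complex" where
 "dpsi \<psi> l x = 2 * pd_z l (%x. cor (\<psi> x)) x"

lemma Ck_dpsi: "Ck2 \<psi> ==> Ck1 (dpsi \<psi> l)"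
 unfolding dpsi_def[abs_def] by (intro Ck_mult Ck_const Ck_pd_z Ck_of_real)

lemma dbar_mat_dpsi:
 assumes "Ck2 \<psi>"
 shows "dbar_mat (dpsi \<psi>) x $ j $ k = 2 * pd_zbar k (pd_z j (%x. cor (\<psi> x))) x"
proof -
 have "Ck1 (pd_z j (%x. cor (\<psi> x)))"
  using assms by (intro Ck_pd_z Ck_of_real)
 hence "pd_zbar k (dpsi \<psi> j) x = 2 * pd_zbar k (pd_z j (%x. cor (\<psi> x))) x"
  unfolding dpsi_def[abs_def] by (subst pd_zbar_mult[OF differentiable_const Ck_differentiable]) auto
 thus ?thesis by (simp add: dbar_mat_def dbar_def)
qed

text \<open>Of the multiplicity m! (n - 1 - m)! of the m-th term, the factor m! cancels the
  factorial in the operator; the other one is the value of the Gamma integral in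
  \<open>BAker\<close>.\<close>

lemma BA_integrand_eq:
 fixes \<psi> :: "complex^'n::finite => real"
 assumes \<psi>: "Ck2 \<psi>"
 shows "BA_integrand \<psi> \<omega> z x = (2 * \<i>) ^ CARD('n) * (exp (phase (dpsi \<psi>) z x) * BAker (dbar_mat (dpsi \<psi>) x) z x (\<omega> x))"
proof -
 let ?n = "CARD('n)" and ?\<Psi> = "%x. cor (\<psi> x)" and ?W = "dbar_mat (dpsi \<psi>) x"
 let ?b = "%i. axis (from_nat_into UNIV (i div 2)) (if even i then 1 else \<i>) :: complex^'n"
 let ?D = "%m. replicate m (%(k, j). ?W $ j $ k) @ replicate (?n - 1 - m) (%(k, j). if j = k then 1 else (0::complex))"
 have f1: "fscale 2 (dbar_del_form ?\<Psi> x) = form11s [%(k, j). ?W $ j $ k]"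
  unfolding dbar_del_form11s fscale_form11s by (simp add: dbar_mat_dpsi[OF \<psi>] case_prod_unfold)
 have f2: "dbar_del_form (dist2 z) x = form11s [%(k, j). if j = k then 1 else 0]"
  unfolding dbar_del_form11s pd_zbar_dist2 ..
 have f3: "del_form (dist2 z) x = (%v. \<Sum>j\<in>UNIV. svec z x $ j * dz j v)"
  by (simp add: fun_eq_iff del_form_def pd_z_dist2)
 have t: "wedge 1 (2 * ?n - 1) (form01 (\<omega> x)) (wedge 1 (2 * ?n - 2) (del_form (dist2 z) x)
    (wedge (2 * m) (2 * (?n - 1 - m)) (wpow2 (fscale 2 (dbar_del_form ?\<Psi> x)) m) (wpow2 (dbar_del_form (dist2 z) x) (?n - 1 - m)))) ?b =
   (2 * \<i>) ^ ?n * (of_real (fact m * fact (?n - 1 - m)) * adj_coeff ?W (svec z x) (\<omega> x) m)" if m: "m < ?n" for m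
 proof -
  have w1: "wpow2 (form11s [C]) j = form11s (replicate j C)" for C :: "'n \<times> 'n => complex" and j
   by (rule ext) (rule wpow2_form11s)
  have w2: "wedge (2 * m) (2 * (?n - 1 - m)) (form11s (replicate m C)) (form11s (replicate (?n - 1 - m) C')) = form11s (replicate m C @ replicate (?n - 1 - m) C')" for C C' :: "'n \<times> 'n => complex"
   using wedge_form11s[of "replicate m C" "replicate (?n - 1 - m) C'"] by (simp add: fun_eq_iff)
  have l: "2 * ?n - 1 = 2 * length (?D m) + 1" "2 * ?n - 2 = 2 * length (?D m)" using m by simp_all
  have "wedge 1 (2 * ?n - 1) (form01 (\<omega> x)) (wedge 1 (2 * ?n - 2) (del_form (dist2 z) x)
    (wedge (2 * m) (2 * (?n - 1 - m)) (wpow2 (fscale 2 (dbar_del_form ?\<Psi> x)) m) (wpow2 (dbar_del_form (dist2 z) x) (?n - 1 - m)))) ?b =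
   form11s ((%(k, j). \<omega> x $ k * svec z x $ j) # ?D m) ?b"
   unfolding f1 f2 f3 w1 w2 l by (rule wedge_one_forms)
  also have "... = top_coeff (form11s ((%(k, j). \<omega> x $ k * svec z x $ j) # ?D m))" by (simp add: top_coeff_def)
  finally show ?thesis unfolding BA_term[OF m] .
 qed
 have "BA_integrand \<psi> \<omega> z x = exp (\<Sum>j\<in>UNIV. 2 * pd_z j ?\<Psi> x * (z $ j - x $ j)) *
  (\<Sum>m<?n. wedge 1 (2 * ?n - 1) (form01 (\<omega> x)) (wedge 1 (2 * ?n - 2) (del_form (dist2 z) x)
    (wedge (2 * m) (2 * (?n - 1 - m)) (wpow2 (fscale 2 (dbar_del_form ?\<Psi> x)) m) (wpow2 (dbar_del_form (dist2 z) x) (?n - 1 - m)))) ?b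
   / (fact m * of_real (norm (x - z) ^ (2 * ?n - 2 * m))))"
  by (simp add: BA_integrand_def top_coeff_def BA_form_def Let_def)
 also have "... = exp (phase (dpsi \<psi>) z x) * (\<Sum>m<?n. (2 * \<i>) ^ ?n * (adj_coeff ?W (svec z x) (\<omega> x) m * of_real (fact (?n - 1 - m) / norm (x - z) ^ (2 * (?n - m)))))"
 proof (intro arg_cong2[of _ _ _ _ "(*)"] sum.cong refl)
  show "exp (\<Sum>j\<in>UNIV. 2 * pd_z j ?\<Psi> x * (z $ j - x $ j)) = exp (phase (dpsi \<psi>) z x)"
   by (simp add: phase_def dpsi_def)
  fix m assume "m \<in> {..<?n}"
  hence m: "m < ?n" by simp
  show "wedge 1 (2 * ?n - 1) (form01 (\<omega> x)) (wedge 1 (2 * ?n - 2) (del_form (dist2 z) x)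
    (wedge (2 * m) (2 * (?n - 1 - m)) (wpow2 (fscale 2 (dbar_del_form ?\<Psi> x)) m) (wpow2 (dbar_del_form (dist2 z) x) (?n - 1 - m)))) ?b
   / (fact m * of_real (norm (x - z) ^ (2 * ?n - 2 * m))) =
   (2 * \<i>) ^ ?n * (adj_coeff ?W (svec z x) (\<omega> x) m * of_real (fact (?n - 1 - m) / norm (x - z) ^ (2 * (?n - m))))"
   unfolding t[OF m] by (simp add: diff_mult_distrib2)
 qed
 finally show ?thesis by (simp add: BAker_def sum_distrib_left mult_ac)
qed

lemma test_fun_Ck1: "test_fun u ==> Ck k u"
 by (simp add: test_fun_def)

lemma test_fun_csupp: "test_fun u ==> csupp u"
proof -
 assume "test_fun u"
 hence "bounded {x. u x ~= 0}"
  unfolding test_fun_def by (meson bounded_subset closure_subset compact_imp_bounded)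
 thus ?thesis by (auto simp: csupp_def bounded_iff)
qed

lemma det_zero_matrix: "det (0 :: complex^'n^'n::finite) = 0"
 using det_0[where 'n='n] by (simp add: mat_def zero_vec_def)

lemma phase_zero [simp]: "phase (%_ _. 0) z x = 0"
 by (simp add: phase_def)

lemma dbar_mat_zero [simp]: "dbar_mat (%_ _. 0) x = 0"
 by (simp add: dbar_mat_def dbar_def vec_eq_iff)

text \<open>The special case \<open>q = 0\<close> is the Bochner--Martinelli formula.\<close>
lemma bochner_martinelli:
 fixes u :: "complex^'n::finite => complex"
 assumes "Ck1 u" "csupp u"
 shows "integ (%x. BAker 0 z x (dbar u x))"
  "(LINT x|lborel. BAker 0 z x (dbar u x)) = - of_real (gauss_const TYPE('n)) * u z"
proof -
 have "Ck1 ((%_ _. 0 :: complex) l :: complex^'n => complex)" for l :: 'n by (rule Ck_const)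
 from BA_representation[OF this assms, of z]
 show "integ (%x. BAker 0 z x (dbar u x))"
  "(LINT x|lborel. BAker 0 z x (dbar u x)) = - of_real (gauss_const TYPE('n)) * u z"
  by (simp_all add: det_zero_matrix)
qed

text \<open>The nonzero test function makes the description defining the constant unique; if all
  test functions vanished, every nonzero number would satisfy it.\<close>

lemma BA_const_eq:
 fixes u0 :: "complex^'n::finite => complex"
 assumes u0: "test_fun u0" "u0 z0 ~= 0"
 shows "BA_const TYPE('n) = - 1 / (of_real (gauss_const TYPE('n)) * (2 * \<i>) ^ CARD('n))"
proof -
 let ?g = "cor (gauss_const TYPE('n))"
 let ?c = "- 1 / (?g * (2 * \<i>) ^ CARD('n))"
 have g: "?g ~= 0" using gauss_const_pos[where 'n='n] by simp
 have q0: "dpsi (%_::complex^'n. 0) = (%_ _. 0)"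
  by (simp add: dpsi_def fun_eq_iff pd_z_eq[OF has_derivative_const])
 have c0: "Ck2 (%_::complex^'n. 0::real)" by (rule Ck_const)
 have main: "(LINT x|lebesgue. BA_integrand (%_. 0) (dbar u) z x) = (2 * \<i>) ^ CARD('n) * (- ?g * u z)" if u: "test_fun u" for u :: "complex^'n => complex" and z
 proof -
  note bm = bochner_martinelli[OF test_fun_Ck1[OF u] test_fun_csupp[OF u], of z]
  have "(LINT x|lebesgue. BA_integrand (%_. 0) (dbar u) z x) = (LINT x|lebesgue. (2 * \<i>) ^ CARD('n) * BAker 0 z x (dbar u x))"
   by (simp only: BA_integrand_eq[OF c0] q0 phase_zero dbar_mat_zero exp_zero mult_1_left)
  also have "... = (LINT x|lborel. (2 * \<i>) ^ CARD('n) * BAker 0 z x (dbar u x))"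
   by (rule integral_completion) (intro borel_measurable_times borel_measurable_const borel_measurable_integrable[OF bm(1)])
  also have "... = (2 * \<i>) ^ CARD('n) * (LINT x|lborel. BAker 0 z x (dbar u x))" by simp
  finally show ?thesis by (simp only: bm(2))
 qed
 show ?thesis unfolding BA_const_def
 proof (rule the_equality)
  have cx: "?c * ((2 * \<i>) ^ CARD('n) * (- ?g * x)) = x" for x
   using g by simp
  show "?c ~= 0 \<and> (\<forall>u::complex^'n => complex. test_fun u \<longrightarrow> (\<forall>z. ?c * (LINT \<xi>|lebesgue. BA_integrand (%_. 0) (dbar u) z \<xi>) = u z))"
  proof (intro conjI allI impI)
   show "?c ~= 0" using g by simp
   fix u :: "complex^'n => complex" and z assume u: "test_fun u"
   show "?c * (LINT \<xi>|lebesgue. BA_integrand (%_. 0) (dbar u) z \<xi>) = u z"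
    by (simp only: main[OF u] cx)
  qed
  fix c assume c: "c ~= 0 \<and> (\<forall>u::complex^'n => complex. test_fun u \<longrightarrow> (\<forall>z. c * (LINT \<xi>|lebesgue. BA_integrand (%_. 0) (dbar u) z \<xi>) = u z))"
  hence "c * ((2 * \<i>) ^ CARD('n) * (- ?g * u0 z0)) = u0 z0" using main[OF u0(1)] u0(1) by metis
  hence "(c * ((2 * \<i>) ^ CARD('n) * (- ?g))) * u0 z0 = 1 * u0 z0" by (simp only: mult.assoc mult_1_left)
  hence "c * ((2 * \<i>) ^ CARD('n) * (- ?g)) = 1" using u0(2) mult_right_cancel by blast
  moreover have "c = - 1 / (g * P)" if "c * (P * (- g)) = 1" for c g P :: complex
  proof -
   have "g * P ~= 0" using that by auto
   moreover have "c * (g * P) = - (c * (P * (- g)))" by simp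
   ultimately show ?thesis using that by (metis nonzero_eq_divide_eq)
  qed
  ultimately show "c = ?c" by blast
 qed
qed

section \<open>Monge--Ampere density and geometry of the weight\<close>

subsection \<open>The Monge--Ampere density\<close>

definition levi :: "(complex^'n => real) => complex^'n => complex^'n^'n" where
 "levi u z = (\<chi> j k. pd_z j (pd_zbar k (%x. cor (u x))) z)"

definition hform :: "complex^'n^'n => complex^'n => complex" where
 "hform A v = (\<Sum>j\<in>UNIV. \<Sum>k\<in>UNIV. A $ j $ k * v $ j * cnj (v $ k))"

definition hermitian :: "complex^'n^'n => bool" where
 "hermitian A \<longleftrightarrow> (\<forall>j k. cnj (A $ j $ k) = A $ k $ j)"

lemma form11_val_levi: "form11_val (i_del_dbar_form (%x. cor (u x)) z) v = 2 * Re (hform (levi u z) v)"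
proof -
 have "wedge 1 1 (dz j) (dzbar k) (%i. if i = 0 then v else \<i> *s v) = - 2 * \<i> * (v $ j * cnj (v $ k))" for j k
  by (subst wedge_11_explicit[of _ "%u. u $ j" _ "%u. cnj (u $ k)"]) (simp_all add: dz_def dzbar_def)
 hence "i_del_dbar_form (%x. cor (u x)) z (%i. if i = 0 then v else \<i> *s v) =
   \<i> * (\<Sum>j\<in>UNIV. \<Sum>k\<in>UNIV. levi u z $ j $ k * (- 2 * \<i> * (v $ j * cnj (v $ k))))"
  by (simp add: i_del_dbar_form_def levi_def)
 also have "... = 2 * hform (levi u z) v"
  by (simp add: hform_def sum_distrib_left mult_ac)
 finally show ?thesis by (simp add: form11_val_def)
qed

lemma form11_val_fscale: "form11_val (fscale (of_real c) \<alpha>) v = c * form11_val \<alpha> v"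
 by (simp add: form11_val_def fscale_def)

lemma top_coeff_levi:
 "top_coeff (wpow2 (i_del_dbar_form (%x. cor (u x)) z) CARD('n::finite)) = 2 ^ CARD('n) * fact CARD('n) * det (levi u z :: complex^'n^'n)"
proof -
 have "(\<chi> i k. - \<i> * pd_z i (pd_zbar k (%x. cor (u x))) z) = (\<chi> i. - \<i> *s levi u z $ i :: complex^'n^'n)"
  by (simp add: levi_def vec_eq_iff)
 hence "det (\<chi> i k. - \<i> * pd_z i (pd_zbar k (%x. cor (u x))) z) = (- \<i>) ^ CARD('n) * det (levi u z :: complex^'n^'n)"
  by (simp only: det_rows_mul) simp
 moreover have "(2 * \<i>) ^ CARD('n) * (- \<i>) ^ CARD('n) = (2 ^ CARD('n) :: complex)"
 proof -
  have "2 * \<i> * (- \<i>) = (2 :: complex)" by (simp add: mult.assoc)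
  thus ?thesis by (simp only: power_mult_distrib[symmetric])
 qed
 moreover have "a * f * (b * d) = a * b * f * d" for a b f d :: complex by (simp only: mult_ac)
 ultimately show ?thesis
  unfolding i_del_dbar_form11s top_coeff_wpow2 by (simp only: prod.case)
qed

lemma frechet_of_real:
 assumes "f differentiable (at x)"
 shows "FD (%x. cor (f x)) (at x) v = of_real (FD f (at x) v)"
 using frechet_derivative_bounded_linear[OF bounded_linear_of_real assms] .

text \<open>Both orders of differentiation in terms of the real Hessian: symmetry of the Hessian
  makes the Levi matrix Hermitian, and bounds for the Hessian pass to the matrix of the
  kernel.\<close>

lemma levi_hessian:
 fixes u :: "complex^'n::finite => real"
 assumes u: "Ck2 u"
 shows "pd_z j (pd_zbar k (%x. cor (u x))) z =
   (of_real (hessian u z (axis j 1) (axis k 1)) + \<i> * of_real (hessian u z (axis j 1) (axis k \<i>))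
   - \<i> * of_real (hessian u z (axis j \<i>) (axis k 1)) + of_real (hessian u z (axis j \<i>) (axis k \<i>))) / 4"
  and "pd_zbar k (pd_z j (%x. cor (u x))) z =
   (of_real (hessian u z (axis k 1) (axis j 1)) - \<i> * of_real (hessian u z (axis k 1) (axis j \<i>))
   + \<i> * of_real (hessian u z (axis k \<i>) (axis j 1)) + of_real (hessian u z (axis k \<i>) (axis j \<i>))) / 4"
proof -
 have d: "FD (%x. cor (u x)) (at x) v = of_real (FD u (at x) v)" for x v
  by (rule frechet_of_real[OF Ck_differentiable[OF u]])
 have h: "((%x. cor (FD u (at x) w)) has_derivative (%v. of_real (hessian u z v w))) (at z)" for w
  unfolding hessian_def
  by (intro bounded_linear.has_derivative[OF bounded_linear_of_real] Ck_Suc_has_derivative[OF Ck_Suc_deriv[OF u]])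
 have "(pd_zbar k (%x. cor (u x)) has_derivative (%v. (of_real (hessian u z v (axis k 1)) + \<i> * of_real (hessian u z v (axis k \<i>))) / 2)) (at z)"
  unfolding pd_zbar_def[abs_def] d by (intro bounded_linear.has_derivative[OF bounded_linear_divide] has_derivative_add has_derivative_diff has_derivative_mult_right h)
 note pd_z_eq[OF this, of j]
 thus "pd_z j (pd_zbar k (%x. cor (u x))) z =
   (of_real (hessian u z (axis j 1) (axis k 1)) + \<i> * of_real (hessian u z (axis j 1) (axis k \<i>))
   - \<i> * of_real (hessian u z (axis j \<i>) (axis k 1)) + of_real (hessian u z (axis j \<i>) (axis k \<i>))) / 4"
  by (simp add: algebra_simps add_divide_distrib diff_divide_distrib)
 have "(pd_z j (%x. cor (u x)) has_derivative (%v. (of_real (hessian u z v (axis j 1)) - \<i> * of_real (hessian u z v (axis j \<i>))) / 2)) (at z)"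
  unfolding pd_z_def[abs_def] d by (intro bounded_linear.has_derivative[OF bounded_linear_divide] has_derivative_add has_derivative_diff has_derivative_mult_right h)
 note pd_zbar_eq[OF this, of k]
 thus "pd_zbar k (pd_z j (%x. cor (u x))) z =
   (of_real (hessian u z (axis k 1) (axis j 1)) - \<i> * of_real (hessian u z (axis k 1) (axis j \<i>))
   + \<i> * of_real (hessian u z (axis k \<i>) (axis j 1)) + of_real (hessian u z (axis k \<i>) (axis j \<i>))) / 4"
  by (simp add: algebra_simps add_divide_distrib diff_divide_distrib)
qed

lemma hessian_sym:
 assumes "Ck2 u" shows "hessian u z v w = hessian u z w v"
 unfolding hessian_def by (rule frechet_derivative_commute_real[OF assms])

lemma hermitian_levi:
 assumes u: "Ck2 u" shows "hermitian (levi u z)"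
 unfolding hermitian_def levi_def
proof (intro allI)
 fix j k
 show "cnj ((\<chi> j k. pd_z j (pd_zbar k (%x. cor (u x))) z) $ j $ k) = (\<chi> j k. pd_z j (pd_zbar k (%x. cor (u x))) z) $ k $ j"
  unfolding vec_lambda_beta levi_hessian(1)[OF u]
  by (simp add: hessian_sym[OF u, of z "axis j 1" "axis k 1"] hessian_sym[OF u, of z "axis j 1" "axis k \<i>"]
   hessian_sym[OF u, of z "axis j \<i>" "axis k 1"] hessian_sym[OF u, of z "axis j \<i>" "axis k \<i>"])
qed

lemma hermitian_det_real:
 assumes "hermitian A" shows "Im (det A) = 0"
proof -
 have "cnj (det A) = (\<Sum>p | p permutes UNIV. of_int (sign p) * (\<Prod>i\<in>UNIV. cnj (A $ i $ p i)))"
  by (simp add: det_def)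
 also have "... = det (transpose A)"
  using assms by (simp add: det_def hermitian_def Finite_Cartesian_Product.transpose_def)
 finally have "cnj (det A) = det A" by simp
 thus ?thesis by (metis complex_cnj_cancel_iff complex_cnj cnj.simps(2) neg_equal_zero)
qed

lemma posdef_det_nz:
 fixes A :: "complex^'n^'n::finite"
 assumes "!!v. v ~= 0 ==> 0 < Re (hform A v)"
 shows "det A ~= 0"
proof
 assume "det A = 0"
 hence "\<not> invertible A" using invertible_det_nz by blast
 then obtain x where x: "A *v x = 0" "x ~= 0"
  by (metis invertible_left_inverse matrix_left_invertible_ker)
 define v where "v = (\<chi> j. cnj (x $ j))"
 have "v ~= 0" using x(2) by (auto simp: v_def vec_eq_iff)
 moreover have "hform A v = (\<Sum>j\<in>UNIV. cnj (x $ j) * (A *v x) $ j)"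
  by (simp add: hform_def v_def matrix_vector_mult_def sum_distrib_left mult_ac)
 ultimately show False using assms[of v] x(1) by simp
qed

lemma hform_add_scale: "hform (\<chi> j k. s * A $ j $ k + t * B $ j $ k) v = s * hform A v + t * hform B v"
 by (simp add: hform_def sum.distrib sum_distrib_left algebra_simps)

lemma hform_mat1: "hform (mat 1) v = of_real ((norm v)^2)"
proof -
 have "hform (mat 1) v = (\<Sum>j\<in>UNIV. v $ j * cnj (v $ j))"
  unfolding hform_def mat_def
  by (intro sum.cong refl) (subst sum.remove, auto intro!: sum.neutral)
 thus ?thesis by (simp only: norm_sq_cvec)
qed

text \<open>Along the segment from the identity to \<open>A\<close> the matrices stay Hermitian and
  positive definite, so the determinant is real and nonzero; starting at 1, it cannot change
  sign.\<close>

lemma posdef_det_pos: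
 fixes A :: "complex^'n^'n::finite"
 assumes h: "hermitian A" and p: "!!v. v ~= 0 ==> 0 < Re (hform A v)"
 shows "0 < Re (det A)"
proof -
 define P where "P s = (\<chi> j k. of_real (1 - s) * (mat 1 :: complex^'n^'n) $ j $ k + of_real s * A $ j $ k :: complex^'n^'n)" for s :: real
 have nz: "Re (det (P s)) ~= 0" if s: "s \<in> {0..1}" for s
 proof -
  have "hermitian (P s)" using h by (auto simp: hermitian_def P_def mat_def)
  moreover have "det (P s) ~= 0"
  proof (rule posdef_det_nz)
   fix v :: "complex^'n" assume v: "v ~= 0"
   have "Re (hform (P s) v) = (1 - s) * (norm v)^2 + s * Re (hform A v)"
    unfolding P_def hform_add_scale hform_mat1 by simp
   also have "... > 0"
    using s v p[OF v] by (cases "s = 0") (auto intro!: add_nonneg_pos mult_nonneg_nonneg)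
   finally show "0 < Re (hform (P s) v)" .
  qed
  ultimately show ?thesis using hermitian_det_real complex_eq_iff by fastforce
 qed
 have c: "continuous_on {0..1} (%s. Re (det (P s)))"
  unfolding P_def by (intro continuous_intros continuous_on_det)
 have "P 0 = mat 1" "P 1 = A" by (simp_all add: P_def)
 hence P0: "Re (det (P 0)) = 1" "det (P 1) = det A" by simp_all
 show ?thesis
 proof (rule ccontr)
  assume "\<not> 0 < Re (det A)"
  hence "\<exists>s\<ge>0. s <= 1 \<and> Re (det (P s)) = 0"
   using P0 by (intro IVT2'[OF _ _ _ c]) auto
  thus False using nz by auto
 qed
qed

lemma hform_real:
 assumes "hermitian A" shows "Im (hform A v) = 0"
proof -
 have "cnj (hform A v) = (\<Sum>j\<in>UNIV. \<Sum>k\<in>UNIV. A $ k $ j * v $ k * cnj (v $ j))"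
  using assms by (simp add: hform_def hermitian_def mult_ac)
 also have "... = hform A v" unfolding hform_def by (rule sum.swap)
 finally show ?thesis by (metis cnj.simps(2) neg_equal_zero)
qed

lemma norm_axis_eq: "norm (axis k c :: complex^'n::finite) = cmod c"
proof -
 have "(\<Sum>i\<in>UNIV. (cmod (axis k c $ i))^2) = (cmod c)^2"
  by (subst sum.remove[of _ k]) (auto simp: axis_def intro!: sum.neutral)
 thus ?thesis by (simp add: norm_vec_def L2_set_def)
qed

lemma norm_vec_le_sum: "norm (x :: 'a::real_normed_vector^'n::finite) <= (\<Sum>i\<in>UNIV. norm (x $ i))"
 unfolding norm_vec_def by (rule L2_set_le_sum) simp

lemma hform_polarization:
 fixes A :: "complex^'n^'n::finite"
 shows "hform A (axis j 1 + 1 *s axis k 1) - hform A (axis j 1 + (-1) *s axis k 1) + \<i> * hform A (axis j 1 + \<i> *s axis k 1)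
  - \<i> * hform A (axis j 1 + (-\<i>) *s axis k 1) = 4 * A $ j $ k"
proof -
 have pol: "hform A (v + 1 *s w) - hform A (v + (-1) *s w) + \<i> * hform A (v + \<i> *s w) - \<i> * hform A (v + (-\<i>) *s w) =
   (\<Sum>j\<in>UNIV. \<Sum>k\<in>UNIV. 4 * (A $ j $ k * v $ j * cnj (w $ k)))" for v w
  unfolding hform_def sum_distrib_left sum_subtractf[symmetric] sum.distrib[symmetric]
  by (intro sum.cong refl) (simp add: algebra_simps)
 have "(\<Sum>k'\<in>UNIV. 4 * (A $ j' $ k' * axis j 1 $ j' * cnj (axis k 1 $ k'))) = (if j' = j then 4 * A $ j $ k else 0)" for j'
  by (subst sum.remove[of _ k]) (auto simp: axis_def intro!: sum.neutral)
 thus ?thesis unfolding pol by simp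
qed

text \<open>Compactness in place of eigenvalues: the pinched Hermitian matrices form a closed set,
  bounded by polarization, on which the continuous positive determinant attains its bounds.\<close>

lemma hermitian_pinched_det:
 fixes m M :: real
 assumes m: "0 < m"
 obtains c1 c2 where "0 < c1" "0 < c2"
  "!!A :: complex^'n^'n::finite. hermitian A ==> (!!v. m * (norm v)^2 <= Re (hform A v)) ==> (!!v. Re (hform A v) <= M * (norm v)^2) ==>
    c1 <= Re (det A) \<and> Re (det A) <= c2"
proof -
 define K where "K = {A :: complex^'n^'n. hermitian A \<and> (\<forall>v. m * (norm v)^2 <= Re (hform A v)) \<and> (\<forall>v. Re (hform A v) <= M * (norm v)^2)}"
 have cont_e: "cont (%A :: complex^'n^'n. A $ j $ k)" for j k by (intro continuous_intros)
 have cont_h: "cont (%A :: complex^'n^'n. Re (hform A v))" for v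
  unfolding hform_def by (intro continuous_intros)
 have "closed K"
 proof -
  have "K = (\<Inter>j. \<Inter>k. {A. cnj (A $ j $ k) = A $ k $ j}) \<inter> (\<Inter>v. {A. m * (norm v)^2 <= Re (hform A v)}) \<inter> (\<Inter>v. {A. Re (hform A v) <= M * (norm v)^2})"
   by (auto simp: K_def hermitian_def)
  moreover have "closed (\<Inter>j. \<Inter>k. {A :: complex^'n^'n. cnj (A $ j $ k) = A $ k $ j})"
   by (intro ballI closed_Collect_eq continuous_intros)
  moreover have "closed (\<Inter>v. {A :: complex^'n^'n. m * (norm v)^2 <= Re (hform A v)})"
   by (intro closed_INT ballI closed_Collect_le continuous_on_const cont_h)
  moreover have "closed (\<Inter>v. {A :: complex^'n^'n. Re (hform A v) <= M * (norm v)^2})"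
   by (intro closed_INT ballI closed_Collect_le continuous_on_const cont_h)
  ultimately show ?thesis by (auto intro: closed_Int)
 qed
 moreover have "bounded K"
 proof -
  have ent: "norm (A $ j $ k) <= 4 * \<bar>M\<bar>" if A: "A \<in> K" for A j k
  proof -
   have h: "norm (hform A v) <= 4 * \<bar>M\<bar>" if "norm v <= 2" for v
   proof -
    have "Im (hform A v) = 0" using A by (auto simp: K_def intro: hform_real)
    moreover have "0 <= Re (hform A v)"
     using A m by (auto simp: K_def intro!: order_trans[OF _ spec[of "%v. m * (norm v)^2 <= Re (hform A v)" v]])
    moreover have "Re (hform A v) <= \<bar>M\<bar> * 2^2"
    proof -
     have "Re (hform A v) <= M * (norm v)^2" using A by (simp add: K_def)
     also have "... <= \<bar>M\<bar> * 2^2" using that by (intro mult_mono power_mono) auto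
     finally show ?thesis .
    qed
    ultimately show ?thesis by (simp add: norm_complex_def)
   qed
   have n2: "norm (axis j 1 + c *s axis k 1 :: complex^'n) <= 2" if "cmod c = 1" for c
   proof -
    have "c *s axis k 1 = (axis k c :: complex^'n)" by (simp add: vec_eq_iff axis_def)
    moreover have "norm (axis k c :: complex^'n) = 1" using that by (simp add: norm_axis_eq)
    ultimately show ?thesis
     using norm_triangle_ineq[of "axis j 1 :: complex^'n" "c *s axis k 1"] by simp
   qed
   have "norm (4 * A $ j $ k) <= 4 * \<bar>M\<bar> + 4 * \<bar>M\<bar> + 4 * \<bar>M\<bar> + 4 * \<bar>M\<bar>"
    unfolding hform_polarization[symmetric]
    by (intro order_trans[OF norm_triangle_ineq4] order_trans[OF norm_triangle_ineq] add_mono)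
     (simp_all only: norm_mult norm_ii mult_1_left, (intro h n2; simp)+)
   thus ?thesis by simp
  qed
  have "norm A <= (\<Sum>j\<in>(UNIV::'n set). \<Sum>k\<in>(UNIV::'n set). 4 * \<bar>M\<bar>)" if A: "A \<in> K" for A
  proof -
   have "norm A <= (\<Sum>j\<in>UNIV. norm (A $ j))" by (rule norm_vec_le_sum)
   also have "... <= (\<Sum>j\<in>UNIV. \<Sum>k\<in>UNIV. norm (A $ j $ k))" by (intro sum_mono norm_vec_le_sum)
   also have "... <= (\<Sum>j\<in>(UNIV::'n set). \<Sum>k\<in>(UNIV::'n set). 4 * \<bar>M\<bar>)" by (intro sum_mono ent A)
   finally show ?thesis .
  qed
  thus ?thesis unfolding bounded_iff by blast
 qed
 ultimately have "compact K" by (simp add: compact_eq_bounded_closed)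
 show thesis
 proof (cases "K = {}")
  case True
  show thesis
  proof (rule that[of 1 1])
   fix A :: "complex^'n^'n"
   assume "hermitian A" "!!v. m * (norm v)^2 <= Re (hform A v)" "!!v. Re (hform A v) <= M * (norm v)^2"
   hence "A \<in> K" by (simp add: K_def)
   thus "1 <= Re (det A) \<and> Re (det A) <= 1" using True by simp
  qed simp_all
 next
  case False
  have cd: "continuous_on K (%A. Re (det A))"
   by (intro continuous_intros continuous_on_det continuous_on_subset[OF cont_e]) auto
  obtain A1 where A1: "A1 \<in> K" "!!A. A \<in> K ==> Re (det A1) <= Re (det A)"
   using continuous_attains_inf[OF \<open>compact K\<close> False cd] by blast
  obtain A2 where A2: "A2 \<in> K" "!!A. A \<in> K ==> Re (det A) <= Re (det A2)"
   using continuous_attains_sup[OF \<open>compact K\<close> False cd] by blast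
  have pos: "0 < Re (det A)" if "A \<in> K" for A
  proof (rule posdef_det_pos)
   show "hermitian A" using that by (simp add: K_def)
   fix v :: "complex^'n" assume "v ~= 0"
   hence "0 < m * (norm v)^2" using m by simp
   also have "... <= Re (hform A v)" using that by (simp add: K_def)
   finally show "0 < Re (hform A v)" .
  qed
  show thesis
   by (rule that[of "Re (det A1)" "Re (det A2)"]) (use A1 A2 pos in \<open>auto simp: K_def\<close>)
 qed
qed

subsection \<open>Weights and doubling\<close>

lemma power_le_fact_exp: "0 <= y ==> y ^ k <= fact k * exp (y::real)"
proof -
 assume y: "0 <= y"
 have "y ^ k /\<^sub>R fact k <= (\<Sum>n. y ^ n /\<^sub>R fact n)"
  using sum_le_suminf[OF summable_exp_generic[of y], of "{k}"] y by simp
 thus ?thesis by (simp add: exp_def field_simps)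
qed

lemma poly_exp_bound:
 assumes "0 < \<kappa>"
 obtains C where "0 < C" "!!x. 0 <= x ==> (1 + x) ^ L * exp (- (\<kappa> * x)) <= (C::real)"
proof
 show "0 < fact L * exp \<kappa> / \<kappa> ^ L" using assms by simp
 fix x :: real assume x: "0 <= x"
 have "(\<kappa> + \<kappa> * x) ^ L <= fact L * exp (\<kappa> + \<kappa> * x)"
  using x assms by (intro power_le_fact_exp) simp
 moreover have "(\<kappa> + \<kappa> * x) ^ L = \<kappa> ^ L * (1 + x) ^ L" by (simp add: power_mult_distrib[symmetric] distrib_left)
 ultimately have "\<kappa> ^ L * ((1 + x) ^ L * exp (- (\<kappa> * x))) <= fact L * exp \<kappa>"
  by (simp add: exp_add exp_minus field_simps)
 thus "(1 + x) ^ L * exp (- (\<kappa> * x)) <= fact L * exp \<kappa> / \<kappa> ^ L"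
  using assms by (simp add: field_simps)
qed

locale S_weight =
 fixes \<rho> :: "complex^'n::finite => real" and c0 :: real
 assumes rho_meas [measurable]: "\<rho> \<in> bm borel"
  and rho_pos: "!!z. 0 < \<rho> z" and c0: "1 <= c0"
  and rho_low: "!!z w. dist w z < \<rho> w ==> \<rho> w / c0 <= \<rho> z"
  and rho_up: "!!z w. dist w z < \<rho> w ==> \<rho> z <= c0 * \<rho> w"
begin

lemma rho_comparable:
 assumes "dist z w < max (\<rho> z) (\<rho> w)"
 shows "\<rho> z <= c0 * \<rho> w" "\<rho> w <= c0 * \<rho> z"
proof -
 have "\<rho> z <= c0 * \<rho> w \<and> \<rho> w <= c0 * \<rho> z"
 proof (cases "dist z w < \<rho> z")
  case True
  thus ?thesis using rho_low[OF True] rho_up[OF True] c0 by (simp add: field_simps)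
 next
  case False
  hence "dist w z < \<rho> w" using assms by (simp add: dist_commute less_max_iff_disj)
  thus ?thesis using rho_low rho_up c0 by (auto simp: field_simps)
 qed
 thus "\<rho> z <= c0 * \<rho> w" "\<rho> w <= c0 * \<rho> z" by auto
qed

end

lemma S_weight_exists:
 assumes "\<rho> \<in> class_S"
 obtains c0 where "S_weight \<rho> c0"
proof -
 from assms obtain c0 where "1 <= c0" "\<forall>w. \<forall>z\<in>ball w (\<rho> w). \<rho> w / c0 <= \<rho> z \<and> \<rho> z <= c0 * \<rho> w"
  "\<rho> \<in> bm borel" "\<forall>z. 0 < \<rho> z" by (auto simp: class_S_def)
 hence "S_weight \<rho> c0" by unfold_locales auto
 thus thesis by (rule that)
qed

text \<open>Multiplied by \<rho>^2 the Levi matrix is pinched between \<open>m\<close> and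
  \<open>M\<close> at every point, and the determinant then scales by \<rho>^(2n).\<close>

lemma MA_density_bounds:
 fixes \<rho> \<phi>t :: "complex^'n::finite => real"
 assumes rho: "!!z. 0 < \<rho> z" and reg: "regularization \<rho> \<phi> \<phi>t"
 obtains a1 a2 where "0 < a1" "0 < a2"
  "!!z. a1 / \<rho> z ^ (2 * CARD('n)) <= Re (top_coeff (wpow2 (i_del_dbar_form (%x. of_real (\<phi>t x)) z) CARD('n)))"
  "!!z. Re (top_coeff (wpow2 (i_del_dbar_form (%x. of_real (\<phi>t x)) z) CARD('n))) <= a2 / \<rho> z ^ (2 * CARD('n))"
proof -
 let ?n = "CARD('n)"
 from reg obtain m M :: real where m: "0 < m" "m <= M"
  and b: "!!z. form11_le (fscale (of_real m) (omega \<rho> z)) (i_del_dbar_form (%x. of_real (\<phi>t x)) z)"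
   "!!z. form11_le (i_del_dbar_form (%x. of_real (\<phi>t x)) z) (fscale (of_real M) (omega \<rho> z))"
  and C2: "Ck2 \<phi>t"
  by (auto simp: regularization_def strictly_psh_C2_def numeral_2_eq_2)
 have levi1: "levi (%x. (norm x)^2) z = (mat 1 :: complex^'n^'n)" for z
 proof -
  have d: "(%x. cor ((norm x)^2)) = dist2 (0 :: complex^'n)" by (simp add: dist2_def fun_eq_iff)
  have C: "Ck2 (%x::complex^'n. (norm x)^2)" using Ck_norm_sq[of _ 0] by simp
  have "levi (%x. (norm x)^2) z $ j $ k = pd_zbar k (pd_z j (%x. cor ((norm x)^2))) z" for j k
   unfolding levi_def vec_lambda_beta levi_hessian[OF C]
   by (simp add: hessian_sym[OF C, of z "axis j 1" "axis k 1"] hessian_sym[OF C, of z "axis j 1" "axis k \<i>"]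
    hessian_sym[OF C, of z "axis j \<i>" "axis k 1"] hessian_sym[OF C, of z "axis j \<i>" "axis k \<i>"])
  thus ?thesis unfolding d by (simp add: vec_eq_iff mat_def pd_zbar_dist2)
 qed
 have om: "form11_val (fscale (of_real c) (omega \<rho> z)) v = c * (\<rho> z powi (-2) * (2 * (norm v)^2))" for c z v
  unfolding omega_def form11_val_fscale form11_val_levi levi1 hform_mat1 by simp
 \<comment> \<open>The zero second summand only gives the scaled matrix the shape required by
   \<open>hform_add_scale\<close>.\<close>
 have h1: "m * (norm v)^2 <= Re (hform (\<chi> j k. of_real ((\<rho> z)^2) * levi \<phi>t z $ j $ k + of_real 0 * (0 :: complex^'n^'n) $ j $ k) v)" for z v
 proof -
  have "m * (\<rho> z powi (-2) * (2 * (norm v)^2)) <= 2 * Re (hform (levi \<phi>t z) v)"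
   using b(1)[of z] unfolding form11_le_def om form11_val_levi by blast
  thus ?thesis using rho[of z] unfolding hform_add_scale by (simp add: power_int_minus field_simps)
 qed
 have h2: "Re (hform (\<chi> j k. of_real ((\<rho> z)^2) * levi \<phi>t z $ j $ k + of_real 0 * (0 :: complex^'n^'n) $ j $ k) v) <= M * (norm v)^2" for z v
 proof -
  have "2 * Re (hform (levi \<phi>t z) v) <= M * (\<rho> z powi (-2) * (2 * (norm v)^2))"
   using b(2)[of z] unfolding form11_le_def om form11_val_levi by blast
  thus ?thesis using rho[of z] unfolding hform_add_scale by (simp add: power_int_minus field_simps)
 qed
 obtain c1 c2 where c: "0 < c1" "0 < c2"
  "!!A :: complex^'n^'n. hermitian A ==> (!!v. m * (norm v)^2 <= Re (hform A v)) ==> (!!v. Re (hform A v) <= M * (norm v)^2) ==>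
    c1 <= Re (det A) \<and> Re (det A) <= c2"
 proof -
  obtain c1 c2 where "0 < c1" "0 < c2"
   and *: "!!A :: complex^'n^'n. hermitian A ==> (!!v. m * (norm v)^2 <= Re (hform A v)) ==> (!!v. Re (hform A v) <= M * (norm v)^2) ==>
    c1 <= Re (det A) \<and> Re (det A) <= c2"
   using hermitian_pinched_det[OF m(1), where M=M and 'n='n] by (smt (verit, best))
  thus thesis by (rule that)
 qed
 have d: "c1 <= (\<rho> z) ^ (2 * ?n) * Re (det (levi \<phi>t z)) \<and> (\<rho> z) ^ (2 * ?n) * Re (det (levi \<phi>t z)) <= c2" for z
 proof -
  let ?A = "\<chi> j k. of_real ((\<rho> z)^2) * levi \<phi>t z $ j $ k + of_real 0 * (0 :: complex^'n^'n) $ j $ k"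
  have h: "hermitian ?A" using hermitian_levi[OF C2, of z] by (simp add: hermitian_def)
  have "?A = (\<chi> j. of_real ((\<rho> z)^2) *s levi \<phi>t z $ j)" by (simp add: vec_eq_iff)
  hence "det ?A = of_real ((\<rho> z)^2) ^ ?n * det (levi \<phi>t z)" by (simp only: det_rows_mul) simp
  also have "... = of_real ((\<rho> z) ^ (2 * ?n)) * det (levi \<phi>t z)" by (simp add: power_mult)
  finally have "Re (det ?A) = (\<rho> z) ^ (2 * ?n) * Re (det (levi \<phi>t z))" by simp
  thus ?thesis using c(3)[OF h h1 h2] by metis
 qed
 have t: "Re (top_coeff (wpow2 (i_del_dbar_form (%x. of_real (\<phi>t x)) z) ?n)) = 2 ^ ?n * fact ?n * Re (det (levi \<phi>t z))" for z
 proof -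
  have c: "(2 ^ ?n * fact ?n :: complex) = of_real (2 ^ ?n * fact ?n)" by simp
  show ?thesis unfolding top_coeff_levi c by simp
 qed
 show thesis
 proof (rule that[of "2 ^ ?n * fact ?n * c1" "2 ^ ?n * fact ?n * c2"])
  have p: "0 < \<rho> z ^ (2 * ?n)" for z using rho by simp
  show "2 ^ ?n * fact ?n * c1 / \<rho> z ^ (2 * ?n) <= Re (top_coeff (wpow2 (i_del_dbar_form (%x. of_real (\<phi>t x)) z) ?n))" for z
   unfolding t using d[of z] p[of z] by (simp add: pos_divide_le_eq mult_ac)
  show "Re (top_coeff (wpow2 (i_del_dbar_form (%x. of_real (\<phi>t x)) z) ?n)) <= 2 ^ ?n * fact ?n * c2 / \<rho> z ^ (2 * ?n)" for z
   unfolding t using d[of z] p[of z] by (simp add: pos_le_divide_eq mult_ac)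
 qed (use c in auto)
qed

lemma exists_power_bracket:
 fixes B x :: real
 assumes "1 < B" "1 <= x"
 obtains k where "B ^ k <= x" "x < B ^ Suc k"
proof -
 have ex: "\<exists>m. x < B ^ m" using real_arch_pow[OF assms(1)] by auto
 define m where "m = (LEAST m. x < B ^ m)"
 have m: "x < B ^ m" unfolding m_def by (rule LeastI_ex[OF ex])
 have "m ~= 0" using m assms by (intro notI) simp
 then obtain k where k: "m = Suc k" using not0_implies_Suc by blast
 have "\<not> x < B ^ k" using not_less_Least[of k "%m. x < B ^ m"] k m_def by auto
 thus thesis using that[of k] m k by simp
qed

context S_weight
begin

text \<open>Doubling and reverse doubling of the Monge--Ampere measure compare \<open>r / \<rho>\<close> at two points of distance \<open>r\<close>.\<close>
lemma doubling_comparison: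
 fixes H :: "complex^'n => real"
 assumes [measurable]: "H \<in> bm borel" and a: "0 < a1" "0 < a2"
  and H: "!!z. a1 / \<rho> z ^ (2 * CARD('n)) <= H z" "!!z. H z <= a2 / \<rho> z ^ (2 * CARD('n))"
  and db: "doubling (density lborel (%z. ennreal (H z)))"
 obtains A N where "1 <= A" "0 < N" "!!z w. \<rho> z <= dist z w ==> \<rho> w <= dist z w ==> dist z w / \<rho> z <= A * (dist z w / \<rho> w) ^ N"
proof -
 let ?D = "2 * CARD('n)"
 define \<mu> where "\<mu> = density lborel (%z. ennreal (H z))"
 obtain C' :: real where C': "!!z r. 0 < r ==> emeasure \<mu> (ball z (2 * r)) <= ennreal C' * emeasure \<mu> (ball z r)"
  using db unfolding doubling_def \<mu>_def by auto
 define C where "C = max C' 1"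
 have C: "1 <= C" "!!z r. 0 < r ==> emeasure \<mu> (ball z (2 * r)) <= ennreal C * emeasure \<mu> (ball z r)"
 proof -
  show "1 <= C" by (simp add: C_def)
  fix z r assume r: "(0::real) < r"
  have "ennreal C' * emeasure \<mu> (ball z r) <= ennreal C * emeasure \<mu> (ball z r)"
   by (intro mult_right_mono ennreal_leI) (auto simp: C_def)
  thus "emeasure \<mu> (ball z (2 * r)) <= ennreal C * emeasure \<mu> (ball z r)" using C'[OF r] order_trans by blast
 qed
 have sets: "S \<in> sets \<mu>" if "S \<in> sets borel" for S using that by (simp add: \<mu>_def)
 have em: "emeasure \<mu> (ball z r) = (\<integral>\<^sup>+x. ennreal (H x) * indicator (ball z r) x \<partial>lborel)" for z r
  unfolding \<mu>_def by (subst emeasure_density) auto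
 let ?V = "ubv TYPE(complex^'n)"
 \<comment> \<open>\<open>b1\<close> and \<open>b2\<close> enclose the measure of
   \<open>ball z (\<rho> z)\<close> for all \<open>z\<close>: the density is of order \<rho>^(-2n)
   and the volume of order \<rho>^(2n), with \<rho> comparable to \<open>\<rho> z\<close> on the
   ball.\<close>
 define b1 where "b1 = a1 / c0 ^ ?D * ?V"
 define b2 where "b2 = a2 * c0 ^ ?D * ?V"
 have V: "0 < ?V" by simp
 have b: "0 < b1" "0 < b2" using a c0 V by (auto simp: b1_def b2_def)
 have vol: "emeasure lborel (ball z (\<rho> z)) = ennreal (?V * \<rho> z ^ ?D)" for z
  using rho_pos[of z] by (simp add: emeasure_ball mult.commute)
 have lo: "ennreal b1 <= emeasure \<mu> (ball z (\<rho> z))" for z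
 proof -
  have "ennreal b1 = ennreal (a1 / (c0 * \<rho> z) ^ ?D) * emeasure lborel (ball z (\<rho> z))"
   unfolding vol using a c0 rho_pos[of z] by (subst ennreal_mult'[symmetric]) (auto simp: b1_def power_mult_distrib field_simps)
  also have "... = (\<integral>\<^sup>+x. ennreal (a1 / (c0 * \<rho> z) ^ ?D) * indicator (ball z (\<rho> z)) x \<partial>lborel)"
   by (simp add: nn_integral_cmult_indicator)
  also have "... <= emeasure \<mu> (ball z (\<rho> z))" unfolding em
  proof (rule nn_integral_mono)
   fix x
   show "ennreal (a1 / (c0 * \<rho> z) ^ ?D) * indicator (ball z (\<rho> z)) x <= ennreal (H x) * indicator (ball z (\<rho> z)) x"
   proof (cases "x \<in> ball z (\<rho> z)")
    case True
    hence "\<rho> x <= c0 * \<rho> z" by (intro rho_up) simp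
    hence "a1 / (c0 * \<rho> z) ^ ?D <= a1 / \<rho> x ^ ?D"
     using rho_pos[of x] a c0 rho_pos[of z] by (intro divide_left_mono power_mono) auto
    thus ?thesis using True H(1)[of x] by (auto intro!: ennreal_leI)
   qed simp
  qed
  finally show ?thesis .
 qed
 have up: "emeasure \<mu> (ball z (\<rho> z)) <= ennreal b2" for z
 proof -
  have "emeasure \<mu> (ball z (\<rho> z)) <= (\<integral>\<^sup>+x. ennreal (a2 / (\<rho> z / c0) ^ ?D) * indicator (ball z (\<rho> z)) x \<partial>lborel)" unfolding em
  proof (rule nn_integral_mono)
   fix x
   show "ennreal (H x) * indicator (ball z (\<rho> z)) x <= ennreal (a2 / (\<rho> z / c0) ^ ?D) * indicator (ball z (\<rho> z)) x"
   proof (cases "x \<in> ball z (\<rho> z)")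
    case True
    hence "\<rho> z / c0 <= \<rho> x" by (intro rho_low) simp
    hence "a2 / \<rho> x ^ ?D <= a2 / (\<rho> z / c0) ^ ?D"
     using rho_pos[of x] a c0 rho_pos[of z] by (intro divide_left_mono power_mono) auto
    thus ?thesis using True H(2)[of x] by (auto intro!: ennreal_leI)
   qed simp
  qed
  also have "... = ennreal (a2 / (\<rho> z / c0) ^ ?D) * emeasure lborel (ball z (\<rho> z))"
   by (simp add: nn_integral_cmult_indicator)
  also have "... = ennreal b2"
   unfolding vol using a c0 rho_pos[of z] by (subst ennreal_mult'[symmetric]) (auto simp: b2_def power_divide field_simps)
  finally show ?thesis .
 qed
 have pow2: "emeasure \<mu> (ball z (2 ^ k * r)) <= ennreal (C ^ k) * emeasure \<mu> (ball z r)" if r: "0 < r" for z r k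
 proof (induction k)
  case (Suc k)
  have "emeasure \<mu> (ball z (2 ^ Suc k * r)) = emeasure \<mu> (ball z (2 * (2 ^ k * r)))" by (simp add: mult.assoc)
  also have "... <= ennreal C * emeasure \<mu> (ball z (2 ^ k * r))" using r by (intro C(2)) simp
  also have "... <= ennreal C * (ennreal (C ^ k) * emeasure \<mu> (ball z r))" by (intro mult_left_mono Suc) auto
  also have "... = ennreal (C ^ Suc k) * emeasure \<mu> (ball z r)"
   using C(1) by (simp add: ennreal_mult' mult.assoc)
  finally show ?case .
 qed simp
 have mono: "emeasure \<mu> (ball z r) <= emeasure \<mu> (ball w s)" if "ball z r \<subseteq> ball w s" for z w r s
  by (rule emeasure_mono[OF that]) (intro sets ball_measurable)
 have fin: "emeasure \<mu> (ball z r) < \<infinity>" for z r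
 proof -
  obtain k where "r / \<rho> z < 2 ^ k" using real_arch_pow[of 2 "r / \<rho> z"] by auto
  hence "ball z r \<subseteq> ball z (2 ^ k * \<rho> z)" using rho_pos[of z] by (intro subset_ball) (simp add: field_simps)
  hence "emeasure \<mu> (ball z r) <= emeasure \<mu> (ball z (2 ^ k * \<rho> z))" by (rule mono)
  also have "... <= ennreal (C ^ k) * emeasure \<mu> (ball z (\<rho> z))" by (rule pow2[OF rho_pos])
  also have "... <= ennreal (C ^ k) * ennreal b2" by (intro mult_left_mono up) auto
  also have "... < \<infinity>" by (simp add: ennreal_mult_less_top)
  finally show ?thesis .
 qed
 define B where "B z r = measure \<mu> (ball z r)" for z r
 have eB: "emeasure \<mu> (ball z r) = ennreal (B z r)" for z r
  unfolding B_def using fin[of z r] by (intro emeasure_eq_ennreal_measure) auto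
 have B0: "0 <= B z r" for z r by (simp add: B_def)
 have Bmono: "B z r <= B w s" if "ball z r \<subseteq> ball w s" for z w r s
  using mono[OF that] unfolding eB using B0 by (simp add: ennreal_le_iff)
 have Bpow: "B z (2 ^ k * r) <= C ^ k * B z r" if "0 < r" for z r k
  using pow2[OF that, of z k] unfolding eB using B0 C(1) by (simp add: ennreal_mult'[symmetric] ennreal_le_iff mult_nonneg_nonneg)
 have Blo: "b1 <= B z (\<rho> z)" and Bup: "B z (\<rho> z) <= b2" for z
  using lo[of z] up[of z] unfolding eB using B0 b by (auto simp: ennreal_le_iff)
 \<comment> \<open>Reverse doubling: \<open>ball x (3 * r)\<close> also contains a disjoint ball of
   radius \<open>r\<close> centred at distance \<open>2 * r\<close>, and doubling that one twice
   covers \<open>ball x r\<close>, so its mass is at least \<open>B x r / C ^ 2\<close>.\<close>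
 define \<theta> where "\<theta> = 1 + 1 / C ^ 2"
 have \<theta>: "1 < \<theta>" using C(1) by (simp add: \<theta>_def)
 have rev1: "\<theta> * B x r <= B x (3 * r)" if r: "0 < r" for x r
 proof -
  define x' where "x' = x + axis undefined (of_real (2 * r))"
  have dx: "dist x' x = 2 * r" using r by (simp add: x'_def dist_norm norm_axis_eq)
  have s1: "ball x r \<subseteq> ball x' (2 ^ 2 * r)"
  proof
   fix y assume "y \<in> ball x r"
   thus "y \<in> ball x' (2 ^ 2 * r)" using dx dist_triangle[of x' y x] r by (simp add: dist_commute)
  qed
  have s2: "ball x' r \<subseteq> ball x (3 * r)"
  proof
   fix y assume "y \<in> ball x' r"
   thus "y \<in> ball x (3 * r)" using dx dist_triangle[of x y x'] r by (simp add: dist_commute)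
  qed
  have disj: "ball x r \<inter> ball x' r = {}"
  proof (rule ccontr)
   assume "ball x r \<inter> ball x' r ~= {}"
   then obtain y where "dist x y < r" "dist x' y < r" by auto
   thus False using dx dist_triangle[of x' x y] by (simp add: dist_commute)
  qed
  have "B x r <= C ^ 2 * B x' r" using Bmono[OF s1] Bpow[OF r, of x' 2] by linarith
  hence "B x r / C ^ 2 <= B x' r" using C(1) by (simp add: field_simps)
  moreover have "B x r + B x' r = measure \<mu> (ball x r \<union> ball x' r)"
   unfolding B_def using fin[of x r] fin[of x' r] disj
   by (intro measure_Union[symmetric]) (auto intro: sets ball_measurable)
  moreover have "measure \<mu> (ball x r \<union> ball x' r) <= B x (3 * r)"
   unfolding B_def
  proof (rule measure_mono_fmeasurable)
   show "ball x r \<union> ball x' r \<subseteq> ball x (3 * r)" using s2 r by auto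
   show "ball x r \<union> ball x' r \<in> sets \<mu>" by (intro sets) auto
   show "ball x (3 * r) \<in> fmeasurable \<mu>" using fin[of x "3 * r"] by (intro fmeasurableI sets ball_measurable)
  qed
  ultimately show ?thesis by (simp add: \<theta>_def algebra_simps)
 qed
 have rev: "\<theta> ^ k * B x r <= B x (3 ^ k * r)" if r: "0 < r" for x r k
 proof (induction k)
  case (Suc k)
  have "\<theta> ^ Suc k * B x r = \<theta> * (\<theta> ^ k * B x r)" by simp
  also have "... <= \<theta> * B x (3 ^ k * r)" using \<theta> by (intro mult_left_mono Suc) auto
  also have "... <= B x (3 * (3 ^ k * r))" using r by (intro rev1) simp
  finally show ?case by (simp add: mult.assoc)
 qed simp
 \<comment> \<open>\<open>p\<close> and \<open>s\<close> translate growth of mass into growth of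
   radius: p triplings of the radius multiply the mass by more than 3, one doubling by less than
   \<open>2 ^ s\<close>. The exponent \<open>s * p\<close> results.\<close>
 obtain p where p: "3 < \<theta> ^ p" using real_arch_pow[OF \<theta>] by blast
 obtain s where s: "C < 2 ^ s" using real_arch_pow[of 2 C] by auto
 let ?q = "b2 / b1"
 define A where "A = max 1 (3 * ?q ^ p * 4 ^ (s * p))"
 have main: "dist z w / \<rho> z <= A * (dist z w / \<rho> w) ^ (s * p)" if r: "\<rho> z <= dist z w" "\<rho> w <= dist z w" for z w
 proof -
  let ?r = "dist z w"
  have r0: "0 < ?r" using r rho_pos[of z] by linarith
  have x1: "1 <= ?r / \<rho> z" "1 <= ?r / \<rho> w" using r rho_pos[of z] rho_pos[of w] by (simp_all add: field_simps)
  obtain k where k: "3 ^ k <= ?r / \<rho> z" "?r / \<rho> z < 3 ^ Suc k" by (rule exists_power_bracket[OF _ x1(1), of 3]) auto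
  obtain l where l: "2 ^ l <= ?r / \<rho> w" "?r / \<rho> w < 2 ^ Suc l" by (rule exists_power_bracket[OF _ x1(2), of 2]) auto
  have "\<theta> ^ k * b1 <= \<theta> ^ k * B z (\<rho> z)" using \<theta> by (intro mult_left_mono Blo) auto
  also have "... <= B z (3 ^ k * \<rho> z)" by (rule rev[OF rho_pos])
  also have "... <= B z ?r" using k(1) rho_pos[of z] by (intro Bmono subset_ball) (simp add: field_simps)
  also have "... <= B w (2 ^ (l + 2) * \<rho> w)"
  proof (rule Bmono, rule subsetI)
   fix y assume "y \<in> ball z ?r"
   hence "dist w y < 2 * ?r" using dist_triangle[of w y z] by (simp add: dist_commute)
   also have "... <= 2 ^ (l + 2) * \<rho> w" using l(2) rho_pos[of w] by (simp add: field_simps)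
   finally show "y \<in> ball w (2 ^ (l + 2) * \<rho> w)" by simp
  qed
  also have "... <= C ^ (l + 2) * B w (\<rho> w)" by (rule Bpow[OF rho_pos])
  also have "... <= C ^ (l + 2) * b2" using C(1) by (intro mult_left_mono Bup) auto
  also have "... <= (2 ^ s) ^ (l + 2) * b2" using C(1) s b by (intro mult_right_mono power_mono) auto
  finally have "\<theta> ^ k <= ?q * (2 ^ s) ^ (l + 2)" using b by (simp add: field_simps)
  also have "(2 ^ s) ^ (l + 2) = (2 ^ (l + 2) :: real) ^ s" by (simp only: power_mult[symmetric] mult.commute)
  also have "?q * (2 ^ (l + 2)) ^ s <= ?q * (4 * (?r / \<rho> w)) ^ s"
   using l(1) b by (intro mult_left_mono power_mono) (auto simp: power_add)
  finally have th: "\<theta> ^ k <= ?q * (4 * (?r / \<rho> w)) ^ s" .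
  have "3 ^ k <= (\<theta> ^ p) ^ k" using p by (intro power_mono) auto
  also have "... = (\<theta> ^ k) ^ p" by (simp only: power_mult[symmetric] mult.commute)
  also have "... <= (?q * (4 * (?r / \<rho> w)) ^ s) ^ p" using th \<theta> by (intro power_mono) auto
  also have "... = ?q ^ p * 4 ^ (s * p) * (?r / \<rho> w) ^ (s * p)" by (simp only: power_mult_distrib power_mult[symmetric] mult.assoc)
  finally have "?r / \<rho> z <= 3 * ?q ^ p * 4 ^ (s * p) * (?r / \<rho> w) ^ (s * p)" using k(2) by simp
  also have "... <= A * (?r / \<rho> w) ^ (s * p)" using rho_pos[of w] r0 by (intro mult_right_mono) (auto simp: A_def)
  finally show ?thesis .
 qed
 have "0 < s * p"
 proof -
  have "p ~= 0" using p by (intro notI) simp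
  moreover have "s ~= 0" using s C(1) by (intro notI) simp
  ultimately show ?thesis by simp
 qed
 thus thesis using main by (intro that[of A "s * p"]) (auto simp: A_def)
qed

end

section \<open>Convexity and pointwise estimates of the kernel\<close>

subsection \<open>Pinched convex functions\<close>

text \<open>As \<open>q\<close> is twice the holomorphic gradient, the real part of the pairing is
  the real differential of \<psi>. The modulus of the exponential therefore compares \<psi> with its
  tangent plane at \<open>x\<close>, which is where real convexity acts.\<close>

lemma Re_phase_dpsi:
 fixes \<psi> :: "complex^'n::finite => real"
 assumes \<psi>: "Ck2 \<psi>"
 shows "Re (phase (dpsi \<psi>) z x) = FD \<psi> (at x) (z - x)"
proof -
 let ?D = "FD \<psi> (at x)"
 have lin: "linear ?D" using has_derivative_linear[OF Ck_Suc_has_derivative[OF \<psi>]] .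
 have d: "FD (%x. cor (\<psi> x)) (at x) v = of_real (?D v)" for v
  by (rule frechet_of_real[OF Ck_differentiable[OF \<psi>]])
 have v: "v = (\<Sum>l\<in>UNIV. Re (v $ l) *\<^sub>R axis l 1 + Im (v $ l) *\<^sub>R axis l \<i>)" for v :: "complex^'n"
 proof (rule vec_eq_iff[THEN iffD2], rule allI)
  fix i
  have "(\<Sum>l\<in>UNIV. Re (v $ l) *\<^sub>R axis l 1 + Im (v $ l) *\<^sub>R axis l \<i>) $ i = (\<Sum>l\<in>UNIV. if l = i then v $ i else 0)"
   unfolding sum_component by (rule sum.cong) (auto simp: axis_def complex_eq_iff)
  thus "v $ i = (\<Sum>l\<in>UNIV. Re (v $ l) *\<^sub>R axis l 1 + Im (v $ l) *\<^sub>R axis l \<i>) $ i" by simp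
 qed
 have "?D (z - x) = (\<Sum>l\<in>UNIV. Re ((z - x) $ l) * ?D (axis l 1) + Im ((z - x) $ l) * ?D (axis l \<i>))"
  by (subst v) (simp add: linear_sum[OF lin] linear_add[OF lin] linear_scale[OF lin])
 also have "... = Re (phase (dpsi \<psi>) z x)"
  unfolding phase_def dpsi_def pd_z_def d Re_sum by (intro sum.cong refl) (simp add: algebra_simps add_divide_distrib)
 finally show ?thesis ..
qed

lemma hessian_add_right:
 assumes u: "Ck2 u"
 shows "hessian u z v (w + w') = hessian u z v w + hessian u z v w'"
 unfolding hessian_sym[OF u, of z v]
 unfolding hessian_def using has_derivative_linear[OF Ck_Suc_has_derivative[OF Ck_Suc_deriv[OF u]]] by (simp add: linear_add)

lemma hessian_add_left:
 assumes u: "Ck2 u"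
 shows "hessian u z (v + v') w = hessian u z v w + hessian u z v' w"
 unfolding hessian_def using has_derivative_linear[OF Ck_Suc_has_derivative[OF Ck_Suc_deriv[OF u]]] by (simp add: linear_add)

locale pinched = S_weight \<rho> c0 for \<rho> :: "complex^'n::finite => real" and c0 +
 fixes \<psi> :: "complex^'n => real" and m M :: real
 assumes psi: "Ck2 \<psi>" and m_pos: "0 < m" and M_ge: "m <= M"
  and hess_low: "!!z v. m / (\<rho> z)^2 * (norm v)^2 <= hessian \<psi> z v v"
  and hess_up: "!!z v. hessian \<psi> z v v <= M / (\<rho> z)^2 * (norm v)^2"
begin

abbreviation "D\<psi> x \<equiv> FD \<psi> (at x)"

lemma hess_nonneg: "0 <= hessian \<psi> z v v"
 using hess_low[of z v] m_pos by (meson divide_nonneg_nonneg less_imp_le mult_nonneg_nonneg order_trans zero_le_power2)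

lemma hess_bound:
 assumes "norm v = 1" "norm w = 1"
 shows "\<bar>hessian \<psi> z v w\<bar> <= 3 * M / (\<rho> z)^2"
proof -
 have M0: "0 <= M / (\<rho> z)^2" using m_pos M_ge by simp
 have "hessian \<psi> z (v + w) (v + w) = hessian \<psi> z v v + 2 * hessian \<psi> z v w + hessian \<psi> z w w"
  by (simp add: hessian_add_left[OF psi] hessian_add_right[OF psi] hessian_sym[OF psi, of z w v])
 moreover have "hessian \<psi> z (v + w) (v + w) <= M / (\<rho> z)^2 * 4"
 proof -
  have "norm (v + w) <= 2" using norm_triangle_ineq[of v w] assms by simp
  hence "(norm (v + w))^2 <= 2^2" by (intro power_mono) auto
  hence "M / (\<rho> z)^2 * (norm (v + w))^2 <= M / (\<rho> z)^2 * 4" using M0 by (intro mult_left_mono) auto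
  thus ?thesis using hess_up[of z "v + w"] by linarith
 qed
 ultimately show ?thesis
  using hess_nonneg[of z "v + w"] hess_nonneg[of z v] hess_nonneg[of z w] hess_up[of z v] hess_up[of z w] assms M0
  by (simp add: abs_le_iff)
qed

lemma dbar_mat_bound: "norm (dbar_mat (dpsi \<psi>) x $ j $ k) <= 6 * M / (\<rho> x)^2"
proof -
 have ax: "norm (axis i 1 :: complex^'n) = 1" "norm (axis i \<i> :: complex^'n) = 1" for i by simp_all
 have b: "norm (cor (hessian \<psi> x (axis k c) (axis j d))) <= 3 * M / (\<rho> x)^2"
  if "cmod c = 1" "cmod d = 1" for c d
  using hess_bound[of "axis k c" "axis j d" x] that by (simp add: norm_axis_eq)
 have "norm (of_real (hessian \<psi> x (axis k 1) (axis j 1)) - \<i> * of_real (hessian \<psi> x (axis k 1) (axis j \<i>))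
   + \<i> * of_real (hessian \<psi> x (axis k \<i>) (axis j 1)) + cor (hessian \<psi> x (axis k \<i>) (axis j \<i>))) <=
   3 * M / (\<rho> x)^2 + 3 * M / (\<rho> x)^2 + 3 * M / (\<rho> x)^2 + 3 * M / (\<rho> x)^2"
  by (intro order_trans[OF norm_triangle_ineq] order_trans[OF norm_triangle_ineq4] add_mono)
   (simp_all only: norm_mult norm_ii mult_1_left, (intro b; simp)+)
 hence "2 / 4 * norm (of_real (hessian \<psi> x (axis k 1) (axis j 1)) - \<i> * of_real (hessian \<psi> x (axis k 1) (axis j \<i>))
   + \<i> * of_real (hessian \<psi> x (axis k \<i>) (axis j 1)) + cor (hessian \<psi> x (axis k \<i>) (axis j \<i>))) <= 6 * M / (\<rho> x)^2"
  by simp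
 thus ?thesis unfolding dbar_mat_dpsi[OF psi] levi_hessian(2)[OF psi] by (simp only: norm_mult) simp
qed

lemma segment_derivs:
 "((%t. \<psi> (x + t *\<^sub>R v)) has_real_derivative D\<psi> (x + t *\<^sub>R v) v) (at t)"
 "((%t. D\<psi> (x + t *\<^sub>R v) v) has_real_derivative hessian \<psi> (x + t *\<^sub>R v) v v) (at t)"
 using has_real_derivative_line[OF psi] has_real_derivative_line[OF Ck_Suc_deriv[OF psi], of x v v]
 by (simp_all add: hessian_def)

lemma slope_mono: "s <= t ==> D\<psi> (x + s *\<^sub>R v) v <= D\<psi> (x + t *\<^sub>R v) v"
 by (rule DERIV_nonneg_imp_nondecreasing) (use segment_derivs(2) hess_nonneg in blast)+

lemma tangent_below_segment:
 assumes "s <= t"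
 shows "\<psi> (x + s *\<^sub>R v) + (t - s) * D\<psi> (x + s *\<^sub>R v) v <= \<psi> (x + t *\<^sub>R v)"
proof (cases "s = t")
 case False
 hence st: "s < t" using assms by simp
 obtain r where "s < r" "r < t" "\<psi> (x + t *\<^sub>R v) - \<psi> (x + s *\<^sub>R v) = (t - s) * D\<psi> (x + r *\<^sub>R v) v"
  using MVT2[OF st segment_derivs(1)] by blast
 moreover have "D\<psi> (x + s *\<^sub>R v) v <= D\<psi> (x + r *\<^sub>R v) v" using \<open>s < r\<close> by (intro slope_mono) simp
 ultimately show ?thesis by (smt (verit) mult_left_mono)
qed simp

text \<open>\<open>m / c0^2\<close> bounds the Hessian on \<open>ball x (\<rho> x)\<close> from
  below in units of \<open>\<rho> x\<close>. One factor 1 / 2 comes from gaining slope up to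
  distance \<open>\<rho> x / 2\<close>, the other from the remaining part of the segment, at least
  half of it, along which this slope persists.\<close>

definition \<kappa> :: real where "\<kappa> = m / c0^2 / 4"

lemma kappa_pos: "0 < \<kappa>"
 using m_pos c0 by (simp add: \<kappa>_def)

text \<open>Half of the available convexity is gained already on the first half of the segment inside \<open>ball x (\<rho> x)\<close>.\<close>
lemma convex_gain: "\<kappa> * (dist z x / \<rho> x - 1) <= \<psi> z - \<psi> x - D\<psi> x (z - x)"
proof -
 define v where "v = z - x"
 define d where "d = norm v / \<rho> x"
 have rho: "0 < \<rho> x" by (rule rho_pos)
 have z: "z = x + 1 *\<^sub>R v" by (simp add: v_def)
 have base: "\<psi> (x + 0 *\<^sub>R v) + (1 - 0) * D\<psi> (x + 0 *\<^sub>R v) v <= \<psi> (x + 1 *\<^sub>R v)" by (rule tangent_below_segment) simp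
 show ?thesis
 proof (cases "d < 1")
  case True
  \<comment> \<open>The subtracted 1 makes the claim nonpositive on the left here, so plain
    convexity suffices inside the ball.\<close>
  hence "\<kappa> * (d - 1) <= 0" using kappa_pos by (simp add: mult_nonneg_nonpos)
  thus ?thesis using base by (simp add: z d_def dist_norm)
 next
  case False
  hence d1: "1 <= d" by simp
  \<comment> \<open>This puts \<open>x + t *\<^sub>R v\<close> at distance
    \<open>\<rho> x / 2\<close> from \<open>x\<close>, within the range where the weight is
    comparable to \<open>\<rho> x\<close>.\<close>
  define t where "t = 1 / (2 * d)"
  have t: "0 < t" "t <= 1 / 2" using d1 by (auto simp: t_def)
  have grow: "m / c0^2 / (\<rho> x)^2 * (norm v)^2 <= hessian \<psi> (x + r *\<^sub>R v) v v" if r: "0 < r" "r < t" for r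
  proof -
   have "norm (r *\<^sub>R v) < \<rho> x"
   proof -
    have "norm (r *\<^sub>R v) = r * d * \<rho> x" using r rho by (simp add: d_def)
    also have "... <= t * d * \<rho> x" using r rho d1 by (intro mult_right_mono) auto
    also have "... < \<rho> x" using d1 rho by (simp add: t_def)
    finally show ?thesis .
   qed
   hence "\<rho> (x + r *\<^sub>R v) <= c0 * \<rho> x" by (intro rho_up) (simp add: dist_norm)
   hence "(\<rho> (x + r *\<^sub>R v))^2 <= (c0 * \<rho> x)^2" using rho_pos[of "x + r *\<^sub>R v"] by (intro power_mono) auto
   hence "m / (c0 * \<rho> x)^2 <= m / (\<rho> (x + r *\<^sub>R v))^2"
    using m_pos rho c0 rho_pos[of "x + r *\<^sub>R v"] by (intro divide_left_mono) auto
   hence "m / (c0 * \<rho> x)^2 * (norm v)^2 <= m / (\<rho> (x + r *\<^sub>R v))^2 * (norm v)^2" by (rule mult_right_mono) simp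
   thus ?thesis using hess_low[of "x + r *\<^sub>R v" v] by (simp add: power_mult_distrib)
  qed
  obtain r where r: "0 < r" "r < t" "D\<psi> (x + t *\<^sub>R v) v - D\<psi> (x + 0 *\<^sub>R v) v = (t - 0) * hessian \<psi> (x + r *\<^sub>R v) v v"
   using MVT2[OF t(1) segment_derivs(2)] by blast
  have "t * (m / c0^2 / (\<rho> x)^2 * (norm v)^2) <= D\<psi> (x + t *\<^sub>R v) v - D\<psi> x v"
   using mult_left_mono[OF grow[OF r(1,2)], of t] t(1) r(3) by simp
  moreover have "t * (m / c0^2 / (\<rho> x)^2 * (norm v)^2) = 2 * \<kappa> * d"
   using d1 rho by (simp add: t_def d_def \<kappa>_def power2_eq_square)
  ultimately have s: "D\<psi> x v + 2 * \<kappa> * d <= D\<psi> (x + t *\<^sub>R v) v" by simp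
  have "\<psi> x + t * D\<psi> x v <= \<psi> (x + t *\<^sub>R v)"
   using tangent_below_segment[of 0 t x v] t by simp
  moreover have "\<psi> (x + t *\<^sub>R v) + (1 - t) * D\<psi> (x + t *\<^sub>R v) v <= \<psi> (x + 1 *\<^sub>R v)"
   using t by (intro tangent_below_segment) simp
  moreover have "(1 - t) * (D\<psi> x v + 2 * \<kappa> * d) <= (1 - t) * D\<psi> (x + t *\<^sub>R v) v"
   using t s by (intro mult_left_mono) auto
  moreover have "\<kappa> * d <= (1 - t) * (2 * \<kappa> * d)"
  proof -
   have "(1 / 2) * (2 * \<kappa> * d) <= (1 - t) * (2 * \<kappa> * d)" using t kappa_pos d1 by (intro mult_right_mono) auto
   thus ?thesis by simp
  qed
  ultimately have "\<kappa> * d <= \<psi> z - \<psi> x - D\<psi> x v" by (simp add: z algebra_simps)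
  moreover have "\<kappa> * (d - 1) <= \<kappa> * d" using kappa_pos by simp
  ultimately show ?thesis by (simp add: d_def dist_norm v_def)
 qed
qed

lemma quadratic_upper:
 assumes "dist z x < \<rho> x"
 shows "\<psi> z - \<psi> x - D\<psi> x (z - x) <= M * c0^2"
proof -
 define v where "v = z - x"
 have nv: "norm v < \<rho> x" using assms by (simp add: v_def dist_norm)
 have rho: "0 < \<rho> x" by (rule rho_pos)
 have hb: "hessian \<psi> (x + r *\<^sub>R v) v v <= M * c0^2" if r: "0 < r" "r < 1" for r
 proof -
  have "norm (r *\<^sub>R v) <= norm v" using r by (simp add: mult_left_le_one_le)
  hence "\<rho> x / c0 <= \<rho> (x + r *\<^sub>R v)" using nv by (intro rho_low) (simp add: dist_norm)
  hence "(\<rho> x / c0)^2 <= (\<rho> (x + r *\<^sub>R v))^2" using rho c0 by (intro power_mono) auto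
  hence "M / (\<rho> (x + r *\<^sub>R v))^2 * (norm v)^2 <= M / (\<rho> x / c0)^2 * (\<rho> x)^2"
   using m_pos M_ge rho c0 rho_pos[of "x + r *\<^sub>R v"] nv by (intro mult_mono divide_left_mono) auto
  also have "... = M * c0^2" using rho by (simp add: power_divide)
  finally show ?thesis using hess_up[of "x + r *\<^sub>R v" v] by linarith
 qed
 obtain s where s: "0 < s" "s < 1" "\<psi> (x + 1 *\<^sub>R v) - \<psi> (x + 0 *\<^sub>R v) = (1 - 0) * D\<psi> (x + s *\<^sub>R v) v"
  using MVT2[OF zero_less_one segment_derivs(1)[of x v]] by blast
 obtain r where r: "0 < r" "r < s" "D\<psi> (x + s *\<^sub>R v) v - D\<psi> (x + 0 *\<^sub>R v) v = (s - 0) * hessian \<psi> (x + r *\<^sub>R v) v v"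
  using MVT2[OF s(1) segment_derivs(2)[of x v]] by blast
 have "s * hessian \<psi> (x + r *\<^sub>R v) v v <= 1 * (M * c0^2)"
  using hb[of r] r s hess_nonneg M_ge by (intro mult_mono) auto
 thus ?thesis using s(3) r(3) by (simp add: v_def)
qed

lemma norm_exp_phase:
 "norm (exp (phase (dpsi \<psi>) z x)) <= exp (\<psi> z - \<psi> x) * exp (- (\<kappa> * (dist z x / \<rho> x - 1)))"
proof -
 have "norm (exp (phase (dpsi \<psi>) z x)) = exp (D\<psi> x (z - x))" by (simp add: Re_phase_dpsi[OF psi])
 also have "... <= exp ((\<psi> z - \<psi> x) + - (\<kappa> * (dist z x / \<rho> x - 1)))" using convex_gain[of z x] by simp
 finally show ?thesis by (simp only: exp_add)
qed

subsection \<open>Pointwise bounds for the kernel\<close>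

definition W0 :: real where "W0 = 6 * M"

text \<open>The size of the kernel as a function of the normalized distance d = |z - x| /
  \<open>\<rho> x\<close>: decay from convexity times the singularities, each entry of the matrix
  counting as \<open>W0\<close> in units of \<open>\<rho> x\<close>.\<close>

definition kprof :: "real => real" where
 "kprof d = exp (- (\<kappa> * (d - 1))) * (\<Sum>l<CARD('n). W0 ^ l * (d / d ^ (2 * (CARD('n) - l))))"

lemma W0_nonneg: "0 <= W0" using m_pos M_ge by (simp add: W0_def)

lemma kprof_nonneg: "0 <= d ==> 0 <= kprof d"
 unfolding kprof_def by (intro mult_nonneg_nonneg sum_nonneg) (auto simp: W0_nonneg)

text \<open>Measured in units of \<open>\<rho> x\<close>, every summand carries the same power
  \<rho>^(1 - 2n); one \<rho> is assigned to the form, the others normalize the profile.\<close>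

lemma kernel_bound:
 assumes a: "!!k. norm (a $ k) <= b"
 shows "norm (exp (phase (dpsi \<psi>) z x) * BAker (dbar_mat (dpsi \<psi>) x) z x a) <=
  exp (\<psi> z - \<psi> x) * (adj_bound TYPE('n) * fact CARD('n) * (\<rho> x * b)) * (kprof (dist z x / \<rho> x) / \<rho> x ^ (2 * CARD('n)))"
proof -
 let ?n = "CARD('n)" and ?r = "norm (x - z)" and ?\<rho> = "\<rho> x"
 have rho: "0 < ?\<rho>" by (rule rho_pos)
 have b0: "0 <= b" using a[of undefined] norm_ge_zero order_trans by blast
 have "norm (BAker (dbar_mat (dpsi \<psi>) x) z x a) <= adj_bound TYPE('n) * fact ?n * (b * (\<Sum>l<?n. (W0 / ?\<rho>\<^sup>2) ^ l * (?r / ?r ^ (2 * (?n - l)))))"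
  using dbar_mat_bound by (intro norm_BAker a) (simp add: W0_def)
 also have "(\<Sum>l<?n. (W0 / ?\<rho>\<^sup>2) ^ l * (?r / ?r ^ (2 * (?n - l)))) = ?\<rho> / ?\<rho> ^ (2 * CARD('n)) * (\<Sum>l<?n. W0 ^ l * ((?r / ?\<rho>) / (?r / ?\<rho>) ^ (2 * (?n - l))))"
  unfolding sum_distrib_left
 proof (rule sum.cong[OF refl])
  fix l assume "l \<in> {..<?n}"
  then obtain k where k: "?n = l + k" using le_Suc_ex[of l "CARD('n)"] by auto
  have "?\<rho> ^ (2 * CARD('n)) = ?\<rho> ^ (2 * l) * ?\<rho> ^ (2 * k)" by (simp add: k power_add[symmetric])
  thus "(W0 / ?\<rho>\<^sup>2) ^ l * (?r / ?r ^ (2 * (?n - l))) = ?\<rho> / ?\<rho> ^ (2 * CARD('n)) * (W0 ^ l * ((?r / ?\<rho>) / (?r / ?\<rho>) ^ (2 * (?n - l))))"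
   using rho by (simp add: k power_mult[symmetric] field_simps)
 qed
 finally have B: "norm (BAker (dbar_mat (dpsi \<psi>) x) z x a) <= adj_bound TYPE('n) * fact ?n * (b * (?\<rho> / ?\<rho> ^ (2 * CARD('n)) * (\<Sum>l<?n. W0 ^ l * ((?r / ?\<rho>) / (?r / ?\<rho>) ^ (2 * (?n - l))))))" .
 have "norm (exp (phase (dpsi \<psi>) z x) * BAker (dbar_mat (dpsi \<psi>) x) z x a) <=
  (exp (\<psi> z - \<psi> x) * exp (- (\<kappa> * (dist z x / ?\<rho> - 1)))) *
  (adj_bound TYPE('n) * fact ?n * (b * (?\<rho> / ?\<rho> ^ (2 * CARD('n)) * (\<Sum>l<?n. W0 ^ l * ((?r / ?\<rho>) / (?r / ?\<rho>) ^ (2 * (?n - l)))))))"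
  unfolding norm_mult by (intro mult_mono norm_exp_phase B) auto
 also have "... = exp (\<psi> z - \<psi> x) * (adj_bound TYPE('n) * fact ?n * (?\<rho> * b)) * (kprof (dist z x / ?\<rho>) / ?\<rho> ^ (2 * CARD('n)))"
  by (simp add: kprof_def dist_norm norm_minus_commute mult_ac)
 finally show ?thesis .
qed

lemma kprof_large:
 obtains C where "0 < C" "!!d. 1 <= d ==> kprof d * d ^ L <= C"
proof -
 obtain C where C: "0 < C" "!!x. 0 <= x ==> (1 + x) ^ (L + 1) * exp (- (\<kappa> * x)) <= C"
  by (rule poly_exp_bound[OF kappa_pos, of "L + 1"], rule that)
 let ?S = "\<Sum>l<CARD('n). W0 ^ l"
 have S: "0 <= ?S" by (intro sum_nonneg) (simp add: W0_nonneg)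
 show thesis
 proof (rule that[of "C * ?S + 1"])
  show "0 < C * ?S + 1" using C(1) S by (simp add: add_nonneg_pos)
  fix d :: real assume d: "1 <= d"
  have "(\<Sum>l<CARD('n). W0 ^ l * (d / d ^ (2 * (CARD('n) - l)))) <= (\<Sum>l<CARD('n). W0 ^ l * d)"
  proof (intro sum_mono mult_left_mono)
   fix l show "d / d ^ (2 * (CARD('n) - l)) <= d"
    using d by (simp add: divide_le_eq)
  qed (simp add: W0_nonneg)
  also have "... = ?S * d" by (simp add: sum_distrib_right)
  finally have "kprof d * d ^ L <= exp (- (\<kappa> * (d - 1))) * (?S * d) * d ^ L"
   unfolding kprof_def using d by (intro mult_right_mono) auto
  also have "... = ?S * ((1 + (d - 1)) ^ (L + 1) * exp (- (\<kappa> * (d - 1))))" by simp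
  also have "... <= ?S * C" using d S by (intro mult_left_mono C(2)) auto
  finally show "kprof d * d ^ L <= C * ?S + 1" by (simp add: mult.commute)
 qed
qed

lemma kprof_radmaj:
 obtains C where "0 < C" "!!d. 0 < d ==> kprof d <= C * radmaj (2 * CARD('n)) d"
proof -
 obtain C1 where C1: "0 < C1" "!!d. 1 <= d ==> kprof d * d ^ ((2 * CARD('n)) + 1) <= C1" by (rule kprof_large[of "(2 * CARD('n)) + 1"], rule that)
 define C2 where "C2 = exp \<kappa> * (\<Sum>l<CARD('n). W0 ^ l)"
 have C2: "0 <= C2" unfolding C2_def by (intro mult_nonneg_nonneg sum_nonneg) (auto simp: W0_nonneg)
 show thesis
 proof (rule that[of "C1 + C2"])
  show "0 < C1 + C2" using C1(1) C2 by simp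
  fix d :: real assume d: "0 < d"
  show "kprof d <= (C1 + C2) * radmaj (2 * CARD('n)) d"
  proof (cases "d < 1")
   case True
   have "(\<Sum>l<CARD('n). W0 ^ l * (d / d ^ (2 * (CARD('n) - l)))) <= (\<Sum>l<CARD('n). W0 ^ l * (1 / d) ^ ((2 * CARD('n)) - 1))"
   proof (intro sum_mono mult_left_mono)
    fix l assume "l \<in> {..<CARD('n)}"
    thus "d / d ^ (2 * (CARD('n) - l)) <= (1 / d) ^ ((2 * CARD('n)) - 1)"
     using radial_power_le[of l "CARD('n)" d 1] d True by simp
   qed (simp add: W0_nonneg)
   moreover have "exp (- (\<kappa> * (d - 1))) <= exp \<kappa>" using kappa_pos d by (simp add: algebra_simps)
   ultimately have "kprof d <= exp \<kappa> * (\<Sum>l<CARD('n). W0 ^ l * (1 / d) ^ ((2 * CARD('n)) - 1))"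
    unfolding kprof_def using d by (intro mult_mono) (auto intro!: sum_nonneg simp: W0_nonneg)
   also have "... = C2 * (1 / d) ^ ((2 * CARD('n)) - 1)" by (simp add: C2_def sum_distrib_right)
   also have "... <= (C1 + C2) * (1 / d) ^ ((2 * CARD('n)) - 1)" using C1(1) d by (intro mult_right_mono) auto
   finally show ?thesis using True by (simp add: radmaj_def)
  next
   case False
   have "kprof d <= C1 / d ^ ((2 * CARD('n)) + 1)" using C1(2)[of d] False d by (simp add: pos_le_divide_eq)
   also have "... <= (C1 + C2) / d ^ ((2 * CARD('n)) + 1)" using C2 d by (intro divide_right_mono) auto
   finally show ?thesis using False by (simp only: radmaj_def if_False power_one_over times_divide_eq_right)
  qed
 qed
qed

text \<open>For positive arguments \<open>radmaj\<close> is the minimum of its two powers, so a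
  change of scale by a bounded factor costs at most that factor to the larger exponent.\<close>

lemma radmaj_rescale:
 assumes "0 < x" "0 < y" "1 <= c" "x <= c * y"
 shows "radmaj d y <= c ^ (d + 1) * radmaj d x"
proof -
 have rm: "radmaj d t = min ((1 / t) ^ (d - 1)) ((1 / t) ^ (d + 1))" if "0 < t" for t :: real
 proof (cases "t < 1")
  case True
  hence "(1 / t) ^ (d - 1) <= (1 / t) ^ (d + 1)" using that by (intro power_increasing) auto
  thus ?thesis using True by (simp add: radmaj_def)
 next
  case False
  hence "(1 / t) ^ (d + 1) <= (1 / t) ^ (d - 1)" by (intro power_decreasing) auto
  thus ?thesis using False by (simp add: radmaj_def)
 qed
 have q: "1 / y <= c * (1 / x)" using assms by (simp add: field_simps)
 have p: "(1 / y) ^ k <= c ^ (d + 1) * (1 / x) ^ k" if "k <= d + 1" for k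
 proof -
  have "(1 / y) ^ k <= (c * (1 / x)) ^ k" using q assms by (intro power_mono) auto
  also have "... = c ^ k * (1 / x) ^ k" by (rule power_mult_distrib)
  also have "... <= c ^ (d + 1) * (1 / x) ^ k" using that assms by (intro mult_right_mono power_increasing) auto
  finally show ?thesis .
 qed
 have gen: "min a b <= k * min a' b'" if "a <= k * a'" "b <= k * b'" for a b k a' b' :: real
  using that by auto
 have "min ((1 / y) ^ (d - 1)) ((1 / y) ^ (d + 1)) <= c ^ (d + 1) * min ((1 / x) ^ (d - 1)) ((1 / x) ^ (d + 1))"
  by (intro gen p) simp_all
 thus ?thesis using assms by (simp only: rm)
qed

end

locale pinched_doubling = pinched \<rho> c0 \<psi> m M for \<rho> :: "complex^'n::finite => real" and c0 \<psi> m M +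
 fixes A :: real and N :: nat
 assumes A: "1 <= A" and N: "0 < N"
  and cmp: "!!z w. \<rho> z <= dist z w ==> \<rho> w <= dist z w ==> dist z w / \<rho> z <= A * (dist z w / \<rho> w) ^ N"
begin

text \<open>The profile is centred at \<rho> x, which suits integration in \<open>z\<close>;
  integration in \<open>x\<close> requires \<rho> z instead. At small distance the two weights are
  comparable. At large distance \<open>cmp\<close> pays for the exchange with powers of |z - x| /
  \<open>\<rho> x\<close>, which the exponential decay absorbs.\<close>

lemma kernel_majorants:
 obtains C where "0 < C" "!!z x. z ~= x ==> kprof (dist z x / \<rho> x) / \<rho> x ^ (2 * CARD('n)) <= C * (radmaj (2 * CARD('n)) (dist z x / \<rho> x) / \<rho> x ^ (2 * CARD('n)))"
  "!!z x. z ~= x ==> kprof (dist z x / \<rho> x) / \<rho> x ^ (2 * CARD('n)) <= C * (radmaj (2 * CARD('n)) (dist z x / \<rho> z) / \<rho> z ^ (2 * CARD('n)))"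
proof -
 obtain C1 where C1: "0 < C1" "!!d. 0 < d ==> kprof d <= C1 * radmaj (2 * CARD('n)) d" by (rule kprof_radmaj, rule that)
 \<comment> \<open>2 n powers replace \<open>\<rho> x\<close> by the distance in the normalization,
   and \<open>N\<close> more pay for one application of \<open>cmp\<close>.\<close>
 obtain C2 where C2: "0 < C2" "!!d. 1 <= d ==> kprof d * d ^ ((2 * CARD('n)) + N) <= C2" by (rule kprof_large[of "(2 * CARD('n)) + N"], rule that)
 define C3 where "C3 = C1 * (c0 ^ (2 * CARD('n)) * c0 ^ ((2 * CARD('n)) + 1))"
 have C3: "0 < C3" using C1(1) c0 by (simp add: C3_def)
 have C13: "C1 <= C3"
 proof -
  have "1 * 1 <= c0 ^ (2 * CARD('n)) * c0 ^ ((2 * CARD('n)) + 1)" using c0 by (intro mult_mono one_le_power) auto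
  thus ?thesis using C1(1) by (simp add: C3_def)
 qed
 define C where "C = C3 + C2 * A"
 have CA: "0 < C2 * A" using C2(1) A by simp
 show thesis
 proof (rule that[of C])
  show "0 < C" using C3 CA by (simp add: C_def)
  fix z x :: "complex^'n" assume zx: "z ~= x"
  hence r0: "0 < dist z x" by simp
  have dx: "0 < dist z x / \<rho> x" "0 < dist z x / \<rho> z" using r0 rho_pos by simp_all
  have near1: "kprof (dist z x / \<rho> x) / \<rho> x ^ (2 * CARD('n)) <= C1 * (radmaj (2 * CARD('n)) (dist z x / \<rho> x) / \<rho> x ^ (2 * CARD('n)))"
   using C1(2)[OF dx(1)] by (simp add: divide_right_mono)
  also have "... <= C * (radmaj (2 * CARD('n)) (dist z x / \<rho> x) / \<rho> x ^ (2 * CARD('n)))"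
   using C13 CA dx rho_pos[of x] by (intro mult_right_mono divide_nonneg_nonneg radmaj_nonneg) (auto simp: C_def)
  finally show "kprof (dist z x / \<rho> x) / \<rho> x ^ (2 * CARD('n)) <= C * (radmaj (2 * CARD('n)) (dist z x / \<rho> x) / \<rho> x ^ (2 * CARD('n)))" .
  have rz0: "0 <= radmaj (2 * CARD('n)) (dist z x / \<rho> z) / \<rho> z ^ (2 * CARD('n))"
   using dx rho_pos[of z] by (intro divide_nonneg_nonneg radmaj_nonneg) auto
  show "kprof (dist z x / \<rho> x) / \<rho> x ^ (2 * CARD('n)) <= C * (radmaj (2 * CARD('n)) (dist z x / \<rho> z) / \<rho> z ^ (2 * CARD('n)))"
  proof (cases "dist z x < max (\<rho> z) (\<rho> x)")
   case True
   note rc = rho_comparable[OF True]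
   have "radmaj (2 * CARD('n)) (dist z x / \<rho> x) <= c0 ^ ((2 * CARD('n)) + 1) * radmaj (2 * CARD('n)) (dist z x / \<rho> z)"
   proof (rule radmaj_rescale[OF dx(2,1) c0])
    have "dist z x / \<rho> z <= c0 * dist z x / \<rho> x"
     using rc(2) rho_pos[of x] rho_pos[of z] r0 by (simp add: field_simps)
    thus "dist z x / \<rho> z <= c0 * (dist z x / \<rho> x)" by simp
   qed
   moreover have "1 / \<rho> x ^ (2 * CARD('n)) <= c0 ^ (2 * CARD('n)) * (1 / \<rho> z ^ (2 * CARD('n)))"
   proof -
    have "\<rho> z ^ (2 * CARD('n)) <= (c0 * \<rho> x) ^ (2 * CARD('n))" using rc(1) rho_pos[of z] by (intro power_mono) auto
    thus ?thesis using rho_pos[of x] rho_pos[of z] by (simp add: field_simps)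
   qed
   ultimately have "radmaj (2 * CARD('n)) (dist z x / \<rho> x) * (1 / \<rho> x ^ (2 * CARD('n))) <= (c0 ^ ((2 * CARD('n)) + 1) * radmaj (2 * CARD('n)) (dist z x / \<rho> z)) * (c0 ^ (2 * CARD('n)) * (1 / \<rho> z ^ (2 * CARD('n))))"
    using dx c0 by (intro mult_mono mult_nonneg_nonneg radmaj_nonneg) auto
   hence "C1 * (radmaj (2 * CARD('n)) (dist z x / \<rho> x) / \<rho> x ^ (2 * CARD('n))) <= C3 * (radmaj (2 * CARD('n)) (dist z x / \<rho> z) / \<rho> z ^ (2 * CARD('n)))"
    using C1(1) unfolding C3_def mult.assoc by (drule_tac mult_left_mono[where c=C1]) (simp_all only: less_imp_le times_divide_eq_left mult_1_right mult_1_left mult_ac)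
   also have "... <= C * (radmaj (2 * CARD('n)) (dist z x / \<rho> z) / \<rho> z ^ (2 * CARD('n)))"
    using CA rz0 by (intro mult_right_mono) (auto simp: C_def)
   finally show ?thesis using near1 by linarith
  next
   case False
   hence far: "\<rho> z <= dist z x" "\<rho> x <= dist z x" by auto
   let ?d = "dist z x / \<rho> x" and ?e = "dist z x / \<rho> z"
   have d1: "1 <= ?d" "1 <= ?e" using far rho_pos[of x] rho_pos[of z] by simp_all
   have "kprof ?d * ?d ^ (2 * CARD('n)) * ?d ^ N <= C2" using C2(2)[OF d1(1)] by (simp add: power_add)
   moreover have "?e <= A * ?d ^ N" by (rule cmp[OF far])
   ultimately have "kprof ?d * ?d ^ (2 * CARD('n)) * ?e <= C2 * A"
   proof -
    have "kprof ?d * ?d ^ (2 * CARD('n)) * ?e <= kprof ?d * ?d ^ (2 * CARD('n)) * (A * ?d ^ N)"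
     using \<open>?e <= A * ?d ^ N\<close> dx by (intro mult_left_mono mult_nonneg_nonneg kprof_nonneg) auto
    also have "... = (kprof ?d * ?d ^ (2 * CARD('n)) * ?d ^ N) * A" by simp
    also have "... <= C2 * A" using \<open>kprof ?d * ?d ^ (2 * CARD('n)) * ?d ^ N <= C2\<close> A by (intro mult_right_mono) auto
    finally show ?thesis .
   qed
   hence "kprof ?d * ?d ^ (2 * CARD('n)) <= C2 * A / ?e" using dx(2) by (simp only: pos_le_divide_eq)
   hence "kprof ?d * ?d ^ (2 * CARD('n)) / dist z x ^ (2 * CARD('n)) <= C2 * A / ?e / dist z x ^ (2 * CARD('n))" by (intro divide_right_mono) auto
   moreover have "kprof ?d * ?d ^ (2 * CARD('n)) / dist z x ^ (2 * CARD('n)) = kprof ?d / \<rho> x ^ (2 * CARD('n))"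
    using r0 by (simp add: power_divide)
   moreover have "C2 * A / ?e / dist z x ^ (2 * CARD('n)) = C2 * A * (radmaj (2 * CARD('n)) ?e / \<rho> z ^ (2 * CARD('n)))"
    using d1(2) r0 by (simp add: radmaj_def field_simps)
   ultimately have "kprof ?d / \<rho> x ^ (2 * CARD('n)) <= C2 * A * (radmaj (2 * CARD('n)) ?e / \<rho> z ^ (2 * CARD('n)))" by simp
   also have "... <= C * (radmaj (2 * CARD('n)) ?e / \<rho> z ^ (2 * CARD('n)))"
    using C3 rz0 by (intro mult_right_mono) (auto simp: C_def)
   finally show ?thesis .
  qed
 qed
qed

end

section \<open>Boundedness of the operator on weighted L^p\<close>

subsection \<open>The Schur test\<close>

text \<open>A form of Young's inequality that is good enough because constants do not matter.\<close>
lemma young_crude: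
 fixes x a p :: real
 assumes "0 <= x" "0 < a" "1 <= p"
 shows "x <= a powr (1 - p) * x powr p + a"
proof (cases "x <= a")
 case True
 thus ?thesis using assms by (simp add: add_increasing)
next
 case False
 hence x: "a < x" by simp
 hence "1 <= (x / a) powr (p - 1)" using assms by (intro ge_one_powr_ge_zero) auto
 hence "x * 1 <= x * (x / a) powr (p - 1)" using assms by (intro mult_left_mono) auto
 also have "x * (x / a) powr (p - 1) = a powr (1 - p) * x powr p"
 proof -
  have "(x / a) powr (p - 1) = x powr (p - 1) * a powr (1 - p)"
   using x assms by (simp add: powr_divide powr_diff powr_minus field_simps)
  moreover have "x * x powr (p - 1) = x powr p" using x assms by (simp add: powr_diff)
  ultimately show ?thesis by (simp add: mult_ac)
 qed
 finally show ?thesis using assms by simp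
qed

lemma ennreal_le_small:
 assumes "!!e. 0 < e ==> G <= ennreal (e * s)" "0 <= s"
 shows "G = 0"
proof -
 have *: "G <= 0 + ennreal e" if e: "0 < e" for e
 proof -
  have "G <= ennreal (e / (s + 1) * s)" using e assms(2) by (intro assms(1)) simp
  also have "... <= ennreal e" using e assms(2) by (intro ennreal_leI) (simp add: field_simps)
  finally show ?thesis by simp
 qed
 have "G <= 0" by (rule ennreal_le_epsilon) (rule *)
 thus ?thesis by simp
qed

text \<open>Hoelder's inequality up to a constant, from Young's inequality with a free parameter
  \<open>a\<close>. For \<open>h = 0\<close> the parameter tends to 0.\<close>

lemma schur_pointwise:
 fixes k \<Phi> :: "'a => real" and p S h :: real
 assumes [measurable]: "k \<in> bm M" "\<Phi> \<in> bm M"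
  and nn: "!!x. 0 <= k x" "!!x. 0 <= \<Phi> x" and p: "1 <= p" and S: "0 <= S" "(\<integral>\<^sup>+x. ennreal (k x) \<partial>M) <= ennreal S"
  and h: "0 <= h" "(\<integral>\<^sup>+x. ennreal (k x * \<Phi> x powr p) \<partial>M) = ennreal h"
 shows "(\<integral>\<^sup>+x. ennreal (k x * \<Phi> x) \<partial>M) <= ennreal ((1 + S) * h powr (1 / p))"
proof -
 let ?G = "\<integral>\<^sup>+x. ennreal (k x * \<Phi> x) \<partial>M"
 have G: "?G <= ennreal (a powr (1 - p) * h + a * S)" if a: "0 < a" for a
 proof -
  have "?G <= (\<integral>\<^sup>+x. ennreal (a powr (1 - p)) * ennreal (k x * \<Phi> x powr p) + ennreal a * ennreal (k x) \<partial>M)"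
  proof (rule nn_integral_mono)
   fix x
   have "k x * \<Phi> x <= k x * (a powr (1 - p) * \<Phi> x powr p + a)"
    by (intro mult_left_mono young_crude nn a p)
   also have "... = a powr (1 - p) * (k x * \<Phi> x powr p) + a * k x" by (simp add: algebra_simps)
   finally show "ennreal (k x * \<Phi> x) <= ennreal (a powr (1 - p)) * ennreal (k x * \<Phi> x powr p) + ennreal a * ennreal (k x)"
    using nn a by (simp add: ennreal_mult'[symmetric] ennreal_plus[symmetric] ennreal_leI del: ennreal_plus)
  qed
  also have "... = ennreal (a powr (1 - p)) * ennreal h + ennreal a * (\<integral>\<^sup>+x. ennreal (k x) \<partial>M)"
   by (simp add: nn_integral_add nn_integral_cmult h(2))
  also have "... <= ennreal (a powr (1 - p)) * ennreal h + ennreal a * ennreal S"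
   by (intro add_left_mono mult_left_mono S) auto
  also have "... = ennreal (a powr (1 - p) * h + a * S)"
   using a h S by (simp add: ennreal_mult'[symmetric] ennreal_plus[symmetric] del: ennreal_plus)
  finally show ?thesis .
 qed
 show ?thesis
 proof (cases "h = 0")
  case True
  have "?G = 0" by (rule ennreal_le_small[OF _ S(1)]) (use G True in simp)
  thus ?thesis by simp
 next
  case False
  hence h0: "0 < h" using h by simp
  \<comment> \<open>This balances the two terms of the bound: \<open>a powr (1 - p) * h\<close>
    becomes \<open>a\<close>.\<close>
  define a where "a = h powr (1 / p)"
  have a: "0 < a" using h0 by (simp add: a_def)
  have "a powr (1 - p) * h = h powr (1 / p * (1 - p) + 1)"
   using h0 by (simp add: a_def powr_powr powr_add)
  also have "1 / p * (1 - p) + 1 = 1 / p" using p by (simp add: field_simps)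
  finally have "a powr (1 - p) * h + a * S = (1 + S) * h powr (1 / p)" by (simp add: a_def algebra_simps)
  thus ?thesis using G[OF a] by simp
 qed
qed

lemma sigma_finite_lebesgue: "sigma_finite_measure (lebesgue :: 'a::euclidean_space measure)"
proof
 show "\<exists>A. countable A \<and> A \<subseteq> sets (lebesgue :: 'a measure) \<and> \<Union>A = space lebesgue \<and> (\<forall>a\<in>A. emeasure lebesgue a ~= \<infinity>)"
 proof (intro exI[of _ "range (%n::nat. cball (0::'a) (real n))"] conjI ballI)
  show "\<Union> (range (%n::nat. cball (0::'a) (real n))) = space lebesgue"
   by (auto intro: real_arch_simple)
  fix a assume "a \<in> range (%n::nat. cball (0::'a) (real n))"
  then obtain n :: nat where a: "a = cball 0 (real n)" by auto
  have "emeasure lebesgue a = emeasure lborel a" unfolding a by simp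
  also have "... < \<infinity>" unfolding a by (intro emeasure_bounded_finite) simp
  finally show "emeasure lebesgue a ~= \<infinity>" by simp
 qed auto
qed

lemma borel_lebesgue: "f \<in> bm borel ==> f \<in> bm lebesgue"
 by (simp add: measurable_completion)

lemma continuous_lebesgue: "cont f ==> f \<in> bm lebesgue"
 by (intro borel_lebesgue borel_measurable_continuous_onI)

lemma pair_lebesgue_borel:
 fixes f :: "'a::euclidean_space \<times> 'b::euclidean_space => 'c::topological_space"
 assumes "f \<in> bm borel"
 shows "f \<in> bm (lebesgue \<Otimes>\<^sub>M lebesgue)"
proof -
 have [measurable]: "(%x. x) \<in> lebesgue \<rightarrow>\<^sub>M (borel :: 'a measure)" "(%x. x) \<in> lebesgue \<rightarrow>\<^sub>M (borel :: 'b measure)"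
  by (auto intro!: borel_lebesgue)
 have "(%p. (fst p, snd p)) \<in> (lebesgue \<Otimes>\<^sub>M lebesgue :: ('a \<times> 'b) measure) \<rightarrow>\<^sub>M (borel \<Otimes>\<^sub>M borel)"
  by (intro measurable_Pair measurable_compose[OF measurable_fst] measurable_compose[OF measurable_snd]) auto
 hence "(%p. p) \<in> (lebesgue \<Otimes>\<^sub>M lebesgue :: ('a \<times> 'b) measure) \<rightarrow>\<^sub>M borel"
  by (simp add: borel_prod)
 from measurable_compose[OF this assms] show ?thesis .
qed

text \<open>The p-th power of the pointwise bound is integrated over \<open>z\<close> and the order
  of integration exchanged; both one-sided integrals of the kernel are at most \<open>S\<close>.
  Here \<tau> is the weighted modulus of the operator, known only through its domination by the
  positive kernel.\<close>

lemma schur_Lp: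
 fixes k :: "'a::euclidean_space => 'a => real" and \<Phi> \<tau> :: "'a => real" and p S C :: real
 assumes k [measurable]: "(%(z, x). k z x) \<in> bm (lebesgue \<Otimes>\<^sub>M lebesgue)" and \<Phi> [measurable]: "\<Phi> \<in> bm lebesgue"
  and nn: "!!z x. 0 <= k z x" "!!x. 0 <= \<Phi> x" "!!z. 0 <= \<tau> z" "0 <= C" and p: "1 <= p"
  and S: "0 <= S" "!!z. (\<integral>\<^sup>+x. ennreal (k z x) \<partial>lebesgue) <= ennreal S" "!!x. (\<integral>\<^sup>+z. ennreal (k z x) \<partial>lebesgue) <= ennreal S"
  and fin: "(\<integral>\<^sup>+x. ennreal (\<Phi> x powr p) \<partial>lebesgue) < \<infinity>"
  and \<tau>: "!!z. ennreal (\<tau> z) <= ennreal C * (\<integral>\<^sup>+x. ennreal (k z x * \<Phi> x) \<partial>lebesgue)"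
 shows "AE z in lebesgue. (\<integral>\<^sup>+x. ennreal (k z x * \<Phi> x) \<partial>lebesgue) < \<infinity>"
  "(\<integral>\<^sup>+z. ennreal (\<tau> z powr p) \<partial>lebesgue) <= ennreal ((C * (1 + S)) powr p * S) * (\<integral>\<^sup>+x. ennreal (\<Phi> x powr p) \<partial>lebesgue)"
proof -
 let ?P = "\<integral>\<^sup>+x. ennreal (\<Phi> x powr p) \<partial>lebesgue"
 interpret sigma_finite_measure "lebesgue :: 'a measure" by (rule sigma_finite_lebesgue)
 interpret pair_sigma_finite "lebesgue :: 'a measure" "lebesgue :: 'a measure" ..
 define H where "H z = (\<integral>\<^sup>+x. ennreal (k z x * \<Phi> x powr p) \<partial>lebesgue)" for z
 have kz [measurable]: "k z \<in> bm lebesgue" for z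
  using measurable_compose[OF measurable_Pair1'[of z lebesgue lebesgue] k] by simp
 have kx [measurable]: "(%z. k z x) \<in> bm lebesgue" for x
  using measurable_compose[OF measurable_Pair2'[of x lebesgue lebesgue] k] by simp
 have joint [measurable]: "(%(z, x). ennreal (k z x * \<Phi> x powr p)) \<in> bm (lebesgue \<Otimes>\<^sub>M lebesgue)"
  by measurable
 have Hm [measurable]: "H \<in> bm lebesgue" unfolding H_def[abs_def] by measurable
 have HI: "(\<integral>\<^sup>+z. H z \<partial>lebesgue) <= ennreal S * ?P"
 proof -
  have "(\<integral>\<^sup>+z. H z \<partial>lebesgue) = (\<integral>\<^sup>+x. (\<integral>\<^sup>+z. ennreal (k z x * \<Phi> x powr p) \<partial>lebesgue) \<partial>lebesgue)"
   unfolding H_def by (rule Fubini'[symmetric]) measurable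
  also have "... = (\<integral>\<^sup>+x. (\<integral>\<^sup>+z. ennreal (k z x) \<partial>lebesgue) * ennreal (\<Phi> x powr p) \<partial>lebesgue)"
   by (intro nn_integral_cong) (simp add: ennreal_mult' nn nn_integral_multc)
  also have "... <= (\<integral>\<^sup>+x. ennreal S * ennreal (\<Phi> x powr p) \<partial>lebesgue)"
   by (intro nn_integral_mono mult_right_mono S) auto
  also have "... = ennreal S * ?P"
   by (intro nn_integral_cmult) measurable
  finally show ?thesis .
 qed
 have "(\<integral>\<^sup>+z. H z \<partial>lebesgue) < \<infinity>"
  using HI fin by (auto simp: ennreal_mult_less_top intro: le_less_trans)
 hence HAE: "AE z in lebesgue. H z ~= \<infinity>" by (intro nn_integral_PInf_AE) auto
 have G: "(\<integral>\<^sup>+x. ennreal (k z x * \<Phi> x) \<partial>lebesgue) <= ennreal ((1 + S) * enn2real (H z) powr (1 / p))" if "H z ~= \<infinity>" for z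
  by (rule schur_pointwise[OF kz \<Phi> nn(1,2) p S(1,2)]) (use that in \<open>auto simp: H_def less_top[symmetric]\<close>)
 show "AE z in lebesgue. (\<integral>\<^sup>+x. ennreal (k z x * \<Phi> x) \<partial>lebesgue) < \<infinity>"
  using HAE
 proof eventually_elim
  case (elim z)
  show ?case using le_less_trans[OF G[OF elim] ennreal_less_top] by simp
 qed
 have "(\<integral>\<^sup>+z. ennreal (\<tau> z powr p) \<partial>lebesgue) <= (\<integral>\<^sup>+z. ennreal ((C * (1 + S)) powr p) * H z \<partial>lebesgue)"
 proof (rule nn_integral_mono_AE, use HAE in eventually_elim)
  fix z assume Hz: "H z ~= \<infinity>"
  have "ennreal (\<tau> z) <= ennreal C * ennreal ((1 + S) * enn2real (H z) powr (1 / p))"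
   using \<tau>[of z] G[OF Hz] by (meson mult_left_mono order_trans zero_le)
  also have "... = ennreal (C * (1 + S) * enn2real (H z) powr (1 / p))"
   using nn(4) by (simp add: ennreal_mult'[symmetric] mult.assoc)
  finally have "\<tau> z <= C * (1 + S) * enn2real (H z) powr (1 / p)"
   using nn(4) S(1) by (simp add: ennreal_le_iff)
  hence "\<tau> z powr p <= (C * (1 + S) * enn2real (H z) powr (1 / p)) powr p"
   using nn p by (intro powr_mono2) auto
  also have "... = (C * (1 + S)) powr p * enn2real (H z)"
   using nn(4) S(1) p by (simp add: powr_mult powr_powr)
  finally have "ennreal (\<tau> z powr p) <= ennreal ((C * (1 + S)) powr p * enn2real (H z))" by (rule ennreal_leI)
  also have "... = ennreal ((C * (1 + S)) powr p) * H z"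
   using Hz by (simp add: ennreal_mult' less_top[symmetric])
  finally show "ennreal (\<tau> z powr p) <= ennreal ((C * (1 + S)) powr p) * H z" .
 qed
 also have "... = ennreal ((C * (1 + S)) powr p) * (\<integral>\<^sup>+z. H z \<partial>lebesgue)" by (intro nn_integral_cmult) measurable
 also have "... <= ennreal ((C * (1 + S)) powr p) * (ennreal S * ?P)"
  by (intro mult_left_mono HI) auto
 also have "... = ennreal ((C * (1 + S)) powr p * S) * ?P"
  using S(1) by (simp add: ennreal_mult' mult.assoc)
 finally show "(\<integral>\<^sup>+z. ennreal (\<tau> z powr p) \<partial>lebesgue) <= ennreal ((C * (1 + S)) powr p * S) * ?P" .
qed

lemma ennreal_powr_mono_scale:
 assumes "X <= ennreal c * Y" "0 < c" "0 < a"
 shows "ennreal_powr X a <= ennreal (c powr a) * ennreal_powr Y a"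
proof (cases "Y = \<infinity>")
 case True
 thus ?thesis using assms by (simp add: ennreal_powr_def ennreal_mult_top)
next
 case False
 then obtain y where y: "Y = ennreal y" "0 <= y" by (cases Y) auto
 have "X <= ennreal (c * y)" using assms y by (simp add: ennreal_mult')
 then obtain x where x: "X = ennreal x" "0 <= x" "x <= c * y"
  using assms y by (cases X) (auto simp: ennreal_le_iff top_unique)
 hence "x powr a <= c powr a * y powr a"
  using assms y by (subst powr_mult[symmetric]) (auto intro: powr_mono2)
 thus ?thesis using x y by (simp add: ennreal_powr_def ennreal_mult'[symmetric] ennreal_leI)
qed

lemma ennreal_powr_less_top_iff: "ennreal_powr X a < \<infinity> \<longleftrightarrow> X < \<infinity>"
 by (auto simp: ennreal_powr_def less_top)

lemma eexp_measurable [measurable]: "eexp \<in> bm borel"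
 unfolding eexp_def[abs_def] by measurable

lemma psh_measurable: "psh \<phi> ==> \<phi> \<in> bm borel"
 unfolding psh_def by (intro borel_measurableI_less) auto

subsection \<open>Weighted norms with a comparable weight\<close>

lemma ereal_near_real:
 assumes "\<bar>x - ereal y\<bar> <= ereal B"
 obtains f where "x = ereal f" "\<bar>f - y\<bar> <= B"
 using assms by (cases x) auto

lemma eexp_ereal [simp]: "eexp (ereal x) = ennreal (exp x)"
 by (simp add: eexp_def)

text \<open>Almost everywhere \<phi> is finite and within \<open>B\<close> of \<phi>t, so the change
  of weight costs a factor exp (p B) in either direction; from then on the weight is real and
  continuous.\<close>

lemma weighted_integral_compare:
 fixes h :: "complex^'n => real"
 assumes ae: "AE z in lebesgue. \<bar>\<phi> z - ereal (\<phi>t z)\<bar> <= ereal B" and h: "!!z. 0 <= h z" and p: "0 <= p"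
  and [measurable]: "\<phi> \<in> bm borel" "\<phi>t \<in> bm borel" "h \<in> bm lebesgue"
 shows "(\<integral>\<^sup>+z. ennreal (h z powr p) * eexp (- (ereal p * \<phi> z)) \<partial>lebesgue) <= ennreal (exp (p * B)) * (\<integral>\<^sup>+z. ennreal ((h z * exp (- \<phi>t z)) powr p) \<partial>lebesgue)" (is "?A <= ?e * ?B")
  and "(\<integral>\<^sup>+z. ennreal ((h z * exp (- \<phi>t z)) powr p) \<partial>lebesgue) <= ennreal (exp (p * B)) * (\<integral>\<^sup>+z. ennreal (h z powr p) * eexp (- (ereal p * \<phi> z)) \<partial>lebesgue)"
proof -
 have pw: "(h z * exp (- \<phi>t z)) powr p = h z powr p * exp (- (p * \<phi>t z))" for z
  using h by (simp add: powr_mult exp_powr_real mult.commute)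
 have pt: "ennreal (h z powr p) * eexp (- (ereal p * \<phi> z)) <= ennreal (exp (p * B)) * ennreal ((h z * exp (- \<phi>t z)) powr p) \<and>
   ennreal ((h z * exp (- \<phi>t z)) powr p) <= ennreal (exp (p * B)) * (ennreal (h z powr p) * eexp (- (ereal p * \<phi> z)))"
  if near: "\<bar>\<phi> z - ereal (\<phi>t z)\<bar> <= ereal B" for z
 proof -
  obtain f where f: "\<phi> z = ereal f" "\<bar>f - \<phi>t z\<bar> <= B" using near by (rule ereal_near_real)
  have "p * (\<phi>t z - f) <= p * B" "p * (f - \<phi>t z) <= p * B" using f p by (auto intro!: mult_left_mono)
  hence e: "exp (- (p * f)) <= exp (p * B) * exp (- (p * \<phi>t z))" "exp (- (p * \<phi>t z)) <= exp (p * B) * exp (- (p * f))"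
   by (simp_all add: mult_exp_exp algebra_simps)
  have "h z powr p * exp (- (p * f)) <= h z powr p * (exp (p * B) * exp (- (p * \<phi>t z)))"
   "h z powr p * exp (- (p * \<phi>t z)) <= h z powr p * (exp (p * B) * exp (- (p * f)))"
   by (intro mult_left_mono e; simp)+
  thus ?thesis unfolding pw f(1) by (simp add: ennreal_mult'[symmetric] ennreal_leI mult_ac)
 qed
 have pt': "AE z in lebesgue. ennreal (h z powr p) * eexp (- (ereal p * \<phi> z)) <= ennreal (exp (p * B)) * ennreal ((h z * exp (- \<phi>t z)) powr p) \<and>
   ennreal ((h z * exp (- \<phi>t z)) powr p) <= ennreal (exp (p * B)) * (ennreal (h z powr p) * eexp (- (ereal p * \<phi> z)))"
  using ae by (rule eventually_mono) (rule pt)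
 have [measurable]: "\<phi> \<in> bm lebesgue" "\<phi>t \<in> bm lebesgue"
  by (intro borel_lebesgue; measurable)+
 have "?A <= (\<integral>\<^sup>+z. ennreal (exp (p * B)) * ennreal ((h z * exp (- \<phi>t z)) powr p) \<partial>lebesgue)"
  by (rule nn_integral_mono_AE) (use pt' in eventually_elim, blast)
 also have "... = ?e * ?B"
  by (rule nn_integral_cmult) measurable
 finally show "?A <= ?e * ?B" .
 have "?B <= (\<integral>\<^sup>+z. ennreal (exp (p * B)) * (ennreal (h z powr p) * eexp (- (ereal p * \<phi> z))) \<partial>lebesgue)"
  by (rule nn_integral_mono_AE) (use pt' in eventually_elim, blast)
 also have "... = ?e * ?A"
  by (rule nn_integral_cmult) measurable
 finally show "?B <= ?e * ?A" .
qed

subsection \<open>Measurability of the kernel\<close>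

lemma BA_kernel_measurable:
 fixes a :: "complex^'n::finite => complex^'n"
 assumes q: "!!l. Ck1 (q l)" and a: "!!k. (%x. a x $ k) \<in> bm lebesgue"
 shows "(%(z, x). exp (phase q z x) * BAker (dbar_mat q x) z x (a x)) \<in> bm (lebesgue \<Otimes>\<^sub>M lebesgue)"
proof -
 let ?M = "lebesgue \<Otimes>\<^sub>M lebesgue :: ((complex^'n) \<times> (complex^'n)) measure"
 have snd_m: "(%p. f (snd p)) \<in> bm ?M" if "f \<in> bm lebesgue" for f :: "complex^'n => complex"
  by (rule measurable_compose[OF measurable_snd that])
 have [measurable]: "(%p. q l (snd p)) \<in> bm ?M" for l
  by (intro snd_m continuous_lebesgue Ck_continuous[OF q])
 have [measurable]: "(%p. dbar_mat q (snd p) $ i $ k) \<in> bm ?M" for i k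
  by (intro snd_m continuous_lebesgue continuous_dbar_mat q)
 have [measurable]: "(%p. a (snd p) $ k) \<in> bm ?M" for k
  by (intro snd_m a)
 have [measurable]: "(%p. fst p $ l) \<in> bm ?M" "(%p. snd p $ l) \<in> bm ?M"
   "(%p. cnj (fst p $ l)) \<in> bm ?M" "(%p. cnj (snd p $ l)) \<in> bm ?M"
   "(%p. norm (snd p - fst p)) \<in> bm ?M" for l
  by (intro pair_lebesgue_borel borel_measurable_continuous_onI continuous_intros)+
 have "(%p. exp (phase q (fst p) (snd p)) * BAker (dbar_mat q (snd p)) (fst p) (snd p) (a (snd p))) \<in> bm ?M"
  unfolding phase_def BAker_def adj_coeff_def svec_def vec_lambda_beta by measurable
 thus ?thesis by (simp only: case_prod_unfold)
qed

lemma BAker_scale: "BAker A z x (c *s a) = c * BAker A z x a"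
 unfolding BAker_def adj_coeff_def by (simp add: sum_distrib_left mult_ac)

lemma form01_abs_nonneg: "0 <= form01_abs a"
 by (simp add: form01_abs_def sum_nonneg)

lemma norm_nth_le_form01_abs: "norm (a $ k) <= form01_abs a"
 unfolding form01_abs_def by (rule member_le_sum) auto

lemma form01_abs_scale: "form01_abs (c *s a) = norm c * form01_abs a"
 unfolding form01_abs_def by (simp add: norm_mult sum_distrib_left)

lemma form01_abs_scaleR: "form01_abs (c *\<^sub>R a) = \<bar>c\<bar> * form01_abs a"
 unfolding form01_abs_def by (simp add: sum_distrib_left)

lemma form01_abs_measurable:
 "(!!k. (%x. a x $ k) \<in> bm M) ==> (%x. form01_abs (a x)) \<in> bm M"
 unfolding form01_abs_def by measurable

lemma entire_continuous: "entire F ==> cont F"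
 unfolding entire_def by (meson continuous_at_imp_continuous_on has_derivative_continuous)

subsection \<open>The estimate for the normalized operator\<close>

locale gc_weight = pinched_doubling \<rho> c0 "psi_of \<phi>t F" m M A N
 for \<rho> :: "complex^'n::finite => real" and c0 \<phi>t F m M A N +
 assumes F: "entire F" and phit: "cont \<phi>t"
begin

definition kk :: "complex^'n => complex^'n => real" where
 "kk z x = kprof (dist z x / \<rho> x) / \<rho> x ^ (2 * CARD('n))"

lemma kk_nonneg: "0 <= kk z x"
 unfolding kk_def using rho_pos[of x] by (intro divide_nonneg_nonneg kprof_nonneg) auto

lemma rho_lebesgue [measurable]: "\<rho> \<in> bm lebesgue"
 by (rule borel_lebesgue[OF rho_meas])

lemma phit_lebesgue [measurable]: "\<phi>t \<in> bm lebesgue" "\<phi>t \<in> bm borel"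
 by (rule continuous_lebesgue[OF phit], rule borel_measurable_continuous_onI[OF phit])

lemma kk_measurable: "(%(z, x). kk z x) \<in> bm (lebesgue \<Otimes>\<^sub>M lebesgue)"
proof -
 have [measurable]: "(%p. dist (fst p) (snd p)) \<in> bm (lebesgue \<Otimes>\<^sub>M lebesgue :: ((complex^'n) \<times> (complex^'n)) measure)"
  by (intro pair_lebesgue_borel borel_measurable_continuous_onI continuous_intros)
 show ?thesis unfolding kk_def kprof_def by measurable
qed

text \<open>Each of the two majorants is one integrable profile, dilated by the weight at the fixed
  point and divided by the corresponding volume, so its integral does not depend on that
  point.\<close>

lemma kk_schur:
 obtains S where "0 <= S" "!!z. (\<integral>\<^sup>+x. ennreal (kk z x) \<partial>lebesgue) <= ennreal S" "!!x. (\<integral>\<^sup>+z. ennreal (kk z x) \<partial>lebesgue) <= ennreal S"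
proof -
 let ?d = "2 * CARD('n)"
 obtain C where C: "0 < C" "!!z x. z ~= x ==> kprof (dist z x / \<rho> x) / \<rho> x ^ ?d <= C * (radmaj ?d (dist z x / \<rho> x) / \<rho> x ^ ?d)"
  "!!z x. z ~= x ==> kprof (dist z x / \<rho> x) / \<rho> x ^ ?d <= C * (radmaj ?d (dist z x / \<rho> z) / \<rho> z ^ ?d)"
  by (rule kernel_majorants, rule that)
 have b: "kk z x <= C / \<rho> x ^ ?d * radmaj ?d (dist z x / \<rho> x)" "kk z x <= C / \<rho> z ^ ?d * radmaj ?d (dist z x / \<rho> z)" for z x
 proof -
  have "0 <= C / \<rho> w ^ ?d * radmaj ?d (dist z x / \<rho> w)" for w
   using C(1) rho_pos[of w] by (intro mult_nonneg_nonneg radmaj_nonneg) auto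
  note nn = this
  \<comment> \<open>On the diagonal every summand of \<open>kprof\<close> contains 0 / 0, which is
    0.\<close>
  have d0: "kk z z = 0" by (simp add: kk_def kprof_def)
  show "kk z x <= C / \<rho> x ^ ?d * radmaj ?d (dist z x / \<rho> x)"
  proof (cases "z = x")
   case True
   thus ?thesis using nn[of x] d0 by (simp only:)
  next
   case False
   thus ?thesis using C(2)[OF False] by (simp only: kk_def times_divide_eq_left times_divide_eq_right)
  qed
  show "kk z x <= C / \<rho> z ^ ?d * radmaj ?d (dist z x / \<rho> z)"
  proof (cases "z = x")
   case True
   thus ?thesis using nn[of x] d0 by (simp only:)
  next
   case False
   thus ?thesis using C(3)[OF False] by (simp only: kk_def times_divide_eq_left times_divide_eq_right)
  qed
 qed
 define S where "S = C * (4 * (ubv TYPE(complex^'n) * 2 ^ ?d))"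
 have I: "(\<integral>\<^sup>+x. ennreal (C / \<rho> w ^ ?d * radmaj ?d (dist x w / \<rho> w)) \<partial>lebesgue) <= ennreal S" for w
 proof -
  have m: "(%x. radmaj ?d (dist x w / \<rho> w)) \<in> bm lborel"
   by measurable
  have "(\<integral>\<^sup>+x. ennreal (C / \<rho> w ^ ?d * radmaj ?d (dist x w / \<rho> w)) \<partial>lebesgue) = (\<integral>\<^sup>+x. ennreal (C / \<rho> w ^ ?d) * ennreal (radmaj ?d (dist x w / \<rho> w)) \<partial>lborel)"
   by (simp only: nn_integral_completion ennreal_mult' divide_nonneg_pos[OF less_imp_le[OF C(1)] zero_less_power[OF rho_pos]])
  also have "... = ennreal (C / \<rho> w ^ ?d) * (\<integral>\<^sup>+x. ennreal (radmaj ?d (dist x w / \<rho> w)) \<partial>lborel)"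
   by (intro nn_integral_cmult) auto
  also have "... <= ennreal (C / \<rho> w ^ ?d) * ennreal (4 * (ubv TYPE(complex^'n) * (2 ^ ?d * \<rho> w ^ ?d)))"
   using nn_integral_radmaj[OF rho_pos[of w], of w] DIM_cvec_ge[where 'n='n] unfolding DIM_cvec by (intro mult_left_mono) auto
  also have "... = ennreal (C / \<rho> w ^ ?d * (4 * (ubv TYPE(complex^'n) * (2 ^ ?d * \<rho> w ^ ?d))))"
   using C(1) by (subst ennreal_mult') auto
  also have "C / \<rho> w ^ ?d * (4 * (ubv TYPE(complex^'n) * (2 ^ ?d * \<rho> w ^ ?d))) = S"
   using rho_pos[of w] by (simp add: S_def)
  finally show ?thesis .
 qed
 show thesis
 proof (rule that[of S])
  show "0 <= S" using C(1) by (simp add: S_def)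
  show "(\<integral>\<^sup>+x. ennreal (kk z x) \<partial>lebesgue) <= ennreal S" for z
   by (rule order_trans[OF nn_integral_mono I[of z]]) (intro ennreal_leI, simp only: dist_commute[of _ z] b(2))
  show "(\<integral>\<^sup>+z. ennreal (kk z x) \<partial>lebesgue) <= ennreal S" for x
   by (rule order_trans[OF nn_integral_mono I[of x]]) (intro ennreal_leI b(1))
 qed
qed

text \<open>Up to constants the L^p norm of this function is the right-hand side of (A).\<close>

definition Phi :: "(complex^'n => complex^'n) => complex^'n => real" where
 "Phi \<omega> x = form01_abs (\<rho> x *\<^sub>R \<omega> x) * exp (- \<phi>t x)"

abbreviation integrand :: "(complex^'n => complex^'n) => complex^'n => complex^'n => complex" where
 "integrand \<omega> \<equiv> BA_integrand (psi_of \<phi>t F) (%\<xi>. exp (- F \<xi>) *s \<omega> \<xi>)"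

definition kc :: real where "kc = 2 ^ CARD('n) * (adj_bound TYPE('n) * fact CARD('n))"

lemma kc_nonneg: "0 <= kc" by (simp add: kc_def adj_bound_nonneg)

lemma Phi_nonneg: "0 <= Phi \<omega> x"
 by (simp add: Phi_def form01_abs_nonneg)

lemma Phi_measurable:
 assumes "\<omega> \<in> L01"
 shows "Phi \<omega> \<in> bm lebesgue"
proof -
 have [measurable]: "(%x. \<omega> x $ k) \<in> bm lebesgue" for k
  using assms by (simp add: L01_def)
 have [measurable]: "(%x. form01_abs (\<rho> x *\<^sub>R \<omega> x)) \<in> bm lebesgue"
  unfolding form01_abs_def vector_scaleR_component by measurable
 show ?thesis unfolding Phi_def[abs_def] by measurable
qed

text \<open>The kernel decays with respect to \<psi> = \<phi>t - Re F. Conjugation by exp F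
  contributes Re F (z) - Re F (x), so that only the weight \<phi>t is left on both sides.\<close>

lemma integrand_bound:
 "norm (integrand \<omega> z x) * exp (Re (F z) - \<phi>t z) <= kc * (kk z x * Phi \<omega> x)"
proof -
 let ?\<psi> = "psi_of \<phi>t F" and ?n = "CARD('n)"
 have "norm (integrand \<omega> z x) = 2 ^ ?n * norm (exp (phase (dpsi ?\<psi>) z x) * BAker (dbar_mat (dpsi ?\<psi>) x) z x (exp (- F x) *s \<omega> x))"
  unfolding BA_integrand_eq[OF psi] by (simp only: norm_mult norm_power norm_ii norm_numeral) simp
 also have "... <= 2 ^ ?n * (exp (?\<psi> z - ?\<psi> x) * (adj_bound TYPE('n) * fact ?n * (\<rho> x * form01_abs (exp (- F x) *s \<omega> x))) * (kprof (dist z x / \<rho> x) / \<rho> x ^ (2 * ?n)))"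
  by (intro mult_left_mono kernel_bound norm_nth_le_form01_abs) simp
 also have "... = kc * kk z x * form01_abs (\<rho> x *\<^sub>R \<omega> x) * (exp (?\<psi> z - ?\<psi> x) * exp (- Re (F x)))"
  using rho_pos[of x] by (simp add: kc_def kk_def form01_abs_scale form01_abs_scaleR norm_exp_eq_Re)
 finally have "norm (integrand \<omega> z x) * exp (Re (F z) - \<phi>t z) <=
   kc * kk z x * form01_abs (\<rho> x *\<^sub>R \<omega> x) * (exp (?\<psi> z - ?\<psi> x) * exp (- Re (F x))) * exp (Re (F z) - \<phi>t z)"
  by (intro mult_right_mono) auto
 also have "... = kc * kk z x * form01_abs (\<rho> x *\<^sub>R \<omega> x) * (exp (?\<psi> z - ?\<psi> x) * exp (- Re (F x)) * exp (Re (F z) - \<phi>t z))" by (simp only: mult.assoc)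
 also have "exp (?\<psi> z - ?\<psi> x) * exp (- Re (F x)) * exp (Re (F z) - \<phi>t z) = exp (- \<phi>t x)"
  by (simp add: mult_exp_exp psi_of_def)
 finally show ?thesis by (simp only: Phi_def)
qed

lemma integrand_measurable:
 assumes "\<omega> \<in> L01"
 shows "(%(z, x). integrand \<omega> z x) \<in> bm (lebesgue \<Otimes>\<^sub>M lebesgue)"
proof -
 have [measurable]: "F \<in> bm lebesgue" by (rule continuous_lebesgue[OF entire_continuous[OF F]])
 have [measurable]: "(%x. \<omega> x $ k) \<in> bm lebesgue" for k
  using assms by (simp add: L01_def)
 have "(%x. exp (- F x) * \<omega> x $ k) \<in> bm lebesgue" for k by measurable
 hence "(%(z, x). exp (phase (dpsi (psi_of \<phi>t F)) z x) * BAker (dbar_mat (dpsi (psi_of \<phi>t F)) x) z x (exp (- F x) *s \<omega> x))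
   \<in> bm (lebesgue \<Otimes>\<^sub>M lebesgue)"
  by (intro BA_kernel_measurable Ck_dpsi psi) simp
 thus ?thesis unfolding BA_integrand_eq[OF psi] case_prod_unfold by (rule borel_measurable_times[OF borel_measurable_const])
qed

lemma integrand_measurable2: "\<omega> \<in> L01 ==> integrand \<omega> z \<in> bm lebesgue"
 using measurable_compose[OF measurable_Pair1'[of z lebesgue lebesgue] integrand_measurable] by simp

lemma T_op_measurable:
 assumes \<omega>: "\<omega> \<in> L01"
 shows "T_op \<phi>t F \<omega> \<in> bm lebesgue"
proof -
 interpret sigma_finite_measure "lebesgue :: (complex^'n) measure" by (rule sigma_finite_lebesgue)
 have [measurable]: "F \<in> bm lebesgue" by (rule continuous_lebesgue[OF entire_continuous[OF F]])
 have [measurable]: "(%z. LINT \<xi>|lebesgue. integrand \<omega> z \<xi>) \<in> bm lebesgue"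
  by (rule borel_measurable_lebesgue_integral[OF integrand_measurable[OF \<omega>]])
 show ?thesis unfolding T_op_def[abs_def] BA_op_def by measurable
qed

lemma integrand_integrable:
 assumes \<omega>: "\<omega> \<in> L01" and fin: "(\<integral>\<^sup>+x. ennreal (kk z x * Phi \<omega> x) \<partial>lebesgue) < \<infinity>"
 shows "integrable lebesgue (integrand \<omega> z)"
proof (rule integrableI_bounded)
 show "integrand \<omega> z \<in> bm lebesgue" by (rule integrand_measurable2[OF \<omega>])
 let ?c = "exp (Re (F z) - \<phi>t z)"
 have le: "ennreal (norm (integrand \<omega> z x)) <= ennreal (kc / ?c) * ennreal (kk z x * Phi \<omega> x)" for x
 proof -
  have "norm (integrand \<omega> z x) <= kc * (kk z x * Phi \<omega> x) / ?c" using integrand_bound[of \<omega> z x] by (simp add: pos_le_divide_eq)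
  thus ?thesis using kc_nonneg by (simp add: ennreal_mult'[symmetric] ennreal_leI)
 qed
 have [measurable]: "(%x. kk z x) \<in> bm lebesgue"
  using measurable_compose[OF measurable_Pair1'[of z lebesgue lebesgue] kk_measurable] by simp
 note [measurable] = Phi_measurable[OF \<omega>]
 have "(\<integral>\<^sup>+x. ennreal (norm (integrand \<omega> z x)) \<partial>lebesgue) <= (\<integral>\<^sup>+x. ennreal (kc / ?c) * ennreal (kk z x * Phi \<omega> x) \<partial>lebesgue)"
  by (intro nn_integral_mono le)
 also have "... = ennreal (kc / ?c) * (\<integral>\<^sup>+x. ennreal (kk z x * Phi \<omega> x) \<partial>lebesgue)" by (rule nn_integral_cmult) measurable
 also have "... < \<infinity>" using fin by (simp add: ennreal_mult_less_top)
 finally show "(\<integral>\<^sup>+x. ennreal (norm (integrand \<omega> z x)) \<partial>lebesgue) < \<infinity>" .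
qed

text \<open>Valid for every \<open>z\<close>: where the integrand is not integrable the operator has
  the default value 0.\<close>

lemma T_op_bound:
 assumes \<omega>: "\<omega> \<in> L01"
 shows "ennreal (norm (T_op \<phi>t F \<omega> z) * exp (- \<phi>t z)) <=
  ennreal (norm (BA_const TYPE('n)) * kc) * (\<integral>\<^sup>+x. ennreal (kk z x * Phi \<omega> x) \<partial>lebesgue)"
proof -
 let ?c = "exp (Re (F z) - \<phi>t z)" and ?b = "norm (BA_const TYPE('n))"
 have [measurable]: "(%x. kk z x) \<in> bm lebesgue"
  using measurable_compose[OF measurable_Pair1'[of z lebesgue lebesgue] kk_measurable] by simp
 note [measurable] = Phi_measurable[OF \<omega>] integrand_measurable2[OF \<omega>]
 have "ennreal (norm (LINT \<xi>|lebesgue. integrand \<omega> z \<xi>)) <= (\<integral>\<^sup>+x. ennreal (norm (integrand \<omega> z x)) \<partial>lebesgue)"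
  by (cases "integrable lebesgue (integrand \<omega> z)") (simp_all add: integral_norm_bound_ennreal not_integrable_integral_eq)
 have "norm (T_op \<phi>t F \<omega> z) * exp (- \<phi>t z) = ?b * ?c * norm (LINT \<xi>|lebesgue. integrand \<omega> z \<xi>)"
  unfolding T_op_def BA_op_def by (simp add: norm_mult exp_diff exp_minus field_simps)
 hence "ennreal (norm (T_op \<phi>t F \<omega> z) * exp (- \<phi>t z)) = ennreal (?b * ?c) * ennreal (norm (LINT \<xi>|lebesgue. integrand \<omega> z \<xi>))"
  by (simp add: ennreal_mult')
 also have "... <= ennreal (?b * ?c) * (\<integral>\<^sup>+x. ennreal (norm (integrand \<omega> z x)) \<partial>lebesgue)"
  by (intro mult_left_mono \<open>_ <= (\<integral>\<^sup>+x. ennreal (norm (integrand \<omega> z x)) \<partial>lebesgue)\<close>) simp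
 also have "... = (\<integral>\<^sup>+x. ennreal (?b * ?c) * ennreal (norm (integrand \<omega> z x)) \<partial>lebesgue)"
  by (rule nn_integral_cmult[symmetric]) measurable
 also have "... <= (\<integral>\<^sup>+x. ennreal (?b * kc) * ennreal (kk z x * Phi \<omega> x) \<partial>lebesgue)"
 proof (rule nn_integral_mono)
  fix x
  have "?b * (norm (integrand \<omega> z x) * ?c) <= ?b * (kc * (kk z x * Phi \<omega> x))"
   by (intro mult_left_mono integrand_bound) simp
  thus "ennreal (?b * ?c) * ennreal (norm (integrand \<omega> z x)) <= ennreal (?b * kc) * ennreal (kk z x * Phi \<omega> x)"
   using kc_nonneg by (simp add: ennreal_mult'[symmetric] ennreal_leI mult_ac)
 qed
 also have "... = ennreal (?b * kc) * (\<integral>\<^sup>+x. ennreal (kk z x * Phi \<omega> x) \<partial>lebesgue)"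
  by (rule nn_integral_cmult) measurable
 finally show ?thesis .
qed

lemma T_definedI:
 assumes "\<omega> \<in> L01" "AE z in lebesgue. (\<integral>\<^sup>+x. ennreal (kk z x * Phi \<omega> x) \<partial>lebesgue) < \<infinity>"
 shows "T_defined \<phi>t F \<omega>"
 unfolding T_defined_def BA_defined_def using assms(2) by (rule eventually_mono) (rule integrand_integrable[OF assms(1)])

lemma T_estimate_finite:
 assumes p: "1 <= p" "p ~= \<infinity>" and \<phi>: "\<phi> \<in> bm borel" and near: "AE z in lebesgue. \<bar>\<phi> z - ereal (\<phi>t z)\<bar> <= ereal B"
 shows "\<exists>C::real. 0 < C \<and> (\<forall>\<omega>\<in>L01. (%z. \<rho> z *\<^sub>R \<omega> z) \<in> Lform p \<phi> \<longrightarrow>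
  T_defined \<phi>t F \<omega> \<and> Lnorm p \<phi> (%z. cmod (T_op \<phi>t F \<omega> z)) <= ennreal C * Lnorm p \<phi> (%z. form01_abs (\<rho> z *\<^sub>R \<omega> z)))"
proof -
 obtain S where S: "0 <= S" "!!z. (\<integral>\<^sup>+x. ennreal (kk z x) \<partial>lebesgue) <= ennreal S" "!!x. (\<integral>\<^sup>+z. ennreal (kk z x) \<partial>lebesgue) <= ennreal S"
  by (rule kk_schur, rule that)
 define P where "P = enn2real p"
 have P: "1 <= P" using p unfolding P_def by (cases p) (auto simp: top_unique)
 let ?c = "norm (BA_const TYPE('n)) * kc"
 \<comment> \<open>The Schur constant between two changes of weight; the added 1 ensures
   positivity.\<close>
 define D where "D = exp (P * B) * ((?c * (1 + S)) powr P * S) * exp (P * B) + 1"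
 have D: "0 < D" using S(1) by (simp add: D_def add_nonneg_pos)
 have "T_defined \<phi>t F \<omega> \<and> Lnorm p \<phi> (%z. cmod (T_op \<phi>t F \<omega> z)) <= ennreal (D powr (1 / P)) * Lnorm p \<phi> (%z. form01_abs (\<rho> z *\<^sub>R \<omega> z))"
  if \<omega>: "\<omega> \<in> L01" and form: "(%z. \<rho> z *\<^sub>R \<omega> z) \<in> Lform p \<phi>" for \<omega>
 proof -
  let ?h = "%z. form01_abs (\<rho> z *\<^sub>R \<omega> z)" and ?t = "%z. cmod (T_op \<phi>t F \<omega> z)"
  let ?I = "%h. \<integral>\<^sup>+z. ennreal (h z powr P) * eexp (- (ereal P * \<phi> z)) \<partial>lebesgue"
  have L: "Lnorm p \<phi> h = ennreal_powr (?I h) (1 / P)" for h using p by (simp add: Lnorm_def P_def)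
  have hm: "?h \<in> bm lebesgue" using form by (intro form01_abs_measurable) (auto simp: Lform_def L01_def)
  have tm: "?t \<in> bm lebesgue" using T_op_measurable[OF \<omega>] by measurable
  have "Lnorm p \<phi> ?h < \<infinity>" using form by (simp add: Lform_def)
  hence "?I ?h < \<infinity>" by (simp only: L ennreal_powr_less_top_iff)
  have Ph: "(\<integral>\<^sup>+x. ennreal (Phi \<omega> x powr P) \<partial>lebesgue) <= ennreal (exp (P * B)) * ?I ?h"
   unfolding Phi_def using P by (intro weighted_integral_compare(2)[OF near _ _ \<phi>] hm phit_lebesgue) (auto simp: form01_abs_nonneg)
  also have "... < \<infinity>" using \<open>?I ?h < \<infinity>\<close> by (simp add: ennreal_mult_less_top)
  finally have fin: "(\<integral>\<^sup>+x. ennreal (Phi \<omega> x powr P) \<partial>lebesgue) < \<infinity>" .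
  note sch = schur_Lp[OF kk_measurable Phi_measurable[OF \<omega>] kk_nonneg Phi_nonneg, of "%z. ?t z * exp (- \<phi>t z)" ?c P S, OF _ _ P S fin T_op_bound[OF \<omega>]]
  have "?I ?t <= ennreal (exp (P * B)) * (\<integral>\<^sup>+z. ennreal ((?t z * exp (- \<phi>t z)) powr P) \<partial>lebesgue)"
   using P by (intro weighted_integral_compare(1)[OF near _ _ \<phi>] tm phit_lebesgue) auto
  also have "... <= ennreal (exp (P * B)) * (ennreal ((?c * (1 + S)) powr P * S) * (ennreal (exp (P * B)) * ?I ?h))"
   using kc_nonneg by (intro mult_left_mono order_trans[OF sch(2)] Ph) auto
  also have "... = ennreal (exp (P * B) * ((?c * (1 + S)) powr P * S) * exp (P * B)) * ?I ?h"
   using S(1) by (simp add: ennreal_mult' mult.assoc)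
  also have "... <= ennreal D * ?I ?h" by (intro mult_right_mono ennreal_leI) (auto simp: D_def)
  finally have "?I ?t <= ennreal D * ?I ?h" .
  hence "ennreal_powr (?I ?t) (1 / P) <= ennreal (D powr (1 / P)) * ennreal_powr (?I ?h) (1 / P)"
   using P by (intro ennreal_powr_mono_scale D) auto
  moreover have "T_defined \<phi>t F \<omega>" by (rule T_definedI[OF \<omega> sch(1)]) (use kc_nonneg in auto)
  ultimately show ?thesis by (simp only: L)
 qed
 thus ?thesis using D by (intro exI[of _ "D powr (1 / P)"]) auto
qed

text \<open>Here \<open>Phi\<close> is essentially bounded, and the integral of the kernel in
  \<open>x\<close> alone gives the estimate.\<close>

lemma T_estimate_infinite:
 assumes \<phi> [measurable]: "\<phi> \<in> bm borel" and near: "AE z in lebesgue. \<bar>\<phi> z - ereal (\<phi>t z)\<bar> <= ereal B"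
 shows "\<exists>C::real. 0 < C \<and> (\<forall>\<omega>\<in>L01. (%z. \<rho> z *\<^sub>R \<omega> z) \<in> Lform \<infinity> \<phi> \<longrightarrow>
  T_defined \<phi>t F \<omega> \<and> Lnorm \<infinity> \<phi> (%z. cmod (T_op \<phi>t F \<omega> z)) <= ennreal C * Lnorm \<infinity> \<phi> (%z. form01_abs (\<rho> z *\<^sub>R \<omega> z)))"
proof -
 obtain S where S: "0 <= S" "!!z. (\<integral>\<^sup>+x. ennreal (kk z x) \<partial>lebesgue) <= ennreal S" "!!x. (\<integral>\<^sup>+z. ennreal (kk z x) \<partial>lebesgue) <= ennreal S"
  by (rule kk_schur, rule that)
 let ?c = "norm (BA_const TYPE('n)) * kc"
 define D where "D = exp B * (?c * (S * exp B)) + 1"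
 have c0': "0 <= ?c" using kc_nonneg by simp
 have D: "0 < D" using S(1) c0' by (simp add: D_def add_nonneg_pos)
 have [measurable]: "\<phi> \<in> bm lebesgue" by (rule borel_lebesgue[OF \<phi>])
 have "T_defined \<phi>t F \<omega> \<and> Lnorm \<infinity> \<phi> (%z. cmod (T_op \<phi>t F \<omega> z)) <= ennreal D * Lnorm \<infinity> \<phi> (%z. form01_abs (\<rho> z *\<^sub>R \<omega> z))"
  if \<omega>: "\<omega> \<in> L01" and form: "(%z. \<rho> z *\<^sub>R \<omega> z) \<in> Lform \<infinity> \<phi>" for \<omega>
 proof -
  let ?h = "%z. form01_abs (\<rho> z *\<^sub>R \<omega> z)" and ?t = "%z. cmod (T_op \<phi>t F \<omega> z)"
  have L: "Lnorm \<infinity> \<phi> h = esssup lebesgue (%z. ennreal (h z) * eexp (- \<phi> z))" for h by (simp add: Lnorm_def)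
  have tm [measurable]: "T_op \<phi>t F \<omega> \<in> bm lebesgue" by (rule T_op_measurable[OF \<omega>])
  obtain y where y: "Lnorm \<infinity> \<phi> ?h = ennreal y" "0 <= y"
   using form by (cases "Lnorm \<infinity> \<phi> ?h") (auto simp: Lform_def)
  have PhiB: "AE x in lebesgue. Phi \<omega> x <= exp B * y"
   using near esssup_AE[where M=lebesgue and f="%z. ennreal (?h z) * eexp (- \<phi> z)"]
  proof eventually_elim
   case (elim x)
   obtain f where f: "\<phi> x = ereal f" "\<bar>f - \<phi>t x\<bar> <= B" using elim(1) by (rule ereal_near_real)
   have "ennreal (?h x) * ennreal (exp (- f)) <= ennreal y" using elim(2) f(1) unfolding y(1)[unfolded L] by simp
   hence "?h x * exp (- f) <= y" using y(2) by (simp add: ennreal_mult'[symmetric] ennreal_le_iff form01_abs_nonneg)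
   hence y': "exp B * (?h x * exp (- f)) <= exp B * y" by (rule mult_left_mono) simp
   have "?h x * exp (- \<phi>t x) <= ?h x * (exp B * exp (- f))"
    using f(2) by (intro mult_left_mono form01_abs_nonneg) (simp add: mult_exp_exp)
   also have "... = exp B * (?h x * exp (- f))" by (rule mult.left_commute)
   also note y'
   finally show ?case by (simp only: Phi_def)
  qed
  have K: "(\<integral>\<^sup>+x. ennreal (kk z x * Phi \<omega> x) \<partial>lebesgue) <= ennreal (S * (exp B * y))" for z
  proof -
   have [measurable]: "(%x. kk z x) \<in> bm lebesgue"
    using measurable_compose[OF measurable_Pair1'[of z lebesgue lebesgue] kk_measurable] by simp
   have "(\<integral>\<^sup>+x. ennreal (kk z x * Phi \<omega> x) \<partial>lebesgue) <= (\<integral>\<^sup>+x. ennreal (kk z x) * ennreal (exp B * y) \<partial>lebesgue)"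
   proof (rule nn_integral_mono_AE, use PhiB in eventually_elim)
    case (elim x)
    hence "kk z x * Phi \<omega> x <= kk z x * (exp B * y)" by (intro mult_left_mono kk_nonneg)
    thus ?case using kk_nonneg y(2) by (simp add: ennreal_mult'[symmetric] ennreal_leI)
   qed
   also have "... = (\<integral>\<^sup>+x. ennreal (kk z x) \<partial>lebesgue) * ennreal (exp B * y)" by (rule nn_integral_multc) measurable
   also have "... <= ennreal S * ennreal (exp B * y)" by (intro mult_right_mono S) simp
   also have "... = ennreal (S * (exp B * y))" using S(1) by (simp add: ennreal_mult')
   finally show ?thesis .
  qed
  have "T_defined \<phi>t F \<omega>"
   by (rule T_definedI[OF \<omega>]) (use K in \<open>auto intro!: AE_I2 le_less_trans[OF K]\<close>)
  moreover have "Lnorm \<infinity> \<phi> ?t <= ennreal D * ennreal y"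
   unfolding L
  proof (rule esssup_I)
   show "(%z. ennreal (?t z) * eexp (- \<phi> z)) \<in> bm lebesgue" by measurable
   show "AE z in lebesgue. ennreal (?t z) * eexp (- \<phi> z) <= ennreal D * ennreal y"
    using near
   proof eventually_elim
    case (elim z)
    obtain f where f: "\<phi> z = ereal f" "\<bar>f - \<phi>t z\<bar> <= B" using elim by (rule ereal_near_real)
    have "ennreal (?t z * exp (- \<phi>t z)) <= ennreal ?c * ennreal (S * (exp B * y))"
     by (rule order_trans[OF T_op_bound[OF \<omega>]]) (intro mult_left_mono K, simp)
    hence t: "?t z * exp (- \<phi>t z) <= ?c * (S * (exp B * y))"
     using c0' S(1) y(2) by (simp add: ennreal_mult'[symmetric] ennreal_le_iff)
    have "?t z * exp (- f) <= ?t z * (exp B * exp (- \<phi>t z))"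
     using f(2) by (intro mult_left_mono) (simp_all add: mult_exp_exp)
    also have "... = exp B * (?t z * exp (- \<phi>t z))" by simp
    also have "... <= exp B * (?c * (S * (exp B * y)))" using t by (intro mult_left_mono) auto
    also have "... <= D * y" using y(2) by (simp add: D_def algebra_simps)
    finally show ?case using y(2) D f(1) by (simp add: ennreal_mult'[symmetric] ennreal_leI)
   qed
  qed
  ultimately show ?thesis by (simp only: y(1))
 qed
 thus ?thesis using D by (intro exI[of _ D]) auto
qed

end

section \<open>Entire functions and growth in the Fock space\<close>

subsection \<open>Entire functions\<close>

lemma entire_has_derivative: "entire F ==> (F has_derivative FD F (at x)) (at x)"
 unfolding entire_def by (metis differentiable_def frechet_derivative_works)

lemma entire_derivative_scale:
 assumes "entire F"
 shows "FD F (at x) (c *s v) = c * FD F (at x) v"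
proof -
 obtain f' where f': "(F has_derivative f') (at x)" "!!c v. f' (c *s v) = c * f' v"
  using assms unfolding entire_def by blast
 thus ?thesis using frechet_derivative_at[OF f'(1)] by simp
qed

lemma bounded_linear_scale_vec: "bounded_linear (%c. c *s (v :: complex^'n))"
proof -
 have "linear (%c. c *s v)"
  by (rule linearI) (simp_all add: vec_eq_iff algebra_simps)
 thus ?thesis by (simp add: linear_conv_bounded_linear)
qed

lemma entire_line:
 fixes F :: "complex^'n => complex"
 assumes F: "entire F"
 shows "((%t. F (x + t *s v)) has_field_derivative FD F (at (x + t *s v)) v) (at t)"
proof -
 let ?D = "FD F (at (x + t *s v))"
 have "((%t. x + t *s v) has_derivative (%c. 0 + c *s v)) (at t)"
  by (intro has_derivative_add has_derivative_const bounded_linear_imp_has_derivative bounded_linear_scale_vec)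
 hence "((%t. x + t *s v) has_derivative (%c. c *s v)) (at t)" by simp
 from has_derivative_compose[OF this entire_has_derivative[OF F]]
 have "((%t. F (x + t *s v)) has_derivative (%c. ?D (c *s v))) (at t)" .
 moreover have "(%c. ?D (c *s v)) = (*) (?D v)"
  by (rule ext) (simp add: entire_derivative_scale[OF F] mult.commute)
 ultimately show ?thesis by (simp only: has_field_derivative_def)
qed

definition circ :: "real => complex" where "circ t = exp (2 * of_real pi * \<i> * of_real t)"

lemma circ_nonzero: "circ t ~= 0" by (simp add: circ_def)

lemma continuous_circ: "continuous_on S (%p. circ (f p))" if "continuous_on S f"
 unfolding circ_def by (intro continuous_intros that)

lemma continuous_on_scale_vec:
 "continuous_on S f ==> continuous_on S g ==> continuous_on S (%p. f p *s (g p :: complex^'n))"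
 unfolding vector_scalar_mult_def by (intro continuous_intros)

text \<open>Cauchy's formula on the complex line through \<open>x\<close> in direction
  \<open>v\<close>. It expresses the derivative by values of \<open>F\<close>, so regularity of the
  derivative follows from integrals with a parameter, starting from complex differentiability
  alone.\<close>

lemma entire_derivative_circle:
 fixes F :: "complex^'n => complex"
 assumes F: "entire F"
 shows "FD F (at x) v = integral (cbox 0 1) (%t. F (x + circ t *s v) / circ t)"
proof -
 define h where "h t = F (x + t *s v)" for t
 have hd: "(h has_field_derivative FD F (at (x + t *s v)) v) (at t)" for t
  unfolding h_def[abs_def] by (rule entire_line[OF F])
 have hol: "h holomorphic_on S" for S
  using hd field_differentiable_at_within unfolding holomorphic_on_def field_differentiable_def by blast
 have d0: "deriv h 0 = FD F (at x) v"
  using DERIV_imp_deriv[OF hd[of 0]] by simp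
 have "((%u. h u / (u - 0) ^ Suc 1) has_contour_integral ((2 * pi * \<i>) / fact 1 * (deriv ^^ 1) h 0)) (circlepath 0 1)"
  by (rule Cauchy_has_contour_integral_higher_derivative_circlepath) (auto intro: hol holomorphic_on_imp_continuous_on)
 hence "((%t. h (circlepath 0 1 t) / (circlepath 0 1 t)^2 * vector_derivative (circlepath 0 1) (at t within {0..1}))
   has_integral (2 * pi * \<i>) * FD F (at x) v) {0..1}"
  by (simp add: has_contour_integral_def d0 power2_eq_square)
 hence "((%t. (2 * pi * \<i>) * (F (x + circ t *s v) / circ t)) has_integral (2 * pi * \<i>) * FD F (at x) v) {0..1}"
 proof (rule has_integral_eq[rotated])
  fix t :: real assume t: "t \<in> {0..1}"
  have c: "circlepath 0 1 t = circ t" by (simp add: circlepath circ_def)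
  have "vector_derivative (circlepath 0 1) (at t within {0..1}) = 2 * pi * \<i> * circ t"
   using t vector_derivative_circlepath01[of t 0 1] by (simp add: circ_def)
  thus "h (circlepath 0 1 t) / (circlepath 0 1 t)^2 * vector_derivative (circlepath 0 1) (at t within {0..1}) = (2 * pi * \<i>) * (F (x + circ t *s v) / circ t)"
   using circ_nonzero[of t] by (simp add: c h_def power2_eq_square)
 qed
 from has_integral_mult_right[OF this, of "1 / (2 * pi * \<i>)"]
 have "((%t. F (x + circ t *s v) / circ t) has_integral FD F (at x) v) (cbox 0 1)"
  by (simp add: field_simps)
 thus ?thesis by (rule integral_unique[symmetric])
qed

lemma entire_derivative_continuous:
 fixes F :: "complex^'n => complex"
 assumes F: "entire F"
 shows "cont (%x. FD F (at x) v)"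
 unfolding entire_derivative_circle[OF F]
proof (rule integral_continuous_on_param)
 have "continuous_on (UNIV \<times> cbox 0 1) (%p. F (fst p + circ (snd p) *s v) / circ (snd p))"
  by (intro continuous_intros continuous_circ continuous_on_scale_vec continuous_on_compose2[OF entire_continuous[OF F]])
   (auto simp: circ_nonzero)
 thus "continuous_on (UNIV \<times> cbox 0 1) (%(x, t). F (x + circ t *s v) / circ t)"
  by (simp only: case_prod_unfold)
qed

text \<open>Differentiation of the circle integral in the base point; complex linearity of the
  resulting differential is inherited from the integrand.\<close>

lemma entire_derivative:
 fixes F :: "complex^'n::finite => complex"
 assumes F: "entire F"
 shows "entire (%x. FD F (at x) v)"
 unfolding entire_def
proof
 fix x0 :: "complex^'n"
 define fx where "fx x t = Blinfun (%w. FD F (at (x + circ t *s v)) w / circ t)" for x t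
 have fx: "blinfun_apply (fx x t) = (%w. FD F (at (x + circ t *s v)) w / circ t)" for x t
  unfolding fx_def
  by (rule bounded_linear_Blinfun_apply)
   (intro bounded_linear_compose[OF bounded_linear_divide] has_derivative_bounded_linear[OF entire_has_derivative[OF F]])
 have cont: "continuous_on (UNIV \<times> cbox 0 1) (%(x, t). fx x t)"
 proof (rule continuous_on_blinfun_componentwise)
  fix i :: "complex^'n"
  have "continuous_on (UNIV \<times> cbox 0 1) (%p. FD F (at (fst p + circ (snd p) *s v)) i / circ (snd p))"
   by (intro continuous_intros continuous_circ continuous_on_scale_vec continuous_on_compose2[OF entire_derivative_continuous[OF F]])
    (auto simp: circ_nonzero)
  thus "continuous_on (UNIV \<times> cbox 0 1) (%p. blinfun_apply (case p of (x, t) => fx x t) i)"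
   by (simp add: case_prod_unfold fx)
 qed
 have "((%x. integral (cbox 0 1) (%t. F (x + circ t *s v) / circ t)) has_derivative integral (cbox 0 1) (fx x0)) (at x0 within UNIV)"
 proof (rule leibniz_rule[OF _ _ cont])
  fix x t
  have "((%x. x + circ t *s v) has_derivative (%w. w + 0)) (at x)"
   by (intro has_derivative_add has_derivative_const has_derivative_ident)
  hence "((%x. x + circ t *s v) has_derivative (%w. w)) (at x)" by simp
  from has_derivative_compose[OF this entire_has_derivative[OF F]]
  show "((%x. F (x + circ t *s v) / circ t) has_derivative blinfun_apply (fx x t)) (at x within UNIV)"
   unfolding fx by (rule bounded_linear.has_derivative[OF bounded_linear_divide])
 next
  fix x
  show "(%t. F (x + circ t *s v) / circ t) integrable_on cbox 0 1"
   by (intro integrable_continuous continuous_intros continuous_circ continuous_on_scale_vec continuous_on_compose2[OF entire_continuous[OF F]])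
    (auto simp: circ_nonzero)
 qed auto
 hence D: "((%x. FD F (at x) v) has_derivative integral (cbox 0 1) (fx x0)) (at x0)"
  by (simp only: entire_derivative_circle[OF F])
 have int: "fx x0 integrable_on cbox 0 1"
 proof (rule integrable_continuous)
  have "continuous_on (cbox 0 1) (%t. case (x0, t) of (x, t) => fx x t)"
   by (rule continuous_on_compose2[OF cont]) (auto intro!: continuous_intros)
  thus "continuous_on (cbox 0 1) (fx x0)" by simp
 qed
 have ev: "blinfun_apply (integral (cbox 0 1) (fx x0)) w = integral (cbox 0 1) (%t. FD F (at (x0 + circ t *s v)) w / circ t)" for w
  using integral_linear[OF int blinfun.bounded_linear_left[of w]] by (simp add: o_def fx)
 have "blinfun_apply (integral (cbox 0 1) (fx x0)) (c *s w) = c * blinfun_apply (integral (cbox 0 1) (fx x0)) w" for c w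
  unfolding ev entire_derivative_scale[OF F] by (simp only: times_divide_eq_right[symmetric] integral_mult_right)
 thus "\<exists>f'. ((%x. FD F (at x) v) has_derivative f') (at x0) \<and> (\<forall>c w. f' (c *s w) = c * f' w)"
  using D by blast
qed

lemma entire_Ck: "entire F ==> Ck k F"
proof (induction k arbitrary: F)
 case 0
 thus ?case by (simp add: Ck.simps entire_continuous)
next
 case (Suc k)
 show ?case
  by (rule Ck_SucI[OF entire_has_derivative[OF Suc.prems]]) (rule Suc.IH[OF entire_derivative[OF Suc.prems]])
qed

lemma entire_pd_zbar:
 fixes F :: "complex^'n => complex"
 assumes F: "entire F"
 shows "pd_zbar k F z = 0"
proof -
 have "axis k \<i> = \<i> *s (axis k 1 :: complex^'n)" by (simp add: vec_eq_iff axis_def)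
 hence "FD F (at z) (axis k \<i>) = \<i> * FD F (at z) (axis k 1)"
  by (simp only: entire_derivative_scale[OF F])
 thus ?thesis by (simp add: pd_zbar_def)
qed

lemma entire_dbar: "entire F ==> dbar F z = 0"
 by (simp add: dbar_def entire_pd_zbar vec_eq_iff)

text \<open>The Levi bounds make the Monge--Ampere density comparable to \<rho>^(-2n), which turns
  doubling into the comparison \<open>cmp\<close> of the weight at two points; the convexity
  constants come directly from the Hessian bounds.\<close>

lemma gc_weight_exists:
 fixes \<rho> :: "complex^'n::finite => real"
 assumes gc: "gc_data \<phi> \<rho> \<phi>t F"
 obtains c0 m M A N where "gc_weight \<rho> c0 \<phi>t F m M A N"
proof -
 from gc obtain m M :: real where mM: "0 < m" "m <= M" and hess: "!!z v. m * \<rho> z powi (-2) * (v \<bullet> v) <= hessian (%x. \<phi>t x - Re (F x)) z v v"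
   "!!z v. hessian (%x. \<phi>t x - Re (F x)) z v v <= M * \<rho> z powi (-2) * (v \<bullet> v)"
  and S: "\<rho> \<in> class_S" and reg: "regularization \<rho> \<phi> \<phi>t" and db: "doubling (monge_ampere \<phi>t)" and F: "entire F"
  unfolding gc_data_def by blast
 obtain c0 where "S_weight \<rho> c0" using S by (rule S_weight_exists)
 then interpret S_weight \<rho> c0 .
 have C2: "Ck2 \<phi>t" using reg by (simp add: regularization_def strictly_psh_C2_def numeral_2_eq_2)
 have psi: "Ck2 (psi_of \<phi>t F)"
  unfolding psi_of_def[abs_def] by (intro Ck_diff C2 Ck_bounded_linear[OF bounded_linear_Re] entire_Ck F)
 have e: "(%x. \<phi>t x - Re (F x)) = psi_of \<phi>t F" by (simp add: psi_of_def fun_eq_iff)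
 have pw: "c * \<rho> z powi (-2) * (v \<bullet> v) = c / (\<rho> z)^2 * (norm v)^2" for c z and v :: "complex^'n"
  by (simp add: power_int_minus divide_inverse power2_norm_eq_inner)
 interpret pinched \<rho> c0 "psi_of \<phi>t F" m M
  by unfold_locales (use psi mM hess in \<open>simp_all only: e pw\<close>)
 let ?H = "%z. Re (top_coeff (wpow2 (i_del_dbar_form (%x. of_real (\<phi>t x)) z) CARD('n)))"
 obtain a1 a2 where a: "0 < a1" "0 < a2" "!!z. a1 / \<rho> z ^ (2 * CARD('n)) <= ?H z" "!!z. ?H z <= a2 / \<rho> z ^ (2 * CARD('n))"
  using rho_pos reg by (rule MA_density_bounds) blast
 have Hm: "?H \<in> bm borel"
  unfolding top_coeff_levi levi_def
  by (intro borel_measurable_continuous_onI continuous_intros continuous_on_det)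
   (simp, intro Ck_continuous[of 0] Ck_pd_z Ck_pd_zbar Ck_of_real C2)
 obtain A N where AN: "1 <= A" "0 < N" "!!z w. \<rho> z <= dist z w ==> \<rho> w <= dist z w ==> dist z w / \<rho> z <= A * (dist z w / \<rho> w) ^ N"
  using doubling_comparison[OF Hm a] db unfolding monge_ampere_def by blast
 have "gc_weight \<rho> c0 \<phi>t F m M A N"
  by unfold_locales (use AN F Ck_continuous[OF C2] in auto)
 thus thesis by (rule that)
qed

context pinched_doubling
begin

subsection \<open>Growth of the weight and decay of the kernel\<close>

text \<open>Comparison with the origin. If one of the two points lies within the weight of the
  other, \<rho> x is comparable to \<rho> 0; otherwise \<open>cmp\<close> applies to (x, 0) for 1 /
  \<rho> and to (0, x) for the last bound.\<close>

lemma rho_growth: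
 obtains B L where "1 <= B" "!!x. \<rho> x <= B * (1 + norm x)" "!!x. 1 / \<rho> x <= B * (1 + norm x) ^ L" "!!x. norm x <= B * (1 + norm x / \<rho> x) ^ L"
proof -
 have r0: "0 < \<rho> 0" by (rule rho_pos)
 define B where "B = 1 + c0 * \<rho> 0 + c0 / \<rho> 0 + A / \<rho> 0 ^ (N + 1) + \<rho> 0 * A"
 have c00: "0 < c0" "0 <= A" using c0 A by auto
 have t: "0 <= c0 * \<rho> 0" "0 <= c0 / \<rho> 0" "0 <= A / \<rho> 0 ^ (N + 1)" "0 <= \<rho> 0 * A" using c00 r0 by auto
 have B: "1 <= B" "c0 * \<rho> 0 <= B" "c0 / \<rho> 0 <= B" "A / \<rho> 0 ^ (N + 1) <= B" "\<rho> 0 * A <= B"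
  using t unfolding B_def by linarith+
 have main: "\<rho> x <= B * (1 + norm x) \<and> 1 / \<rho> x <= B * (1 + norm x) ^ N \<and> norm x <= B * (1 + norm x / \<rho> x) ^ N" for x
 proof -
  have d: "dist 0 x = norm x" "dist x 0 = norm x" by simp_all
  have rx: "0 < \<rho> x" by (rule rho_pos)
  have ge1: "B <= B * (1 + norm x)" "B <= B * (1 + norm x) ^ N" "B <= B * (1 + norm x / \<rho> x) ^ N"
   using B(1) rx by (simp_all add: mult_le_cancel_left1 one_le_power)
  show ?thesis
  proof (cases "dist 0 x < max (\<rho> 0) (\<rho> x)")
   case True
   note rc = rho_comparable[OF True]
   have "\<rho> x <= B" using rc(2) B(2) by linarith
   moreover have "1 / \<rho> x <= B"
   proof -
    have "1 / \<rho> x <= c0 / \<rho> 0" using rc(1) r0 rx by (simp add: field_simps)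
    thus ?thesis using B(3) by linarith
   qed
   moreover have "norm x <= B"
   proof -
    have "\<rho> 0 <= c0 * \<rho> 0" using c0 r0 by simp
    hence "max (\<rho> 0) (\<rho> x) <= c0 * \<rho> 0" using rc(2) by simp
    thus ?thesis using True B(2) unfolding d by linarith
   qed
   ultimately show ?thesis using ge1 by linarith
  next
   case False
   hence far: "\<rho> 0 <= norm x" "\<rho> x <= norm x" by auto
   have "\<rho> x <= B * (1 + norm x)"
   proof -
    have "1 * (1 + norm x) <= B * (1 + norm x)" using B(1) by (intro mult_right_mono) auto
    moreover have "\<rho> x <= 1 * (1 + norm x)" using far by simp
    ultimately show ?thesis by (rule order_trans[rotated])
   qed
   moreover have "1 / \<rho> x <= B * (1 + norm x) ^ N"
   proof -
    have nx: "0 < norm x" using far r0 by linarith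
    have "norm x / \<rho> x <= A * (norm x / \<rho> 0) ^ N" using cmp[of x 0] far unfolding d by simp
    hence "norm x * (1 / \<rho> x) <= A / \<rho> 0 ^ N * norm x ^ N" by (simp add: power_divide)
    also have "... = (A / \<rho> 0 ^ (N + 1)) * \<rho> 0 * norm x ^ N" using r0 by simp
    also have "... <= (A / \<rho> 0 ^ (N + 1)) * norm x * norm x ^ N"
     using far t by (intro mult_right_mono mult_left_mono) auto
    also have "... = norm x * ((A / \<rho> 0 ^ (N + 1)) * norm x ^ N)" by simp
    finally have "1 / \<rho> x <= (A / \<rho> 0 ^ (N + 1)) * norm x ^ N" using nx mult_left_le_imp_le by blast
    also have "... <= B * (1 + norm x) ^ N" using B by (intro mult_mono power_mono) auto
    finally show ?thesis .
   qed
   moreover have "norm x <= B * (1 + norm x / \<rho> x) ^ N"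
   proof -
    have "norm x / \<rho> 0 <= A * (norm x / \<rho> x) ^ N" using cmp[of 0 x] far unfolding d by simp
    hence "norm x <= \<rho> 0 * A * (norm x / \<rho> x) ^ N" using r0 by (simp add: field_simps)
    also have "... <= B * (1 + norm x / \<rho> x) ^ N" using B rx by (intro mult_mono power_mono) auto
    finally show ?thesis .
   qed
   ultimately show ?thesis by blast
  qed
 qed
 show thesis by (rule that[of B N]) (use B(1) main in auto)
qed

text \<open>For |x| at least 2 |z| the distance is at least |x| / 2, and |x| is bounded by a power
  of 1 + |x| / \<open>\<rho> x\<close>; exponential decay in |x| / \<open>\<rho> x\<close> thus
  beats every power of |x|.\<close>

lemma phase_decay:
 obtains C where "0 < C" "!!z x. 2 * norm z <= norm x ==>
  (1 + norm x) ^ L * norm (exp (phase (dpsi \<psi>) z x)) <= C * exp (\<psi> z - \<psi> x)"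
proof -
 obtain B L1 where B: "1 <= B" "!!x. norm x <= B * (1 + norm x / \<rho> x) ^ L1" by (rule rho_growth, rule that)
 have k2: "0 < \<kappa> / 2" using kappa_pos by simp
 obtain C where C: "0 < C" "!!t. 0 <= t ==> (1 + t) ^ (L1 * L) * exp (- (\<kappa> / 2 * t)) <= C" by (rule poly_exp_bound[OF k2, of "L1 * L"], rule that)
 show thesis
 proof (rule that[of "(2 * B) ^ L * C * exp \<kappa>"])
  show "0 < (2 * B) ^ L * C * exp \<kappa>" using B C by simp
  fix z x :: "complex^'n" assume zx: "2 * norm z <= norm x"
  define t where "t = norm x / \<rho> x"
  have t0: "0 <= t" using rho_pos[of x] by (simp add: t_def)
  have "norm x / 2 <= dist z x" using zx norm_triangle_ineq3[of x z] by (simp add: dist_norm norm_minus_commute)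
  hence "norm x / 2 / \<rho> x <= dist z x / \<rho> x" using rho_pos[of x] by (intro divide_right_mono) auto
  hence tz: "t / 2 <= dist z x / \<rho> x" by (simp add: t_def)
  have "1 * 1 <= B * (1 + t) ^ L1" using B(1) t0 by (intro mult_mono one_le_power) auto
  hence "1 + norm x <= 2 * B * (1 + t) ^ L1" using B(2)[of x] by (simp add: t_def)
  hence "(1 + norm x) ^ L <= (2 * B * (1 + t) ^ L1) ^ L" by (intro power_mono) auto
  also have "... = (2 * B) ^ L * (1 + t) ^ (L1 * L)" by (simp only: power_mult_distrib power_mult)
  finally have p: "(1 + norm x) ^ L <= (2 * B) ^ L * (1 + t) ^ (L1 * L)" .
  have "norm (exp (phase (dpsi \<psi>) z x)) <= exp (\<psi> z - \<psi> x) * exp (- (\<kappa> * (dist z x / \<rho> x - 1)))" by (rule norm_exp_phase)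
  also have "... <= exp (\<psi> z - \<psi> x) * exp (\<kappa> + - (\<kappa> / 2 * t))"
  proof -
   have "\<kappa> * (t / 2) <= \<kappa> * (dist z x / \<rho> x)" using tz kappa_pos by (intro mult_left_mono) auto
   thus ?thesis by (intro mult_left_mono) (auto simp: algebra_simps)
  qed
  finally have e: "norm (exp (phase (dpsi \<psi>) z x)) <= exp (\<psi> z - \<psi> x) * (exp \<kappa> * exp (- (\<kappa> / 2 * t)))" by (simp only: exp_add)
  have "(1 + norm x) ^ L * norm (exp (phase (dpsi \<psi>) z x)) <= ((2 * B) ^ L * (1 + t) ^ (L1 * L)) * (exp (\<psi> z - \<psi> x) * (exp \<kappa> * exp (- (\<kappa> / 2 * t))))"
   using B(1) t0 by (intro mult_mono p e) auto
  also have "... = (2 * B) ^ L * exp \<kappa> * exp (\<psi> z - \<psi> x) * ((1 + t) ^ (L1 * L) * exp (- (\<kappa> / 2 * t)))" by (simp only: mult_ac)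
  also have "... <= (2 * B) ^ L * exp \<kappa> * exp (\<psi> z - \<psi> x) * C" using B(1) by (intro mult_left_mono C(2) t0) auto
  finally show "(1 + norm x) ^ L * norm (exp (phase (dpsi \<psi>) z x)) <= (2 * B) ^ L * C * exp \<kappa> * exp (\<psi> z - \<psi> x)" by (simp only: mult_ac)
 qed
qed

end

subsection \<open>A cutoff profile\<close>

lemma DERIV_pos_part_square: "((%t::real. (max 0 t)^2) has_field_derivative 2 * max 0 t) (at t)"
proof -
 consider "0 < t" | "t < 0" | "t = 0" by linarith
 thus ?thesis
 proof cases
  case 1
  have "((%t::real. t^2) has_field_derivative 2 * max 0 t) (at t)"
   using 1 by (auto intro!: derivative_eq_intros)
  thus ?thesis
   by (rule has_field_derivative_transform_within_open[of _ _ _ "{0<..}"]) (use 1 in auto)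
 next
  case 2
  have "((%t::real. 0) has_field_derivative 2 * max 0 t) (at t)" using 2 by simp
  thus ?thesis
   by (rule has_field_derivative_transform_within_open[of _ _ _ "{..<0}"]) (use 2 in auto)
 next
  case 3
  have "((%h::real. max 0 h) \<longlongrightarrow> max 0 0) (at 0)" by (intro tendsto_intros)
  hence "((%h::real. max 0 h) \<longlongrightarrow> 0) (at 0)" by simp
  moreover have "\<forall>\<^sub>F h in at (0::real). max 0 h = ((max 0 (0 + h))^2 - (max 0 0)\<^sup>2) / h"
   by (rule eventually_at_filter[THEN iffD2], rule always_eventually) (auto simp: max_def power2_eq_square)
  ultimately have "((%h::real. ((max 0 (0 + h))^2 - (max 0 0)\<^sup>2) / h) \<longlongrightarrow> 0) (at 0)"
   by (rule Lim_transform_eventually)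
  thus ?thesis using 3 by (simp add: DERIV_def)
 qed
qed

text \<open>A continuously differentiable function that is \<open>1\<close> on \<open>{..1}\<close> and \<open>0\<close> on \<open>{2..}\<close>, with its derivative.\<close>
definition bump :: "real => real" where
 "bump x = (max 0 (1 - (max 0 (x - 1))\<^sup>2))^2"

definition bump' :: "real => real" where
 "bump' x = 2 * max 0 (1 - (max 0 (x - 1))\<^sup>2) * - (2 * max 0 (x - 1))"

lemma bump_deriv: "(bump has_field_derivative bump' x) (at x)"
proof -
 have i: "((%x. x - 1) has_field_derivative 1) (at x)" by (auto intro!: derivative_eq_intros)
 have "((%x. 1 - (max 0 (x - 1))\<^sup>2) has_field_derivative - (2 * max 0 (x - 1))) (at x)"
  using DERIV_diff[OF DERIV_const[of 1] DERIV_chain2[OF DERIV_pos_part_square i]] by simp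
 from DERIV_chain2[OF DERIV_pos_part_square this] show ?thesis
  by (simp only: bump_def[abs_def] bump'_def)
qed

lemma bump_scaled_deriv: "((%s. bump (2 * s / r^2)) has_field_derivative bump' (2 * s / r^2) * (2 / r^2)) (at s)"
proof (rule DERIV_chain2[OF bump_deriv])
 show "((%s. 2 * s / r^2) has_field_derivative 2 / r^2) (at s)"
  using DERIV_cmult[OF DERIV_ident, of "2 / r^2"] by simp
qed

lemma bump'_continuous: "continuous_on S bump'"
 unfolding bump'_def[abs_def] by (intro continuous_intros)

lemma bump_low: "x <= 1 ==> bump x = 1" "x <= 1 ==> bump' x = 0"
 by (simp_all add: bump_def bump'_def max_def)

lemma bump_high:
 assumes "2 <= x"
 shows "bump x = 0" "bump' x = 0"
proof -
 have "1^2 <= (max 0 (x - 1))^2" using assms by (intro power_mono) auto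
 thus "bump x = 0" "bump' x = 0" by (simp_all add: bump_def bump'_def)
qed

lemma bump_bounds: "0 <= bump x" "bump x <= 1"
proof -
 have "(max 0 (1 - (max 0 (x - 1))\<^sup>2))^2 <= 1^2" by (rule power_mono) auto
 thus "0 <= bump x" "bump x <= 1" by (simp_all add: bump_def)
qed

lemma bump'_bound: "\<bar>bump' x\<bar> <= 4"
proof (cases "x <= 2")
 case True
 have "\<bar>bump' x\<bar> = 2 * max 0 (1 - (max 0 (x - 1))\<^sup>2) * (2 * max 0 (x - 1))" by (simp add: bump'_def)
 also have "... <= (2 * 1) * (2 * 1)" using True by (intro mult_mono) auto
 finally show ?thesis by simp
qed (simp add: bump_high)

lemma Ck1_bump:
 assumes "Ck1 (f :: 'a::euclidean_space => real)"
 shows "Ck1 (%x. bump (f x))"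
 by (rule Ck1_chain[OF bump_deriv bump'_continuous assms])

lemma Ck1_bump_ball: "Ck1 (%x::complex^'n. bump (2 * (norm (x - z))^2 / r^2))"
proof (rule Ck1_bump)
 have "Ck1 (%x::complex^'n. 2 / r^2 * (norm (x - z))^2)" by (intro Ck_mult Ck_const Ck_norm_sq)
 thus "Ck1 (%x::complex^'n. 2 * (norm (x - z))^2 / r^2)" by simp
qed

lemma pd_zbar_of_real_chain:
 fixes u :: "complex^'n => real"
 assumes h: "(h has_field_derivative h') (at (u z))" and u: "u differentiable (at z)"
 shows "pd_zbar k (%x. cor (h (u x))) z = of_real h' * pd_zbar k (%x. cor (u x)) z"
proof -
 let ?D = "FD u (at z)"
 have D: "(u has_derivative ?D) (at z)" using u by (simp add: frechet_derivative_works)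
 have "((%x. cor (h (u x))) has_derivative (%v. of_real (h' * ?D v))) (at z)"
  using has_derivative_compose[OF D, of h "(*) h'"] h
  by (intro bounded_linear.has_derivative[OF bounded_linear_of_real]) (simp add: has_field_derivative_def)
 moreover have "((%x. cor (u x)) has_derivative (%v. of_real (?D v))) (at z)"
  by (intro bounded_linear.has_derivative[OF bounded_linear_of_real] D)
 ultimately show ?thesis by (simp add: pd_zbar_eq algebra_simps)
qed

lemma pd_zbar_norm_sq:
 fixes a x :: "complex^'n::finite"
 shows "pd_zbar k (%x. cor ((norm (x - a))^2)) x = x $ k - a $ k"
proof -
 have s: "(\<Sum>i\<in>UNIV. (x $ i - a $ i) * cnj (axis k c $ i) + axis k c $ i * svec a x $ i) = (x $ k - a $ k) * cnj c + c * svec a x $ k" for c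
  by (subst sum.remove[of _ k]) (auto simp: axis_def intro!: sum.neutral)
 have "pd_zbar k (dist2 a) x = x $ k - a $ k"
  unfolding pd_zbar_eq[OF dist2_has_derivative] s by (simp add: field_simps)
 thus ?thesis by (simp add: dist2_def[abs_def])
qed

subsection \<open>Closure properties of entire functions\<close>

lemma entireI:
 assumes "!!z. (f has_derivative f' z) (at z)" "!!z c v. f' z (c *s v) = c * f' z v"
 shows "entire f"
 unfolding entire_def using assms by blast

lemma entire_const: "entire (%z. c)"
 by (rule entireI[where f'="%z v. 0"]) auto

lemma entire_nth: "entire (%z :: complex^'n. z $ l)"
 by (rule entireI[where f'="%z v. v $ l"]) (auto intro: bounded_linear_imp_has_derivative linear_component_cvec)

lemma entire_add: "entire f ==> entire g ==> entire (%z. f z + g z)"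
 by (rule entireI[OF has_derivative_add[OF entire_has_derivative entire_has_derivative]])
  (auto simp: entire_derivative_scale algebra_simps)

lemma entire_mult: "entire f ==> entire g ==> entire (%z. f z * g z)"
 by (rule entireI[OF has_derivative_mult[OF entire_has_derivative entire_has_derivative]])
  (auto simp: entire_derivative_scale algebra_simps)

lemma entire_minus: "entire f ==> entire (%z. - f z)"
 using entire_mult[OF entire_const, of f "- 1"] by simp

lemma entire_diff: "entire f ==> entire g ==> entire (%z. f z - g z)"
 using entire_add[OF _ entire_minus, of f g] by simp

lemma entire_sum: "(!!i. i \<in> S ==> entire (f i)) ==> entire (%z. \<Sum>i\<in>S. f i z)"
 by (induction S rule: infinite_finite_induct) (auto intro: entire_const entire_add)

lemma entire_exp:
 assumes f: "entire f"
 shows "entire (%z. exp (f z))"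
proof (rule entireI)
 fix z
 show "((%z. exp (f z)) has_derivative (%v. exp (f z) * FD f (at z) v)) (at z)"
  by (rule has_derivative_compose[OF entire_has_derivative[OF f] DERIV_exp[THEN has_field_derivative_imp_has_derivative]])
 show "exp (f z) * FD f (at z) (c *s v) = c * (exp (f z) * FD f (at z) v)" for c v
  by (simp add: entire_derivative_scale[OF f])
qed

lemma entire_phase: "entire (%z. phase q z x)"
 unfolding phase_def by (intro entire_sum entire_mult entire_diff entire_const entire_nth)

subsection \<open>Growth of functions in the Fock space\<close>

context gc_weight
begin

text \<open>The derivative of the cutoff lives where |x - z|^2 is between r^2 / 2 and r^2, away from
  the singularity: there the kernel is of order r^(1 - 2n) and the derivative of order 1 /
  r.\<close>

lemma bump_kernel_bound:
 fixes H :: "complex^'n => complex"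
 assumes H: "entire H" and r: "0 < r"
 shows "norm (BAker 0 z x (dbar (%x. of_real (bump (2 * (norm (x - z))^2 / r^2)) * H x) x)) <=
  adj_bound TYPE('n) * fact CARD('n) * (8 * 2 ^ CARD('n)) / r ^ (2 * CARD('n)) * (indicator (ball z r) x * norm (H x))"
proof -
 let ?n = "CARD('n)" and ?R = "norm (x - z)"
 let ?t = "2 * ?R^2 / r^2" and ?\<chi> = "%x. cor (bump (2 * (norm (x - z))^2 / r^2))"
 have d: "((%s. bump (2 * s / r^2)) has_field_derivative bump' (2 * s / r^2) * (2 / r^2)) (at s)" for s
  by (rule bump_scaled_deriv)
 have C\<chi>: "Ck1 ?\<chi>"
  by (intro Ck_of_real Ck1_bump_ball)
 have p: "pd_zbar k ?\<chi> x = of_real (bump' ?t * (2 / r^2)) * (x $ k - z $ k)" for k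
  using pd_zbar_of_real_chain[OF d Ck_differentiable[OF Ck_norm_sq], of k z x] by (simp only: pd_zbar_norm_sq)
 have D: "dbar (%x. ?\<chi> x * H x) x = H x *s dbar ?\<chi> x"
  using dbar_mult[OF Ck_differentiable[OF C\<chi>] Ck_differentiable[OF entire_Ck[OF H]], of x] by (simp add: entire_dbar[OF H])
 have comp: "norm (dbar (%x. ?\<chi> x * H x) x $ k) = norm (H x) * (\<bar>bump' ?t\<bar> * (2 / r^2) * norm ((x - z) $ k))" for k
  unfolding D by (simp add: dbar_def p norm_mult norm_divide norm_power)
 show ?thesis
 proof (cases "bump' ?t = 0")
  case True
  have "dbar (%x. ?\<chi> x * H x) x = 0" using comp True by (simp add: vec_eq_iff)
  moreover have "BAker 0 z x 0 = 0" using BAker_scale[of 0 z x 0 0] by simp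
  ultimately have "norm (BAker 0 z x (dbar (%x. ?\<chi> x * H x) x)) = 0" by (simp only: norm_zero)
  thus ?thesis using r adj_bound_nonneg[where 'n='n] by (simp only:) (intro mult_nonneg_nonneg divide_nonneg_nonneg, auto)
 next
  case False
  hence t: "1 < ?t" "?t < 2" using bump_low(2) bump_high(2) by (meson not_le)+
  have R: "?R^2 < r^2" "r^2 / 2 < ?R^2" using t r by (simp_all add: field_simps)
  have R0: "0 < ?R^2" using R(2) r by (meson less_trans zero_less_divide_iff zero_less_numeral zero_less_power)
  have "?R < r" by (rule power_less_imp_less_base[OF R(1)]) (use r in simp)
  hence inb: "x \<in> ball z r" by (simp add: dist_norm norm_minus_commute)
  let ?b = "norm (H x) * (8 * ?R / r^2)"
  have b: "norm (dbar (%x. ?\<chi> x * H x) x $ k) <= ?b" for k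
  proof -
   have "\<bar>bump' ?t\<bar> * (2 / r^2) * norm ((x - z) $ k) <= 4 * (2 / r^2) * ?R"
    by (intro mult_mono bump'_bound Finite_Cartesian_Product.norm_nth_le) auto
   thus ?thesis unfolding comp by (intro mult_left_mono) auto
  qed
  have "norm (BAker 0 z x (dbar (%x. ?\<chi> x * H x) x)) <= adj_bound TYPE('n) * fact ?n * (?b * (\<Sum>l<?n. 0 ^ l * (?R / ?R ^ (2 * (?n - l)))))"
   by (intro norm_BAker b) simp
  also have "(\<Sum>l<?n. 0 ^ l * (?R / ?R ^ (2 * (?n - l)))) = ?R / ?R ^ (2 * ?n)"
   by (subst sum.remove[of _ 0]) (auto intro!: sum.neutral)
  also have "?b * (?R / ?R ^ (2 * ?n)) = 8 * norm (H x) * (?R^2 / r^2 * (1 / (?R^2) ^ ?n))"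
   by (simp add: power_mult power2_eq_square)
  also have "... <= 8 * norm (H x) * (1 * (2 ^ ?n / r ^ (2 * ?n)))"
  proof (intro mult_left_mono mult_mono)
   show "?R^2 / r^2 <= 1" using less_imp_le[OF R(1)] by (simp only: pos_divide_le_eq[OF zero_less_power[OF r]])
   have "1 / (?R^2) ^ ?n <= 1 / (r^2 / 2) ^ ?n" using R r R0 by (intro divide_left_mono) auto
   also have "... = 2 ^ ?n / r ^ (2 * ?n)" by (simp only: power_divide power_mult divide_divide_eq_right)
   finally show "1 / (?R^2) ^ ?n <= 2 ^ ?n / r ^ (2 * ?n)" .
  qed auto
  finally have "norm (BAker 0 z x (dbar (%x. ?\<chi> x * H x) x)) <= adj_bound TYPE('n) * fact ?n * (8 * norm (H x) * (1 * (2 ^ ?n / r ^ (2 * ?n))))"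
   by (simp add: mult_left_mono adj_bound_nonneg)
  thus ?thesis using inb by (simp add: mult_ac)
 qed
qed

text \<open>A mean value estimate at scale \<open>\<rho> z\<close>: an entire factor straightens the
  weight on the ball, and the Bochner--Martinelli formula bounds the value at the centre by an
  integral over the ball.\<close>

lemma Fock_growth:
 assumes K: "K \<in> Fock2 \<phi>" and \<phi>: "\<phi> \<in> bm borel" and near: "AE z in lebesgue. \<bar>\<phi> z - ereal (\<phi>t z)\<bar> <= ereal B"
 obtains C where "0 < C" "!!z. norm (K z) * exp (- \<phi>t z) <= C * (1 + (1 / \<rho> z) ^ (2 * CARD('n)))"
proof -
 let ?n = "CARD('n)" and ?\<psi> = "psi_of \<phi>t F"
 define y where "y x = norm (K x) * exp (- \<phi>t x)" for x
 have K': "entire K" "Lnorm 2 \<phi> (%z. cmod (K z)) < \<infinity>" using K by (auto simp: Fock2_def Lfun_def)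
 have cK: "cont K" by (rule entire_continuous[OF K'(1)])
 have ycont: "cont y" unfolding y_def[abs_def] by (intro continuous_intros cK phit)
 have "(\<integral>\<^sup>+z. ennreal (cmod (K z) powr 2) * eexp (- (ereal 2 * \<phi> z)) \<partial>lebesgue) < \<infinity>"
  using K'(2) by (simp add: Lnorm_def ennreal_powr_less_top_iff[unfolded infinity_ennreal_def])
 hence "ennreal (exp (2 * B)) * (\<integral>\<^sup>+z. ennreal (cmod (K z) powr 2) * eexp (- (ereal 2 * \<phi> z)) \<partial>lebesgue) < \<infinity>"
  by (simp add: ennreal_mult_less_top)
 moreover have "(\<integral>\<^sup>+z. ennreal ((cmod (K z) * exp (- \<phi>t z)) powr 2) \<partial>lebesgue) <=
   ennreal (exp (2 * B)) * (\<integral>\<^sup>+z. ennreal (cmod (K z) powr 2) * eexp (- (ereal 2 * \<phi> z)) \<partial>lebesgue)"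
  by (intro weighted_integral_compare(2)[OF near _ _ \<phi>] phit_lebesgue continuous_lebesgue continuous_intros cK) auto
 ultimately have "(\<integral>\<^sup>+z. ennreal ((cmod (K z) * exp (- \<phi>t z)) powr 2) \<partial>lebesgue) < \<infinity>" by (rule le_less_trans[rotated])
 hence "(\<integral>\<^sup>+z. ennreal (norm ((y z)^2)) \<partial>lborel) < \<infinity>" by (simp add: y_def nn_integral_completion)
 hence int: "integ (%z. (y z)^2)"
  by (intro integrableI_bounded measurable_lborel_continuous continuous_intros ycont) auto
 define J where "J = (LINT z|lborel. (y z)^2)"
 have J: "0 <= J" by (simp add: J_def)
 define c1 where "c1 = adj_bound TYPE('n) * fact ?n * (8 * 2 ^ ?n)"
 have c1: "0 <= c1" by (simp add: c1_def adj_bound_nonneg)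
 define c2 where "c2 = c1 * exp (M * c0^2)"
 have c2: "0 <= c2" using c1 by (simp add: c2_def)
 have \<gamma>: "0 < gauss_const TYPE('n)" by (rule gauss_const_pos)
 have main: "y z <= c2 / gauss_const TYPE('n) * (ubv TYPE(complex^'n) + J) * (1 + (1 / \<rho> z) ^ (2 * ?n))" for z
 proof -
  let ?r = "\<rho> z" and ?D = "2 * CARD('n)"
  have r: "0 < ?r" by (rule rho_pos)
  \<comment> \<open>The exponent removes F and the linear part of \<psi> at \<open>z\<close>, both
    holomorphic in \<open>x\<close>. On the ball \<psi> exceeds its tangent at \<open>z\<close> by
    at most \<open>M * c0^2\<close>, so |H| exp (- \<psi> z) is controlled by |K| exp (-
    \<phi>t).\<close>
  define H where "H x = K x * exp (- F x - phase (dpsi ?\<psi>) x z)" for x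
  have H: "entire H" unfolding H_def[abs_def] by (intro entire_mult K' entire_exp entire_diff entire_minus F entire_phase)
  let ?\<chi> = "%x. cor (bump (2 * (norm (x - z))^2 / ?r^2))"
  let ?u = "%x. ?\<chi> x * H x"
  have Cu: "Ck1 ?u"
   by (intro Ck_mult entire_Ck H Ck_of_real Ck1_bump_ball)
  have su: "csupp ?u"
  proof (rule csuppI)
   fix x :: "complex^'n" assume "norm z + ?r < norm x"
   hence "?r^2 <= (norm (x - z))^2" using r norm_triangle_ineq2[of x z] by simp
   hence "bump (2 * (norm (x - z))^2 / ?r^2) = 0" using r by (intro bump_high) (simp add: pos_le_divide_eq)
   thus "?u x = 0" by simp
  qed
  note bm = bochner_martinelli[OF Cu su, of z]
  have uz: "?u z = H z" by (simp add: bump_low)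
  have Hb: "norm (H x) * exp (- ?\<psi> z) <= exp (M * c0^2) * (1 + (y x)^2)" if "x \<in> ball z ?r" for x
  proof -
   have "?\<psi> x - ?\<psi> z - D\<psi> z (x - z) <= M * c0^2" using that by (intro quadratic_upper) (simp add: dist_commute)
   hence e: "- D\<psi> z (x - z) - ?\<psi> z <= M * c0^2 - ?\<psi> x" by simp
   have "norm (H x) * exp (- ?\<psi> z) = norm (K x) * exp (- Re (F x)) * exp (- D\<psi> z (x - z) - ?\<psi> z)"
    unfolding H_def by (simp add: norm_mult Re_phase_dpsi[OF psi] mult_exp_exp)
   also have "... <= norm (K x) * exp (- Re (F x)) * exp (M * c0^2 - ?\<psi> x)" using e by (intro mult_left_mono) auto
   also have "... = exp (M * c0^2) * y x" by (simp add: y_def psi_of_def mult_exp_exp)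
   \<comment> \<open>Passing from first to second powers this way avoids Cauchy--Schwarz and
     produces the summand 1 next to the power of 1 / \<rho>.\<close>
   also have "... <= exp (M * c0^2) * (1 + (y x)^2)"
   proof (intro mult_left_mono)
    have "0 <= (y x - 1)^2 + 1 + (y x)^2" by simp
    thus "y x <= 1 + (y x)^2" by (simp add: power2_diff)
   qed simp
   finally show ?thesis .
  qed
  have ker: "norm (exp (- ?\<psi> z) *\<^sub>R BAker 0 z x (dbar ?u x)) <= c2 / ?r ^ ?D * (indicator (ball z ?r) x + (y x)^2)" for x
  proof -
   have "norm (exp (- ?\<psi> z) *\<^sub>R BAker 0 z x (dbar ?u x)) = norm (BAker 0 z x (dbar ?u x)) * exp (- ?\<psi> z)" by simp
   also have "... <= c1 / ?r ^ ?D * (indicator (ball z ?r) x * norm (H x)) * exp (- ?\<psi> z)"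
    unfolding c1_def by (intro mult_right_mono bump_kernel_bound[OF H r]) simp
   also have "... = c1 / ?r ^ ?D * (indicator (ball z ?r) x * (norm (H x) * exp (- ?\<psi> z)))" by simp
   also have "... <= c1 / ?r ^ ?D * (exp (M * c0^2) * (indicator (ball z ?r) x + (y x)^2))"
    using c1 r Hb[of x] by (intro mult_left_mono) (auto split: split_indicator)
   finally show ?thesis by (simp add: c2_def)
  qed
  have ib: "integ (%x. indicator (ball z ?r) x :: real)"
   by (intro integrable_real_indicator emeasure_bounded_finite) auto
  have "exp (- ?\<psi> z) * (gauss_const TYPE('n) * norm (H z)) = norm (LINT x|lborel. exp (- ?\<psi> z) *\<^sub>R BAker 0 z x (dbar ?u x))"
   unfolding integral_scaleR_right bm(2) uz using \<gamma> by (simp add: norm_mult)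
  also have "... <= (LINT x|lborel. c2 / ?r ^ ?D * (indicator (ball z ?r) x + (y x)^2))"
   by (rule order_trans[OF integral_norm_bound integral_mono])
    (intro ker integrable_norm integrable_scaleR_right bm integrable_mult_right Bochner_Integration.integrable_add ib int)+
  also have "... = c2 / ?r ^ ?D * (measure lborel (ball z ?r) + J)"
   using ib int by (simp add: J_def)
  also have "measure lborel (ball z ?r) = ubv TYPE(complex^'n) * ?r ^ ?D"
   using content_ball[of ?r z] r unfolding DIM_cvec by simp
  finally have "exp (- ?\<psi> z) * norm (H z) * gauss_const TYPE('n) <= c2 / ?r ^ ?D * (ubv TYPE(complex^'n) * ?r ^ ?D + J)"
   by (simp only: mult_ac)
  hence "exp (- ?\<psi> z) * norm (H z) <= c2 / ?r ^ ?D * (ubv TYPE(complex^'n) * ?r ^ ?D + J) / gauss_const TYPE('n)"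
   by (simp only: pos_le_divide_eq[OF \<gamma>])
  also have "... = c2 / gauss_const TYPE('n) * (ubv TYPE(complex^'n) + J * (1 / ?r) ^ ?D)"
   using r by (simp add: field_simps)
  also have "... <= c2 / gauss_const TYPE('n) * ((ubv TYPE(complex^'n) + J) * (1 + (1 / ?r) ^ ?D))"
  proof (intro mult_left_mono)
   have "0 <= ubv TYPE(complex^'n) * (1 / ?r) ^ ?D" by simp
   thus "ubv TYPE(complex^'n) + J * (1 / ?r) ^ ?D <= (ubv TYPE(complex^'n) + J) * (1 + (1 / ?r) ^ ?D)"
    using J by (simp add: distrib_right distrib_left)
  qed (use c2 \<gamma> in auto)
  finally have "exp (- ?\<psi> z) * norm (H z) <= c2 / gauss_const TYPE('n) * (ubv TYPE(complex^'n) + J) * (1 + (1 / ?r) ^ ?D)" by (simp only: mult.assoc)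
  moreover have "exp (- ?\<psi> z) * norm (H z) = y z"
  proof -
   have "norm (H z) = norm (K z) * exp (- Re (F z))" by (simp add: H_def phase_def norm_mult)
   thus ?thesis by (simp add: y_def psi_of_def exp_diff exp_minus field_simps)
  qed
  ultimately show ?thesis by simp
 qed
 show thesis
 proof (rule that[of "c2 / gauss_const TYPE('n) * (ubv TYPE(complex^'n) + J) + 1"])
  have nn: "0 <= c2 / gauss_const TYPE('n) * (ubv TYPE(complex^'n) + J)" using c2 \<gamma> J by simp
  thus "0 < c2 / gauss_const TYPE('n) * (ubv TYPE(complex^'n) + J) + 1" by linarith
  fix z
  have "0 <= 1 + (1 / \<rho> z) ^ (2 * ?n)" by simp
  thus "norm (K z) * exp (- \<phi>t z) <= (c2 / gauss_const TYPE('n) * (ubv TYPE(complex^'n) + J) + 1) * (1 + (1 / \<rho> z) ^ (2 * ?n))"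
   by (intro order_trans[OF main[of z, unfolded y_def]] mult_right_mono) auto
 qed
qed

lemma Gamma_growth:
 assumes g: "g \<in> Gamma_span \<phi>" and \<phi>: "\<phi> \<in> bm borel" and near: "AE z in lebesgue. \<bar>\<phi> z - ereal (\<phi>t z)\<bar> <= ereal B"
 obtains C where "entire g" "0 < C" "!!z. norm (g z) * exp (- \<phi>t z) <= C * (1 + (1 / \<rho> z) ^ (2 * CARD('n)))"
proof -
 from g obtain S a where S: "finite S" "S \<subseteq> {K. \<exists>z. repr_kernel_at \<phi> z K}" "g = (%w. \<Sum>K\<in>S. a K * K w)"
  unfolding Gamma_span_def by blast
 have "\<exists>C. entire (%w. \<Sum>K\<in>S. a K * K w) \<and> 0 < C \<and> (\<forall>z. norm (\<Sum>K\<in>S. a K * K z) * exp (- \<phi>t z) <= C * (1 + (1 / \<rho> z) ^ (2 * CARD('n))))"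
  using S(1,2)
 proof (induction S rule: finite_induct)
  case empty
  have "0 <= 1 * (1 + (1 / \<rho> z) ^ (2 * CARD('n)))" for z by simp
  thus ?case by (intro exI[of _ 1]) (auto intro: entire_const)
 next
  case (insert K S)
  then obtain C where C: "entire (%w. \<Sum>K\<in>S. a K * K w)" "0 < C" "!!z. norm (\<Sum>K\<in>S. a K * K z) * exp (- \<phi>t z) <= C * (1 + (1 / \<rho> z) ^ (2 * CARD('n)))"
   by auto
  have K: "K \<in> Fock2 \<phi>" using insert.prems by (auto simp: repr_kernel_at_def)
  hence eK: "entire K" by (simp add: Fock2_def)
  obtain C' where C': "0 < C'" "!!z. norm (K z) * exp (- \<phi>t z) <= C' * (1 + (1 / \<rho> z) ^ (2 * CARD('n)))"
   by (rule Fock_growth[OF K \<phi> near], rule that)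
  have "norm (\<Sum>K\<in>insert K S. a K * K z) * exp (- \<phi>t z) <= (norm (a K) * C' + C) * (1 + (1 / \<rho> z) ^ (2 * CARD('n)))" for z
  proof -
   have "norm (\<Sum>K\<in>insert K S. a K * K z) <= norm (a K) * norm (K z) + norm (\<Sum>K\<in>S. a K * K z)"
    using insert.hyps norm_triangle_ineq[of "a K * K z"] by (simp add: norm_mult)
   hence "norm (\<Sum>K\<in>insert K S. a K * K z) * exp (- \<phi>t z) <= (norm (a K) * norm (K z) + norm (\<Sum>K\<in>S. a K * K z)) * exp (- \<phi>t z)"
    by (rule mult_right_mono) simp
   also have "... = norm (a K) * (norm (K z) * exp (- \<phi>t z)) + norm (\<Sum>K\<in>S. a K * K z) * exp (- \<phi>t z)" by (simp add: algebra_simps)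
   also have "... <= norm (a K) * (C' * (1 + (1 / \<rho> z) ^ (2 * CARD('n)))) + C * (1 + (1 / \<rho> z) ^ (2 * CARD('n)))"
    by (intro add_mono mult_left_mono C C') auto
   finally show ?thesis by (simp add: algebra_simps)
  qed
  moreover have "entire (%w. \<Sum>K\<in>insert K S. a K * K w)"
   using insert.hyps by (simp add: entire_add[OF entire_mult[OF entire_const eK] C(1)])
  moreover have "0 < norm (a K) * C' + C" using C(2) C'(1) by (simp add: add_nonneg_pos)
  ultimately show ?case by blast
 qed
 thus thesis using that S(3) by blast
qed

end

section \<open>The d-bar equation\<close>

subsection \<open>Weighted integrability of the right-hand side\<close>

text \<open>L^p is contained in the sum of L^\<infinity> and L^1, by t \<le> 1 + t^p; afterwards all
  exponents are treated alike.\<close>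

lemma Lform_split:
 fixes \<eta> :: "complex^'n => complex^'n"
 assumes p: "1 <= p" and \<eta>: "\<eta> \<in> Lform p (%_. 0)"
 obtains c s where "0 <= c" "!!x. 0 <= s x" "s \<in> bm lebesgue" "(\<integral>\<^sup>+x. ennreal (s x) \<partial>lebesgue) < \<infinity>"
  "AE x in lebesgue. form01_abs (\<eta> x) <= c + s x"
proof (cases "p = \<infinity>")
 case True
 obtain y where y: "Lnorm p (%_. 0) (%z. form01_abs (\<eta> z)) = ennreal y" "0 <= y"
  using \<eta> by (cases "Lnorm p (%_. 0) (%z. form01_abs (\<eta> z))") (auto simp: Lform_def)
 have e: "eexp 0 = 1" by (simp add: eexp_def)
 have "AE x in lebesgue. form01_abs (\<eta> x) <= y + 0"
  using esssup_AE[where M=lebesgue and f="%z. ennreal (form01_abs (\<eta> z)) * eexp 0"]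
 proof eventually_elim
  case (elim x)
  thus ?case using y(2) y(1) True by (simp add: Lnorm_def e)
 qed
 thus thesis using y(2) by (intro that[of y "%_. 0"]) auto
next
 case False
 define P where "P = enn2real p"
 have P: "1 <= P" using p False unfolding P_def by (cases p) auto
 have [measurable]: "(%x. form01_abs (\<eta> x)) \<in> bm lebesgue"
  using \<eta> by (intro form01_abs_measurable) (auto simp: Lform_def L01_def)
 have e: "eexp 0 = 1" by (simp add: eexp_def)
 have "Lnorm p (%_. 0) (%z. form01_abs (\<eta> z)) < \<infinity>" using \<eta> by (simp add: Lform_def)
 hence "(\<integral>\<^sup>+x. ennreal (form01_abs (\<eta> x) powr P) \<partial>lebesgue) < \<infinity>"
  using False by (simp add: Lnorm_def ennreal_powr_less_top_iff[unfolded infinity_ennreal_def] P_def[symmetric] e)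
 moreover have "form01_abs (\<eta> x) <= 1 + form01_abs (\<eta> x) powr P" for x
  using young_crude[OF form01_abs_nonneg, of 1 P "\<eta> x"] P by simp
 ultimately show thesis by (intro that[of 1 "%x. form01_abs (\<eta> x) powr P"]) auto
qed

lemma nn_integral_poly_decay:
 "(\<integral>\<^sup>+x. ennreal (1 / (1 + norm (x::complex^'n::finite)) ^ (2 * CARD('n) + 1)) \<partial>lborel) < \<infinity>"
proof -
 let ?d = "2 * CARD('n)"
 have "(\<integral>\<^sup>+x. ennreal (1 / (1 + norm (x::complex^'n)) ^ (?d + 1)) \<partial>lborel) <= (\<integral>\<^sup>+x. ennreal (radmaj ?d (dist (x::complex^'n) 0 / 1)) \<partial>lborel)"
 proof (rule nn_integral_mono_AE, use AE_lborel_singleton[of 0] in eventually_elim)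
  case (elim x)
  hence x: "0 < norm x" by simp
  have "(1 / (1 + norm x)) ^ (?d + 1) <= radmaj ?d (norm x)"
  proof (cases "norm x < 1")
   case True
   have "0 < 1 + norm x" using x by linarith
   hence "(1 / (1 + norm x)) ^ (?d + 1) <= 1" by (intro power_le_one) auto
   also have "1 <= (1 / norm x) ^ (?d - 1)" using x True by (intro one_le_power) auto
   finally show ?thesis using True by (simp add: radmaj_def)
  next
   case False
   have "1 / (1 + norm x) <= 1 / norm x" using x by (intro frac_le) linarith+
   hence "(1 / (1 + norm x)) ^ (?d + 1) <= (1 / norm x) ^ (?d + 1)" by (intro power_mono) auto
   thus ?thesis using False by (simp only: radmaj_def if_False)
  qed
  thus ?case by (intro ennreal_leI) (simp add: power_one_over)
 qed
 also have "... <= ennreal (4 * (ubv TYPE(complex^'n) * (2 ^ ?d * 1 ^ ?d)))"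
  using nn_integral_radmaj[OF zero_less_one DIM_cvec_ge, of "0 :: complex^'n"] unfolding DIM_cvec .
 finally show ?thesis by (rule le_less_trans) simp
qed

context gc_weight
begin

text \<open>The sign of the exponent is arbitrary, so both \<rho> and 1 / \<rho> are bounded by one
  polynomial, raised to an integer above the modulus of the exponent.\<close>

lemma powr_growth:
 obtains B L where "1 <= B" "!!x. \<rho> x powr (- \<kappa>') <= B * (1 + norm x) ^ L"
proof -
 obtain B L where B: "1 <= B" "!!x. \<rho> x <= B * (1 + norm x)" "!!x. 1 / \<rho> x <= B * (1 + norm x) ^ L" by (rule rho_growth, rule that)
 obtain k :: nat where k: "\<bar>\<kappa>'\<bar> <= real k" using real_arch_simple by blast
 show thesis
 proof (rule that[of "B ^ k" "(L + 1) * k"])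
  show "1 <= B ^ k" using B(1) by simp
  fix x :: "complex^'n"
  let ?Y = "B * (1 + norm x) ^ (L + 1)"
  have Y: "\<rho> x <= ?Y" "1 / \<rho> x <= ?Y"
  proof -
   have "B * (1 + norm x) ^ 1 <= ?Y" "B * (1 + norm x) ^ L <= ?Y"
    using B(1) by (intro mult_left_mono power_increasing; simp)+
   thus "\<rho> x <= ?Y" "1 / \<rho> x <= ?Y" using B(2,3)[of x] by (simp_all only: power_one_right)
  qed
  have r: "0 < \<rho> x" by (rule rho_pos)
  have "\<rho> x powr (- \<kappa>') <= ?Y ^ k"
  proof (cases "1 <= \<rho> x")
   case True
   have "\<rho> x powr (- \<kappa>') <= \<rho> x powr real k" using True k by (intro powr_mono) auto
   also have "... = \<rho> x ^ k" using r by (rule powr_realpow)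
   also have "... <= ?Y ^ k" using Y r by (intro power_mono) auto
   finally show ?thesis .
  next
   case False
   have "\<rho> x powr (- \<kappa>') = (1 / \<rho> x) powr \<kappa>'" by (simp add: powr_minus_divide powr_divide)
   also have "... <= (1 / \<rho> x) powr real k" using False k r by (intro powr_mono) auto
   also have "... = (1 / \<rho> x) ^ k" using r by (intro powr_realpow) simp
   also have "... <= ?Y ^ k" using Y r by (intro power_mono) auto
   finally show ?thesis .
  qed
  also have "?Y ^ k = B ^ k * (1 + norm x) ^ ((L + 1) * k)" by (simp only: power_mult_distrib power_mult)
  finally show "\<rho> x powr (- \<kappa>') <= B ^ k * (1 + norm x) ^ ((L + 1) * k)" .
 qed
qed

text \<open>The growth of \<open>g\<close> and the power of \<rho> cost only polynomial factors. The
  integrability obtained up to a power of 1 + |x| suffices, since the kernel decays faster than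
  every such power.\<close>

lemma rhs_integrable:
 assumes p: "1 <= p" and f: "Ck 2 f" and form: "(%z. (\<rho> z powr \<kappa>') *\<^sub>R dbar f z) \<in> Lform p (%_. 0)"
  and g: "entire g" "0 < Cg" "!!z. norm (g z) * exp (- \<phi>t z) <= Cg * (1 + (1 / \<rho> z) ^ (2 * CARD('n)))"
 obtains L where "integ (%x. norm (g x) * form01_abs (dbar f x) * exp (- \<phi>t x) / (1 + norm x) ^ L)"
proof -
 let ?d = "2 * CARD('n)"
 let ?Y = "%x. norm (g x) * form01_abs (dbar f x) * exp (- \<phi>t x)"
 let ?h = "%x. form01_abs ((\<rho> x powr \<kappa>') *\<^sub>R dbar f x)"
 obtain c s where s: "0 <= c" "!!x. 0 <= s x" "s \<in> bm lebesgue" "(\<integral>\<^sup>+x. ennreal (s x) \<partial>lebesgue) < \<infinity>"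
  "AE x in lebesgue. ?h x <= c + s x" by (rule Lform_split[OF p form], rule that)
 note [measurable] = s(3)
 obtain B1 L1 where B1: "1 <= B1" "!!x. 1 / \<rho> x <= B1 * (1 + norm x) ^ L1" by (rule rho_growth, rule that)
 obtain B2 L2 where B2: "1 <= B2" "!!x. \<rho> x powr (- \<kappa>') <= B2 * (1 + norm x) ^ L2" by (rule powr_growth[of \<kappa>'], rule that)
 define C where "C = Cg * (2 * B1 ^ ?d) * B2"
 define l where "l = L1 * ?d + L2"
 have C: "0 < C" using g(2) B1 B2 by (simp add: C_def)
 have Yb: "?Y x <= C * (1 + norm x) ^ l * ?h x" for x
 proof -
  have "1 * 1 <= B1 ^ ?d * (1 + norm x) ^ (L1 * ?d)" using B1(1) by (intro mult_mono) auto
  moreover have "(1 / \<rho> x) ^ ?d <= (B1 * (1 + norm x) ^ L1) ^ ?d" using B1(2)[of x] rho_pos[of x] by (intro power_mono) auto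
  ultimately have "1 + (1 / \<rho> x) ^ ?d <= 2 * B1 ^ ?d * (1 + norm x) ^ (L1 * ?d)" unfolding power_mult_distrib power_mult by simp
  hence "Cg * (1 + (1 / \<rho> x) ^ ?d) <= Cg * (2 * B1 ^ ?d * (1 + norm x) ^ (L1 * ?d))" using g(2) by (intro mult_left_mono) auto
  hence G: "norm (g x) * exp (- \<phi>t x) <= Cg * (2 * B1 ^ ?d * (1 + norm x) ^ (L1 * ?d))" using g(3)[of x] by linarith
  have "\<rho> x powr (- \<kappa>') * \<rho> x powr \<kappa>' = 1" using rho_pos[of x] by (simp add: powr_minus)
  hence "form01_abs (dbar f x) = \<rho> x powr (- \<kappa>') * ?h x" by (simp add: form01_abs_scaleR)
  also have "... <= B2 * (1 + norm x) ^ L2 * ?h x" by (intro mult_right_mono B2 form01_abs_nonneg)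
  finally have H: "form01_abs (dbar f x) <= B2 * (1 + norm x) ^ L2 * ?h x" .
  have "?Y x = (norm (g x) * exp (- \<phi>t x)) * form01_abs (dbar f x)" by simp
  also have "... <= (Cg * (2 * B1 ^ ?d * (1 + norm x) ^ (L1 * ?d))) * (B2 * (1 + norm x) ^ L2 * ?h x)"
   using g(2) by (intro mult_mono G H form01_abs_nonneg) auto
  also have "... = C * (1 + norm x) ^ l * ?h x" by (simp add: C_def l_def power_add)
  finally show ?thesis .
 qed
 \<comment> \<open>\<open>l\<close> absorbs the growth of the factors; the further 2 n + 1 powers
   make the bounded part \<open>c\<close> integrable.\<close>
 let ?L = "l + (?d + 1)"
 have Ycont: "cont (%x. ?Y x / (1 + norm x) ^ ?L)"
 proof -
  have "Ck1 f" using f by (simp add: numeral_2_eq_2 Ck_Suc_imp)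
  hence "cont (%x. form01_abs (dbar f x))"
   unfolding form01_abs_def by (intro continuous_intros continuous_dbar_nth)
  moreover have "1 + norm x ~= 0" for x :: "complex^'n" using norm_ge_zero[of x] by linarith
  ultimately show ?thesis by (intro continuous_intros entire_continuous[OF g(1)] phit) auto
 qed
 have "(\<integral>\<^sup>+x. ennreal (norm (?Y x / (1 + norm x) ^ ?L)) \<partial>lborel) = (\<integral>\<^sup>+x. ennreal (norm (?Y x / (1 + norm x) ^ ?L)) \<partial>lebesgue)"
  by (simp only: nn_integral_completion)
 also have "... <= (\<integral>\<^sup>+x. ennreal (C * c) * ennreal (1 / (1 + norm x) ^ (?d + 1)) + ennreal C * ennreal (s x) \<partial>lebesgue)"
 proof (rule nn_integral_mono_AE, use s(5) in eventually_elim)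
  case (elim x)
  have p1: "0 < 1 + norm x" by (simp add: add_pos_nonneg)
  have "?Y x / (1 + norm x) ^ ?L <= C * (1 + norm x) ^ l * ?h x / (1 + norm x) ^ ?L"
   by (intro divide_right_mono Yb) auto
  also have "... = C * ?h x / (1 + norm x) ^ (?d + 1)" by (simp add: power_add)
  also have "... <= C * (c + s x) / (1 + norm x) ^ (?d + 1)" using elim C p1 by (intro divide_right_mono) auto
  also have "... = C * c * (1 / (1 + norm x) ^ (?d + 1)) + C * s x / (1 + norm x) ^ (?d + 1)" by (simp only: distrib_left add_divide_distrib times_divide_eq_right mult_1_right)
  also have "C * s x / (1 + norm x) ^ (?d + 1) <= C * s x / 1"
  proof -
   have ge: "1 <= (1 + norm x) ^ (?d + 1)" by (intro one_le_power) simp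
   have "C * s x * 1 <= C * s x * (1 + norm x) ^ (?d + 1)"
    using C s(2)[of x] by (intro mult_left_mono ge) simp
   thus ?thesis by (simp only: div_by_1 pos_divide_le_eq[OF less_le_trans[OF zero_less_one ge]])
  qed
  finally have "?Y x / (1 + norm x) ^ ?L <= C * c * (1 / (1 + norm x) ^ (?d + 1)) + C * s x" by simp
  moreover have "0 <= ?Y x / (1 + norm x) ^ ?L" by (simp add: form01_abs_nonneg)
  ultimately have "ennreal (norm (?Y x / (1 + norm x) ^ ?L)) <= ennreal (C * c * (1 / (1 + norm x) ^ (?d + 1)) + C * s x)"
   by (simp only: real_norm_def ennreal_leI)
  also have "... = ennreal (C * c) * ennreal (1 / (1 + norm x) ^ (?d + 1)) + ennreal C * ennreal (s x)"
   using C s(1) s(2)[of x] p1 by (subst ennreal_plus) (auto simp: ennreal_mult'[symmetric])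
  finally show ?case .
 qed
 also have "... = ennreal (C * c) * (\<integral>\<^sup>+x. ennreal (1 / (1 + norm (x :: complex^'n)) ^ (?d + 1)) \<partial>lebesgue) + ennreal C * (\<integral>\<^sup>+x. ennreal (s x) \<partial>lebesgue)"
 proof -
  have [measurable]: "(%x. norm (x :: complex^'n)) \<in> bm lebesgue" by (intro continuous_lebesgue continuous_intros)
  show ?thesis by (subst nn_integral_add) (measurable, simp add: nn_integral_cmult)
 qed
 also have "... < \<infinity>"
  using s(4) nn_integral_poly_decay[where 'n='n] by (simp add: ennreal_mult_less_top nn_integral_completion)
 finally have "integ (%x. ?Y x / (1 + norm x) ^ ?L)"
  by (intro integrableI_bounded measurable_lborel_continuous Ycont)
 thus thesis by (rule that)
qed

end

subsection \<open>The solution operator\<close>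

lemma BA_kernel_borel:
 fixes a :: "complex^'n::finite => complex^'n"
 assumes q: "!!l. Ck1 (q l)" and a: "!!k. cont (%x. a x $ k)"
 shows "(%(z, x). exp (phase q z x) * BAker (dbar_mat q x) z x (a x)) \<in> bm (lborel \<Otimes>\<^sub>M lborel)"
proof -
 let ?M = "borel :: ((complex^'n) \<times> (complex^'n)) measure"
 have snd_m: "(%p. f (snd p)) \<in> bm ?M" if "cont f" for f :: "complex^'n => complex"
  by (intro borel_measurable_continuous_onI continuous_on_compose2[OF that] continuous_intros) auto
 have [measurable]: "(%p. q l (snd p)) \<in> bm ?M" for l
  by (intro snd_m Ck_continuous[OF q])
 have [measurable]: "(%p. dbar_mat q (snd p) $ i $ k) \<in> bm ?M" for i k
  by (intro snd_m continuous_dbar_mat q)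
 have [measurable]: "(%p. a (snd p) $ k) \<in> bm ?M" for k
  by (intro snd_m a)
 have [measurable]: "(%p. fst p $ l) \<in> bm ?M" "(%p. snd p $ l) \<in> bm ?M"
   "(%p. cnj (fst p $ l)) \<in> bm ?M" "(%p. cnj (snd p $ l)) \<in> bm ?M"
   "(%p. norm (snd p - fst p)) \<in> bm ?M" for l
  by (intro borel_measurable_continuous_onI continuous_intros)+
 have "(%p. exp (phase q (fst p) (snd p)) * BAker (dbar_mat q (snd p)) (fst p) (snd p) (a (snd p))) \<in> bm ?M"
  unfolding phase_def BAker_def adj_coeff_def svec_def vec_lambda_beta by measurable
 thus ?thesis by (simp add: case_prod_unfold lborel_prod)
qed

text \<open>Interpolates between \<open>1\<close> on \<open>{..0}\<close> and \<open>\<delta>\<close> on \<open>{1..}\<close>; the phase is perturbed by its negative logarithm.\<close>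
definition damp :: "real => real => real" where
 "damp \<delta> s = \<delta> + (1 - \<delta>) * bump (s + 1)"

text \<open>Despite its name the derivative of \<open>- ln (damp \<delta> s)\<close>, not of
  \<open>damp\<close>.\<close>

definition damp' :: "real => real => real" where
 "damp' \<delta> s = - ((1 - \<delta>) * bump' (s + 1)) / damp \<delta> s"

context
 fixes \<delta> :: real
 assumes \<delta>: "0 < \<delta>" "\<delta> <= 1"
begin

lemma damp_bounds: "\<delta> <= damp \<delta> s" "0 < damp \<delta> s" "damp \<delta> s <= 1"
proof -
 have "0 <= (1 - \<delta>) * bump (s + 1)" "(1 - \<delta>) * bump (s + 1) <= (1 - \<delta>) * 1"
  using \<delta> bump_bounds by (simp, intro mult_left_mono) auto
 thus "\<delta> <= damp \<delta> s" "0 < damp \<delta> s" "damp \<delta> s <= 1" using \<delta> by (simp_all add: damp_def)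
qed

lemma damp_low: "s <= 0 ==> damp \<delta> s = 1" "s <= 0 ==> damp' \<delta> s = 0"
 by (simp_all add: damp_def damp'_def bump_low)

lemma damp_high: "1 <= s ==> damp \<delta> s = \<delta>"
 by (simp add: damp_def bump_high)

lemma damp_deriv: "((%s. - ln (damp \<delta> s)) has_field_derivative damp' \<delta> s) (at s)"
proof -
 have i: "((%s. s + 1) has_field_derivative 1) (at s)" by (auto intro!: derivative_eq_intros)
 have "((%s. bump (s + 1)) has_field_derivative bump' (s + 1)) (at s)"
  using DERIV_chain2[OF bump_deriv i] by simp
 hence "(damp \<delta> has_field_derivative (1 - \<delta>) * bump' (s + 1)) (at s)"
  unfolding damp_def[abs_def] by (auto intro!: derivative_eq_intros)
 from DERIV_minus[OF DERIV_chain2[OF DERIV_ln this]] show ?thesis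
  using damp_bounds(2)[of s] by (simp add: damp'_def divide_inverse mult_ac)
qed

lemma damp'_continuous: "cont (damp' \<delta>)"
proof -
 have b: "cont bump" using bump_deriv DERIV_continuous_on has_field_derivative_at_within by blast
 have c1: "cont (%s. bump (s + 1))" "cont (%s. bump' (s + 1))"
  by (rule continuous_on_compose2[OF b] continuous_on_compose2[OF bump'_continuous[of UNIV]]; auto intro!: continuous_intros)+
 have c2: "cont (damp \<delta>)" unfolding damp_def[abs_def] by (intro continuous_intros c1)
 have nz: "damp \<delta> s ~= 0" for s using damp_bounds(2)[of s] by simp
 show ?thesis unfolding damp'_def[abs_def]
  by (intro continuous_on_divide continuous_on_minus continuous_on_mult continuous_on_const c1 c2 ballI nz)
qed

text \<open>The logarithm is no larger than 1 / \<open>damp\<close>, so it costs no more in the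
  matrix than its derivative does.\<close>

lemma neg_ln_damp: "0 <= - ln (damp \<delta> s)" "- ln (damp \<delta> s) <= 1 / damp \<delta> s"
proof -
 show "0 <= - ln (damp \<delta> s)" using damp_bounds[of s] by simp
 have "- ln (damp \<delta> s) = ln (1 / damp \<delta> s)" using damp_bounds(2)[of s] by (simp add: ln_div)
 also have "... <= 1 / damp \<delta> s - 1" using damp_bounds(2)[of s] by (intro ln_le_minus_one) simp
 finally show "- ln (damp \<delta> s) <= 1 / damp \<delta> s" by simp
qed

lemma damp'_bound: "\<bar>damp' \<delta> s\<bar> <= 4 / damp \<delta> s"
proof -
 have "\<bar>(1 - \<delta>) * bump' (s + 1)\<bar> <= 1 * 4" unfolding abs_mult using \<delta> bump'_bound by (intro mult_mono) auto
 thus ?thesis using damp_bounds(2)[of s] by (simp add: damp'_def abs_divide divide_right_mono)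
qed

end

context gc_weight
begin

abbreviation "psi0 \<equiv> psi_of \<phi>t F"
abbreviation "q0 \<equiv> dpsi psi0"

text \<open>A logarithmic multiple of the conjugate of x: the extra exponent then becomes a power of
  \<open>damp\<close>, while the derivatives of the perturbation are only of order 1 /
  \<open>damp\<close>, up to a polynomial in |x|. For |x|^2 \<le> Q nothing is changed.\<close>

definition qp :: "real => real => 'n => complex^'n => complex" where
 "qp \<delta> Q l x = q0 l x + of_real (- ln (damp \<delta> ((norm x)^2 - Q))) * cnj (x $ l)"

abbreviation BAK :: "('n => complex^'n => complex) => complex^'n => complex^'n => complex^'n => complex" where
 "BAK q z x a \<equiv> exp (phase q z x) * BAker (dbar_mat q x) z x a"

lemma q0_C1: "Ck1 (q0 l)"
 by (rule Ck_dpsi[OF psi])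

lemma Ck_norm_sq0: "Ck k (%x::complex^'n. (norm x)^2 - Q)"
 using Ck_diff[OF Ck_norm_sq[of k 0] Ck_const, of Q] by simp

context
 fixes \<delta> :: real
 assumes \<delta>: "0 < \<delta>" "\<delta> <= 1"
begin

lemma yy_C1: "Ck1 (%x::complex^'n. - ln (damp \<delta> ((norm x)^2 - Q)))"
 by (rule Ck1_chain[OF damp_deriv[OF \<delta>] damp'_continuous[OF \<delta>] Ck_norm_sq0])

lemma qp_C1: "Ck1 (qp \<delta> Q l)"
 unfolding qp_def[abs_def] by (intro Ck_add q0_C1 Ck_mult Ck_of_real yy_C1 Ck_cnj_nth)

lemma pd_zbar_yy:
 "pd_zbar k (%x::complex^'n. of_real (- ln (damp \<delta> ((norm x)^2 - Q)))) x = of_real (damp' \<delta> ((norm x)^2 - Q)) * x $ k"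
proof -
 have d: "((%s. - ln (damp \<delta> (s - Q))) has_field_derivative damp' \<delta> (s - Q)) (at s)" for s
 proof -
  have "((%s. s - Q) has_field_derivative 1) (at s)" by (auto intro!: derivative_eq_intros)
  from DERIV_chain2[OF damp_deriv[OF \<delta>] this] show ?thesis by simp
 qed
 have "(%x::complex^'n. (norm x)^2) differentiable (at x)" using Ck_differentiable[OF Ck_norm_sq0[of "Suc 0" 0]] by simp
 from pd_zbar_of_real_chain[OF d this, of k] show ?thesis using pd_zbar_norm_sq[of k 0 x] by simp
qed

lemma dbar_mat_qp:
 "dbar_mat (qp \<delta> Q) x $ l $ k = dbar_mat q0 x $ l $ k +
   (of_real (- ln (damp \<delta> ((norm x)^2 - Q))) * (if l = k then 1 else 0) + of_real (damp' \<delta> ((norm x)^2 - Q)) * x $ k * cnj (x $ l))"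
proof -
 let ?y = "%x::complex^'n. cor (- ln (damp \<delta> ((norm x)^2 - Q)))"
 have dy: "?y differentiable (at x)" by (rule Ck_differentiable[OF Ck_of_real[OF yy_C1]])
 have dq: "q0 l differentiable (at x)" by (rule Ck_differentiable[OF q0_C1])
 have "pd_zbar k (qp \<delta> Q l) x = pd_zbar k (q0 l) x + pd_zbar k (%x. ?y x * cnj (x $ l)) x"
  unfolding qp_def[abs_def]
  by (rule pd_zbar_add[OF dq Ck_differentiable[OF Ck_mult[OF Ck_of_real[OF yy_C1] Ck_cnj_nth]]])
 also have "pd_zbar k (%x. ?y x * cnj (x $ l)) x = ?y x * (if l = k then 1 else 0) + of_real (damp' \<delta> ((norm x)^2 - Q)) * x $ k * cnj (x $ l)"
  unfolding pd_zbar_mult[OF dy differentiable_cnj_nth] by (simp only: pd_zbar_yy pd_zbar_cnj_nth)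
 finally show ?thesis by (simp add: dbar_mat_def dbar_def)
qed

lemma qp_inside:
 assumes "(norm x)^2 <= Q"
 shows "phase (qp \<delta> Q) z x = phase q0 z x" "dbar_mat (qp \<delta> Q) x = dbar_mat q0 x"
proof -
 have s: "(norm x)^2 - Q <= 0" using assms by simp
 show "phase (qp \<delta> Q) z x = phase q0 z x" by (simp add: phase_def qp_def damp_low[OF \<delta> s])
 show "dbar_mat (qp \<delta> Q) x = dbar_mat q0 x" by (simp add: vec_eq_iff dbar_mat_qp damp_low[OF \<delta> s])
qed

lemma dbar_mat_qp_bound:
 "norm (dbar_mat (qp \<delta> Q) x $ l $ k) <= (W0 / (\<rho> x)^2 + 1 + 4 * (norm x)^2) / damp \<delta> ((norm x)^2 - Q)"
proof -
 let ?E = "damp \<delta> ((norm x)^2 - Q)"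
 have E: "0 < ?E" "?E <= 1" using damp_bounds[OF \<delta>] by auto
 have W: "norm (dbar_mat q0 x $ l $ k) <= W0 / (\<rho> x)^2" using dbar_mat_bound by (simp add: W0_def)
 have c1: "norm (cor (- ln ?E) * (if l = k then 1 else 0)) <= 1 / ?E"
  using neg_ln_damp[OF \<delta>, of "(norm x)^2 - Q"] E by (auto simp: norm_mult simp del: of_real_minus)
 have c2: "norm (cor (damp' \<delta> ((norm x)^2 - Q)) * x $ k * cnj (x $ l)) <= 4 / ?E * norm x * norm x"
  unfolding norm_mult norm_of_real complex_mod_cnj
  using E by (intro mult_mono damp'_bound[OF \<delta>] Finite_Cartesian_Product.norm_nth_le) auto
 have "norm (dbar_mat (qp \<delta> Q) x $ l $ k) <= W0 / (\<rho> x)^2 + (1 / ?E + 4 / ?E * norm x * norm x)"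
  unfolding dbar_mat_qp by (intro norm_triangle_le add_mono W norm_triangle_le[OF add_mono] c1 c2)
 also have "... <= W0 / (\<rho> x)^2 / ?E + (1 / ?E + 4 / ?E * norm x * norm x)"
 proof -
  have "0 <= W0 / (\<rho> x)^2" using W0_nonneg by simp
  hence "W0 / (\<rho> x)^2 / 1 <= W0 / (\<rho> x)^2 / ?E" using E by (intro divide_left_mono) auto
  thus ?thesis by simp
 qed
 also have "... = (W0 / (\<rho> x)^2 + 1 + 4 * (norm x)^2) / ?E" by (simp add: add_divide_distrib power2_eq_square)
 finally show ?thesis .
qed

text \<open>For |z| \<le> |x| / 2 the real part of the pairing of the conjugate of x with z - x is
  at most - |x|^2 / 2, hence at most - n; multiplied by the logarithm it gives the factor
  \<open>damp\<close> to the power n.\<close>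

lemma exp_phase_qp_bound:
 assumes "2 * norm z <= norm x" "2 * real CARD('n) <= (norm x)^2"
 shows "norm (exp (phase (qp \<delta> Q) z x)) <= norm (exp (phase q0 z x)) * damp \<delta> ((norm x)^2 - Q) ^ CARD('n)"
proof -
 let ?n = "CARD('n)" and ?E = "damp \<delta> ((norm x)^2 - Q)"
 let ?s = "\<Sum>l\<in>UNIV. cnj (x $ l) * (z $ l - x $ l)"
 have E: "0 < ?E" using damp_bounds[OF \<delta>] by auto
 have y: "0 <= - ln ?E" by (rule neg_ln_damp[OF \<delta>])
 have "phase (qp \<delta> Q) z x = phase q0 z x + of_real (- ln ?E) * ?s"
  by (simp only: phase_def qp_def sum_distrib_left sum.distrib[symmetric] distrib_right mult.assoc)
 hence "Re (phase (qp \<delta> Q) z x) = Re (phase q0 z x) + - ln ?E * Re ?s" by (simp del: Re_sum)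
 hence e: "norm (exp (phase (qp \<delta> Q) z x)) = norm (exp (phase q0 z x)) * exp (- ln ?E * Re ?s)"
  by (simp only: norm_exp_eq_Re exp_add)
 have "Re ?s = x \<bullet> (z - x)" by (simp add: inner_vec_def inner_complex_def algebra_simps)
 also have "... = x \<bullet> z - (norm x)\<^sup>2" by (simp add: inner_diff_right power2_norm_eq_inner)
 also have "... <= norm x * norm z - (norm x)\<^sup>2" using norm_cauchy_schwarz[of x z] by simp
 also have "... <= norm x * (norm x / 2) - (norm x)\<^sup>2" using assms(1) by (intro diff_right_mono mult_left_mono) auto
 also have "... = - ((norm x)^2 / 2)" by (simp add: power2_eq_square)
 also have "... <= - real ?n" using assms(2) by simp
 finally have "- ln ?E * Re ?s <= - ln ?E * - real ?n" using y by (rule mult_left_mono)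
 hence "exp (- ln ?E * Re ?s) <= exp (real ?n * ln ?E)" by (simp add: mult.commute)
 also have "... = ?E ^ ?n" using E by (simp add: exp_of_nat_mult)
 finally show ?thesis unfolding e by (rule mult_left_mono) simp
qed

end

lemma qp_one: "qp 1 Q = q0"
 by (simp add: qp_def damp_def fun_eq_iff)

text \<open>The matrix contributes at most n - 1 factors 1 / \<open>damp\<close> and the exponential
  n factors \<open>damp\<close>, so one remains. The polynomial growth of the entries is absorbed by
  \<open>phase_decay\<close>; the constants are independent of \<delta> and
  \<open>Q\<close>.\<close>

lemma kernel_far:
 obtains C X where "0 < C" "1 <= X" "!!\<delta> Q z x a. 0 < \<delta> ==> \<delta> <= 1 ==> 2 * norm z <= norm x ==> X <= norm x ==>
  norm (BAK (qp \<delta> Q) z x a) <= C * exp (psi0 z) * (damp \<delta> ((norm x)^2 - Q) * (exp (- psi0 x) / (1 + norm x) ^ L * form01_abs a))"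
proof -
 let ?n = "CARD('n)"
 define w where "w x = W0 / (\<rho> x)^2 + 1 + 4 * (norm x)^2" for x
 obtain B L1 where B: "1 <= B" "!!x. 1 / \<rho> x <= B * (1 + norm x) ^ L1" by (rule rho_growth, rule that)
 define Bw where "Bw = W0 * B^2 + 4"
 define Lw where "Lw = 2 * L1 + 2"
 have w1: "1 <= w x" for x using W0_nonneg by (simp add: w_def)
 have wB: "w x <= Bw * (1 + norm x) ^ Lw" for x
 proof -
  have "W0 / (\<rho> x)^2 = W0 * (1 / \<rho> x)^2" by (simp add: power_divide)
  also have "... <= W0 * (B * (1 + norm x) ^ L1)^2" using B(2)[of x] W0_nonneg rho_pos[of x] by (intro mult_left_mono power_mono) auto
  also have "... = W0 * B^2 * (1 + norm x) ^ (2 * L1)" by (simp add: power_mult_distrib power_mult[symmetric] mult.commute)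
  also have "... <= W0 * B^2 * (1 + norm x) ^ Lw" using W0_nonneg by (intro mult_left_mono power_increasing) (auto simp: Lw_def)
  finally have 1: "W0 / (\<rho> x)^2 <= W0 * B^2 * (1 + norm x) ^ Lw" .
  have "1 + 4 * (norm x)^2 <= 4 * (1 + norm x) ^ 2" by (simp add: power2_eq_square algebra_simps)
  also have "... <= 4 * (1 + norm x) ^ Lw" by (intro mult_left_mono power_increasing) (auto simp: Lw_def)
  finally show ?thesis using 1 by (simp add: w_def Bw_def distrib_right)
 qed
 obtain Cd where Cd: "0 < Cd" "!!z x. 2 * norm z <= norm x ==>
  (1 + norm x) ^ (Lw * (?n - 1) + L) * norm (exp (phase q0 z x)) <= Cd * exp (psi0 z - psi0 x)" by (rule phase_decay[of "Lw * (?n - 1) + L"], rule that)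
 define cb where "cb = adj_bound TYPE('n) * fact ?n * real ?n * Bw ^ (?n - 1)"
 have Bw: "0 <= Bw" using W0_nonneg by (simp add: Bw_def)
 have cb: "0 <= cb" using Bw by (simp add: cb_def adj_bound_nonneg)
 show thesis
 \<comment> \<open>From this radius on, |x - z| \<ge> 1, so that no singularity is felt, and |x|^2
   \<ge> 2 n, as the damping of the exponential requires.\<close>
 proof (rule that[of "cb * Cd + 1" "2 + 2 * real ?n"])
  show "0 < cb * Cd + 1" using cb Cd(1) by (simp add: add_nonneg_pos)
  show "1 <= 2 + 2 * real ?n" by simp
  fix \<delta> Q and z x a :: "complex^'n" assume \<delta>: "0 < \<delta>" "\<delta> <= (1::real)" and zx: "2 * norm z <= norm x" and X: "2 + 2 * real ?n <= norm x"
  let ?E = "damp \<delta> ((norm x)^2 - Q)" and ?r = "norm (x - z)" and ?b = "form01_abs a" and ?p = "norm (exp (phase q0 z x))"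
  have E: "0 < ?E" "?E <= 1" using damp_bounds[OF \<delta>] by auto
  have x2: "2 * real ?n <= (norm x)^2"
  proof -
   have "2 * real ?n * 1 <= norm x * norm x" using X by (intro mult_mono) linarith+
   thus ?thesis by (simp add: power2_eq_square)
  qed
  have r1: "1 <= ?r" using norm_triangle_ineq2[of x z] zx X by linarith
  define t where "t = w x / ?E"
  have t1: "1 <= t" using w1[of x] E by (simp add: t_def)
  have "norm (BAker (dbar_mat (qp \<delta> Q) x) z x a) <= adj_bound TYPE('n) * fact ?n * (?b * (\<Sum>m<?n. t ^ m * (?r / ?r ^ (2 * (?n - m)))))"
   unfolding t_def w_def by (intro norm_BAker dbar_mat_qp_bound[OF \<delta>] norm_nth_le_form01_abs)
  also have "... <= adj_bound TYPE('n) * fact ?n * (?b * (\<Sum>m<?n. t ^ (?n - 1) * 1))"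
  proof (intro mult_left_mono sum_mono mult_mono)
   fix m assume m: "m \<in> {..<?n}"
   show "t ^ m <= t ^ (?n - 1)" using m t1 by (intro power_increasing) auto
   have "?r <= ?r ^ (2 * (?n - m))" using m r1 by (intro self_le_power) auto
   thus "?r / ?r ^ (2 * (?n - m)) <= 1" using r1 by (simp add: divide_le_eq)
  qed (use t1 in \<open>auto simp: form01_abs_nonneg adj_bound_nonneg\<close>)
  also have "... = adj_bound TYPE('n) * fact ?n * real ?n * ?b * t ^ (?n - 1)" by simp
  finally have K: "norm (BAker (dbar_mat (qp \<delta> Q) x) z x a) <= adj_bound TYPE('n) * fact ?n * real ?n * ?b * t ^ (?n - 1)" .
  have En: "?E ^ ?n * t ^ (?n - 1) = ?E * w x ^ (?n - 1)"
  proof -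
   have "?E ^ ?n = ?E * ?E ^ (?n - 1)" by (rule power_eq_if[THEN trans]) simp
   thus ?thesis using E by (simp add: t_def power_divide)
  qed
  have "norm (BAK (qp \<delta> Q) z x a) <= (?p * ?E ^ ?n) * (adj_bound TYPE('n) * fact ?n * real ?n * ?b * t ^ (?n - 1))"
   unfolding norm_mult[of "exp _"] using E by (intro mult_mono K exp_phase_qp_bound[OF \<delta> zx x2]) auto
  also have "... = adj_bound TYPE('n) * fact ?n * real ?n * ?b * ?p * (?E ^ ?n * t ^ (?n - 1))" by (simp only: mult_ac)
  also have "... = adj_bound TYPE('n) * fact ?n * real ?n * ?b * ?p * (?E * w x ^ (?n - 1))" by (simp only: En)
  also have "... <= adj_bound TYPE('n) * fact ?n * real ?n * ?b * ?p * (?E * (Bw * (1 + norm x) ^ Lw) ^ (?n - 1))"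
   using E w1[of x] by (intro mult_left_mono power_mono wB) (auto simp: form01_abs_nonneg adj_bound_nonneg)
  also have "... = cb * ?E * ?b * ((1 + norm x) ^ (Lw * (?n - 1)) * ?p)"
   by (simp only: cb_def power_mult_distrib power_mult[symmetric] mult_ac)
  also have "... <= cb * ?E * ?b * (Cd * exp (psi0 z - psi0 x) / (1 + norm x) ^ L)"
  proof (intro mult_left_mono)
   have p: "0 < (1 + norm x) ^ L" by (intro zero_less_power) (use X in linarith)
   have "(1 + norm x) ^ (Lw * (?n - 1)) * ?p * (1 + norm x) ^ L <= Cd * exp (psi0 z - psi0 x)"
    using Cd(2)[OF zx] by (simp only: power_add mult_ac)
   thus "(1 + norm x) ^ (Lw * (?n - 1)) * ?p <= Cd * exp (psi0 z - psi0 x) / (1 + norm x) ^ L"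
    by (simp only: pos_le_divide_eq[OF p])
  qed (use cb E in \<open>simp add: form01_abs_nonneg\<close>)
  also have "... = (cb * Cd) * (exp (psi0 z) * (?E * (exp (- psi0 x) / (1 + norm x) ^ L * ?b)))"
   by (simp add: exp_diff exp_minus divide_inverse mult_ac)
  also have "... <= (cb * Cd + 1) * (exp (psi0 z) * (?E * (exp (- psi0 x) / (1 + norm x) ^ L * ?b)))"
   using E X by (intro mult_right_mono mult_nonneg_nonneg divide_nonneg_nonneg form01_abs_nonneg) auto
  finally show "norm (BAK (qp \<delta> Q) z x a) <= (cb * Cd + 1) * exp (psi0 z) * (?E * (exp (- psi0 x) / (1 + norm x) ^ L * ?b))"
   by (simp only: mult.assoc)
 qed
qed

lemma psi0_continuous: "continuous_on S psi0"
 using Ck_continuous[OF psi] continuous_on_subset by blast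

lemma bounded_on_cball:
 fixes f :: "complex^'n => real"
 assumes "cont f"
 obtains B where "0 < B" "!!x. norm x <= R ==> \<bar>f x\<bar> <= B"
proof -
 have "bounded (f ` cball 0 R)"
  by (intro compact_imp_bounded compact_continuous_image continuous_on_subset[OF assms]) auto
 then obtain B where B: "\<forall>x\<in>cball 0 R. \<bar>f x\<bar> <= B" by (auto simp: bounded_iff)
 show thesis
 proof (rule that[of "\<bar>B\<bar> + 1"])
  fix x :: "complex^'n" assume "norm x <= R"
  thus "\<bar>f x\<bar> <= \<bar>B\<bar> + 1" using B by (auto dest!: bspec[of _ _ x])
 qed simp
qed

lemma kernel_near:
 fixes a :: "complex^'n => complex^'n"
 assumes a: "cont (%x. form01_abs (a x))"
 obtains C where "0 < C" "!!z x. norm z <= R ==> norm x <= R ==> norm (BAK q0 z x (a x)) <= C * (1 / norm (x - z)) ^ (2 * CARD('n) - 1)"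
proof -
 let ?n = "CARD('n)"
 obtain B L1 where B: "1 <= B" "!!x. 1 / \<rho> x <= B * (1 + norm x) ^ L1" by (rule rho_growth, rule that)
 obtain P where P: "0 < P" "!!x. norm x <= R ==> \<bar>psi0 x\<bar> <= P" by (rule bounded_on_cball[OF psi0_continuous], rule that)
 obtain b where b: "0 < b" "!!x. norm x <= R ==> \<bar>form01_abs (a x)\<bar> <= b" by (rule bounded_on_cball[OF a], rule that)
 define W where "W = W0 * (B * (1 + \<bar>R\<bar>) ^ L1)^2"
 have W: "0 <= W" using W0_nonneg by (simp add: W_def)
 define S where "S = (\<Sum>m<?n. W ^ m * (2 * \<bar>R\<bar>) ^ (2 * m))"
 have S: "0 <= S" unfolding S_def using W by (intro sum_nonneg) simp
 define C where "C = exp (2 * P + \<kappa>) * (adj_bound TYPE('n) * fact ?n * (b * S))"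
 have C: "0 <= C" unfolding C_def using S b(1) by (simp add: adj_bound_nonneg)
 show thesis
 proof (rule that[of "C + 1"])
  show "0 < C + 1" using C by simp
  fix z x :: "complex^'n" assume z: "norm z <= R" and x: "norm x <= R"
  let ?r = "norm (x - z)"
  have Wx: "W0 / (\<rho> x)^2 <= W"
  proof -
   have "1 / \<rho> x <= B * (1 + \<bar>R\<bar>) ^ L1"
    using x B(1) by (intro order_trans[OF B(2)] mult_left_mono power_mono) auto
   hence "W0 * (1 / \<rho> x)^2 <= W" unfolding W_def using W0_nonneg rho_pos[of x] by (intro mult_left_mono power_mono) auto
   thus ?thesis by (simp add: power_divide)
  qed
  have r: "?r <= 2 * \<bar>R\<bar>" using norm_triangle_ineq4[of x z] z x by linarith
  have "norm (BAker (dbar_mat q0 x) z x (a x)) <= adj_bound TYPE('n) * fact ?n * (b * (\<Sum>m<?n. W ^ m * (?r / ?r ^ (2 * (?n - m)))))"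
  proof (rule norm_BAker)
   show "norm (dbar_mat q0 x $ i $ k) <= W" for i k using dbar_mat_bound[of x i k] Wx by (simp add: W0_def)
   show "norm (a x $ k) <= b" for k using norm_nth_le_form01_abs[of "a x" k] b(2)[OF x] by linarith
  qed
  also have "... <= adj_bound TYPE('n) * fact ?n * (b * (\<Sum>m<?n. W ^ m * ((2 * \<bar>R\<bar>) ^ (2 * m) * (1 / ?r) ^ (2 * ?n - 1))))"
   using W b(1) r by (intro mult_left_mono sum_mono radial_power_le) (auto simp: adj_bound_nonneg)
  also have "... = adj_bound TYPE('n) * fact ?n * (b * S) * (1 / ?r) ^ (2 * ?n - 1)"
   by (simp add: S_def sum_distrib_right mult.assoc)
  finally have K: "norm (BAker (dbar_mat q0 x) z x (a x)) <= adj_bound TYPE('n) * fact ?n * (b * S) * (1 / ?r) ^ (2 * ?n - 1)" .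
  have e: "norm (exp (phase q0 z x)) <= exp (2 * P + \<kappa>)"
  proof -
   have "0 <= \<kappa> * (dist z x / \<rho> x)" using kappa_pos rho_pos[of x] by simp
   hence "psi0 z - psi0 x + - (\<kappa> * (dist z x / \<rho> x - 1)) <= 2 * P + \<kappa>" using P(2)[OF z] P(2)[OF x] by (simp add: algebra_simps)
   hence "exp (psi0 z - psi0 x) * exp (- (\<kappa> * (dist z x / \<rho> x - 1))) <= exp (2 * P + \<kappa>)" unfolding mult_exp_exp by simp
   thus ?thesis by (rule order_trans[OF norm_exp_phase])
  qed
  have "norm (BAK q0 z x (a x)) <= exp (2 * P + \<kappa>) * (adj_bound TYPE('n) * fact ?n * (b * S) * (1 / ?r) ^ (2 * ?n - 1))"
   unfolding norm_mult[of "exp _"] by (intro mult_mono e K) auto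
  also have "... = C * (1 / ?r) ^ (2 * ?n - 1)" by (simp only: C_def mult.assoc)
  also have "... <= (C + 1) * (1 / ?r) ^ (2 * ?n - 1)" by (intro mult_right_mono) auto
  finally show "norm (BAK q0 z x (a x)) <= (C + 1) * (1 / ?r) ^ (2 * ?n - 1)" .
 qed
qed

end

lemma integrable_mult_csupp:
 fixes f g :: "complex^'n::finite => complex"
 assumes f: "f \<in> bm lborel" and fb: "!!x. norm x <= R ==> norm (f x) <= B"
  and g: "cont g" and gR: "!!x. R < norm x ==> g x = 0"
 shows "integ (%x. f x * g x)"
proof (rule Bochner_Integration.integrable_bound)
 show "integ (%x. B * norm (g x))"
  by (intro integrable_mult_right integrable_norm csupp_integrable[OF g] csuppI[of R]) (rule gR)
 show "(%x. f x * g x) \<in> bm lborel"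
  by (intro borel_measurable_times f measurable_lborel_continuous g)
 show "AE x in lborel. norm (f x * g x) <= norm (B * norm (g x))"
 proof (intro AE_I2)
  fix x
  show "norm (f x * g x) <= norm (B * norm (g x))"
  proof (cases "norm x <= R")
   case True
   hence "norm (f x) * norm (g x) <= B * norm (g x)" by (intro mult_right_mono fb) auto
   thus ?thesis by (simp add: norm_mult)
  qed (simp add: gR)
 qed
qed

text \<open>Fubini, followed by integration by parts in \<open>z\<close>, in which the exponential
  of the phase is entire.\<close>

lemma integral_holomorphic_parameter:
 fixes q :: "'n::finite => complex^'n => complex" and u h :: "complex^'n => complex"
 assumes q: "!!l. Ck1 (q l)" and u: "cont u" "csupp u" and h: "Ck1 h" "csupp h"
 shows "(LINT z|lborel. (LINT x|lborel. u x * exp (phase q z x)) * pd_zbar j h z) = 0"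
  and "integ (%z. (LINT x|lborel. u x * exp (phase q z x)) * pd_zbar j h z)"
proof -
 obtain R where R: "!!x. R < norm x ==> u x = 0" using csuppE[OF u(2)] by blast
 obtain R' where R': "!!x. R' < norm x ==> pd_zbar j h x = 0" using csuppE[OF csupp_pd_zbar[OF h(2)]] by blast
 let ?f = "%z x. u x * exp (phase q z x) * pd_zbar j h z"
 have ch: "cont (pd_zbar j h)" by (rule Ck_continuous[OF Ck_pd_zbar[OF h(1)]])
 have c: "cont (%p. ?f (fst p) (snd p))"
  unfolding phase_def
  by (intro continuous_intros continuous_on_compose2[OF u(1)] continuous_on_compose2[OF ch] continuous_on_compose2[OF Ck_continuous[OF q]]) auto
 have "integ (%p. indicator (cball 0 R' \<times> cball 0 R) p *\<^sub>R ?f (fst p) (snd p))"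
  by (intro borel_integrable_compact continuous_on_subset[OF c]) (auto intro: compact_Times)
 also have "(%p. indicator (cball 0 R' \<times> cball 0 R) p *\<^sub>R ?f (fst p) (snd p)) = (%(z, x). ?f z x)"
  using R R' by (force simp: fun_eq_iff indicator_def not_le)
 finally have I: "integrable (lborel \<Otimes>\<^sub>M lborel) (%(z, x). ?f z x)"
  by (simp add: lborel_prod)
 have eq: "(LINT x|lborel. ?f z x) = (LINT x|lborel. u x * exp (phase q z x)) * pd_zbar j h z" for z
  by simp
 have "integ (%z. LINT x|lborel. ?f z x)"
  using lborel_pair.integrable_fst'[OF I] by simp
 thus "integ (%z. (LINT x|lborel. u x * exp (phase q z x)) * pd_zbar j h z)"
  by (simp only: eq)
 have "(LINT z|lborel. ?f z x) = 0" for x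
 proof -
  have "(LINT z|lborel. pd_zbar j h z * exp (phase q z x)) = - (LINT z|lborel. h z * pd_zbar j (%z. exp (phase q z x)) z)"
   by (intro integral_by_parts_zbar h entire_Ck entire_exp entire_phase)
  also have "... = 0" by (simp add: entire_pd_zbar[OF entire_exp[OF entire_phase]])
  finally have z: "(LINT z|lborel. pd_zbar j h z * exp (phase q z x)) = 0" .
  have "(LINT z|lborel. ?f z x) = (LINT z|lborel. u x * (pd_zbar j h z * exp (phase q z x)))" by (simp only: mult_ac)
  also have "... = u x * (LINT z|lborel. pd_zbar j h z * exp (phase q z x))" by (rule integral_mult_right_zero)
  finally show ?thesis by (simp only: z mult_zero_right)
 qed
 hence "(LINT x|lborel. (LINT z|lborel. ?f z x)) = 0" by simp
 hence "(LINT z|lborel. (LINT x|lborel. ?f z x)) = 0"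
  using lborel_pair.Fubini_integral[OF I] by simp
 thus "(LINT z|lborel. (LINT x|lborel. u x * exp (phase q z x)) * pd_zbar j h z) = 0" by (simp only: eq)
qed

lemma integral_tail_small:
 fixes f :: "complex^'n::finite => real"
 assumes f: "integ f" and e: "0 < e"
 obtains Q where "Q0 <= Q" "\<bar>LINT x|lborel. indicator {x. Q < (norm x)^2} x * f x\<bar> < e"
proof -
 have "(%k. LINT x|lborel. indicator {x. real k < (norm x)^2} x * f x) \<longlonglongrightarrow> (LINT x|(lborel :: (complex^'n) measure). (0::real))" (is "?I \<longlonglongrightarrow> _")
 proof (rule integral_dominated_convergence[where w="%x. norm (f x)"])
  have [measurable]: "f \<in> bm borel" using borel_measurable_integrable[OF f] by simp
  show "(%x. indicator {x. real k < (norm x)^2} x * f x) \<in> bm lborel" for k by measurable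
  show "AE x in lborel. (%k. indicator {x. real k < (norm x)^2} x * f x) \<longlonglongrightarrow> 0"
  proof (intro AE_I2 tendsto_eventually)
   fix x :: "complex^'n"
   obtain K :: nat where "(norm x)^2 <= real K" using real_arch_simple by blast
   thus "\<forall>\<^sub>F k in sequentially. indicator {x. real k < (norm x)^2} x * f x = 0"
    unfolding eventually_sequentially by (intro exI[of _ K]) (auto simp: indicator_def)
  qed
  show "AE x in lborel. norm (indicator {x. real k < (norm x)^2} x * f x) <= norm (f x)" for k
   by (intro AE_I2) (auto simp: indicator_def)
 qed (use f in auto)
 hence "?I \<longlonglongrightarrow> 0" by simp
 hence "\<forall>\<^sub>F k in sequentially. \<bar>?I k\<bar> < e" using e by (auto dest: tendstoD simp: dist_real_def)
 moreover obtain k0 :: nat where "Q0 <= real k0" using real_arch_simple by blast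
 hence "\<forall>\<^sub>F k in sequentially. Q0 <= real k"
  unfolding eventually_sequentially by (intro exI[of _ k0]) (meson of_nat_mono order_trans)
 ultimately have "\<forall>\<^sub>F k in sequentially. \<bar>?I k\<bar> < e \<and> Q0 <= real k" by (rule eventually_conj)
 then obtain k where "\<bar>?I k\<bar> < e" "Q0 <= real k" unfolding eventually_sequentially by blast
 thus thesis by (intro that[of "real k"]) auto
qed

context gc_weight
begin

context
 fixes u :: "complex^'n => complex" and L :: nat
 assumes u: "Ck1 u"
  and int_u: "integ (%x. form01_abs (dbar u x) * exp (- psi0 x) / (1 + norm x) ^ L)"
begin

text \<open>The operator applied to the derivative of \<open>u\<close>, without its constants and
  without the conjugation by exp F.\<close>

definition sol :: "complex^'n => complex" where
 "sol z = (LINT x|lborel. BAK q0 z x (dbar u x))"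

text \<open>The part of the far bound that depends on \<open>x\<close>; its integrability is the
  only global information about \<open>u\<close>.\<close>

definition Om :: "complex^'n => real" where
 "Om x = exp (- psi0 x) / (1 + norm x) ^ L * form01_abs (dbar u x)"

lemma Om_integrable: "integ Om"
 using int_u unfolding Om_def[abs_def] by (simp only: times_divide_eq_left times_divide_eq_right mult.commute)

lemma Om_nonneg: "0 <= Om x"
 unfolding Om_def by (intro mult_nonneg_nonneg divide_nonneg_nonneg form01_abs_nonneg zero_le_power) auto

lemma dbar_u_continuous: "cont (%x. dbar u x $ k)"
 by (rule continuous_dbar_nth[OF u])

lemma BAK_borel: "(%(z, x). BAK q0 z x (dbar u x)) \<in> bm (lborel \<Otimes>\<^sub>M lborel)"
 by (intro BA_kernel_borel q0_C1 dbar_u_continuous)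

lemma BAK_borel2: "(%x. BAK q0 z x (dbar u x)) \<in> bm lborel"
 using measurable_compose[OF measurable_Pair1'[of z lborel lborel] BAK_borel] by simp

lemma sol_borel: "sol \<in> bm lborel"
 unfolding sol_def[abs_def] by (rule lborel.borel_measurable_lebesgue_integral[OF BAK_borel])

text \<open>Near the ball the kernel is dominated by a translate of one truncated singularity, whose
  integral does not depend on \<open>z\<close>; further out it is dominated by a multiple of
  \<open>Om\<close>.\<close>

lemma sol_integrable_bounded:
 obtains B where "0 < B" "!!z. norm z <= R ==> integ (%x. BAK q0 z x (dbar u x))" "!!z. norm z <= R ==> norm (sol z) <= B"
proof -
 let ?d = "2 * CARD('n)"
 obtain C X where C: "0 < C" "1 <= X" "!!\<delta> Q z x a. 0 < \<delta> ==> \<delta> <= 1 ==> 2 * norm z <= norm x ==> X <= norm x ==>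
  norm (BAK (qp \<delta> Q) z x a) <= C * exp (psi0 z) * (damp \<delta> ((norm x)^2 - Q) * (exp (- psi0 x) / (1 + norm x) ^ L * form01_abs a))"
  by (rule kernel_far, rule that)
 define R1 where "R1 = 2 * \<bar>R\<bar> + X"
 have R1: "0 < R1" "R <= R1" using C(2) by (simp_all add: R1_def)
 have ca: "cont (%x. form01_abs (dbar u x))"
  unfolding form01_abs_def by (intro continuous_intros dbar_u_continuous)
 obtain C' where C': "0 < C'" "!!z x. norm z <= R1 ==> norm x <= R1 ==> norm (BAK q0 z x (dbar u x)) <= C' * (1 / norm (x - z)) ^ (?d - 1)"
  by (rule kernel_near[OF ca, of R1], rule that)
 obtain P where P: "0 < P" "!!x. norm x <= R ==> \<bar>psi0 x\<bar> <= P" by (rule bounded_on_cball[OF psi0_continuous], rule that)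
 define s where "s = 2 * R1 + 1"
 have s: "0 < s" using R1 by (simp add: s_def)
 define N where "N y = indicator (ball 0 s) y * (1 / norm (y :: complex^'n)) ^ (?d - 1)" for y
 have Nint: "integ (%x. N (x - z))" for z
 proof -
  have "(%x. N (x - z)) = (%x. indicator (ball z s) x * (1 / dist x z) ^ (?d - 1))"
   by (auto simp: N_def fun_eq_iff indicator_def dist_norm norm_minus_commute)
  thus ?thesis using integrable_near[OF s DIM_cvec_ge, of z] unfolding DIM_cvec by simp
 qed
 have Nb: "N \<in> bm borel" using borel_measurable_integrable[OF Nint[of 0]] by simp
 have Ntr: "(LINT x|lborel. N (x - z)) = (LINT x|lborel. N x)" for z
  using integral_translate[OF Nb, of "- z"] by simp
 have b: "norm (BAK q0 z x (dbar u x)) <= C' * N (x - z) + C * exp P * Om x" if z: "norm z <= R" for z x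
 proof (cases "norm x <= R1")
  case True
  have "norm (x - z) < s" using norm_triangle_ineq4[of x z] True z R1 by (simp add: s_def)
  hence "norm (BAK q0 z x (dbar u x)) <= C' * N (x - z)" using C'(2)[of z x] True z R1 by (simp add: N_def)
  moreover have "0 <= C * exp P * Om x" using C(1) Om_nonneg by simp
  ultimately show ?thesis by linarith
 next
  case False
  \<comment> \<open>For \<delta> = 1 there is no damping, and the far bound speaks of
    \<open>q0\<close> itself.\<close>
  have "norm (BAK (qp 1 0) z x (dbar u x)) <= C * exp (psi0 z) * (damp 1 ((norm x)^2 - 0) * (exp (- psi0 x) / (1 + norm x) ^ L * form01_abs (dbar u x)))"
   using False z C(2) by (intro C(3)) (auto simp: R1_def)
  hence "norm (BAK q0 z x (dbar u x)) <= C * exp (psi0 z) * Om x" by (simp add: qp_one damp_def Om_def)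
  also have "... <= C * exp P * Om x" using C(1) P(2)[OF z] by (intro mult_right_mono mult_left_mono Om_nonneg) auto
  moreover have "0 <= C' * N (x - z)" using C'(1) by (simp add: N_def)
  ultimately show ?thesis by linarith
 qed
 have gi: "integ (%x. C' * N (x - z) + C * exp P * Om x)" for z
  by (intro Bochner_Integration.integrable_add integrable_mult_right Nint Om_integrable)
 have int: "integ (%x. BAK q0 z x (dbar u x))" if z: "norm z <= R" for z
  by (rule Bochner_Integration.integrable_bound[OF gi[of z] BAK_borel2]) (use b[OF z] in \<open>auto intro!: AE_I2 order_trans[OF b[OF z]]\<close>)
 have "norm (sol z) <= C' * (LINT x|lborel. N x) + C * exp P * (LINT x|lborel. Om x)" if z: "norm z <= R" for z
 proof -
  have "norm (sol z) <= (LINT x|lborel. norm (BAK q0 z x (dbar u x)))" unfolding sol_def by (rule integral_norm_bound)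
  also have "... <= (LINT x|lborel. C' * N (x - z) + C * exp P * Om x)" by (intro integral_mono integrable_norm int z gi b)
  also have "... = C' * (LINT x|lborel. N x) + C * exp P * (LINT x|lborel. Om x)" using Nint[of z] Om_integrable by (simp add: Ntr)
  finally show ?thesis .
 qed
 note bd = this
 show thesis
 proof (rule that[of "\<bar>C' * (LINT x|lborel. N x) + C * exp P * (LINT x|lborel. Om x)\<bar> + 1"])
  show "norm (sol z) <= \<bar>C' * (LINT x|lborel. N x) + C * exp P * (LINT x|lborel. Om x)\<bar> + 1" if "norm z <= R" for z
   using bd[OF that] by linarith
 qed (use int in auto)
qed

text \<open>For |x|^2 \<le> Q the two integrands agree. For |x|^2 between Q and Q + 1 the damping
  sets in while \<open>u\<close> is still intact, and the tail of \<open>Om\<close> controls both.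
  The cutoff acts only beyond Q + 1, where the damping has reached \<delta>.\<close>

lemma sol_approx:
 assumes e: "0 < e" and R: "0 < R"
 obtains \<delta> Q where "0 < \<delta>" "\<delta> <= 1" "R^2 <= Q"
  "!!z. norm z <= R ==> norm ((LINT x|lborel. BAK (qp \<delta> Q) z x (dbar (%x. of_real (bump ((norm x)^2 - Q)) * u x) x)) - sol z) <= e"
proof -
 obtain C X where C: "0 < C" "1 <= X" "!!\<delta> Q z x a. 0 < \<delta> ==> \<delta> <= 1 ==> 2 * norm z <= norm x ==> X <= norm x ==>
  norm (BAK (qp \<delta> Q) z x a) <= C * exp (psi0 z) * (damp \<delta> ((norm x)^2 - Q) * (exp (- psi0 x) / (1 + norm x) ^ L * form01_abs a))"
  by (rule kernel_far, rule that)
 obtain P where P: "0 < P" "!!x. norm x <= R ==> \<bar>psi0 x\<bar> <= P" by (rule bounded_on_cball[OF psi0_continuous], rule that)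
 define c where "c = C * exp P"
 have c: "0 < c" using C(1) by (simp add: c_def)
 \<comment> \<open>Beyond this radius the far bound holds for all \<open>z\<close> in the ball. The
   tail is counted twice, once for each kernel, hence the 4.\<close>
 obtain Q where Q: "(2 * R + X)^2 <= Q" "\<bar>LINT x|lborel. indicator {x. Q < (norm x)^2} x * Om x\<bar> < e / (4 * c)"
  by (rule integral_tail_small[OF Om_integrable, of "e / (4 * c)" "(2 * R + X)^2"]) (use e c in auto)
 let ?tail = "LINT x|lborel. indicator {x. Q < (norm x)^2} x * Om x"
 let ?\<chi> = "%x::complex^'n. cor (bump ((norm x)^2 - Q))"
 let ?u = "%x. ?\<chi> x * u x"
 have Q0: "0 <= Q" "R^2 <= Q"
 proof -
  have "R^2 <= (2 * R + X)^2" using R C(2) by (intro power_mono) auto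
  thus "R^2 <= Q" using Q(1) by linarith
  thus "0 <= Q" using zero_le_power2[of R] by linarith
 qed
 have C\<chi>: "Ck1 ?\<chi>" by (intro Ck_of_real Ck1_bump Ck_norm_sq0)
 have Cu: "Ck1 ?u" by (intro Ck_mult C\<chi> u)
 have su: "?u x = 0" if "sqrt (Q + 2) < norm x" for x
 proof -
  have "(sqrt (Q + 2))^2 <= (norm x)^2" using that Q0 by (intro power_mono) auto
  thus ?thesis using Q0 by (simp add: bump_high)
 qed
 have csu: "csupp ?u" by (rule csuppI[OF su])
 have d\<chi>: "dbar ?\<chi> x = 0" if "(norm x)^2 - Q <= 1" for x
 proof -
  have dd: "((%s. bump (s - Q)) has_field_derivative bump' (s - Q)) (at s)" for s
  proof -
   have "((%s. s - Q) has_field_derivative 1) (at s)" by (auto intro!: derivative_eq_intros)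
   from DERIV_chain2[OF bump_deriv this] show ?thesis by simp
  qed
  have "(%x::complex^'n. (norm x)^2) differentiable (at x)" using Ck_differentiable[OF Ck_norm_sq0[of "Suc 0" 0]] by simp
  from pd_zbar_of_real_chain[OF dd this] that show ?thesis by (simp add: dbar_def vec_eq_iff bump_low)
 qed
 have du: "dbar ?u x = dbar u x" if "(norm x)^2 - Q <= 1" for x
  unfolding dbar_mult[OF Ck_differentiable[OF C\<chi>] Ck_differentiable[OF u]] d\<chi>[OF that]
  using that by (simp add: bump_low)
 define G where "G x = exp (- psi0 x) / (1 + norm x) ^ L * form01_abs (dbar ?u x)" for x
 have G0: "0 <= G x" for x
  unfolding G_def by (intro mult_nonneg_nonneg divide_nonneg_nonneg form01_abs_nonneg zero_le_power) auto
 have Gint: "integ G"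
 proof (rule csupp_integrable)
  have "1 + norm x ~= 0" for x :: "complex^'n" using norm_ge_zero[of x] by linarith
  thus "cont G" unfolding G_def[abs_def] form01_abs_def
   by (intro continuous_intros psi0_continuous continuous_dbar_nth Cu) auto
  show "csupp G"
  proof (rule csuppI)
   fix x :: "complex^'n" assume "sqrt (Q + 2) < norm x"
   hence "dbar ?u x = 0" by (intro dbar_eq_0_outside[OF su])
   thus "G x = 0" by (simp add: G_def form01_abs_def)
  qed
 qed
 define g where "g = (LINT x|lborel. G x)"
 have g: "0 <= g" unfolding g_def by (intro integral_nonneg_AE AE_I2 G0)
 \<comment> \<open>Chosen after \<open>Q\<close>, because the mass \<open>g\<close> of the
   derivative of the cut-off function depends on \<open>Q\<close> and on values of \<open>u\<close>
   not controlled by \<open>Om\<close>.\<close>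
 define \<delta> where "\<delta> = min 1 (e / (2 * c * (g + 1)))"
 have \<delta>: "0 < \<delta>" "\<delta> <= 1" using e c g by (simp_all add: \<delta>_def)
 have \<delta>g: "c * \<delta> * g <= e / 2"
 proof -
  have "\<delta> * (2 * c * (g + 1)) <= e" using c g by (simp add: \<delta>_def min_def pos_le_divide_eq)
  moreover have "c * \<delta> * g <= c * \<delta> * (g + 1)" using c \<delta> by (intro mult_left_mono) auto
  moreover have "c * \<delta> * (g + 1) = \<delta> * (2 * c * (g + 1)) / 2" by simp
  ultimately show ?thesis by linarith
 qed
 have main: "norm ((LINT x|lborel. BAK (qp \<delta> Q) z x (dbar ?u x)) - sol z) <= e" if z: "norm z <= R" for z
 proof -
  have i1: "integ (%x. BAK q0 z x (dbar u x))" by (rule sol_integrable_bounded[of R]) (use z in blast)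
  have i2: "integ (%x. BAK (qp \<delta> Q) z x (dbar ?u x))"
   by (intro BA_representation(1) qp_C1 \<delta> Cu csu)
  have cz: "C * exp (psi0 z) <= c" unfolding c_def using C(1) P(2)[OF z] by (intro mult_left_mono) auto
  have b: "norm (BAK (qp \<delta> Q) z x (dbar ?u x) - BAK q0 z x (dbar u x)) <=
    c * (2 * (indicator {x. Q < (norm x)^2} x * Om x) + \<delta> * G x)" for x
  proof (cases "(norm x)^2 <= Q")
   case True
   hence "BAK (qp \<delta> Q) z x (dbar ?u x) - BAK q0 z x (dbar u x) = 0"
    using du[of x] by (simp add: qp_inside[OF \<delta> True])
   thus ?thesis using c \<delta> G0 Om_nonneg by simp
  next
   case False
   have "(2 * R + X)^2 < (norm x)^2" using False Q(1) by linarith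
   hence nx: "2 * R + X < norm x" by (rule power_less_imp_less_base) simp
   hence zx: "2 * norm z <= norm x" "X <= norm x" using z R C(2) by linarith+
   have far: "norm (BAK (qp \<delta>' Q) z x a) <= c * (damp \<delta>' ((norm x)^2 - Q) * (exp (- psi0 x) / (1 + norm x) ^ L * form01_abs a))"
    if d: "0 < \<delta>'" "\<delta>' <= 1" for \<delta>' a
   proof -
    have "0 <= damp \<delta>' ((norm x)^2 - Q) * (exp (- psi0 x) / (1 + norm x) ^ L * form01_abs a)"
     using damp_bounds(2)[OF d, of "(norm x)^2 - Q"]
     by (intro mult_nonneg_nonneg divide_nonneg_nonneg form01_abs_nonneg zero_le_power) auto
    from mult_right_mono[OF cz this] C(3)[OF d zx, of Q a] show ?thesis by linarith
   qed
   have f1: "norm (BAK q0 z x (dbar u x)) <= c * Om x"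
    using far[of 1 "dbar u x"] by (simp add: qp_one damp_def Om_def)
   have f2: "norm (BAK (qp \<delta> Q) z x (dbar ?u x)) <= c * (Om x + \<delta> * G x)"
   proof (cases "(norm x)^2 - Q <= 1")
    case True
    have "norm (BAK (qp \<delta> Q) z x (dbar ?u x)) <= c * (damp \<delta> ((norm x)^2 - Q) * Om x)"
     using far[OF \<delta>, of "dbar u x"] by (simp only: du[OF True] Om_def)
    also have "... <= c * (1 * Om x)" using c damp_bounds(3)[OF \<delta>] by (intro mult_left_mono mult_right_mono Om_nonneg) auto
    also have "... <= c * (Om x + \<delta> * G x)" using c \<delta> G0 by (intro mult_left_mono) auto
    finally show ?thesis .
   next
    case False
    have "norm (BAK (qp \<delta> Q) z x (dbar ?u x)) <= c * (damp \<delta> ((norm x)^2 - Q) * G x)"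
     using far[OF \<delta>, of "dbar ?u x"] by (simp only: G_def)
    also have "damp \<delta> ((norm x)^2 - Q) = \<delta>" using False by (intro damp_high[OF \<delta>]) simp
    also have "c * (\<delta> * G x) <= c * (Om x + \<delta> * G x)" using c Om_nonneg by (intro mult_left_mono) auto
    finally show ?thesis .
   qed
   have ind: "indicator {x. Q < (norm x)^2} x = (1::real)" using False by simp
   have "norm (BAK (qp \<delta> Q) z x (dbar ?u x) - BAK q0 z x (dbar u x)) <= c * (Om x + \<delta> * G x) + c * Om x"
    by (intro order_trans[OF norm_triangle_ineq4] add_mono f1 f2)
   thus ?thesis unfolding ind by (simp add: algebra_simps)
  qed
  have ti: "integ (%x. indicator {x. Q < (norm x)^2} x * Om x)"
  proof (rule Bochner_Integration.integrable_bound[OF Om_integrable])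
   have [measurable]: "Om \<in> bm borel" using borel_measurable_integrable[OF Om_integrable] by simp
   show "(%x. indicator {x. Q < (norm x)^2} x * Om x) \<in> bm lborel" by measurable
  qed (auto simp: indicator_def)
  have "norm ((LINT x|lborel. BAK (qp \<delta> Q) z x (dbar ?u x)) - sol z) =
    norm (LINT x|lborel. BAK (qp \<delta> Q) z x (dbar ?u x) - BAK q0 z x (dbar u x))"
   unfolding sol_def by (simp only: Bochner_Integration.integral_diff[OF i2 i1])
  also have "... <= (LINT x|lborel. norm (BAK (qp \<delta> Q) z x (dbar ?u x) - BAK q0 z x (dbar u x)))" by (rule integral_norm_bound)
  also have "... <= (LINT x|lborel. c * (2 * (indicator {x. Q < (norm x)^2} x * Om x) + \<delta> * G x))"
   by (intro integral_mono b integrable_norm Bochner_Integration.integrable_diff i1 i2 integrable_mult_right Bochner_Integration.integrable_add ti Gint)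
  also have "... = c * (2 * ?tail + \<delta> * g)" using ti Gint by (simp add: g_def)
  also have "... = 2 * (c * ?tail) + c * \<delta> * g" by (simp add: algebra_simps)
  also have "... <= 2 * (e / 4) + e / 2"
  proof (intro add_mono mult_left_mono \<delta>g)
   have "c * ?tail <= c * (e / (4 * c))" using Q(2) c by (intro mult_left_mono) auto
   thus "c * ?tail <= e / 4" using c by simp
  qed simp
  finally show ?thesis by simp
 qed
 show thesis by (rule that[OF \<delta> Q0(2) main])
qed

text \<open>\<open>sol + \<gamma> u\<close> is weakly holomorphic: up to a small error it agrees, on the support of \<open>h\<close>, with an integral
 depending holomorphically on the parameter.\<close>
lemma sol_weak:
 assumes h: "Ck1 h" "csupp h"
 shows "(LINT z|lborel. (sol z + of_real (gauss_const TYPE('n)) * u z) * pd_zbar j h z) = 0"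
proof -
 let ?\<gamma> = "cor (gauss_const TYPE('n))"
 let ?I = "LINT z|lborel. (sol z + ?\<gamma> * u z) * pd_zbar j h z"
 obtain R where R: "R > 0" "!!z. R < norm z ==> pd_zbar j h z = 0" using csuppE[OF csupp_pd_zbar[OF h(2)]] by blast
 have ch: "cont (pd_zbar j h)" by (rule Ck_continuous[OF Ck_pd_zbar[OF h(1)]])
 have nh: "integ (%z. norm (pd_zbar j h z))" by (intro integrable_norm csupp_integrable[OF ch] csuppI[OF R(2)])
 obtain B where B: "!!z. norm z <= R ==> norm (sol z) <= B" by (rule sol_integrable_bounded[of R]) blast
 obtain Bu where Bu: "!!z. norm z <= R ==> \<bar>norm (u z)\<bar> <= Bu" by (rule bounded_on_cball[of "%z. norm (u z)" R]) (auto intro!: continuous_intros Ck_continuous[OF u])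
 have int1: "integ (%z. (sol z + ?\<gamma> * u z) * pd_zbar j h z)"
 proof (rule integrable_mult_csupp[OF _ _ ch R(2)])
  show "(%z. sol z + ?\<gamma> * u z) \<in> bm lborel"
   by (intro borel_measurable_add sol_borel measurable_lborel_continuous continuous_intros Ck_continuous[OF u])
  show "norm (sol z + ?\<gamma> * u z) <= B + norm ?\<gamma> * Bu" if "norm z <= R" for z
   using B[OF that] Bu[OF that] by (intro norm_triangle_le add_mono) (auto simp: norm_mult intro!: mult_left_mono)
 qed
 have small: "norm ?I <= e * (LINT z|lborel. norm (pd_zbar j h z))" if e: "0 < e" for e
 proof -
  obtain \<delta> Q where dQ: "0 < \<delta>" "\<delta> <= 1" "R^2 <= Q"
   "!!z. norm z <= R ==> norm ((LINT x|lborel. BAK (qp \<delta> Q) z x (dbar (%x. of_real (bump ((norm x)^2 - Q)) * u x) x)) - sol z) <= e"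
   by (rule sol_approx[OF e R(1)], rule that)
  let ?u = "%x. of_real (bump ((norm x)^2 - Q)) * u x"
  have Cu: "Ck1 ?u" by (intro Ck_mult Ck_of_real Ck1_bump Ck_norm_sq0 u)
  have Q0: "0 <= Q" using dQ(3) zero_le_power2[of R] by linarith
  have csu: "csupp ?u"
  proof (rule csuppI)
   fix x :: "complex^'n" assume "sqrt (Q + 2) < norm x"
   hence "(sqrt (Q + 2))^2 <= (norm x)^2" using Q0 by (intro power_mono) auto
   thus "?u x = 0" using Q0 by (simp add: bump_high)
  qed
  let ?w = "%x. ?u x * det (dbar_mat (qp \<delta> Q) x)"
  let ?H = "%z. (LINT x|lborel. ?w x * exp (phase (qp \<delta> Q) z x))"
  have cw: "cont ?w"
   by (intro continuous_on_mult Ck_continuous[OF Cu] continuous_on_det continuous_dbar_mat qp_C1 dQ)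
  have csw: "csupp ?w" by (rule csupp_mono[OF csu]) simp
  note hol = integral_holomorphic_parameter[of "qp \<delta> Q", OF qp_C1[OF dQ(1,2)] cw csw h, of j]
  have close: "norm ((sol z + ?\<gamma> * u z) * pd_zbar j h z - ?H z * pd_zbar j h z) <= e * norm (pd_zbar j h z)" for z
  proof (cases "norm z <= R")
   case True
   have "(norm z)^2 <= R^2" using True by (intro power_mono) auto
   hence uz: "?u z = u z" using dQ(3) by (simp add: bump_low)
   have "(LINT x|lborel. BAK (qp \<delta> Q) z x (dbar ?u x)) = (LINT x|lborel. ?u x * (exp (phase (qp \<delta> Q) z x) * det (dbar_mat (qp \<delta> Q) x))) - ?\<gamma> * ?u z"
    by (intro BA_representation(2) qp_C1 dQ Cu csu)
   also have "(LINT x|lborel. ?u x * (exp (phase (qp \<delta> Q) z x) * det (dbar_mat (qp \<delta> Q) x))) = ?H z"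
    by (intro Bochner_Integration.integral_cong refl) (simp only: mult_ac)
   finally have eq: "(LINT x|lborel. BAK (qp \<delta> Q) z x (dbar ?u x)) = ?H z - ?\<gamma> * u z" by (simp only: uz)
   have "norm ((sol z + ?\<gamma> * u z) - ?H z) <= e"
    using dQ(4)[OF True] unfolding eq by (simp add: norm_minus_commute algebra_simps)
   thus ?thesis unfolding left_diff_distrib[symmetric] norm_mult by (rule mult_right_mono) simp
  qed (simp add: R(2))
  \<comment> \<open>The subtracted integral vanishes, its integrand being holomorphic in
    \<open>z\<close> apart from the derivative of \<open>h\<close>.\<close>
  have I: "?I = (LINT z|lborel. (sol z + ?\<gamma> * u z) * pd_zbar j h z - ?H z * pd_zbar j h z)"
   using Bochner_Integration.integral_diff[OF int1 hol(2)] hol(1) by simp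
  have "norm ?I <= (LINT z|lborel. norm ((sol z + ?\<gamma> * u z) * pd_zbar j h z - ?H z * pd_zbar j h z))"
   unfolding I by (rule integral_norm_bound)
  also have "... <= (LINT z|lborel. e * norm (pd_zbar j h z))"
   by (intro integral_mono close integrable_norm Bochner_Integration.integrable_diff int1 hol(2) integrable_mult_right nh)
  finally show ?thesis by simp
 qed
 define J where "J = (LINT z|lborel. norm (pd_zbar j h z))"
 have h0: "0 <= J" unfolding J_def by (intro integral_nonneg_AE AE_I2) simp
 have le: "norm ?I <= 0 + e" if e: "0 < e" for e
 proof -
  have "0 < e / (J + 1)" using e h0 by simp
  from small[OF this] have "norm ?I <= e / (J + 1) * J" by (simp only: J_def)
  also have "... <= e" using e h0 by (simp add: field_simps)
  finally show ?thesis by simp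
 qed
 have "norm ?I <= 0" by (rule field_le_epsilon) (rule le)
 thus ?thesis by simp
qed

end

end

context gc_weight
begin

text \<open>Since exp (- F) g is entire, the form entering the operator is the d-bar derivative of u
  = exp (- F) g f. The operator is then a constant times exp F times \<open>sol u\<close>, and weak
  holomorphy of \<open>sol\<close> + \<gamma> \<open>u\<close> together with the constant - 1 /
  \<gamma> gives the equation.\<close>

lemma weak_solution:
 fixes f g :: "complex^'n => complex"
 assumes p: "1 <= p" and f: "Ck 2 f" and form: "(%z. (\<rho> z powr \<kappa>') *\<^sub>R dbar f z) \<in> Lform p (%_. 0)"
  and g: "entire g" "0 < Cg" "!!z. norm (g z) * exp (- \<phi>t z) <= Cg * (1 + (1 / \<rho> z) ^ (2 * CARD('n)))"
 shows "T_defined \<phi>t F (%z. g z *s dbar f z) \<and>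
  dbar_distr (T_op \<phi>t F (%z. g z *s dbar f z)) (%z. g z *s dbar f z)"
proof -
 let ?n = "CARD('n)" and ?\<gamma> = "cor (gauss_const TYPE('n))"
 let ?\<omega> = "%z. g z *s dbar f z" and ?T = "T_op \<phi>t F (%z. g z *s dbar f z)"
 define u where "u z = exp (- F z) * g z * f z" for z
 have \<gamma>: "?\<gamma> ~= 0" using gauss_const_pos[where 'n='n] by simp
 have eg: "entire (%z. exp (- F z) * g z)" by (intro entire_mult entire_exp entire_minus F g)
 have Cf: "Ck1 f" using f by (simp add: numeral_2_eq_2 Ck_Suc_imp)
 have Cu: "Ck1 u" unfolding u_def[abs_def] by (intro Ck_mult entire_Ck[OF eg] Cf)
 have du: "dbar u x = exp (- F x) *s ?\<omega> x" for x
  using dbar_mult[OF Ck_differentiable[OF entire_Ck[OF eg]] Ck_differentiable[OF Cf], of x]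
  unfolding u_def[abs_def] by (simp add: entire_dbar[OF eg] vector_smult_assoc)
 obtain L where "integ (%x. norm (g x) * form01_abs (dbar f x) * exp (- \<phi>t x) / (1 + norm x) ^ L)"
  by (rule rhs_integrable[OF p f form g], rule that)
 moreover have "form01_abs (dbar u x) * exp (- psi0 x) = norm (g x) * form01_abs (dbar f x) * exp (- \<phi>t x)" for x
 proof -
  have n: "norm (exp (- F x)) = exp (- Re (F x))" by (simp only: norm_exp_eq_Re uminus_complex.sel)
  have e: "exp (- psi0 x) = exp (Re (F x)) * exp (- \<phi>t x)" by (simp add: psi_of_def mult_exp_exp)
  show ?thesis unfolding du form01_abs_scale n e by (simp add: exp_minus)
 qed
 ultimately have iu: "integ (%x. form01_abs (dbar u x) * exp (- psi0 x) / (1 + norm x) ^ L)" by simp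
 have ig: "integrand ?\<omega> z = (%x. (2 * \<i>) ^ ?n * BAK q0 z x (dbar u x))" for z
  by (rule ext) (simp only: BA_integrand_eq[OF psi] du)
 have igb: "(%x. (2 * \<i>) ^ ?n * BAK q0 z x (dbar u x)) \<in> bm lborel" for z
  by (intro borel_measurable_times[OF borel_measurable_const BAK_borel2[OF Cu iu]])
 have ii: "integ (%x. BAK q0 z x (dbar u x))" for z
  by (rule sol_integrable_bounded[OF Cu iu, of "norm z"]) blast
 have Tdef: "T_defined \<phi>t F ?\<omega>"
  unfolding T_defined_def BA_defined_def ig
  by (intro AE_I2) (simp only: integrable_completion[OF igb] integrable_mult_right[OF ii])
 define c where "c = BA_const TYPE('n) * (2 * \<i>) ^ ?n"
 have T: "?T z = exp (F z) * (c * sol u z)" for z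
 proof -
  have "(LINT x|lebesgue. integrand ?\<omega> z x) = (2 * \<i>) ^ ?n * sol u z"
   unfolding ig integral_completion[OF igb] sol_def[OF Cu iu] by (rule integral_mult_right_zero)
  thus ?thesis unfolding T_op_def BA_op_def c_def by (simp only: mult.assoc)
 qed
 have cF: "cont (%z. exp (F z))" by (intro continuous_intros entire_continuous[OF F])
 have Tb: "?T \<in> bm lborel"
  unfolding T[abs_def] by (intro borel_measurable_times borel_measurable_const sol_borel[OF Cu iu] measurable_lborel_continuous cF)
 have locT: "loc_integrable ?T"
  unfolding loc_integrable_def set_integrable_def
 proof (intro allI impI)
  fix K :: "(complex^'n) set" assume K: "compact K"
  obtain R where R: "!!z. z \<in> K ==> norm z <= R" using compact_imp_bounded[OF K] by (auto simp: bounded_iff)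
  obtain B where B: "0 < B" "!!z. norm z <= R ==> norm (sol u z) <= B" by (rule sol_integrable_bounded[OF Cu iu, of R]) blast
  obtain E where E: "0 < E" "!!z. norm z <= R ==> \<bar>norm (exp (F z))\<bar> <= E"
   by (rule bounded_on_cball[OF continuous_on_norm[OF cF], of R], rule that)
  have Km [measurable]: "K \<in> sets borel" using K by (intro borel_closed compact_imp_closed)
  have m: "(%z. indicator K z *\<^sub>R ?T z) \<in> bm lborel" using Tb by measurable
  have "integ (%z. indicator K z *\<^sub>R ?T z)"
  proof (rule Bochner_Integration.integrable_bound[OF _ m])
   show "integ (%z. indicator K z * (E * (norm c * B)))"
    using K by (intro integrable_mult_left integrable_real_indicator emeasure_bounded_finite compact_imp_bounded) auto
   show "AE z in lborel. norm (indicator K z *\<^sub>R ?T z) <= norm (indicator K z * (E * (norm c * B)))"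
   proof (intro AE_I2)
    fix z
    show "norm (indicator K z *\<^sub>R ?T z) <= norm (indicator K z * (E * (norm c * B)))"
    proof (cases "z \<in> K")
     case True
     have "norm (exp (F z)) * (norm c * norm (sol u z)) <= E * (norm c * B)"
      using E(2)[OF R[OF True]] B(2)[OF R[OF True]] E(1) by (intro mult_mono) auto
     thus ?thesis using True by (simp add: T norm_mult)
    qed simp
   qed
  qed
  thus "integrable lebesgue (%z. indicator K z *\<^sub>R ?T z)" by (simp only: integrable_completion[OF m])
 qed
 have c\<omega>: "cont (%z. ?\<omega> z $ j)" for j
  by simp (intro continuous_intros entire_continuous[OF g(1)] continuous_dbar_nth[OF Cf])
 have loc\<omega>: "loc_integrable (%z. ?\<omega> z $ j)" for j
  unfolding loc_integrable_def set_integrable_def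
 proof (intro allI impI)
  fix K :: "(complex^'n) set" assume K: "compact K"
  have [measurable]: "K \<in> sets borel" using K by (intro borel_closed compact_imp_closed)
  have m: "(%z. indicator K z *\<^sub>R ?\<omega> z $ j) \<in> bm lborel"
   using measurable_lborel_continuous[OF c\<omega>[of j]] by measurable
  have "integ (%z. indicator K z *\<^sub>R ?\<omega> z $ j)"
   by (rule borel_integrable_compact[OF K continuous_on_subset[OF c\<omega>]]) simp
  thus "integrable lebesgue (%z. indicator K z *\<^sub>R ?\<omega> z $ j)" by (simp only: integrable_completion[OF m])
 qed
 have "- (LINT z|lebesgue. ?T z * pd_zbar j h z) = (LINT z|lebesgue. ?\<omega> z $ j * h z)" if h: "test_fun h" for h j
 \<comment> \<open>The zero function satisfies the identity trivially; any other test function is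
   itself the witness that determines the normalizing constant.\<close>
 proof (cases "\<exists>z0. h z0 ~= 0")
  case False
  hence "h = (%_. 0)" by auto
  thus ?thesis by simp
 next
  case True
  then obtain z0 where z0: "h z0 ~= 0" by blast
  have c: "c = - 1 / ?\<gamma>" using \<gamma> unfolding c_def BA_const_eq[OF h z0] by simp
  have Ch: "Ck1 h" and csh: "csupp h" using h by (simp_all add: test_fun_Ck1 test_fun_csupp)
  \<comment> \<open>The entire factor exp F is moved from the operator to the test function, where
    it commutes with d-bar.\<close>
  define h' where "h' z = exp (F z) * h z" for z
  have Ch': "Ck1 h'" unfolding h'_def[abs_def] by (intro Ck_mult entire_Ck entire_exp F Ch)
  have csh': "csupp h'" unfolding h'_def[abs_def] by (rule csupp_mono[OF csh]) simp
  have dh': "pd_zbar j h' z = exp (F z) * pd_zbar j h z" for z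
   unfolding h'_def[abs_def]
   by (simp add: pd_zbar_mult[OF Ck_differentiable[OF entire_Ck[OF entire_exp[OF F]]] Ck_differentiable[OF Ch]]
    entire_pd_zbar[OF entire_exp[OF F]])
  have cdh: "cont (pd_zbar j h')" by (rule Ck_continuous[OF Ck_pd_zbar[OF Ch']])
  obtain R where R: "!!z. R < norm z ==> pd_zbar j h' z = 0" using csuppE[OF csupp_pd_zbar[OF csh']] by blast
  obtain B where B: "!!z. norm z <= R ==> norm (sol u z) <= B" by (rule sol_integrable_bounded[OF Cu iu, of R]) blast
  have i1: "integ (%z. sol u z * pd_zbar j h' z)"
   by (rule integrable_mult_csupp[OF sol_borel[OF Cu iu] B cdh R])
  have i2: "integ (%z. u z * pd_zbar j h' z)"
   by (intro csupp_integrable continuous_on_mult cdh Ck_continuous[OF Cu] csuppI[of R]) (simp add: R)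
  have "(LINT z|lborel. (sol u z + ?\<gamma> * u z) * pd_zbar j h' z) = (LINT z|lborel. sol u z * pd_zbar j h' z + ?\<gamma> * (u z * pd_zbar j h' z))"
   by (simp only: distrib_right mult.assoc)
  also have "... = (LINT z|lborel. sol u z * pd_zbar j h' z) + ?\<gamma> * (LINT z|lborel. u z * pd_zbar j h' z)"
   by (subst Bochner_Integration.integral_add[OF i1 integrable_mult_right[OF i2]]) simp
  finally have S: "(LINT z|lborel. sol u z * pd_zbar j h' z) = - (?\<gamma> * (LINT z|lborel. u z * pd_zbar j h' z))"
   using sol_weak[OF Cu iu Ch' csh', of j] by (simp add: eq_neg_iff_add_eq_0)
  have "(LINT z|lborel. u z * pd_zbar j h' z) = - (LINT z|lborel. h' z * pd_zbar j u z)"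
   using integral_by_parts_zbar[OF Ch' Cu csh', of j] by (simp only: mult.commute)
  also have "(LINT z|lborel. h' z * pd_zbar j u z) = (LINT z|lborel. ?\<omega> z $ j * h z)"
  proof (intro Bochner_Integration.integral_cong refl)
   fix z
   have "pd_zbar j u z = exp (- F z) * ?\<omega> z $ j" using arg_cong[OF du[of z], of "%v. v $ j"] by (simp add: dbar_def)
   thus "h' z * pd_zbar j u z = ?\<omega> z $ j * h z" by (simp add: h'_def exp_minus)
  qed
  finally have U: "(LINT z|lborel. u z * pd_zbar j h' z) = - (LINT z|lborel. ?\<omega> z $ j * h z)" .
  have m1: "(%z. ?T z * pd_zbar j h z) \<in> bm lborel"
   by (intro borel_measurable_times Tb measurable_lborel_continuous Ck_continuous[OF Ck_pd_zbar[OF Ch]])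
  have m2: "(%z. ?\<omega> z $ j * h z) \<in> bm lborel"
   by (intro borel_measurable_times measurable_lborel_continuous c\<omega> Ck_continuous[OF Ch])
  have "(LINT z|lebesgue. ?T z * pd_zbar j h z) = (LINT z|lborel. c * (sol u z * pd_zbar j h' z))"
   unfolding integral_completion[OF m1] by (simp only: T dh' mult_ac)
  also have "... = c * (LINT z|lborel. sol u z * pd_zbar j h' z)" by (rule integral_mult_right_zero)
  also have "... = - (LINT z|lborel. ?\<omega> z $ j * h z)" unfolding S U c using \<gamma> by simp
  finally show ?thesis unfolding integral_completion[OF m2] by simp
 qed
 thus ?thesis using Tdef locT loc\<omega> unfolding dbar_distr_def by blast
qed

end

theorem lemma5p1:
  fixes p :: ennreal
    and \<phi> :: "complex^'n \<Rightarrow> ereal"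
    and \<rho> \<phi>t :: "complex^'n \<Rightarrow> real"
    and F :: "complex^'n \<Rightarrow> complex"
  assumes "1 \<le> p"
    and "\<phi> \<in> W_star_gc"
    and "gc_data \<phi> \<rho> \<phi>t F"
  shows "(\<exists>C::real. 0 < C \<and>
            (\<forall>\<omega>\<in>L01. (\<lambda>z. \<rho> z *\<^sub>R \<omega> z) \<in> Lform p \<phi> \<longrightarrow>
               T_defined \<phi>t F \<omega> \<and> T_op \<phi>t F \<omega> \<in> borel_measurable lebesgue \<and>
               Lnorm p \<phi> (\<lambda>z. cmod (T_op \<phi>t F \<omega> z))
                 \<le> ennreal C * Lnorm p \<phi> (\<lambda>z. form01_abs (\<rho> z *\<^sub>R \<omega> z)))) \<and>
         (\<forall>\<kappa>::real. \<forall>g\<in>Gamma_span \<phi>. \<forall>f::complex^'n \<Rightarrow> complex.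
            Ck 2 f \<longrightarrow> (\<lambda>z. (\<rho> z powr \<kappa>) *\<^sub>R dbar f z) \<in> Lform p (\<lambda>_. 0) \<longrightarrow>
              T_defined \<phi>t F (\<lambda>z. g z *s dbar f z) \<and>
              dbar_distr (T_op \<phi>t F (\<lambda>z. g z *s dbar f z)) (\<lambda>z. g z *s dbar f z))"
proof -
 obtain c0 m M A N where "gc_weight \<rho> c0 \<phi>t F m M A N" using assms(3) by (rule gc_weight_exists)
 then interpret gc_weight \<rho> c0 \<phi>t F m M A N .
 have \<phi>: "\<phi> \<in> bm borel" using assms(2) by (auto simp: W_star_gc_def W_star_def intro: psh_measurable)
 obtain B :: real where near: "AE z in lebesgue. \<bar>\<phi> z - ereal (\<phi>t z)\<bar> <= ereal B"
  using assms(3) by (auto simp: gc_data_def regularization_def)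
 have "\<exists>C::real. 0 < C \<and> (\<forall>\<omega>\<in>L01. (%z. \<rho> z *\<^sub>R \<omega> z) \<in> Lform p \<phi> \<longrightarrow>
  T_defined \<phi>t F \<omega> \<and> Lnorm p \<phi> (%z. cmod (T_op \<phi>t F \<omega> z)) <= ennreal C * Lnorm p \<phi> (%z. form01_abs (\<rho> z *\<^sub>R \<omega> z)))"
 proof (cases "p = \<infinity>")
  case True
  show ?thesis unfolding True by (rule T_estimate_infinite[OF \<phi> near])
 next
  case False
  show ?thesis by (rule T_estimate_finite[OF assms(1) False \<phi> near])
 qed
 hence A: "\<exists>C::real. 0 < C \<and> (\<forall>\<omega>\<in>L01. (%z. \<rho> z *\<^sub>R \<omega> z) \<in> Lform p \<phi> \<longrightarrow>
        T_defined \<phi>t F \<omega> \<and> T_op \<phi>t F \<omega> \<in> bm lebesgue \<and>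
        Lnorm p \<phi> (%z. cmod (T_op \<phi>t F \<omega> z))
         <= ennreal C * Lnorm p \<phi> (%z. form01_abs (\<rho> z *\<^sub>R \<omega> z)))"
  using T_op_measurable by blast
 have "T_defined \<phi>t F (%z. g z *s dbar f z) \<and> dbar_distr (T_op \<phi>t F (%z. g z *s dbar f z)) (%z. g z *s dbar f z)"
  if g: "g \<in> Gamma_span \<phi>" and f: "Ck 2 f" "(%z. (\<rho> z powr \<kappa>) *\<^sub>R dbar f z) \<in> Lform p (%_. 0)" for \<kappa> g and f :: "complex^'n => complex"
 proof -
  obtain C where "entire g" "0 < C" "!!z. norm (g z) * exp (- \<phi>t z) <= C * (1 + (1 / \<rho> z) ^ (2 * CARD('n)))"
   by (rule Gamma_growth[OF g \<phi> near], rule that)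
  thus ?thesis by (rule weak_solution[OF assms(1) f])
 qed
 with A show ?thesis by blast
qed

end
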